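(* For every $n\ge3$, the map $\mathfrak{bu}$ induces an isomorphism $$\mathfrak{bu}\colon\mathcal{A}_{n-2,1}^c\to\mathcal{A}_{n,2}^c/\langle\Theta_n^{\ge1}\rangle .$$
   Context: Fix $g$. A Jacobi diagram is a uni-trivalent graph with a cyclic order at each trivalent vertex (counterclockwise in planar descriptions) and a label in $\{1^\pm,\dots,g^\pm\}$ at each univalent vertex. $\mathcal{A}_n^c$ is the $\mathbb{Z}$-module generated by connected Jacobi diagrams with $n$ trivalent vertices modulo: AS (reversing the cyclic order at one trivalent vertex changes the sign); IHX ($D_I-D_H+D_X=0$, where the diagrams agree except near an edge $e$ whose ends have cyclic orders $(e,2,1),(e,3,4)$ in $D_I$, $(e,1,3),(e,4,2)$ in $D_H$, $(e,2,3),(e,4,1)$ in $D_X$, where $1,2,3,4$ are the four neighbouring half-edges); self-loop (a diagram with an edge joining a vertex to itself is $0$). $\mathcal{A}_{n,l}^c$ is the submodule generated by diagrams of first Betti number $l$. $\mathfrak{bu}\colon\mathcal{A}_{n,l}^c\to\mathcal{A}_{n+2,l+1}^c$ is the homomorphism obtained by blowing up one trivalent vertex of a diagram, i.e. replacing (in a planar neighbourhood) the vertex by a small circle to which the three incident edges are attached from outside in the same planar positions, all new cyclic orders being counterclockwise; the result does not depend on the choice of the vertex. $\theta(a_1,\dots,a_p;b_1,\dots,b_q;c_1,\dots,c_r)$ is the planar diagram with $p+q+r+2$ trivalent vertices consisting of a circle with a horizontal chord, legs labelled $a_1,\dots,a_p$ (left to right) attached outside the upper arc, legs $b_1,\dots,b_q$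 (left to right) attached on the upper side of the chord, and legs $c_1,\dots,c_r$ (left to right) attached outside the lower arc. $\langle\Theta_n^{\ge1}\rangle$ is the submodule of $\mathcal{A}_{n,2}^c$ generated by all $\theta(a_1,\dots,a_p;b_1,\dots,b_q;c_1,\dots,c_r)$ with $p,q,r\ge1$, $p+q+r+2=n$, and labels in $\{1^\pm,\dots,g^\pm\}$. *)

theory Defs
  imports "HOL-Algebra.Free_Abelian_Groups"
begin

text \<open>
  A uni-trivalent graph is encoded by its half-edges. The permutation \<open>rot\<close> has orbits of size
  one and three: the fixed points are the univalent vertices, the three-cycles are the trivalent
  vertices together with their cyclic (counterclockwise) order. The fixed-point-free involution
  \<open>opp\<close> pairs the two halves of each edge. Only the values on \<open>half\<close> (for \<open>lab\<close>: on the
  univalent half-edges) are relevant.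
\<close>

datatype sign = Plus | Minus

type_synonym label = "nat \<times> sign"

definition labels :: "nat \<Rightarrow> label set" where
  "labels g = {1..g} \<times> UNIV"

record 'h diagram =
  half :: "'h set"
  rot :: "'h \<Rightarrow> 'h"
  opp :: "'h \<Rightarrow> 'h"
  lab :: "'h \<Rightarrow> label"

definition jacobi_diagram :: "nat \<Rightarrow> 'h diagram \<Rightarrow> bool" where
  "jacobi_diagram g D \<longleftrightarrow>
     finite (half D) \<and>
     (\<forall>h\<in>half D. rot D h \<in> half D \<and> rot D (rot D (rot D h)) = h \<and>
                 opp D h \<in> half D \<and> opp D (opp D h) = h \<and> opp D h \<noteq> h \<and>
                 (rot D h = h \<longrightarrow> lab D h \<in> labels g))"

definition vertices :: "'h diagram \<Rightarrow> 'h set set" where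
  "vertices D = {{h, rot D h, rot D (rot D h)} |h. h \<in> half D}"

definition trivalent_vertices :: "'h diagram \<Rightarrow> 'h set set" where
  "trivalent_vertices D = {v \<in> vertices D. card v = 3}"

definition edges :: "'h diagram \<Rightarrow> 'h set set" where
  "edges D = {{h, opp D h} |h. h \<in> half D}"

definition linked :: "'h diagram \<Rightarrow> ('h \<times> 'h) set" where
  "linked D = {(h, k). h \<in> half D \<and> k \<in> half D \<and> (k = rot D h \<or> k = opp D h)}"

definition components :: "'h diagram \<Rightarrow> 'h set set" where
  "components D = half D // (linked D \<union> (linked D)\<inverse>)\<^sup>*"

definition connected_diagram :: "'h diagram \<Rightarrow> bool" where
  "connected_diagram D \<longleftrightarrow> card (components D) = 1"

definition betti1 :: "'h diagram \<Rightarrow> int" where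
  "betti1 D = int (card (edges D)) - int (card (vertices D)) + int (card (components D))"

definition diagram_iso :: "'h diagram \<Rightarrow> 'k diagram \<Rightarrow> bool" where
  "diagram_iso D E \<longleftrightarrow>
     (\<exists>f. bij_betw f (half D) (half E) \<and>
          (\<forall>h\<in>half D. f (rot D h) = rot E (f h) \<and> f (opp D h) = opp E (f h) \<and>
                      (rot D h = h \<longrightarrow> lab E (f h) = lab D h)))"

definition jacobi_diagrams :: "nat \<Rightarrow> nat \<Rightarrow> nat diagram set" where
  "jacobi_diagrams g n =
     {D. jacobi_diagram g D \<and> connected_diagram D \<and> card (trivalent_vertices D) = n}"

definition cyc3 :: "'h \<Rightarrow> 'h \<Rightarrow> 'h \<Rightarrow> ('h \<Rightarrow> 'h) \<Rightarrow> 'h \<Rightarrow> 'h" where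
  "cyc3 a b c r = r(a := b, b := c, c := a)"

definition iso_relators :: "nat \<Rightarrow> nat \<Rightarrow> (nat diagram \<Rightarrow>\<^sub>0 int) set" where
  "iso_relators g n =
     {frag_of D - frag_of E |D E.
        D \<in> jacobi_diagrams g n \<and> E \<in> jacobi_diagrams g n \<and> diagram_iso D E}"

definition reverse_at :: "'h \<Rightarrow> 'h diagram \<Rightarrow> 'h diagram" where
  "reverse_at h D = D\<lparr>rot := cyc3 h (rot D (rot D h)) (rot D h) (rot D)\<rparr>"

definition as_relators :: "nat \<Rightarrow> nat \<Rightarrow> (nat diagram \<Rightarrow>\<^sub>0 int) set" where
  "as_relators g n =
     {frag_of D + frag_of (reverse_at h D) |D h.
        D \<in> jacobi_diagrams g n \<and> h \<in> half D \<and> rot D h \<noteq> h}"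

text \<open>
  The edge consists of the half-edges \<open>e\<close> and \<open>opp D e\<close>. In \<open>D\<close>, read as \<open>D\<^sub>I\<close>, their vertices
  carry the cyclic orders \<open>(e, x2, x1)\<close> and \<open>(opp D e, x3, x4)\<close>.
\<close>

definition ihx_H :: "'h \<Rightarrow> 'h diagram \<Rightarrow> 'h diagram" where
  "ihx_H e D =
     (let e' = opp D e;
          x2 = rot D e; x1 = rot D x2; x3 = rot D e'; x4 = rot D x3
      in D\<lparr>rot := cyc3 e x1 x3 (cyc3 e' x4 x2 (rot D))\<rparr>)"

definition ihx_X :: "'h \<Rightarrow> 'h diagram \<Rightarrow> 'h diagram" where
  "ihx_X e D =
     (let e' = opp D e;
          x2 = rot D e; x1 = rot D x2; x3 = rot D e'; x4 = rot D x3
      in D\<lparr>rot := cyc3 e x2 x3 (cyc3 e' x4 x1 (rot D))\<rparr>)"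

definition ihx_relators :: "nat \<Rightarrow> nat \<Rightarrow> (nat diagram \<Rightarrow>\<^sub>0 int) set" where
  "ihx_relators g n =
     {frag_of D - frag_of (ihx_H e D) + frag_of (ihx_X e D) |D e.
        D \<in> jacobi_diagrams g n \<and> e \<in> half D \<and>
        rot D e \<noteq> e \<and> rot D (opp D e) \<noteq> opp D e \<and>
        opp D e \<notin> {rot D e, rot D (rot D e)}}"

definition self_loop_relators :: "nat \<Rightarrow> nat \<Rightarrow> (nat diagram \<Rightarrow>\<^sub>0 int) set" where
  "self_loop_relators g n =
     {frag_of D |D. D \<in> jacobi_diagrams g n \<and>
        (\<exists>h\<in>half D. opp D h \<in> {rot D h, rot D (rot D h)})}"

definition relations :: "nat \<Rightarrow> nat \<Rightarrow> (nat diagram \<Rightarrow>\<^sub>0 int) set" where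
  "relations g n =
     generate (free_Abelian_group (jacobi_diagrams g n))
       (iso_relators g n \<union> as_relators g n \<union> ihx_relators g n \<union> self_loop_relators g n)"

definition A :: "nat \<Rightarrow> nat \<Rightarrow> (nat diagram \<Rightarrow>\<^sub>0 int) set monoid" where
  "A g n = free_Abelian_group (jacobi_diagrams g n) Mod relations g n"

text \<open>
  The class of a diagram with half-edges of an arbitrary type; by the isomorphism relators it
  does not depend on the chosen copy.
\<close>

definition cls :: "nat \<Rightarrow> nat \<Rightarrow> 'h diagram \<Rightarrow> (nat diagram \<Rightarrow>\<^sub>0 int) set" where
  "cls g n D =
     relations g n #>\<^bsub>free_Abelian_group (jacobi_diagrams g n)\<^esub>
       frag_of (SOME E :: nat diagram. diagram_iso D E)"

definition A_loop :: "nat \<Rightarrow> nat \<Rightarrow> nat \<Rightarrow> (nat diagram \<Rightarrow>\<^sub>0 int) set monoid" where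
  "A_loop g n l =
     (A g n)\<lparr>carrier :=
        generate (A g n) {cls g n D |D. D \<in> jacobi_diagrams g n \<and> betti1 D = int l}\<rparr>"

text \<open>
  In the blow-up, each half-edge \<open>x\<close> of the blown-up vertex becomes the outward half-edge
  \<open>Old x\<close> of its own vertex on the small circle; \<open>Fwd x\<close> and \<open>Bwd x\<close> are the half-edges at that
  vertex running along the circle counterclockwise and clockwise, respectively. Seen with the
  outward edge pointing up, counterclockwise is left, so the cyclic order is
  \<open>(Old x, Fwd x, Bwd x)\<close>.
\<close>

datatype 'h bu_half = Old 'h | Fwd 'h | Bwd 'h

definition blow_up :: "'h \<Rightarrow> 'h diagram \<Rightarrow> 'h bu_half diagram" where
  "blow_up h D =
     (let v = {h, rot D h, rot D (rot D h)} in
      \<lparr>half = Old ` half D \<union> Fwd ` v \<union> Bwd ` v,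
       rot = (\<lambda>k. case k of Old x \<Rightarrow> if x \<in> v then Fwd x else Old (rot D x)
                            | Fwd x \<Rightarrow> Bwd x
                            | Bwd x \<Rightarrow> Old x),
       opp = (\<lambda>k. case k of Old x \<Rightarrow> Old (opp D x)
                            | Fwd x \<Rightarrow> Bwd (rot D x)
                            | Bwd x \<Rightarrow> Fwd (rot D (rot D x))),
       lab = (\<lambda>k. case k of Old x \<Rightarrow> lab D x | Fwd x \<Rightarrow> lab D x | Bwd x \<Rightarrow> lab D x)\<rparr>)"

definition is_blow_up_hom ::
  "nat \<Rightarrow> nat \<Rightarrow> nat \<Rightarrow>
   ((nat diagram \<Rightarrow>\<^sub>0 int) set \<Rightarrow> (nat diagram \<Rightarrow>\<^sub>0 int) set) \<Rightarrow> bool" where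
  "is_blow_up_hom g n l f \<longleftrightarrow>
     f \<in> hom (A_loop g n l) (A_loop g (n + 2) (l + 1)) \<and>
     f \<in> extensional (carrier (A_loop g n l)) \<and>
     (\<forall>D\<in>jacobi_diagrams g n. betti1 D = int l \<longrightarrow>
        (\<forall>h\<in>half D. rot D h \<noteq> h \<longrightarrow> f (cls g n D) = cls g (n + 2) (blow_up h D)))"

text \<open>
  For \<open>n > 0\<close> at most one map satisfies \<open>is_blow_up_hom\<close>: its values on generators are prescribed.
\<close>

definition bu ::
  "nat \<Rightarrow> nat \<Rightarrow> nat \<Rightarrow> (nat diagram \<Rightarrow>\<^sub>0 int) set \<Rightarrow> (nat diagram \<Rightarrow>\<^sub>0 int) set" where
  "bu g n l = (THE f. is_blow_up_hom g n l f)"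

text \<open>
  On a strand with \<open>k\<close> legs, position \<open>0\<close> is the left and position \<open>k + 1\<close> the right end of the
  chord (common to the three strands), and the legs sit at the positions \<open>1, \<dots>, k\<close>. \<open>Lt s j\<close>
  and \<open>Rt s j\<close> are the half-edges at position \<open>j\<close> running along the strand to the left and to the
  right; \<open>Foot s j\<close> and \<open>Tip s j\<close> are the trivalent and the univalent half of the leg.
\<close>

datatype strand = Upper | Chord | Lower

datatype theta_half = Lt strand nat | Rt strand nat | Foot strand nat | Tip strand nat

definition theta :: "label list \<Rightarrow> label list \<Rightarrow> label list \<Rightarrow> theta_half diagram" where
  "theta as bs cs =
     (let legs = (\<lambda>s. case s of Upper \<Rightarrow> as | Chord \<Rightarrow> bs | Lower \<Rightarrow> cs);
          len = (\<lambda>s. length (legs s)) in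
      \<lparr>half = {Lt s j |s j. 1 \<le> j \<and> j \<le> len s + 1} \<union> {Rt s j |s j. j \<le> len s} \<union>
              {Foot s j |s j. 1 \<le> j \<and> j \<le> len s} \<union> {Tip s j |s j. 1 \<le> j \<and> j \<le> len s},
       rot = (\<lambda>h. case h of
           Foot s j \<Rightarrow> (if s = Lower then Rt s j else Lt s j)
         | Lt s j \<Rightarrow>
             (if j = len s + 1
              then (case s of Upper \<Rightarrow> Lt Chord (len Chord + 1)
                            | Chord \<Rightarrow> Lt Lower (len Lower + 1)
                            | Lower \<Rightarrow> Lt Upper (len Upper + 1))
              else if s = Lower then Foot s j else Rt s j)
         | Rt s j \<Rightarrow>
             (if j = 0
              then (case s of Upper \<Rightarrow> Rt Lower 0 | Lower \<Rightarrow> Rt Chord 0 | Chord \<Rightarrow> Rt Upper 0)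
              else if s = Lower then Lt s j else Foot s j)
         | Tip s j \<Rightarrow> Tip s j),
       opp = (\<lambda>h. case h of
           Rt s j \<Rightarrow> Lt s (j + 1)
         | Lt s j \<Rightarrow> Rt s (j - 1)
         | Foot s j \<Rightarrow> Tip s j
         | Tip s j \<Rightarrow> Foot s j),
       lab = (\<lambda>h. case h of Tip s j \<Rightarrow> legs s ! (j - 1) | _ \<Rightarrow> undefined)\<rparr>)"

definition Theta_ge1 :: "nat \<Rightarrow> nat \<Rightarrow> (nat diagram \<Rightarrow>\<^sub>0 int) set set" where
  "Theta_ge1 g n =
     generate (A_loop g n 2)
       {cls g n (theta as bs cs) |as bs cs.
          length as \<ge> 1 \<and> length bs \<ge> 1 \<and> length cs \<ge> 1 \<and>
          length as + length bs + length cs + 2 = n \<and>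
          set as \<subseteq> labels g \<and> set bs \<subseteq> labels g \<and> set cs \<subseteq> labels g}"

end

theory Submission imports Defs begin

text \<open>
  Two applications of IHX express the blow-up of an end of an edge \<open>e\<close> as the difference of two
  diagrams in which \<open>e\<close> is replaced by a square, and this difference is symmetric in the ends of
  \<open>e\<close>. Hence the vertex does not matter, and the IHX relation at \<open>e\<close> becomes a telescoping sum.

  For surjectivity, IHX lengthens a cycle along an edge leaving it, so one may assume that it passes
  through all trivalent vertices. One-loop diagrams thus reduce to wheels and two-loop diagrams to
  \<open>theta as [] cs\<close>. Modulo \<open>theta as bs cs\<close> with three nonempty strands, IHX moves the
  labels of \<open>cs\<close> one by one to \<open>as\<close> until a single one is left, and
  \<open>theta as [] [b]\<close> is the blow-up of a wheel.

  The inverse is a state sum. Fix a trivalent vertex and sum over all ways of reversing the other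
  trivalent vertices, with the sign of the number of reversals. Regard each state as a ribbon graph;
  if one of its boundary components carries all legs and another one none, it contributes the wheel
  with the legs in the order of the first component, and otherwise zero. The sum respects AS, the
  twelve ribbon graphs arising from an IHX relation cancel in pairs, and no state of
  \<open>theta as bs cs\<close> with three nonempty strands contributes.
\<close>

text \<open>The modules are over the integers, so a factor 2 has to be avoided: complementary states
  contribute equally to the signed sum, and fixing one vertex counts each pair once. This makes the
  inverse exact on \<open>theta as [] [b]\<close>, where only the unreversed state survives. For a
  theta diagram with legs on the outer strands, the demand for a boundary component without legs
  excludes the states of genus one, and the demand that one component carry all legs excludes planar
  states with a leg pushed across its strand. The fixed vertex must stay away from the vertices
  touched by a relator; IHX touches two, and at least three are present. For n = 3 injectivity needs
  no state sum: the only wheel has a self-loop, so the source vanishes. The blow-up is still well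
  defined there, because the theta with one leg is killed by 2 and by 3. Once the number of
  trivalent vertices is given, the Betti number is a function of the number of legs, so it is
  tracked by counting legs. All computations take place with integral chains of diagrams and
  congruence modulo the relations; quotient groups enter only at the end.\<close>

section \<open>Half-edge combinatorics of uni-trivalent graphs\<close>

definition jac :: "nat \<Rightarrow> nat \<Rightarrow> 'h diagram \<Rightarrow> bool" where
  "jac g n D \<longleftrightarrow> jacobi_diagram g D \<and> connected_diagram D \<and> card (trivalent_vertices D) = n"

definition vertex :: "'h diagram \<Rightarrow> 'h \<Rightarrow> 'h set" where
  "vertex D h = {h, rot D h, rot D (rot D h)}"

definition tips :: "'h diagram \<Rightarrow> 'h set" where
  "tips D = {h \<in> half D. rot D h = h}"

definition iso_by :: "('h \<Rightarrow> 'k) \<Rightarrow> 'h diagram \<Rightarrow> 'k diagram \<Rightarrow> bool" where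
  "iso_by f D E \<longleftrightarrow> bij_betw f (half D) (half E) \<and>
     (\<forall>h\<in>half D. f (rot D h) = rot E (f h) \<and> f (opp D h) = opp E (f h) \<and>
                 (rot D h = h \<longrightarrow> lab E (f h) = lab D h))"

lemma diagram_iso_iff: "diagram_iso D E \<longleftrightarrow> (\<exists>f. iso_by f D E)"
  by (simp add: diagram_iso_def iso_by_def)

lemma jac_mem: "D \<in> jacobi_diagrams g n \<longleftrightarrow> jac g n D"
  by (simp add: jacobi_diagrams_def jac_def)

locale jacobi =
  fixes g :: nat and D :: "'h diagram"
  assumes jd: "jacobi_diagram g D"
begin

lemma fin [simp]: "finite (half D)"
  and rot_in [simp]: "h \<in> half D \<Longrightarrow> rot D h \<in> half D"
  and rot3 [simp]: "h \<in> half D \<Longrightarrow> rot D (rot D (rot D h)) = h"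
  and opp_in [simp]: "h \<in> half D \<Longrightarrow> opp D h \<in> half D"
  and opp_opp [simp]: "h \<in> half D \<Longrightarrow> opp D (opp D h) = h"
  and opp_neq [simp]: "h \<in> half D \<Longrightarrow> opp D h \<noteq> h"
  and lab_in: "h \<in> half D \<Longrightarrow> rot D h = h \<Longrightarrow> lab D h \<in> labels g"
  using jd by (auto simp: jacobi_diagram_def)

lemma opp_neq' [simp]: "h \<in> half D \<Longrightarrow> h \<noteq> opp D h"
  using opp_neq by metis

lemma rot_eq_iff [simp]: "h \<in> half D \<Longrightarrow> k \<in> half D \<Longrightarrow> rot D h = rot D k \<longleftrightarrow> h = k"
  by (metis rot3)

lemma opp_eq_iff [simp]: "h \<in> half D \<Longrightarrow> k \<in> half D \<Longrightarrow> opp D h = opp D k \<longleftrightarrow> h = k"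
  by (metis opp_opp)

lemma rot2_eq [simp]: "h \<in> half D \<Longrightarrow> rot D (rot D h) = h \<longleftrightarrow> rot D h = h"
  by (metis rot3)

lemma rot2_eq' [simp]: "h \<in> half D \<Longrightarrow> h = rot D (rot D h) \<longleftrightarrow> rot D h = h"
  by (metis rot3)

lemma vertex_sub: "h \<in> half D \<Longrightarrow> vertex D h \<subseteq> half D"
  by (simp add: vertex_def)

lemma self_in_vertex [simp]: "h \<in> vertex D h"
  by (simp add: vertex_def)

lemma vertex_eq: "h \<in> half D \<Longrightarrow> k \<in> vertex D h \<Longrightarrow> vertex D k = vertex D h"
  by (auto simp: vertex_def)

lemma vertex_rot [simp]: "h \<in> half D \<Longrightarrow> vertex D (rot D h) = vertex D h"
  by (rule vertex_eq) (simp_all add: vertex_def)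

lemma finite_vertex [simp]: "finite (vertex D h)"
  by (simp add: vertex_def)

lemma card_vertex: "h \<in> half D \<Longrightarrow> card (vertex D h) = (if rot D h = h then 1 else 3)"
  by (auto simp: vertex_def card_insert_if)

lemma vertex_tip: "h \<in> half D \<Longrightarrow> k \<in> vertex D h \<Longrightarrow> rot D k = k \<longleftrightarrow> rot D h = h"
  by (auto simp: vertex_def)

lemma vertices_eq: "vertices D = vertex D ` half D"
  by (auto simp: vertices_def vertex_def)

lemma trivalent_eq: "trivalent_vertices D = vertex D ` (half D - tips D)"
  by (auto simp: trivalent_vertices_def vertices_eq tips_def card_vertex split: if_splits)

lemma trivalent_iff: "h \<in> half D \<Longrightarrow> vertex D h \<in> trivalent_vertices D \<longleftrightarrow> rot D h \<noteq> h"
  by (auto simp: trivalent_vertices_def vertices_eq card_vertex)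

lemma trivalent_sub: "v \<in> trivalent_vertices D \<Longrightarrow> v \<subseteq> half D"
  using vertex_sub by (auto simp: trivalent_eq)

lemma vertices_disjoint: "v \<in> vertices D \<Longrightarrow> w \<in> vertices D \<Longrightarrow> v \<noteq> w \<Longrightarrow> v \<inter> w = {}"
  using vertex_eq unfolding vertices_eq by blast

lemma trivalent_memD: "v \<in> trivalent_vertices D \<Longrightarrow> h \<in> v \<Longrightarrow> v = vertex D h \<and> rot D h \<noteq> h \<and> h \<in> half D"
proof -
  assume "v \<in> trivalent_vertices D" and h: "h \<in> v"
  then obtain k where k: "k \<in> half D" "rot D k \<noteq> k" "v = vertex D k"
    by (auto simp: trivalent_eq tips_def)
  then show ?thesis using h vertex_eq[of k h] vertex_tip[of k h] vertex_sub[of k] by blast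
qed

lemma finite_trivalent [simp]: "finite (trivalent_vertices D)"
  by (simp add: trivalent_eq)

lemma Union_trivalent: "\<Union>(trivalent_vertices D) = half D - tips D"
proof
  show "\<Union>(trivalent_vertices D) \<subseteq> half D - tips D"
    using trivalent_memD by (auto simp: tips_def)
  show "half D - tips D \<subseteq> \<Union>(trivalent_vertices D)"
    unfolding trivalent_eq using self_in_vertex by blast
qed

lemma card_trivalent3: "card (half D - tips D) = 3 * card (trivalent_vertices D)"
proof -
  have "card (\<Union>(trivalent_vertices D)) = sum card (trivalent_vertices D)"
    by (rule card_Union_disjoint)
      (use vertices_disjoint in \<open>auto simp: trivalent_vertices_def vertices_eq disjnt_def pairwise_def\<close>)
  also have "\<dots> = 3 * card (trivalent_vertices D)"
    by (simp add: trivalent_vertices_def)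
  finally show ?thesis by (simp add: Union_trivalent)
qed

lemma finite_tips [simp]: "finite (tips D)"
  by (simp add: tips_def)

lemma card_vertices: "card (vertices D) = card (tips D) + card (trivalent_vertices D)"
proof -
  have "vertices D = (\<lambda>h. {h}) ` tips D \<union> trivalent_vertices D"
    by (auto simp: vertices_eq trivalent_eq tips_def vertex_def image_iff)
  moreover have "(\<lambda>h. {h}) ` tips D \<inter> trivalent_vertices D = {}"
    by (auto simp: trivalent_vertices_def)
  moreover have "card ((\<lambda>h. {h}) ` tips D) = card (tips D)"
    by (simp add: card_image)
  ultimately show ?thesis by (simp add: card_Un_disjoint)
qed

lemma card_edges: "card (half D) = 2 * card (edges D)"
proof -
  have e: "edges D = (\<lambda>h. {h, opp D h}) ` half D" by (auto simp: edges_def)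
  have u: "\<Union>(edges D) = half D" by (auto simp: e)
  have "card (\<Union>(edges D)) = sum card (edges D)"
    by (rule card_Union_disjoint)
      (auto simp: e disjnt_def pairwise_def insert_commute)
  also have "\<dots> = sum (\<lambda>_. 2) (edges D)"
    by (rule sum.cong) (auto simp: e card_insert_if)
  finally show ?thesis by (simp add: u)
qed

text \<open>Forward closure under \<open>rot\<close> and \<open>opp\<close> is enough, although
  \<open>components\<close> uses a symmetric relation: the inverses are \<open>rot\<close> applied
  twice and \<open>opp\<close> itself, so a closed set also contains all predecessors.\<close>

lemma connected_iff: "connected_diagram D \<longleftrightarrow>
   half D \<noteq> {} \<and> (\<forall>S. S \<subseteq> half D \<and> S \<noteq> {} \<and> rot D ` S \<subseteq> S \<and> opp D ` S \<subseteq> S \<longrightarrow> S = half D)"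
proof -
  define R where "R = (linked D \<union> (linked D)\<inverse>)\<^sup>*"
  have R: "equiv UNIV R"
    unfolding R_def
    by (intro equivI refl_rtrancl sym_rtrancl trans_rtrancl) (auto simp: sym_def)
  have comp: "components D = (\<lambda>h. R `` {h}) ` half D"
    by (auto simp: components_def R_def quotient_def)
  show ?thesis
  proof
    assume "connected_diagram D"
    then obtain c where c: "components D = {c}"
      by (auto simp: connected_diagram_def card_1_singleton_iff)
    have "half D \<noteq> {}" using c comp by auto
    moreover have "S = half D" if S: "S \<subseteq> half D" "S \<noteq> {}" "rot D ` S \<subseteq> S" "opp D ` S \<subseteq> S" for S
    proof
      obtain s where s: "s \<in> S" using S by auto
      show "half D \<subseteq> S"
      proof
        fix x assume x: "x \<in> half D"
        have "R `` {x} = R `` {s}"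
          using c comp x s S(1) by (metis image_eqI singletonD subsetD)
        then have "(s, x) \<in> R" using R by (metis UNIV_I eq_equiv_class_iff equivE symE)
        then show "x \<in> S" unfolding R_def
        proof (induction rule: rtrancl_induct)
          case base show ?case by (rule s)
        next
          case (step y z)
          have yz: "y \<in> half D" "z \<in> half D" using step(2) by (auto simp: linked_def)
          have "z = rot D y \<or> z = opp D y \<or> y = rot D z \<or> y = opp D z"
            using step(2) by (auto simp: linked_def)
          moreover have "z = rot D (rot D y)" if "y = rot D z" using that yz by simp
          moreover have "z = opp D y" if "y = opp D z" using that yz by simp
          ultimately show ?case using step(3) S(3,4) by blast
        qed
      qed
    qed (fact S)
    ultimately show "half D \<noteq> {} \<and>
       (\<forall>S. S \<subseteq> half D \<and> S \<noteq> {} \<and> rot D ` S \<subseteq> S \<and> opp D ` S \<subseteq> S \<longrightarrow> S = half D)" by blast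
  next
    assume a: "half D \<noteq> {} \<and>
       (\<forall>S. S \<subseteq> half D \<and> S \<noteq> {} \<and> rot D ` S \<subseteq> S \<and> opp D ` S \<subseteq> S \<longrightarrow> S = half D)"
    then obtain x where x: "x \<in> half D" by auto
    let ?S = "R `` {x} \<inter> half D"
    have l: "(y, rot D y) \<in> R" "(y, opp D y) \<in> R" if "y \<in> half D" for y
      unfolding R_def using that by (auto intro!: r_into_rtrancl simp: linked_def)
    have tr: "(a,c) \<in> R" if "(a,b) \<in> R" "(b,c) \<in> R" for a b c
      using that R by (meson equivE transE)
    have "?S = half D"
    proof -
      have "?S \<subseteq> half D" by auto
      moreover have "?S \<noteq> {}" using x R by (auto simp: R_def)
      moreover have "rot D ` ?S \<subseteq> ?S" "opp D ` ?S \<subseteq> ?S"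
        using l tr by (auto; blast)+
      ultimately show ?thesis using a by blast
    qed
    then have "R `` {y} = R `` {x}" if "y \<in> half D" for y
      using R that by (metis IntD1 Image_singleton_iff equiv_class_eq)
    then have "(\<lambda>h. R `` {h}) ` half D = (\<lambda>h. R `` {x}) ` half D" by (rule image_cong[OF refl])
    then have "components D = {R `` {x}}" unfolding comp using x by (metis equals0D image_constant_conv)
    then show "connected_diagram D" by (simp add: connected_diagram_def)
  qed
qed

text \<open>Counting half-edges gives that twice the number of edges is the number of legs plus
  three times the number of trivalent vertices. Consequently one-loop diagrams are those with as
  many legs as trivalent vertices, and two-loop diagrams those with two legs fewer.\<close>

lemma betti1_eq:
  assumes "connected_diagram D"
  shows "2 * betti1 D = int (card (trivalent_vertices D)) - int (card (tips D)) + 2"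
proof -
  have "card (half D) = card (tips D) + card (half D - tips D)"
    using card_Diff_subset[of "tips D" "half D"] card_mono[of "half D" "tips D"] by (auto simp: tips_def)
  then have "2 * card (edges D) = card (tips D) + 3 * card (trivalent_vertices D)"
    by (simp add: card_trivalent3 flip: card_edges)
  then show ?thesis
    using assms by (simp add: betti1_def card_vertices connected_diagram_def)
qed

end

lemma jac_jacobi: "jac g n D \<Longrightarrow> jacobi g D"
  by (simp add: jac_def jacobi_def)

text \<open>Induction along a connected diagram: a property that holds at one half-edge and spreads
  along \<open>rot\<close> and \<open>opp\<close> holds everywhere.\<close>

lemma jac_closedI:
  assumes "jac g n D" "S \<subseteq> half D" "x \<in> S" "\<And>h. h \<in> S \<Longrightarrow> rot D h \<in> S" "\<And>h. h \<in> S \<Longrightarrow> opp D h \<in> S"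
  shows "S = half D"
proof -
  interpret jacobi g D using assms(1) by (rule jac_jacobi)
  have "connected_diagram D" using assms(1) by (simp add: jac_def)
  moreover have "rot D ` S \<subseteq> S" "opp D ` S \<subseteq> S" "S \<noteq> {}" using assms by auto
  ultimately show ?thesis using assms(2) unfolding connected_iff by blast
qed

lemma jacI:
  assumes "jacobi_diagram g D" "half D \<noteq> {}"
    and "\<And>S. S \<subseteq> half D \<Longrightarrow> S \<noteq> {} \<Longrightarrow> (\<And>h. h \<in> S \<Longrightarrow> rot D h \<in> S) \<Longrightarrow> (\<And>h. h \<in> S \<Longrightarrow> opp D h \<in> S) \<Longrightarrow> half D \<subseteq> S"
    and "card (half D - tips D) = 3 * n"
  shows "jac g n D"
proof -
  interpret jacobi g D by unfold_locales fact
  have "connected_diagram D" unfolding connected_iff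
  proof (intro conjI allI impI)
    fix S assume S: "S \<subseteq> half D \<and> S \<noteq> {} \<and> rot D ` S \<subseteq> S \<and> opp D ` S \<subseteq> S"
    have "half D \<subseteq> S" by (rule assms(3)) (use S in auto)
    then show "S = half D" using S by auto
  qed (fact assms(2))
  then show ?thesis using assms(1,4) by (simp add: jac_def card_trivalent3)
qed

lemma jac_cards:
  assumes "jac g n D"
  shows "card (half D - tips D) = 3 * n" "2 * betti1 D = int n - int (card (tips D)) + 2"
proof -
  interpret jacobi g D using assms(1) by (rule jac_jacobi)
  show "card (half D - tips D) = 3 * n" "2 * betti1 D = int n - int (card (tips D)) + 2"
    using assms by (auto simp: jac_def card_trivalent3 betti1_eq)
qed

lemma betti1_cong: "jac g n D \<Longrightarrow> jac g n E \<Longrightarrow> card (tips D) = card (tips E) \<Longrightarrow> betti1 D = betti1 E"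
  using jac_cards(2)[of g n D] jac_cards(2)[of g n E] by simp

subsection \<open>Isomorphisms\<close>

lemma iso_byD:
  assumes "iso_by f D E"
  shows "bij_betw f (half D) (half E)" "inj_on f (half D)" "f ` half D = half E"
    "\<And>h. h \<in> half D \<Longrightarrow> f h \<in> half E"
    "\<And>h. h \<in> half D \<Longrightarrow> rot E (f h) = f (rot D h)"
    "\<And>h. h \<in> half D \<Longrightarrow> opp E (f h) = f (opp D h)"
    "\<And>h. h \<in> half D \<Longrightarrow> rot D h = h \<Longrightarrow> lab E (f h) = lab D h"
    "\<And>h k. h \<in> half D \<Longrightarrow> k \<in> half D \<Longrightarrow> f h = f k \<longleftrightarrow> h = k"
    "\<And>x. x \<in> half E \<Longrightarrow> \<exists>h\<in>half D. x = f h"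
  using assms by (auto simp: iso_by_def bij_betw_def inj_on_eq_iff)

lemma iso_by_tips:
  assumes "jacobi_diagram g D" "iso_by f D E"
  shows "tips E = f ` tips D"
proof -
  interpret jacobi g D by unfold_locales fact
  note f = iso_byD[OF assms(2)]
  show ?thesis
  proof (intro equalityI subsetI)
    fix x assume x: "x \<in> tips E"
    then obtain h where h: "h \<in> half D" "x = f h" using f(9) by (auto simp: tips_def)
    then have "rot D h = h" using x by (simp add: tips_def f)
    then show "x \<in> f ` tips D" using h by (simp add: tips_def)
  next
    fix x assume "x \<in> f ` tips D"
    then show "x \<in> tips E" by (auto simp: tips_def f)
  qed
qed

lemma iso_by_jac:
  assumes "jac g n D" "iso_by f D E"
  shows "jac g n E" "card (tips E) = card (tips D)" "betti1 E = betti1 D"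
proof -
  interpret jacobi g D using assms(1) by (rule jac_jacobi)
  note f = iso_byD[OF assms(2)]
  have t: "tips E = f ` tips D" using iso_by_tips[OF jd assms(2)] .
  have jE: "jacobi_diagram g E" unfolding jacobi_diagram_def
  proof (intro conjI ballI)
    show "finite (half E)" unfolding f(3)[symmetric] using fin by (rule finite_imageI)
  next
    fix x assume "x \<in> half E"
    then obtain h where h: "h \<in> half D" "x = f h" using f(9) by blast
    then show "rot E x \<in> half E" "rot E (rot E (rot E x)) = x" "opp E x \<in> half E"
       "opp E (opp E x) = x" "opp E x \<noteq> x" "rot E x = x \<longrightarrow> lab E x \<in> labels g"
      using f(8)[of "rot D h" h] by (auto simp: f lab_in)
  qed
  show e: "jac g n E"
  proof (rule jacI[OF jE])
    show "half E \<noteq> {}" using assms f(3) by (auto simp: jac_def connected_iff)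
    have "half E - tips E = f ` (half D - tips D)"
      unfolding t f(3)[symmetric] using f(2) by (intro inj_on_image_set_diff[symmetric]) (auto simp: tips_def)
    then have "card (half E - tips E) = card (half D - tips D)"
      by (metis Diff_subset card_image f(2) inj_on_subset)
    then show "card (half E - tips E) = 3 * n" using jac_cards[OF assms(1)] by simp
    fix S assume S: "S \<subseteq> half E" "S \<noteq> {}" "\<And>h. h \<in> S \<Longrightarrow> rot E h \<in> S" "\<And>h. h \<in> S \<Longrightarrow> opp E h \<in> S"
    then obtain x where x: "x \<in> half D" "f x \<in> S" using f(9) by blast
    have "{h \<in> half D. f h \<in> S} = half D"
    proof (rule jac_closedI[OF assms(1), of _ x])
      fix h assume "h \<in> {h \<in> half D. f h \<in> S}"
      then show "rot D h \<in> {h \<in> half D. f h \<in> S}" "opp D h \<in> {h \<in> half D. f h \<in> S}"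
        using S(3)[of "f h"] S(4)[of "f h"] by (auto simp: f)
    qed (use x in auto)
    then show "half E \<subseteq> S" using f(9) by blast
  qed
  show c: "card (tips E) = card (tips D)"
    unfolding t by (rule card_image) (rule inj_on_subset[OF f(2)], auto simp: tips_def)
  show "betti1 E = betti1 D" using betti1_cong[OF e assms(1) c] .
qed

lemma iso_by_sym:
  assumes "jacobi_diagram g D" "iso_by f D E"
  shows "iso_by (inv_into (half D) f) E D"
proof -
  interpret jacobi g D by unfold_locales fact
  note f = iso_byD[OF assms(2)]
  show ?thesis unfolding iso_by_def
  proof (intro conjI ballI)
    show "bij_betw (inv_into (half D) f) (half E) (half D)" using f(1) by (rule bij_betw_inv_into)
  next
    fix x assume "x \<in> half E"
    then obtain h where h: "h \<in> half D" "x = f h" using f(9) by blast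
    then show "inv_into (half D) f (rot E x) = rot D (inv_into (half D) f x)"
       "inv_into (half D) f (opp E x) = opp D (inv_into (half D) f x)"
       "rot E x = x \<longrightarrow> lab D (inv_into (half D) f x) = lab E x"
      by (auto simp: f inv_into_f_f[OF f(2)])
  qed
qed

lemma iso_by_trans:
  assumes "jacobi_diagram g D" "iso_by f D E" "iso_by f' E F"
  shows "iso_by (f' \<circ> f) D F"
proof -
  interpret jacobi g D by unfold_locales fact
  note f = iso_byD[OF assms(2)] note f' = iso_byD[OF assms(3)]
  show ?thesis unfolding iso_by_def
    using bij_betw_trans[OF f(1) f'(1)] by (auto simp: f f')
qed

lemma nat_copy_exists:
  assumes "jac g n (D :: 'h diagram)"
  shows "\<exists>E :: nat diagram. \<exists>f. iso_by f D E"
proof -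
  interpret jacobi g D using assms(1) by (rule jac_jacobi)
  obtain f :: "'h \<Rightarrow> nat" where f: "inj_on f (half D)"
    using finite_imp_inj_to_nat_seg[OF fin] by blast
  let ?i = "inv_into (half D) f"
  let ?E = "\<lparr>half = f ` half D, rot = f \<circ> rot D \<circ> ?i, opp = f \<circ> opp D \<circ> ?i, lab = lab D \<circ> ?i\<rparr>"
  have "iso_by f D ?E" using f by (simp add: iso_by_def bij_betw_def)
  then show ?thesis by blast
qed

subsection \<open>Classes modulo the relations\<close>

text \<open>Wheels, thetas and blow-ups live on their own types of half-edges. They enter the chains
  through a chosen copy on the naturals, the same copy as in \<open>cls\<close>; modulo the
  relations the choice is immaterial.\<close>

definition fr :: "'h diagram \<Rightarrow> nat diagram \<Rightarrow>\<^sub>0 int" where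
  "fr D = frag_of (SOME E :: nat diagram. diagram_iso D E)"

lemma fr_ex:
  assumes "jac g n D"
  obtains E :: "nat diagram" and f where "jac g n E" "iso_by f D E" "fr D = frag_of E"
proof -
  have "\<exists>E :: nat diagram. diagram_iso D E"
    using nat_copy_exists[OF assms] by (simp add: diagram_iso_iff)
  then have "diagram_iso D (SOME E :: nat diagram. diagram_iso D E)" by (rule someI_ex)
  then obtain f where "iso_by f D (SOME E :: nat diagram. diagram_iso D E)"
    by (auto simp: diagram_iso_iff)
  then show ?thesis using that iso_by_jac(1)[OF assms] fr_def by metis
qed

text \<open>Subgroups of the additive group of all chains. The spanning arguments take an arbitrary
  such \<open>S\<close> containing the relations, so they can be reused for the relations
  themselves, for the chains on which two maps agree, and for sums of theta diagrams and
  blow-ups.\<close>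

definition is_sub :: "(nat diagram \<Rightarrow>\<^sub>0 int) set \<Rightarrow> bool" where
  "is_sub S \<longleftrightarrow> 0 \<in> S \<and> (\<forall>x\<in>S. \<forall>y\<in>S. x - y \<in> S)"

lemma is_subD:
  assumes "is_sub S"
  shows "0 \<in> S" "x \<in> S \<Longrightarrow> y \<in> S \<Longrightarrow> x - y \<in> S" "x \<in> S \<Longrightarrow> - x \<in> S" "x \<in> S \<Longrightarrow> y \<in> S \<Longrightarrow> x + y \<in> S"
proof -
  show 0: "0 \<in> S" and d: "x \<in> S \<Longrightarrow> y \<in> S \<Longrightarrow> x - y \<in> S" for x y
    using assms by (auto simp: is_sub_def)
  show m: "x \<in> S \<Longrightarrow> - x \<in> S" for x using d[OF 0, of x] by simp
  show "x \<in> S \<Longrightarrow> y \<in> S \<Longrightarrow> x + y \<in> S" for x y using d[of x "-y"] m[of y] by simp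
qed

lemma is_sub_cmul:
  assumes "is_sub S" "x \<in> S" shows "frag_cmul c x \<in> S"
  using is_subD[OF assms(1)] assms(2) by (intro frag_closure_minus_cmul[where P="\<lambda>x. x \<in> S"]) auto

lemma is_sub_sum:
  assumes "is_sub S" "\<And>i. i \<in> I \<Longrightarrow> f i \<in> S" shows "sum f I \<in> S"
  using assms(2) by (induction I rule: infinite_finite_induct) (auto intro: is_subD[OF assms(1)])

lemma is_sub_diff_iff:
  assumes "is_sub S" "x - y \<in> S"
  shows "x \<in> S \<longleftrightarrow> y \<in> S"
  using is_subD[OF assms(1)] assms(2) by (metis add_diff_cancel_left' diff_add_cancel)

subsection \<open>Reversing vertices\<close>

text \<open>Reverses many vertices at once: \<open>rot\<close> twice is the inverse rotation.
  Meaningful for \<open>Z\<close> a union of vertices; univalent half-edges are unaffected.\<close>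

definition flip :: "'h set \<Rightarrow> 'h diagram \<Rightarrow> 'h diagram" where
  "flip Z D = D\<lparr>rot := \<lambda>h. if h \<in> Z then rot D (rot D h) else rot D h\<rparr>"

lemma flip_simps [simp]:
  "half (flip Z D) = half D" "opp (flip Z D) = opp D" "lab (flip Z D) = lab D"
  "rot (flip Z D) h = (if h \<in> Z then rot D (rot D h) else rot D h)"
  by (simp_all add: flip_def)

lemma flip_empty [simp]: "flip {} D = D"
  by (simp add: flip_def)

context jacobi begin

lemma flip_jacobi:
  assumes "\<And>h. h \<in> Z \<Longrightarrow> h \<in> half D \<and> rot D h \<in> Z"
  shows "jacobi_diagram g (flip Z D)" "tips (flip Z D) = tips D"
    "h \<in> half D \<Longrightarrow> vertex (flip Z D) h = vertex D h"
proof -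
  have Z': "h \<in> half D \<Longrightarrow> rot D h \<in> Z \<Longrightarrow> h \<in> Z" for h
    using assms[of "rot D h"] assms[of "rot D (rot D h)"] by simp
  have i: "h \<in> half D \<Longrightarrow> rot D h \<in> Z \<longleftrightarrow> h \<in> Z" for h
    using assms[of h] Z'[of h] by blast
  show "jacobi_diagram g (flip Z D)"
    unfolding jacobi_diagram_def using lab_in by (auto simp: i)
  show "tips (flip Z D) = tips D" by (auto simp: tips_def)
  show "h \<in> half D \<Longrightarrow> vertex (flip Z D) h = vertex D h" by (auto simp: vertex_def i)
qed

lemma reverse_at_eq_flip:
  assumes "h \<in> half D" "rot D h \<noteq> h"
  shows "reverse_at h D = flip (vertex D h) D"
  using assms by (simp add: reverse_at_def flip_def cyc3_def vertex_def fun_eq_iff)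

end

lemma flip_flip:
  assumes "jacobi_diagram g D" "\<And>h. h \<in> Z \<Longrightarrow> h \<in> half D \<and> rot D h \<in> Z" "\<And>h. h \<in> Z' \<Longrightarrow> h \<in> half D \<and> rot D h \<in> Z'"
  shows "flip Z (flip Z' D) = flip ((Z - Z') \<union> (Z' - Z)) D"
proof -
  interpret jacobi g D by unfold_locales fact
  have "h \<in> half D \<Longrightarrow> rot D h \<in> Z' \<Longrightarrow> h \<in> Z'" for h
    using assms(3)[of "rot D h"] assms(3)[of "rot D (rot D h)"] by simp
  then have i: "h \<in> half D \<Longrightarrow> rot D h \<in> Z' \<longleftrightarrow> h \<in> Z'" for h
    using assms(3)[of h] by blast
  show ?thesis unfolding flip_def using assms(2,3) by (auto simp: fun_eq_iff i)
qed

lemma flip_jac: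
  assumes "jac g n D" "\<And>h. h \<in> Z \<Longrightarrow> h \<in> half D \<and> rot D h \<in> Z"
  shows "jac g n (flip Z D)" "tips (flip Z D) = tips D" "trivalent_vertices (flip Z D) = trivalent_vertices D"
proof -
  interpret jacobi g D using assms(1) by (rule jac_jacobi)
  note fl = flip_jacobi[of Z, OF assms(2)]
  interpret F: jacobi g "flip Z D" by unfold_locales (rule fl(1))
  show "tips (flip Z D) = tips D" by (rule fl(2))
  show "trivalent_vertices (flip Z D) = trivalent_vertices D"
    unfolding F.trivalent_eq trivalent_eq by (intro image_cong) (simp_all add: fl)
  show "jac g n (flip Z D)"
  proof (rule jacI[OF fl(1)])
    show "half (flip Z D) \<noteq> {}" using assms(1) by (simp add: jac_def connected_iff)
    show "card (half (flip Z D) - tips (flip Z D)) = 3 * n" using jac_cards[OF assms(1)] by (simp add: fl(2))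
    fix S assume S: "S \<subseteq> half (flip Z D)" "S \<noteq> {}" "\<And>h. h \<in> S \<Longrightarrow> rot (flip Z D) h \<in> S"
      "\<And>h. h \<in> S \<Longrightarrow> opp (flip Z D) h \<in> S"
    then obtain x where x: "x \<in> S" by blast
    have "S = half D"
    proof (rule jac_closedI[OF assms(1) _ x])
      fix h assume h: "h \<in> S"
      show "rot D h \<in> S"
      proof (cases "h \<in> Z")
        case True
        then have "rot (flip Z D) (rot (flip Z D) h) = rot D h" using assms(2) S(1) h by auto
        then show ?thesis using S(3) h by metis
      qed (use S(3)[OF h] in auto)
      show "opp D h \<in> S" using S(4)[OF h] by simp
    qed (use S(1) in simp)
    then show "half (flip Z D) \<subseteq> S" by simp
  qed
qed

subsection \<open>Rewiring the two ends of an edge\<close>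

text \<open>A common form for all diagrams around an edge: its ends get the cyclic orders
  \<open>(e, a, b)\<close> and \<open>(opp D e, c, d)\<close>. The diagrams I, H and X, and all
  their states at the two ends, are obtained from one diagram by permuting the four
  neighbours.\<close>

definition rewire :: "'h \<Rightarrow> 'h \<Rightarrow> 'h \<Rightarrow> 'h \<Rightarrow> 'h \<Rightarrow> 'h diagram \<Rightarrow> 'h diagram" where
  "rewire e a b c d D = D\<lparr>rot := cyc3 e a b (cyc3 (opp D e) c d (rot D))\<rparr>"

definition inner_edge :: "'h diagram \<Rightarrow> 'h \<Rightarrow> bool" where
  "inner_edge D e \<longleftrightarrow> e \<in> half D \<and> rot D e \<noteq> e \<and> rot D (opp D e) \<noteq> opp D e \<and>
     opp D e \<notin> {rot D e, rot D (rot D e)}"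

lemma rewire_simps [simp]:
  "half (rewire e a b c d D) = half D" "opp (rewire e a b c d D) = opp D" "lab (rewire e a b c d D) = lab D"
  by (simp_all add: rewire_def)

lemma ihx_rewire:
  "ihx_H e D = rewire e (rot D (rot D e)) (rot D (opp D e)) (rot D (rot D (opp D e))) (rot D e) D"
  "ihx_X e D = rewire e (rot D e) (rot D (opp D e)) (rot D (rot D (opp D e))) (rot D (rot D e)) D"
  by (simp_all add: ihx_H_def ihx_X_def rewire_def Let_def)

context jacobi begin

lemma inner_edge_distinct:
  assumes "inner_edge D e"
  shows "distinct [e, rot D e, rot D (rot D e), opp D e, rot D (opp D e), rot D (rot D (opp D e))]"
proof -
  have e: "e \<in> half D" "opp D e \<in> half D" using assms by (auto simp: inner_edge_def)
  have v: "opp D e \<notin> vertex D e" using assms e by (auto simp: inner_edge_def vertex_def)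
  then have "vertex D e \<inter> vertex D (opp D e) = {}"
    using vertex_eq[OF e(1)] vertex_eq[OF e(2)] self_in_vertex by blast
  then show ?thesis using assms e by (auto simp: vertex_def inner_edge_def)
qed

lemma rewire_self:
  assumes "inner_edge D e"
  shows "rewire e (rot D e) (rot D (rot D e)) (rot D (opp D e)) (rot D (rot D (opp D e))) D = D"
proof -
  have e: "e \<in> half D" "opp D e \<in> half D" using assms by (auto simp: inner_edge_def)
  have "cyc3 h (rot D h) (rot D (rot D h)) (rot D) = rot D" if "h \<in> half D" for h
    using that by (simp add: cyc3_def fun_upd_idem)
  then show ?thesis using e by (simp add: rewire_def)
qed

lemma rewire_rot:
  assumes "inner_edge D e"
    "distinct [a, b, c, d]" "{a, b, c, d} = {rot D e, rot D (rot D e), rot D (opp D e), rot D (rot D (opp D e))}"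
  shows "rot (rewire e a b c d D) e = a" "rot (rewire e a b c d D) a = b" "rot (rewire e a b c d D) b = e"
    "rot (rewire e a b c d D) (opp D e) = c" "rot (rewire e a b c d D) c = d" "rot (rewire e a b c d D) d = opp D e"
    "h \<notin> {e, opp D e, a, b, c, d} \<Longrightarrow> rot (rewire e a b c d D) h = rot D h"
    "{e, opp D e, a, b, c, d} \<subseteq> half D" "distinct [e, opp D e, a, b, c, d]"
    "h \<in> half D \<Longrightarrow> rot D h \<in> {e, opp D e, a, b, c, d} \<longleftrightarrow> h \<in> {e, opp D e, a, b, c, d}"
    "h \<in> {e, opp D e, a, b, c, d} \<Longrightarrow> rot D h \<noteq> h"
proof -
  note d = inner_edge_distinct[OF assms(1)]
  have e: "e \<in> half D" "opp D e \<in> half D" using assms by (auto simp: inner_edge_def)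
  have ne: "e \<notin> {a,b,c,d}" "opp D e \<notin> {a,b,c,d}" unfolding assms(3) using d by auto
  show dd: "distinct [e, opp D e, a, b, c, d]" using ne assms(2) e by auto
  show "rot (rewire e a b c d D) e = a" "rot (rewire e a b c d D) a = b" "rot (rewire e a b c d D) b = e"
    "rot (rewire e a b c d D) (opp D e) = c" "rot (rewire e a b c d D) c = d" "rot (rewire e a b c d D) d = opp D e"
    "h \<notin> {e, opp D e, a, b, c, d} \<Longrightarrow> rot (rewire e a b c d D) h = rot D h"
    using dd by (auto simp: rewire_def cyc3_def)
  have six: "{e, opp D e, a, b, c, d} = vertex D e \<union> vertex D (opp D e)"
    using assms(3) by (auto simp: vertex_def)
  show "{e, opp D e, a, b, c, d} \<subseteq> half D" unfolding six using e vertex_sub by auto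
  show "rot D h \<in> {e, opp D e, a, b, c, d} \<longleftrightarrow> h \<in> {e, opp D e, a, b, c, d}" if h: "h \<in> half D"
    unfolding six using h e by (auto simp: vertex_def) (metis rot3 rot_eq_iff rot_in)+
  show "rot D h \<noteq> h" if "h \<in> {e, opp D e, a, b, c, d}"
    using that vertex_tip[of e h] vertex_tip[of "opp D e" h] assms(1) e unfolding six
    by (auto simp: inner_edge_def)
qed

lemma rewire_jacobi:
  assumes "inner_edge D e"
    "distinct [a, b, c, d]" "{a, b, c, d} = {rot D e, rot D (rot D e), rot D (opp D e), rot D (rot D (opp D e))}"
  shows "jacobi_diagram g (rewire e a b c d D)" "tips (rewire e a b c d D) = tips D"
proof -
  let ?E = "rewire e a b c d D" and ?T = "{e, opp D e, a, b, c, d}"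
  note r = rewire_rot[OF assms]
  have T: "rot ?E h \<in> ?T \<and> rot ?E (rot ?E (rot ?E h)) = h \<and> rot ?E h \<noteq> h" if "h \<in> ?T" for h
    using that r(9) by (auto simp: r(1-6))
  have N: "rot ?E h = rot D h" "rot D h \<notin> ?T" if "h \<in> half D" "h \<notin> ?T" for h
    using r(7)[OF that(2)] r(10)[OF that(1)] that by auto
  show "jacobi_diagram g ?E" unfolding jacobi_diagram_def
  proof (intro conjI ballI)
    fix h assume h: "h \<in> half ?E"
    show "opp ?E h \<in> half ?E" "opp ?E (opp ?E h) = h" "opp ?E h \<noteq> h" using h by auto
    show "rot ?E h \<in> half ?E" using T[of h] N[of h] h r(8) by (cases "h \<in> ?T") auto
    have "rot ?E (rot ?E (rot ?E h)) = h" if h': "h \<notin> ?T"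
    proof -
      have "rot D h \<in> half D" "rot D (rot D h) \<in> half D" using h by auto
      then show ?thesis using N[of h] N[of "rot D h"] N[of "rot D (rot D h)"] h h' by simp
    qed
    then show "rot ?E (rot ?E (rot ?E h)) = h" using T by blast
    show "rot ?E h = h \<longrightarrow> lab ?E h \<in> labels g"
      using T[of h] N[of h] h lab_in by (cases "h \<in> ?T") auto
  qed simp
  show "tips ?E = tips D"
  proof (intro equalityI subsetI)
    fix h assume "h \<in> tips ?E"
    then show "h \<in> tips D" using T[of h] N[of h] by (cases "h \<in> ?T") (auto simp: tips_def)
  next
    fix h assume h: "h \<in> tips D"
    then have "h \<notin> ?T" using r(11)[of h] by (auto simp: tips_def)
    then show "h \<in> tips ?E" using r(7)[of h] h by (auto simp: tips_def)
  qed
qed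

end

text \<open>The six half-edges at the two ends of the edge hang together through the edge in either
  wiring. Hence a set closed in the rewired diagram contains all or none of them and is closed in
  \<open>D\<close> as well, which transfers connectedness.\<close>

lemma rewire_jac:
  assumes "jac g n D" "inner_edge D e"
    "distinct [a, b, c, d]" "{a, b, c, d} = {rot D e, rot D (rot D e), rot D (opp D e), rot D (rot D (opp D e))}"
  shows "jac g n (rewire e a b c d D)"
proof -
  interpret jacobi g D using assms(1) by (rule jac_jacobi)
  let ?E = "rewire e a b c d D" and ?T = "{e, opp D e, a, b, c, d}"
  note r = rewire_rot[OF assms(2-)] note j = rewire_jacobi[OF assms(2-)]
  interpret E: jacobi g ?E by unfold_locales (rule j(1))
  show ?thesis
  proof (rule jacI[OF j(1)])
    show "half ?E \<noteq> {}" using assms(2) by (auto simp: inner_edge_def)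
    show "card (half ?E - tips ?E) = 3 * n" using jac_cards[OF assms(1)] by (simp add: j(2))
    fix S assume S: "S \<subseteq> half ?E" "S \<noteq> {}" "\<And>h. h \<in> S \<Longrightarrow> rot ?E h \<in> S" "\<And>h. h \<in> S \<Longrightarrow> opp ?E h \<in> S"
    then obtain x where x: "x \<in> S" by blast
    have all: "?T \<subseteq> S" if "h \<in> ?T" "h \<in> S" for h
    proof -
      have "e \<in> S \<longleftrightarrow> opp D e \<in> S" using S(4)[of e] S(4)[of "opp D e"] r(8) by auto
      moreover have "e \<in> S \<longleftrightarrow> a \<in> S" "a \<in> S \<longleftrightarrow> b \<in> S"
        using S(3)[of e] S(3)[of a] S(3)[of b] by (auto simp: r(1-6))
      moreover have "opp D e \<in> S \<longleftrightarrow> c \<in> S" "c \<in> S \<longleftrightarrow> d \<in> S"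
        using S(3)[of "opp D e"] S(3)[of c] S(3)[of d] by (auto simp: r(1-6))
      ultimately show ?thesis using that by auto
    qed
    have "S = half D"
    proof (rule jac_closedI[OF assms(1) _ x])
      fix h assume h: "h \<in> S"
      show "rot D h \<in> S"
      proof (cases "h \<in> ?T")
        case True
        then have "rot D h \<in> ?T" using r(10)[of h] r(8) by blast
        then show ?thesis using all[OF True h] by blast
      qed (use S(3)[OF h] r(7)[of h] in auto)
      show "opp D h \<in> S" using S(4)[OF h] by simp
    qed (use S(1) in simp)
    then show "half ?E \<subseteq> S" by simp
  qed
qed

lemma ihx_jac:
  assumes "jac g n D" "inner_edge D e"
  shows "jac g n (ihx_H e D)" "tips (ihx_H e D) = tips D" "jac g n (ihx_X e D)" "tips (ihx_X e D) = tips D"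
proof -
  interpret jacobi g D using assms(1) by (rule jac_jacobi)
  note d = inner_edge_distinct[OF assms(2)]
  show "jac g n (ihx_H e D)" "jac g n (ihx_X e D)"
    unfolding ihx_rewire by (rule rewire_jac[OF assms]; use d in auto)+
  show "tips (ihx_H e D) = tips D" "tips (ihx_X e D) = tips D"
    unfolding ihx_rewire by (rule rewire_jacobi[OF assms(2)]; use d in auto)+
qed

section \<open>The relators and congruence of chains modulo them\<close>

abbreviation relators :: "nat \<Rightarrow> nat \<Rightarrow> (nat diagram \<Rightarrow>\<^sub>0 int) set" where
  "relators g n \<equiv> iso_relators g n \<union> as_relators g n \<union> ihx_relators g n \<union> self_loop_relators g n"

lemma as_relators_eq:
  "as_relators g n = {frag_of D + frag_of (flip (vertex D h) D) |D h. jac g n D \<and> h \<in> half D \<and> rot D h \<noteq> h}"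
proof -
  have r: "reverse_at h D = flip (vertex D h) D" if "jac g n D" "h \<in> half D" "rot D h \<noteq> h" for h and D :: "nat diagram"
    using jacobi.reverse_at_eq_flip[OF jac_jacobi[OF that(1)] that(2,3)] .
  show ?thesis unfolding as_relators_def jac_mem
  proof (intro equalityI subsetI; elim CollectE exE conjE; intro CollectI exI conjI)
  qed (auto simp: r)
qed

lemma ihx_relators_eq:
  "ihx_relators g n = {frag_of D - frag_of (ihx_H e D) + frag_of (ihx_X e D) |D e. jac g n D \<and> inner_edge D e}"
  unfolding ihx_relators_def inner_edge_def by (auto simp: jac_mem)

lemma vertex_closed:
  assumes "jacobi_diagram g D" "h \<in> half D" "k \<in> vertex D h"
  shows "k \<in> half D \<and> rot D k \<in> vertex D h"
proof -
  interpret jacobi g D by unfold_locales fact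
  show ?thesis using assms by (auto simp: vertex_def)
qed

lemma flip_vertex_jac:
  assumes "jac g n D" "h \<in> half D"
  shows "jac g n (flip (vertex D h) D)" "tips (flip (vertex D h) D) = tips D"
proof -
  interpret jacobi g D using assms(1) by (rule jac_jacobi)
  show "jac g n (flip (vertex D h) D)" "tips (flip (vertex D h) D) = tips D"
    by (rule flip_jac[OF assms(1)]; use vertex_closed[OF jd assms(2)] in blast)+
qed

lemma keys_add_sub: "Poly_Mapping.keys x \<subseteq> S \<Longrightarrow> Poly_Mapping.keys y \<subseteq> S \<Longrightarrow> Poly_Mapping.keys (x + y) \<subseteq> S"
  using keys_add[of x y] by blast

lemma keys_diff_sub: "Poly_Mapping.keys (x::'a \<Rightarrow>\<^sub>0 int) \<subseteq> S \<Longrightarrow> Poly_Mapping.keys y \<subseteq> S \<Longrightarrow> Poly_Mapping.keys (x - y) \<subseteq> S"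
  using keys_diff[of x y] by blast

lemma relators_keys:
  assumes "x \<in> relators g n"
  shows "Poly_Mapping.keys x \<subseteq> jacobi_diagrams g n"
proof -
  have k: "Poly_Mapping.keys (frag_of D) \<subseteq> jacobi_diagrams g n" if "jac g n D" for D
    using that by (simp add: keys_frag_of jac_mem)
  from assms consider "x \<in> iso_relators g n" | "x \<in> as_relators g n" | "x \<in> ihx_relators g n"
    | "x \<in> self_loop_relators g n" by blast
  then show ?thesis
  proof cases
    case 1 then show ?thesis unfolding iso_relators_def
      by (elim CollectE exE conjE) (simp only: jac_mem keys_diff_sub k)
  next
    case 2 then show ?thesis unfolding as_relators_eq
      by (elim CollectE exE conjE) (simp only: keys_add_sub k flip_vertex_jac)
  next
    case 3 then show ?thesis unfolding ihx_relators_eq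
      by (elim CollectE exE conjE) (simp only: keys_add_sub keys_diff_sub k ihx_jac)
  next
    case 4 then show ?thesis unfolding self_loop_relators_def
      by (elim CollectE exE conjE) (simp only: jac_mem k)
  qed
qed

lemma relations_subgroup: "subgroup (relations g n) (free_Abelian_group (jacobi_diagrams g n))"
  unfolding relations_def
  by (rule group.generate_is_subgroup[OF group_free_Abelian_group], rule subsetI,
      unfold carrier_free_Abelian_group_iff, rule relators_keys)

lemma relations_keys: "x \<in> relations g n \<Longrightarrow> Poly_Mapping.keys x \<subseteq> jacobi_diagrams g n"
  using subgroup.subset[OF relations_subgroup, of g n] by (auto simp: free_Abelian_group_def)

lemma relators_in: "x \<in> relators g n \<Longrightarrow> x \<in> relations g n"
  unfolding relations_def by (rule generate.incl)

lemma is_sub_relations: "is_sub (relations g n)"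
proof -
  note s = relations_subgroup[of g n]
  have m: "- y \<in> relations g n" if "y \<in> relations g n" for y
    using subgroup.m_inv_closed[OF s that] inv_free_Abelian_group[OF relations_keys[OF that]] by simp
  have "x - y \<in> relations g n" if "x \<in> relations g n" "y \<in> relations g n" for x y
    using subgroup.m_closed[OF s that(1) m[OF that(2)]] by simp
  then show ?thesis using subgroup.one_closed[OF s] by (simp add: is_sub_def)
qed

text \<open>A difference-preserving map on chains respects the relations as soon as it respects the
  relators. The blow-up and the state sum are both checked in this way before any quotient is
  formed.\<close>

lemma relations_hom:
  assumes "is_sub S" "\<And>x y. F (x - y) = F x - F y" "\<And>x. x \<in> relators g n \<Longrightarrow> F x \<in> S" "x \<in> relations g n"
  shows "F x \<in> S"
proof -
  have F0: "F 0 = 0" using assms(2)[of 0 0] by simp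
  have Fm: "F (- x) = - F x" for x using assms(2)[of 0 x] F0 by simp
  have Fa: "F (x + y) = F x + F y" for x y using assms(2)[of x "- y"] Fm by simp
  show ?thesis using assms(4) unfolding relations_def
  proof induction
    case one then show ?case using F0 is_subD[OF assms(1)] by simp
  next
    case (incl h) then show ?case by (rule assms(3))
  next
    case (inv h)
    then show ?case using relators_keys[of h g n] assms(3)[of h] Fm is_subD[OF assms(1)] by simp
  next
    case (eng h1 h2) then show ?case using Fa is_subD[OF assms(1)] by simp
  qed
qed

definition congr :: "nat \<Rightarrow> nat \<Rightarrow> (nat diagram \<Rightarrow>\<^sub>0 int) \<Rightarrow> (nat diagram \<Rightarrow>\<^sub>0 int) \<Rightarrow> bool" where
  "congr g n x y \<longleftrightarrow> x - y \<in> relations g n"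

lemmas relsub = is_subD[OF is_sub_relations]

lemma congr_refl [simp]: "congr g n x x"
  by (simp add: congr_def relsub)

lemma congr_sym: "congr g n x y \<Longrightarrow> congr g n y x"
  unfolding congr_def using relsub(3)[of "x - y"] by simp

lemma congr_trans [trans]: "congr g n x y \<Longrightarrow> congr g n y z \<Longrightarrow> congr g n x z"
  unfolding congr_def using relsub(4)[of "x - y" g n "y - z"] by simp

lemma congr_eq_trans [trans]: "congr g n x y \<Longrightarrow> y = z \<Longrightarrow> congr g n x z"
  "x = y \<Longrightarrow> congr g n y z \<Longrightarrow> congr g n x z"
  by simp_all

lemma congr_add: "congr g n x y \<Longrightarrow> congr g n x' y' \<Longrightarrow> congr g n (x + x') (y + y')"
  unfolding congr_def using relsub(4)[of "x - y" g n "x' - y'"] by (simp add: algebra_simps)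

lemma congr_diff: "congr g n x y \<Longrightarrow> congr g n x' y' \<Longrightarrow> congr g n (x - x') (y - y')"
  unfolding congr_def using relsub(2)[of "x - y" g n "x' - y'"] by (simp add: algebra_simps)

lemma congr_minus: "congr g n x y \<Longrightarrow> congr g n (- x) (- y)"
  using congr_diff[OF congr_refl[of g n 0]] by simp

lemma congr_cmul: "congr g n x y \<Longrightarrow> congr g n (frag_cmul c x) (frag_cmul c y)"
  unfolding congr_def using is_sub_cmul[OF is_sub_relations, of "x - y" g n c]
  by (metis add_uminus_conv_diff frag_cmul_distrib2 minus_frag_cmul mult_minus1_right frag_cmul_cmul frag_cmul_minus_one)

lemma congr_sum: "(\<And>i. i \<in> I \<Longrightarrow> congr g n (f i) (h i)) \<Longrightarrow> congr g n (sum f I) (sum h I)"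
  unfolding congr_def sum_subtractf[symmetric] by (rule is_sub_sum[OF is_sub_relations])

lemma congr_0_iff: "congr g n x 0 \<longleftrightarrow> x \<in> relations g n"
  by (simp add: congr_def)

lemma frag_of_fr:
  fixes E :: "nat diagram"
  assumes "jac g n E"
  shows "congr g n (frag_of E) (fr E)"
proof -
  obtain F :: "nat diagram" and f where F: "jac g n F" "iso_by f E F" "fr E = frag_of F"
    using fr_ex[OF assms] by blast
  then have "frag_of E - fr E \<in> iso_relators g n"
    using assms by (auto simp: iso_relators_def jac_mem diagram_iso_iff)
  then show ?thesis unfolding congr_def by (intro relators_in) simp
qed

lemma fr_iso:
  assumes "jac g n D" "iso_by f D E"
  shows "congr g n (fr D) (fr E)"
proof -
  interpret jacobi g D using assms(1) by (rule jac_jacobi)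
  obtain D' :: "nat diagram" and d where D': "jac g n D'" "iso_by d D D'" "fr D = frag_of D'"
    using fr_ex[OF assms(1)] by blast
  obtain E' :: "nat diagram" and e where E': "jac g n E'" "iso_by e E E'" "fr E = frag_of E'"
    using fr_ex[OF iso_by_jac(1)[OF assms]] by blast
  have "iso_by (inv_into (half D) d) D' D" by (rule iso_by_sym[OF jd D'(2)])
  moreover have "iso_by (e \<circ> f) D E'" by (rule iso_by_trans[OF jd assms(2) E'(2)])
  ultimately have "iso_by (e \<circ> f \<circ> inv_into (half D) d) D' E'"
    using iso_by_trans D'(1) unfolding jac_def by blast
  then have "frag_of D' - frag_of E' \<in> iso_relators g n"
    using D'(1) E'(1) by (auto simp: iso_relators_def jac_mem diagram_iso_iff)
  then show ?thesis unfolding congr_def D'(3) E'(3) by (intro relators_in) simp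
qed

lemma iso_by_flip:
  assumes "jacobi_diagram g D" "iso_by f D E" "Z \<subseteq> half D"
  shows "iso_by f (flip Z D) (flip (f ` Z) E)"
proof -
  interpret jacobi g D by unfold_locales fact
  note f = iso_byD[OF assms(2)]
  have "f h \<in> f ` Z \<longleftrightarrow> h \<in> Z" if "h \<in> half D" for h
    using that assms(3) f(8) by blast
  then show ?thesis using f(1) by (auto simp: iso_by_def f)
qed

lemma iso_by_vertex:
  assumes "jacobi_diagram g D" "iso_by f D E" "h \<in> half D"
  shows "vertex E (f h) = f ` vertex D h"
proof -
  interpret jacobi g D by unfold_locales fact
  show ?thesis using assms(3) by (simp add: vertex_def iso_byD[OF assms(2)])
qed

lemma iso_by_rewire:
  assumes "jacobi_diagram g D" "iso_by f D E" "{e, a, b, c, d} \<subseteq> half D"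
    "distinct [e, opp D e, a, b, c, d]" "\<And>h. h \<in> {e, opp D e, a, b, c, d} \<Longrightarrow> rot D h \<noteq> h"
  shows "iso_by f (rewire e a b c d D) (rewire (f e) (f a) (f b) (f c) (f d) E)"
proof -
  interpret jacobi g D by unfold_locales fact
  note f = iso_byD[OF assms(2)]
  have i: "f h = f x \<longleftrightarrow> h = x" if "h \<in> half D" "x \<in> {e, a, b, c, d} \<union> {opp D e}" for h x
    using that assms(3) f(8)[of h x] opp_in[of e] by auto
  have o: "opp E (f e) = f (opp D e)" using assms(3) f by simp
  have iu: "(f x = f y) = (x = y)" if "x \<in> {e, opp D e, a, b, c, d}" "y \<in> {e, opp D e, a, b, c, d}" for x y
    using that assms(3) f(8)[of x y] opp_in[of e] by auto
  show ?thesis unfolding iso_by_def rewire_def cyc3_def o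
  proof (intro conjI ballI)
    fix h assume "h \<in> half (D\<lparr>rot := (rot D)(opp D e := c, c := d, d := opp D e, e := a, a := b, b := e)\<rparr>)"
    then have h: "h \<in> half D" by simp
    note ih = i[OF h]
    show "f (rot (D\<lparr>rot := (rot D)(opp D e := c, c := d, d := opp D e, e := a, a := b, b := e)\<rparr>) h) =
         rot (E\<lparr>rot := (rot E)(f (opp D e) := f c, f c := f d, f d := f (opp D e), f e := f a, f a := f b, f b := f e)\<rparr>) (f h)"
      using h by (simp add: ih f)
    show "f (opp (D\<lparr>rot := (rot D)(opp D e := c, c := d, d := opp D e, e := a, a := b, b := e)\<rparr>) h) =
         opp (E\<lparr>rot := (rot E)(f (opp D e) := f c, f c := f d, f d := f (opp D e), f e := f a, f a := f b, f b := f e)\<rparr>) (f h)"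
      using h by (simp add: f)
    show "rot (D\<lparr>rot := (rot D)(opp D e := c, c := d, d := opp D e, e := a, a := b, b := e)\<rparr>) h = h \<longrightarrow>
      lab (E\<lparr>rot := (rot E)(f (opp D e) := f c, f c := f d, f d := f (opp D e), f e := f a, f a := f b, f b := f e)\<rparr>) (f h) =
      lab (D\<lparr>rot := (rot D)(opp D e := c, c := d, d := opp D e, e := a, a := b, b := e)\<rparr>) h"
      using h assms(4) by (auto simp: f)
  qed (use f(1) in simp)
qed

lemma fr_flip_vertex:
  assumes "jac g n D" "h \<in> half D" "rot D h \<noteq> h"
  shows "congr g n (fr (flip (vertex D h) D)) (- fr D)"
proof -
  interpret jacobi g D using assms(1) by (rule jac_jacobi)
  obtain E :: "nat diagram" and f where E: "jac g n E" "iso_by f D E" "fr D = frag_of E"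
    using fr_ex[OF assms(1)] by blast
  note f = iso_byD[OF E(2)]
  have h: "f h \<in> half E" "rot E (f h) \<noteq> f h" using assms by (auto simp: f)
  have "frag_of E + frag_of (flip (vertex E (f h)) E) \<in> as_relators g n"
    unfolding as_relators_eq using h E(1) by auto
  then have 1: "congr g n (frag_of (flip (vertex E (f h)) E)) (- fr D)"
    unfolding congr_def E(3) by (intro relators_in) (simp add: algebra_simps)
  have "iso_by f (flip (vertex D h) D) (flip (vertex E (f h)) E)"
    unfolding iso_by_vertex[OF jd E(2) assms(2)] by (rule iso_by_flip[OF jd E(2) vertex_sub[OF assms(2)]])
  then have "congr g n (fr (flip (vertex D h) D)) (fr (flip (vertex E (f h)) E))"
    by (rule fr_iso[OF flip_vertex_jac(1)[OF assms(1,2)]])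
  also have "congr g n (fr (flip (vertex E (f h)) E)) (frag_of (flip (vertex E (f h)) E))"
    by (rule congr_sym, rule frag_of_fr, rule flip_vertex_jac(1)[OF E(1) h(1)])
  also note 1
  finally show ?thesis .
qed

lemma fr_ihx:
  assumes "jac g n D" "inner_edge D e"
  shows "congr g n (fr D) (fr (ihx_H e D) - fr (ihx_X e D))"
proof -
  interpret jacobi g D using assms(1) by (rule jac_jacobi)
  obtain E :: "nat diagram" and f where E: "jac g n E" "iso_by f D E" "fr D = frag_of E"
    using fr_ex[OF assms(1)] by blast
  note f = iso_byD[OF E(2)]
  have e: "e \<in> half D" "opp D e \<in> half D" using assms by (auto simp: inner_edge_def)
  note dd = inner_edge_distinct[OF assms(2)]
  have ie: "inner_edge E (f e)" using assms(2) e by (auto simp: inner_edge_def f)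
  have nt: "rot D h \<noteq> h" if "h \<in> {e, opp D e, rot D e, rot D (rot D e), rot D (opp D e), rot D (rot D (opp D e))}" for h
    using that assms(2) e by (auto simp: inner_edge_def)
  have "frag_of E - frag_of (ihx_H (f e) E) + frag_of (ihx_X (f e) E) \<in> ihx_relators g n"
    unfolding ihx_relators_eq using E(1) ie by auto
  then have 1: "congr g n (fr D) (frag_of (ihx_H (f e) E) - frag_of (ihx_X (f e) E))"
    unfolding congr_def E(3) by (intro relators_in) (simp add: algebra_simps)
  have "iso_by f (ihx_H e D) (ihx_H (f e) E)" "iso_by f (ihx_X e D) (ihx_X (f e) E)"
  proof -
    have eq: "ihx_H (f e) E = rewire (f e) (f (rot D (rot D e))) (f (rot D (opp D e))) (f (rot D (rot D (opp D e)))) (f (rot D e)) E"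
      "ihx_X (f e) E = rewire (f e) (f (rot D e)) (f (rot D (opp D e))) (f (rot D (rot D (opp D e)))) (f (rot D (rot D e))) E"
      using e by (simp_all add: ihx_rewire f)
    have in_half: "{e, rot D e, rot D (rot D e), rot D (opp D e), rot D (rot D (opp D e))} \<subseteq> half D"
      using e by simp
    show "iso_by f (ihx_H e D) (ihx_H (f e) E)" "iso_by f (ihx_X e D) (ihx_X (f e) E)"
      unfolding eq unfolding ihx_rewire
      by (rule iso_by_rewire[OF jd E(2)]; (rule nt)?; use in_half dd in force)+
  qed
  then have "congr g n (fr (ihx_H e D)) (fr (ihx_H (f e) E))" "congr g n (fr (ihx_X e D)) (fr (ihx_X (f e) E))"
    using fr_iso ihx_jac[OF assms] by blast+
  moreover have "congr g n (fr (ihx_H (f e) E)) (frag_of (ihx_H (f e) E))"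
     "congr g n (fr (ihx_X (f e) E)) (frag_of (ihx_X (f e) E))"
    using ihx_jac[OF E(1) ie] by (auto intro: congr_sym frag_of_fr)
  ultimately have "congr g n (fr (ihx_H e D) - fr (ihx_X e D)) (frag_of (ihx_H (f e) E) - frag_of (ihx_X (f e) E))"
    by (blast intro: congr_diff congr_trans)
  with 1 show ?thesis by (blast intro: congr_sym congr_trans)
qed

lemma fr_self_loop:
  assumes "jac g n D" "h \<in> half D" "opp D h \<in> {rot D h, rot D (rot D h)}"
  shows "congr g n (fr D) 0"
proof -
  interpret jacobi g D using assms(1) by (rule jac_jacobi)
  obtain E :: "nat diagram" and f where E: "jac g n E" "iso_by f D E" "fr D = frag_of E"
    using fr_ex[OF assms(1)] by blast
  note f = iso_byD[OF E(2)]
  have "f h \<in> half E" "opp E (f h) \<in> {rot E (f h), rot E (rot E (f h))}"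
    using assms by (auto simp: f)
  then have "frag_of E \<in> self_loop_relators g n"
    using E(1) by (auto simp: self_loop_relators_def jac_mem)
  then show ?thesis unfolding congr_0_iff E(3) by (intro relators_in) simp
qed

text \<open>AS is applied to one vertex of \<open>Z\<close> after another; a set of
  \<open>3 * k\<close> trivalent half-edges closed under \<open>rot\<close> consists of
  \<open>k\<close> vertices.\<close>

lemma fr_flip:
  assumes "jac g n D" "Z \<subseteq> half D - tips D" "\<And>h. h \<in> Z \<Longrightarrow> rot D h \<in> Z" "card Z = 3 * k"
  shows "congr g n (fr (flip Z D)) (frag_cmul ((-1) ^ k) (fr D))"
  using assms(2-)
proof (induction k arbitrary: Z)
  case 0
  interpret jacobi g D using assms(1) by (rule jac_jacobi)
  have "finite Z" using 0(1) finite_subset[of Z "half D"] by auto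
  then have "Z = {}" using 0 by simp
  then show ?case by simp
next
  case (Suc k)
  interpret jacobi g D using assms(1) by (rule jac_jacobi)
  have finZ: "finite Z" using Suc.prems(1) finite_subset[of Z "half D"] by auto
  have "Z \<noteq> {}" using Suc.prems(3) by auto
  then obtain h where hZ: "h \<in> Z" by blast
  then have h: "h \<in> half D" "rot D h \<noteq> h" using Suc.prems(1) by (auto simp: tips_def)
  let ?v = "vertex D h" and ?Z = "Z - vertex D h"
  have vZ: "?v \<subseteq> Z" using hZ Suc.prems(2) by (auto simp: vertex_def)
  have cl: "rot D x \<in> ?Z" if "x \<in> ?Z" for x
  proof -
    have x: "x \<in> half D" using that Suc.prems(1) by auto
    have "rot D x \<notin> ?v"
    proof
      assume "rot D x \<in> ?v"
      then have "vertex D (rot D x) = ?v" by (rule vertex_eq[OF h(1)])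
      then have "?v = vertex D x" by (simp only: vertex_rot[OF x])
      from this[symmetric] self_in_vertex[of x] have "x \<in> ?v" by (rule subst)
      then show False using that by blast
    qed
    then show ?thesis using that Suc.prems(2) by auto
  qed
  have "card ?Z = 3 * k" using Suc.prems(3) vZ finZ by (simp add: card_Diff_subset card_vertex h)
  then have IH: "congr g n (fr (flip ?Z D)) (frag_cmul ((-1) ^ k) (fr D))"
    using Suc.IH[of ?Z] cl Suc.prems(1) by blast
  have Zc: "\<And>x. x \<in> ?Z \<Longrightarrow> x \<in> half D \<and> rot D x \<in> ?Z" using cl Suc.prems(1) by blast
  note fl = flip_jac[OF assms(1), of ?Z, OF Zc]
  have vv: "vertex (flip ?Z D) h = ?v" using flip_jacobi(3)[of ?Z, OF Zc] h by simp
  have "flip ?v (flip ?Z D) = flip ((?v - ?Z) \<union> (?Z - ?v)) D"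
    by (rule flip_flip[OF jd]) (use vertex_closed[OF jd h(1)] Zc in blast)+
  also have "(?v - ?Z) \<union> (?Z - ?v) = Z" using vZ by auto
  finally have e: "flip Z D = flip (vertex (flip ?Z D) h) (flip ?Z D)" by (simp add: vv)
  have "h \<notin> ?Z" by simp
  have "congr g n (fr (flip Z D)) (- fr (flip ?Z D))"
    unfolding e by (rule fr_flip_vertex[OF fl(1)]) (use h in auto)
  also have "congr g n \<dots> (- frag_cmul ((-1) ^ k) (fr D))" by (rule congr_minus[OF IH])
  finally show ?case by simp
qed

text \<open>The shape of all sign computations below: an explicit isomorphism that becomes
  orientation preserving after \<open>k\<close> vertices are reversed yields the sign
  \<open>(-1) ^ k\<close>.\<close>

lemma fr_flip_iso:
  assumes "jac g n D" "Z \<subseteq> half D - tips D" "\<And>h. h \<in> Z \<Longrightarrow> rot D h \<in> Z" "card Z = 3 * k"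
    and "iso_by f (flip Z D) E"
  shows "congr g n (fr E) (frag_cmul ((-1) ^ k) (fr D))" "jac g n E"
proof -
  have j: "jac g n (flip Z D)" by (rule flip_jac[OF assms(1)]) (use assms(2,3) in auto)
  have "congr g n (fr E) (fr (flip Z D))" by (rule congr_sym, rule fr_iso[OF j assms(5)])
  also note fr_flip[OF assms(1-4)]
  finally show "congr g n (fr E) (frag_cmul ((-1) ^ k) (fr D))" .
  show "jac g n E" by (rule iso_by_jac(1)[OF j assms(5)])
qed

subsection \<open>Blowing up a vertex\<close>

lemma iso_byI:
  assumes "\<And>h. h \<in> half D \<Longrightarrow> f h \<in> half E \<and> f' (f h) = h" "\<And>k. k \<in> half E \<Longrightarrow> f' k \<in> half D \<and> f (f' k) = k"
    and "\<And>h. h \<in> half D \<Longrightarrow> rot E (f h) = f (rot D h)"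
    and "\<And>h. h \<in> half D \<Longrightarrow> opp E (f h) = f (opp D h)"
    and "\<And>h. h \<in> half D \<Longrightarrow> rot D h = h \<Longrightarrow> lab E (f h) = lab D h"
  shows "iso_by f D E"
proof -
  have "bij_betw f (half D) (half E)"
    by (rule bij_betw_byWitness[where f' = f']) (use assms(1,2) in auto)
  then show ?thesis using assms(3-5) by (simp add: iso_by_def)
qed

lemma blow_up_half: "half (blow_up h D) = Old ` half D \<union> Fwd ` vertex D h \<union> Bwd ` vertex D h"
  and blow_up_rot [simp]:
    "rot (blow_up h D) (Old x) = (if x \<in> vertex D h then Fwd x else Old (rot D x))"
    "rot (blow_up h D) (Fwd x) = Bwd x" "rot (blow_up h D) (Bwd x) = Old x"
  and blow_up_opp [simp]:
    "opp (blow_up h D) (Old x) = Old (opp D x)"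
    "opp (blow_up h D) (Fwd x) = Bwd (rot D x)" "opp (blow_up h D) (Bwd x) = Fwd (rot D (rot D x))"
  and blow_up_lab [simp]: "lab (blow_up h D) (Old x) = lab D x" "lab (blow_up h D) (Fwd x) = lab D x"
    "lab (blow_up h D) (Bwd x) = lab D x"
  by (simp_all add: blow_up_def vertex_def Let_def)

lemma blow_up_half_iff [simp]:
  "Old x \<in> half (blow_up h D) \<longleftrightarrow> x \<in> half D" "Fwd x \<in> half (blow_up h D) \<longleftrightarrow> x \<in> vertex D h"
  "Bwd x \<in> half (blow_up h D) \<longleftrightarrow> x \<in> vertex D h"
  by (auto simp: blow_up_half)

lemma blow_up_cong: "vertex D h = vertex D k \<Longrightarrow> blow_up h D = blow_up k D"
  by (simp add: blow_up_def vertex_def Let_def)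

lemma blow_up_jac:
  assumes "jac g n D" "h \<in> half D" "rot D h \<noteq> h"
  shows "jac g (n + 2) (blow_up h D)" "tips (blow_up h D) = Old ` tips D"
proof -
  interpret jacobi g D using assms(1) by (rule jac_jacobi)
  let ?B = "blow_up h D" and ?v = "vertex D h"
  have v: "x \<in> half D" "rot D x \<in> ?v" "rot D x \<noteq> x" if "x \<in> ?v" for x
    using that assms vertex_tip[OF assms(2) that] by (auto simp: vertex_def)
  have nv: "rot D x \<notin> ?v" if "x \<in> half D" "x \<notin> ?v" for x
    using that v(2)[of "rot D x"] v(2)[of "rot D (rot D x)"] by auto
  have j: "jacobi_diagram g ?B" unfolding jacobi_diagram_def
  proof (intro conjI ballI)
    show "finite (half ?B)" by (simp add: blow_up_half)
    fix k assume k: "k \<in> half ?B"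
    show "rot ?B k \<in> half ?B" "rot ?B (rot ?B (rot ?B k)) = k" "opp ?B k \<in> half ?B" "opp ?B (opp ?B k) = k"
      "opp ?B k \<noteq> k" "rot ?B k = k \<longrightarrow> lab ?B k \<in> labels g"
      using k v nv lab_in by (cases k; simp)+
  qed
  show t: "tips ?B = Old ` tips D"
  proof (intro equalityI subsetI)
    fix x assume "x \<in> tips ?B"
    then show "x \<in> Old ` tips D" by (cases x) (auto simp: tips_def split: if_splits)
  next
    fix x assume "x \<in> Old ` tips D"
    then show "x \<in> tips ?B" using v(3) by (auto simp: tips_def)
  qed
  show "jac g (n + 2) ?B"
  proof (rule jacI[OF j])
    show "half ?B \<noteq> {}" using assms(2) by (auto simp: blow_up_half)
    have "half ?B - tips ?B = Old ` (half D - tips D) \<union> (Fwd ` ?v \<union> Bwd ` ?v)"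
      unfolding t by (auto simp: blow_up_half)
    moreover have "card \<dots> = card (half D - tips D) + (card ?v + card ?v)"
      by (subst card_Un_disjoint; (subst card_Un_disjoint)?; auto simp: card_image inj_on_def)
    ultimately show "card (half ?B - tips ?B) = 3 * (n + 2)"
      using jac_cards[OF assms(1)] assms by (simp add: card_vertex)
    fix S assume S: "S \<subseteq> half ?B" "S \<noteq> {}" "\<And>h. h \<in> S \<Longrightarrow> rot ?B h \<in> S" "\<And>h. h \<in> S \<Longrightarrow> opp ?B h \<in> S"
    then obtain x where x: "x \<in> S" by blast
    have fb: "Fwd y \<in> S \<Longrightarrow> Bwd y \<in> S" "Bwd y \<in> S \<Longrightarrow> Old y \<in> S" for y
      using S(3)[of "Fwd y"] S(3)[of "Bwd y"] by simp_all
    have bS: "y \<in> ?v" if "Fwd y \<in> S \<or> Bwd y \<in> S" for y using that S(1) by auto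
    have "\<exists>y. Old y \<in> S" using x fb by (cases x) auto
    then obtain y where y: "Old y \<in> S" by blast
    have "{x \<in> half D. Old x \<in> S} = half D"
    proof (rule jac_closedI[OF assms(1)])
      show "y \<in> {x \<in> half D. Old x \<in> S}" using y S(1) by auto
      fix x assume x: "x \<in> {x \<in> half D. Old x \<in> S}"
      then show "opp D x \<in> {x \<in> half D. Old x \<in> S}" using S(4)[of "Old x"] by simp
      show "rot D x \<in> {x \<in> half D. Old x \<in> S}"
      proof (cases "x \<in> ?v")
        case True
        then have "Fwd x \<in> S" using S(3)[of "Old x"] x by simp
        then have "Bwd (rot D x) \<in> S" using S(4)[of "Fwd x"] by simp
        then show ?thesis using fb x by simp
      next
        case False then show ?thesis using S(3)[of "Old x"] x by simp
      qed
    qed auto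
    then have o: "Old x \<in> S" if "x \<in> half D" for x using that by blast
    moreover have "Fwd x \<in> S" if "x \<in> ?v" for x using S(3)[of "Old x"] o[of x] that v by simp
    ultimately show "half ?B \<subseteq> S" using fb by (auto simp: blow_up_half)
  qed
qed

lemma blow_up_iso:
  assumes "jacobi_diagram g D" "iso_by f D E" "h \<in> half D" "rot D h \<noteq> h"
  shows "iso_by (map_bu_half f) (blow_up h D) (blow_up (f h) E)"
proof -
  interpret jacobi g D by unfold_locales fact
  note f = iso_byD[OF assms(2)]
  have v: "vertex E (f h) = f ` vertex D h" by (rule iso_by_vertex[OF assms(1-3)])
  have vD: "x \<in> half D" if "x \<in> vertex D h" for x using that vertex_sub[OF assms(3)] by blast
  have fv: "f x \<in> f ` vertex D h \<longleftrightarrow> x \<in> vertex D h" if "x \<in> half D" for x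
    using that vD f(8) by blast
  have b: "bij_betw (map_bu_half f) (half (blow_up h D)) (half (blow_up (f h) E))"
    unfolding bij_betw_def
  proof
    show "inj_on (map_bu_half f) (half (blow_up h D))"
    proof (rule inj_onI)
      fix x y assume "x \<in> half (blow_up h D)" "y \<in> half (blow_up h D)" "map_bu_half f x = map_bu_half f y"
      then show "x = y" using f(8) vD by (cases x; cases y; simp)
    qed
    show "map_bu_half f ` half (blow_up h D) = half (blow_up (f h) E)"
      by (simp add: blow_up_half v image_Un image_image f(3)[symmetric])
  qed
  show ?thesis unfolding iso_by_def
  proof (intro conjI ballI b)
    fix k assume k: "k \<in> half (blow_up h D)"
    show "map_bu_half f (rot (blow_up h D) k) = rot (blow_up (f h) E) (map_bu_half f k)"
      using k vD by (cases k) (simp_all add: v fv f)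
    show "map_bu_half f (opp (blow_up h D) k) = opp (blow_up (f h) E) (map_bu_half f k)"
      using k vD by (cases k) (simp_all add: f)
    show "rot (blow_up h D) k = k \<longrightarrow> lab (blow_up (f h) E) (map_bu_half f k) = lab (blow_up h D) k"
      using k vD by (cases k) (simp_all add: f)
  qed
qed

text \<open>Blowing up the reversed vertex traverses the small circle in the opposite direction.
  Exchanging \<open>Fwd\<close> and \<open>Bwd\<close> repairs this at the price of reversing its
  three vertices, an odd number.\<close>

lemma blow_up_flip:
  assumes "jac g n D" "h \<in> half D" "rot D h \<noteq> h"
  shows "congr g (n + 2) (fr (blow_up h (flip (vertex D h) D))) (- fr (blow_up h D))"
proof -
  interpret jacobi g D using assms(1) by (rule jac_jacobi)
  let ?B = "blow_up h D" and ?v = "vertex D h"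
  let ?E = "blow_up h (flip ?v D)"
  let ?Z = "Old ` ?v \<union> (Fwd ` ?v \<union> Bwd ` ?v)"
  let ?f = "\<lambda>k. case k of Old x \<Rightarrow> Old x | Fwd x \<Rightarrow> Bwd x | Bwd x \<Rightarrow> Fwd x"
  have v: "x \<in> half D" "rot D x \<in> ?v" "rot D x \<noteq> x" if "x \<in> ?v" for x
    using that assms vertex_tip[OF assms(2) that] by (auto simp: vertex_def)
  have ve: "vertex (flip ?v D) h = ?v"
    by (rule flip_jacobi) (use v assms(2) in auto)
  have iso: "iso_by ?f (flip ?Z ?B) ?E"
  proof (rule iso_byI[where f' = ?f])
    fix k assume k: "k \<in> half (flip ?Z ?B)"
    show "?f k \<in> half ?E \<and> ?f (?f k) = k" "opp ?E (?f k) = ?f (opp (flip ?Z ?B) k)"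
      "rot (flip ?Z ?B) k = k \<Longrightarrow> lab ?E (?f k) = lab (flip ?Z ?B) k"
      "rot ?E (?f k) = ?f (rot (flip ?Z ?B) k)"
      using k v by (cases k; auto simp: ve)+
  next
    fix k assume k: "k \<in> half ?E"
    show "?f k \<in> half (flip ?Z ?B) \<and> ?f (?f k) = k" using k by (cases k; simp add: ve)
  qed
  have "card ?Z = card ?v + (card ?v + card ?v)"
    by (subst card_Un_disjoint; (subst card_Un_disjoint)?; auto simp: card_image inj_on_def)
  then have c: "card ?Z = 3 * 3" using assms by (simp add: card_vertex)
  have Z: "?Z \<subseteq> half ?B - tips ?B" using v by (auto simp: blow_up_half tips_def)
  have "congr g (n + 2) (fr ?E) (frag_cmul ((-1) ^ 3) (fr ?B))"
    by (rule fr_flip_iso(1)[OF blow_up_jac(1)[OF assms] Z _ c iso]) (use v in auto)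
  then show ?thesis by simp
qed

subsection \<open>Replacing an edge by a square\<close>

definition cyc4 :: "'h \<Rightarrow> 'h \<Rightarrow> 'h \<Rightarrow> 'h \<Rightarrow> 'h \<Rightarrow> 'h" where
  "cyc4 a b c d x = (if x = a then b else if x = b then c else if x = c then d else if x = d then a else x)"

text \<open>The edge \<open>e\<close> and its ends are replaced by a four-cycle to which
  \<open>a\<close>, \<open>b\<close>, \<open>c\<close>, \<open>d\<close> are attached in this order.
  The values of \<open>rot\<close> at the deleted half-edges \<open>e\<close> and
  \<open>opp D e\<close> are fixed artificially, so that the square does not depend on the wiring at
  \<open>e\<close> and \<open>square_rewire\<close> is an equality of diagrams.\<close>

definition square :: "'h \<Rightarrow> 'h \<Rightarrow> 'h \<Rightarrow> 'h \<Rightarrow> 'h \<Rightarrow> 'h diagram \<Rightarrow> 'h bu_half diagram" where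
  "square e a b c d D =
     \<lparr>half = Old ` (half D - {e, opp D e}) \<union> Fwd ` {a, b, c, d} \<union> Bwd ` {a, b, c, d},
      rot = (\<lambda>k. case k of Old x \<Rightarrow> if x \<in> {a, b, c, d} then Fwd x else if x \<in> {e, opp D e} then Old x else Old (rot D x)
                           | Fwd x \<Rightarrow> Bwd x
                           | Bwd x \<Rightarrow> Old x),
      opp = (\<lambda>k. case k of Old x \<Rightarrow> Old (opp D x)
                           | Fwd x \<Rightarrow> Bwd (cyc4 a b c d x)
                           | Bwd x \<Rightarrow> Fwd (cyc4 d c b a x)),
      lab = (\<lambda>k. case k of Old x \<Rightarrow> lab D x | Fwd x \<Rightarrow> lab D x | Bwd x \<Rightarrow> lab D x)\<rparr>"

lemma square_simps [simp]:
  "Old x \<in> half (square e a b c d D) \<longleftrightarrow> x \<in> half D \<and> x \<noteq> e \<and> x \<noteq> opp D e"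
  "Fwd x \<in> half (square e a b c d D) \<longleftrightarrow> x \<in> {a, b, c, d}"
  "Bwd x \<in> half (square e a b c d D) \<longleftrightarrow> x \<in> {a, b, c, d}"
  "rot (square e a b c d D) (Old x) =
     (if x \<in> {a, b, c, d} then Fwd x else if x \<in> {e, opp D e} then Old x else Old (rot D x))"
  "rot (square e a b c d D) (Fwd x) = Bwd x" "rot (square e a b c d D) (Bwd x) = Old x"
  "opp (square e a b c d D) (Old x) = Old (opp D x)"
  "opp (square e a b c d D) (Fwd x) = Bwd (cyc4 a b c d x)"
  "opp (square e a b c d D) (Bwd x) = Fwd (cyc4 d c b a x)"
  "lab (square e a b c d D) (Old x) = lab D x" "lab (square e a b c d D) (Fwd x) = lab D x"
  "lab (square e a b c d D) (Bwd x) = lab D x"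
  by (auto simp: square_def)

lemma square_rotate:
  assumes "distinct [a, b, c, d]"
  shows "square e a b c d D = square e b c d a D"
proof -
  have 1: "{a, b, c, d} = {b, c, d, a}" by auto
  have 2: "cyc4 a b c d = cyc4 b c d a" "cyc4 d c b a = cyc4 a d c b"
    using assms by (auto simp: cyc4_def fun_eq_iff)
  show ?thesis unfolding square_def 1 2 ..
qed

lemma square_rotate2:
  assumes "distinct [a, b, c, d]"
  shows "square e a b c d D = square e c d a b D"
  using square_rotate[OF assms, of e D] square_rotate[of b c d a e D] assms by auto

lemma square_opp:
  assumes "opp D (opp D e) = e"
  shows "square (opp D e) a b c d D = square e a b c d D"
proof -
  have 1: "{opp D e, e} = {e, opp D e}" by auto
  show ?thesis unfolding square_def assms 1 ..
qed

lemma square_rewire: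
  assumes "jacobi_diagram g D" "inner_edge D e"
    "distinct [a, b, c, d]" "{a, b, c, d} = {rot D e, rot D (rot D e), rot D (opp D e), rot D (rot D (opp D e))}"
    "{a', b', c', d'} = {a, b, c, d}"
  shows "square e a' b' c' d' (rewire e a b c d D) = square e a' b' c' d' D"
proof -
  interpret jacobi g D by unfold_locales fact
  have "rot (rewire e a b c d D) x = rot D x" if "x \<notin> {a', b', c', d'}" "x \<notin> {e, opp D e}" for x
    by (rule rewire_rot(7)[OF assms(2-4)]) (use that assms(5) in auto)
  then show ?thesis unfolding square_def by (auto simp: fun_eq_iff split: bu_half.split)
qed

text \<open>The mirror image reverses the four vertices of the square, and four signs
  cancel.\<close>

lemma square_reverse:
  assumes "jac g n (square e a b c d D)" "distinct [a, b, c, d]" "{a, b, c, d} \<inter> {e, opp D e} = {}" "{a, b, c, d} \<subseteq> half D"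
  shows "congr g n (fr (square e a b c d D)) (fr (square e d c b a D))"
proof -
  let ?B = "square e a b c d D" and ?E = "square e d c b a D" and ?v = "{a, b, c, d}"
  let ?Z = "Old ` ?v \<union> (Fwd ` ?v \<union> Bwd ` ?v)"
  let ?f = "\<lambda>k. case k of Old x \<Rightarrow> Old x | Fwd x \<Rightarrow> Bwd x | Bwd x \<Rightarrow> Fwd x"
  have vs: "{d, c, b, a} = ?v" by auto
  have iso: "iso_by ?f (flip ?Z ?B) ?E"
  proof (rule iso_byI[where f' = ?f])
    fix k assume k: "k \<in> half (flip ?Z ?B)"
    show "?f k \<in> half ?E \<and> ?f (?f k) = k" "opp ?E (?f k) = ?f (opp (flip ?Z ?B) k)"
      "rot (flip ?Z ?B) k = k \<Longrightarrow> lab ?E (?f k) = lab (flip ?Z ?B) k"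
      "rot ?E (?f k) = ?f (rot (flip ?Z ?B) k)"
      using k by (cases k; auto)+
  next
    fix k assume k: "k \<in> half ?E"
    show "?f k \<in> half (flip ?Z ?B) \<and> ?f (?f k) = k" using k by (cases k; auto)
  qed
  have c: "card ?Z = 3 * 4" using assms(2) by simp
  have Z: "?Z \<subseteq> half ?B - tips ?B" using assms(3,4) by (auto simp: tips_def)
  have "congr g n (fr ?E) (frag_cmul ((-1) ^ 4) (fr ?B))"
    by (rule fr_flip_iso(1)[OF assms(1) Z _ c iso]) auto
  then show ?thesis by (simp add: congr_sym)
qed

lemma distinct6:
  "distinct [a, b, c, d, e, f] \<Longrightarrow>
     a \<noteq> b \<and> a \<noteq> c \<and> a \<noteq> d \<and> a \<noteq> e \<and> a \<noteq> f \<and> b \<noteq> a \<and> b \<noteq> c \<and> b \<noteq> d \<and> b \<noteq> e \<and> b \<noteq> f \<and>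
     c \<noteq> a \<and> c \<noteq> b \<and> c \<noteq> d \<and> c \<noteq> e \<and> c \<noteq> f \<and> d \<noteq> a \<and> d \<noteq> b \<and> d \<noteq> c \<and> d \<noteq> e \<and> d \<noteq> f \<and>
     e \<noteq> a \<and> e \<noteq> b \<and> e \<noteq> c \<and> e \<noteq> d \<and> e \<noteq> f \<and> f \<noteq> a \<and> f \<noteq> b \<and> f \<noteq> c \<and> f \<noteq> d \<and> f \<noteq> e"
  by auto

text \<open>IHX is applied to the edge that joins a corner of the triangle to the other end of
  \<open>e\<close>. In H and in X this edge is inserted into the triangle, turning it into a
  four-cycle; \<open>x3\<close> and \<open>x4\<close> become attached to it in one order or the
  other, and this accounts for the two squares.\<close>

lemma blow_up_square:
  assumes "jac g n D" "inner_edge D e" "rot D e = x2" "rot D x2 = x1" "rot D (opp D e) = x3" "rot D x3 = x4"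
  shows "congr g (n + 2) (fr (blow_up e D)) (fr (square e x1 x3 x4 x2 D) - fr (square e x1 x4 x3 x2 D))"
    "jac g (n + 2) (square e x1 x3 x4 x2 D)" "jac g (n + 2) (square e x1 x4 x3 x2 D)"
proof -
  interpret jacobi g D using assms(1) by (rule jac_jacobi)
  let ?B = "blow_up e D"
  define e' where "e' = opp D e"
  have eh: "e \<in> half D" "rot D e \<noteq> e" and e'h: "e' \<in> half D" "rot D e' \<noteq> e'"
    using assms(2) by (auto simp: inner_edge_def e'_def)
  have dd: "distinct [e, x2, x1, e', x3, x4]"
    using inner_edge_distinct[OF assms(2)] assms(3-6) by (simp add: e'_def)
  have r: "rot D e = x2" "rot D x2 = x1" "rot D x1 = e" "rot D e' = x3" "rot D x3 = x4" "rot D x4 = e'"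
    using assms(3-6) eh e'h rot3[of e] rot3[of e'] by (simp_all add: e'_def)
  have o: "opp D e = e'" "opp D e' = e" using eh by (auto simp: e'_def)
  note ne = distinct6[OF dd]
  have vx: "vertex D e = {e, x2, x1}" by (auto simp: vertex_def r)
  have six: "{e, x2, x1, e', x3, x4} \<subseteq> half D" using eh(1) e'h(1) rot_in[of e] rot_in[of x2] rot_in[of e'] rot_in[of x3] by (simp add: r)
  have rT: "rot D x \<in> {e, x2, x1, e', x3, x4} \<longleftrightarrow> x \<in> {e, x2, x1, e', x3, x4}" if "x \<in> half D" for x
  proof -
    have "x = rot D (rot D y)" if "rot D x = y" for y using that \<open>x \<in> half D\<close> by auto
    then show ?thesis using r by auto
  qed
  have oe: "opp D x = e \<longleftrightarrow> x = e'" "opp D x = e' \<longleftrightarrow> x = e" if "x \<in> half D" for x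
    using opp_eq_iff[OF that e'h(1)] opp_eq_iff[OF that eh(1)] by (simp_all only: o)
  have jB: "jac g (n + 2) ?B" by (rule blow_up_jac(1)[OF assms(1) eh])
  interpret B: jacobi g ?B using jB by (rule jac_jacobi)
  have ie: "inner_edge ?B (Old e)"
    using eh e'h ne by (simp add: inner_edge_def vx o r)
  have Br: "rot ?B (Old e) = Fwd e" "rot ?B (Fwd e) = Bwd e" "rot ?B (Old e') = Old x3" "rot ?B (Old x3) = Old x4"
    "opp ?B (Old e) = Old e'"
    using ne by (simp_all add: vx o r)
  have H: "ihx_H (Old e) ?B = rewire (Old e) (Bwd e) (Old x3) (Old x4) (Fwd e) ?B"
    and X: "ihx_X (Old e) ?B = rewire (Old e) (Fwd e) (Old x3) (Old x4) (Bwd e) ?B"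
    unfolding ihx_rewire Br by simp_all
  note rw = B.rewire_rot[OF ie, unfolded Br]
  have Hr: "rot (ihx_H (Old e) ?B) (Old e) = Bwd e" "rot (ihx_H (Old e) ?B) (Bwd e) = Old x3"
     "rot (ihx_H (Old e) ?B) (Old x3) = Old e" "rot (ihx_H (Old e) ?B) (Old e') = Old x4"
     "rot (ihx_H (Old e) ?B) (Old x4) = Fwd e" "rot (ihx_H (Old e) ?B) (Fwd e) = Old e'"
     "k \<notin> {Old e, Bwd e, Old x3, Old e', Old x4, Fwd e} \<Longrightarrow> rot (ihx_H (Old e) ?B) k = rot ?B k" for k
  proof -
    have p: "distinct [Bwd e, Old x3, Old x4, Fwd e]" "{Bwd e, Old x3, Old x4, Fwd e} = {Fwd e, Bwd e, Old x3, Old x4}"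
      using ne by auto
    show "rot (ihx_H (Old e) ?B) (Old e) = Bwd e" "rot (ihx_H (Old e) ?B) (Bwd e) = Old x3"
     "rot (ihx_H (Old e) ?B) (Old x3) = Old e" "rot (ihx_H (Old e) ?B) (Old e') = Old x4"
     "rot (ihx_H (Old e) ?B) (Old x4) = Fwd e" "rot (ihx_H (Old e) ?B) (Fwd e) = Old e'"
     "k \<notin> {Old e, Bwd e, Old x3, Old e', Old x4, Fwd e} \<Longrightarrow> rot (ihx_H (Old e) ?B) k = rot ?B k" for k
      unfolding H using rw(1-6)[OF p] rw(7)[OF p, of k] by simp_all
  qed
  have Xr: "rot (ihx_X (Old e) ?B) (Old e) = Fwd e" "rot (ihx_X (Old e) ?B) (Fwd e) = Old x3"
     "rot (ihx_X (Old e) ?B) (Old x3) = Old e" "rot (ihx_X (Old e) ?B) (Old e') = Old x4"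
     "rot (ihx_X (Old e) ?B) (Old x4) = Bwd e" "rot (ihx_X (Old e) ?B) (Bwd e) = Old e'"
     "k \<notin> {Old e, Bwd e, Old x3, Old e', Old x4, Fwd e} \<Longrightarrow> rot (ihx_X (Old e) ?B) k = rot ?B k" for k
  proof -
    have p: "distinct [Fwd e, Old x3, Old x4, Bwd e]" "{Fwd e, Old x3, Old x4, Bwd e} = {Fwd e, Bwd e, Old x3, Old x4}"
      using ne by auto
    show "rot (ihx_X (Old e) ?B) (Old e) = Fwd e" "rot (ihx_X (Old e) ?B) (Fwd e) = Old x3"
     "rot (ihx_X (Old e) ?B) (Old x3) = Old e" "rot (ihx_X (Old e) ?B) (Old e') = Old x4"
     "rot (ihx_X (Old e) ?B) (Old x4) = Bwd e" "rot (ihx_X (Old e) ?B) (Bwd e) = Old e'"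
     "k \<notin> {Old e, Bwd e, Old x3, Old e', Old x4, Fwd e} \<Longrightarrow> rot (ihx_X (Old e) ?B) k = rot ?B k" for k
      unfolding X using rw(1-6)[OF p] rw(7)[OF p, of k] by simp_all
  qed
  have sH: "half (ihx_H (Old e) ?B) = half ?B" "opp (ihx_H (Old e) ?B) = opp ?B" "lab (ihx_H (Old e) ?B) = lab ?B"
    and sX: "half (ihx_X (Old e) ?B) = half ?B" "opp (ihx_X (Old e) ?B) = opp ?B" "lab (ihx_X (Old e) ?B) = lab ?B"
    by (simp_all add: H X)
  note jHX = ihx_jac[OF jB ie]
  let ?S = "square e x1 x3 x4 x2 D" and ?T = "square e x1 x4 x3 x2 D"
  have six': "e \<in> half D" "e' \<in> half D" "x1 \<in> half D" "x2 \<in> half D" "x3 \<in> half D" "x4 \<in> half D"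
    using six by auto
  \<comment> \<open>The half-edges that are not involved in the change and whose images under
    \<open>rot\<close> and \<open>opp\<close> avoid the edge; on them both isomorphisms are the
    identity. What remains is a finite list of half-edges, checked one by one.\<close>
  define P where "P x \<longleftrightarrow> x \<in> half D \<and> x \<noteq> e \<and> x \<noteq> e' \<and> x \<noteq> x1 \<and> x \<noteq> x2 \<and> x \<noteq> x3 \<and> x \<noteq> x4 \<and>
     rot D x \<noteq> e \<and> rot D x \<noteq> e' \<and> opp D x \<noteq> e \<and> opp D x \<noteq> e'" for x
  have Px: "x = e \<or> x = e' \<or> x = x1 \<or> x = x2 \<or> x = x3 \<or> x = x4 \<or> P x" if "x \<in> half D" for x
    using rT[OF that] oe[OF that] that unfolding P_def by auto
  have KB: "k \<in> {Old e, Old e', Old x1, Old x2, Old x3, Old x4, Fwd e, Fwd x1, Fwd x2, Bwd e, Bwd x1, Bwd x2} \<or> (\<exists>x. k = Old x \<and> P x)"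
    if "k \<in> half ?B" for k
    using that Px by (cases k) (auto simp: vx)
  have KS: "k \<in> {Old x1, Old x2, Old x3, Old x4, Fwd x1, Fwd x2, Fwd x3, Fwd x4, Bwd x1, Bwd x2, Bwd x3, Bwd x4} \<or> (\<exists>x. k = Old x \<and> P x)"
    if "k \<in> half (square e a b c d D)" "{a, b, c, d} = {x1, x2, x3, x4}" for k a b c d
    using that(1) Px unfolding that(2) by (cases k) (auto simp: o that(2))
  have oo: "opp D x1 \<noteq> e" "opp D x1 \<noteq> e'" "opp D x2 \<noteq> e" "opp D x2 \<noteq> e'" "opp D x3 \<noteq> e" "opp D x3 \<noteq> e'" "opp D x4 \<noteq> e" "opp D x4 \<noteq> e'"
    using oe six' ne by auto
  note simps = ne r o oo vx six' P_def cyc4_def sH sX Hr(1-6) Xr(1-6)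
  \<comment> \<open>The two halves of the edge and the circle half-edges at its corner become the
    circle half-edges at \<open>x3\<close> and \<open>x4\<close>; the corners at \<open>x1\<close>
    and \<open>x2\<close> keep their names.\<close>
  let ?f = "\<lambda>k. case k of Old x \<Rightarrow> if x = e then Fwd x3 else if x = e' then Bwd x4 else Old x
     | Fwd x \<Rightarrow> if x = e then Fwd x4 else Fwd x | Bwd x \<Rightarrow> if x = e then Bwd x3 else Bwd x"
  let ?f' = "\<lambda>k. case k of Old x \<Rightarrow> Old x
     | Fwd x \<Rightarrow> if x = x3 then Old e else if x = x4 then Fwd e else Fwd x
     | Bwd x \<Rightarrow> if x = x3 then Bwd e else if x = x4 then Old e' else Bwd x"
  have iH: "iso_by ?f (ihx_H (Old e) ?B) ?S"
  proof (rule iso_byI[where f' = ?f'])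
    fix k assume "k \<in> half (ihx_H (Old e) ?B)"
    then have k: "k \<in> half ?B" by (simp only: sH)
    show "?f k \<in> half ?S \<and> ?f' (?f k) = k"
      using KB[OF k] by (elim disjE insertE emptyE exE conjE; simp add: simps)
    show "opp ?S (?f k) = ?f (opp (ihx_H (Old e) ?B) k)"
      using KB[OF k] by (elim disjE insertE emptyE exE conjE; simp add: simps)
    show "rot ?S (?f k) = ?f (rot (ihx_H (Old e) ?B) k)"
      using KB[OF k] by (elim disjE insertE emptyE exE conjE; simp add: simps Hr(7))
    assume "rot (ihx_H (Old e) ?B) k = k"
    then show "lab ?S (?f k) = lab (ihx_H (Old e) ?B) k"
      using KB[OF k] by (elim disjE insertE emptyE exE conjE; simp add: simps Hr(7))
  next
    fix k assume k: "k \<in> half ?S"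
    have "{x1, x3, x4, x2} = {x1, x2, x3, x4}" by auto
    from KS[OF k this] show "?f' k \<in> half (ihx_H (Old e) ?B) \<and> ?f (?f' k) = k"
      by (elim disjE insertE emptyE exE conjE; simp add: simps)
  qed
  let ?h = "\<lambda>k. case k of Old x \<Rightarrow> if x = e then Bwd x3 else if x = e' then Fwd x4 else Old x
     | Fwd x \<Rightarrow> if x = e then Fwd x3 else Fwd x | Bwd x \<Rightarrow> if x = e then Bwd x4 else Bwd x"
  let ?h' = "\<lambda>k. case k of Old x \<Rightarrow> Old x
     | Fwd x \<Rightarrow> if x = x3 then Fwd e else if x = x4 then Old e' else Fwd x
     | Bwd x \<Rightarrow> if x = x3 then Old e else if x = x4 then Bwd e else Bwd x"
  \<comment> \<open>The two ends of the edge in X. They have to be reversed to match the orientation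
    of the square, and the two signs cancel.\<close>
  let ?Z = "{Old e, Bwd e, Old x3, Old e', Old x4, Fwd e}"
  have iX: "iso_by ?h (flip ?Z (ihx_X (Old e) ?B)) ?T"
  proof (rule iso_byI[where f' = ?h'])
    fix k assume "k \<in> half (flip ?Z (ihx_X (Old e) ?B))"
    then have k: "k \<in> half ?B" by (simp only: sX flip_simps)
    show "?h k \<in> half ?T \<and> ?h' (?h k) = k"
      using KB[OF k] by (elim disjE insertE emptyE exE conjE; simp add: simps)
    show "opp ?T (?h k) = ?h (opp (flip ?Z (ihx_X (Old e) ?B)) k)"
      using KB[OF k] by (elim disjE insertE emptyE exE conjE; simp add: simps)
    show "rot ?T (?h k) = ?h (rot (flip ?Z (ihx_X (Old e) ?B)) k)"
      using KB[OF k] by (elim disjE insertE emptyE exE conjE; simp add: simps Xr(7))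
    assume "rot (flip ?Z (ihx_X (Old e) ?B)) k = k"
    then show "lab ?T (?h k) = lab (flip ?Z (ihx_X (Old e) ?B)) k"
      using KB[OF k] by (elim disjE insertE emptyE exE conjE; simp add: simps Xr(7))
  next
    fix k assume k: "k \<in> half ?T"
    have "{x1, x4, x3, x2} = {x1, x2, x3, x4}" by auto
    from KS[OF k this] show "?h' k \<in> half (flip ?Z (ihx_X (Old e) ?B)) \<and> ?h (?h' k) = k"
      by (elim disjE insertE emptyE exE conjE; simp add: simps)
  qed
  have c: "card ?Z = 3 * 2" using ne by simp
  have Z1: "?Z \<subseteq> half (ihx_X (Old e) ?B) - tips (ihx_X (Old e) ?B)"
    using ne six' by (auto simp: tips_def sX Xr vx)
  have Z2: "\<And>k. k \<in> ?Z \<Longrightarrow> rot (ihx_X (Old e) ?B) k \<in> ?Z" by (auto simp: Xr)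
  note T = fr_flip_iso[OF jHX(3) Z1 Z2 c iX]
  show "jac g (n + 2) ?T" by (rule T(2))
  show "jac g (n + 2) ?S" by (rule iso_by_jac(1)[OF jHX(1) iH])
  have "congr g (n + 2) (fr ?B) (fr (ihx_H (Old e) ?B) - fr (ihx_X (Old e) ?B))"
    by (rule fr_ihx[OF jB ie])
  also have "congr g (n + 2) \<dots> (fr ?S - fr ?T)"
    by (rule congr_diff[OF fr_iso[OF jHX(1) iH] congr_sym]) (use T(1) in simp)
  finally show "congr g (n + 2) (fr ?B) (fr ?S - fr ?T)" .
qed

lemma inner_edge_opp: "jacobi_diagram g D \<Longrightarrow> inner_edge D e \<Longrightarrow> inner_edge D (opp D e)"
proof -
  assume j: "jacobi_diagram g D" and e: "inner_edge D e"
  interpret jacobi g D by unfold_locales fact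
  show ?thesis using inner_edge_distinct[OF e] e by (auto simp: inner_edge_def)
qed

lemma square_reverse_rotate:
  assumes "jac g n D" "inner_edge D e" "jac g n' (square e a b c d D)" "distinct [a, b, c, d]"
    "{a, b, c, d} = {rot D e, rot D (rot D e), rot D (opp D e), rot D (rot D (opp D e))}"
  shows "congr g n' (fr (square e a b c d D)) (fr (square e d c b a D))"
proof -
  interpret jacobi g D using assms(1) by (rule jac_jacobi)
  note dd = inner_edge_distinct[OF assms(2)]
  have e: "e \<in> half D" "opp D e \<in> half D" using assms(2) by (auto simp: inner_edge_def)
  show ?thesis
    by (rule square_reverse[OF assms(3,4)]; unfold assms(5); use dd e in auto)
qed

text \<open>Expanding from the other end of \<open>e\<close> gives two squares again. The first
  agrees with the original one after a half-turn, the second after a reflection, which costs no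
  sign.\<close>

lemma blow_up_across_edge:
  assumes "jac g n D" "inner_edge D e"
  shows "congr g (n + 2) (fr (blow_up e D)) (fr (blow_up (opp D e) D))"
proof -
  interpret jacobi g D using assms(1) by (rule jac_jacobi)
  define x2 x1 x3 x4 where x: "x2 = rot D e" "x1 = rot D x2" "x3 = rot D (opp D e)" "x4 = rot D x3"
  have e: "e \<in> half D" "opp D (opp D e) = e" using assms(2) by (auto simp: inner_edge_def)
  note s1 = blow_up_square[OF assms x(1)[symmetric] x(2)[symmetric] x(3)[symmetric] x(4)[symmetric]]
  have "rot D (opp D (opp D e)) = x2" using x(1) e by simp
  note s2 = blow_up_square[OF assms(1) inner_edge_opp[OF jd assms(2)] x(3)[symmetric] x(4)[symmetric] this x(2)[symmetric],
      unfolded square_opp[OF e(2)]]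
  have ne: "distinct [x1, x2, x3, x4]"
    using distinct6[OF inner_edge_distinct[OF assms(2)]] by (simp add: x)
  have "square e x4 x2 x1 x3 D = square e x1 x3 x4 x2 D"
    by (rule square_rotate2) (use ne in auto)
  moreover have "congr g (n + 2) (fr (square e x4 x1 x2 x3 D)) (fr (square e x1 x4 x3 x2 D))"
  proof -
    have "congr g (n + 2) (fr (square e x4 x1 x2 x3 D)) (fr (square e x3 x2 x1 x4 D))"
      by (rule square_reverse_rotate[OF assms s2(3)]) (use ne in \<open>auto simp: x\<close>)
    also have "square e x3 x2 x1 x4 D = square e x1 x4 x3 x2 D"
      by (rule square_rotate2) (use ne in auto)
    finally show ?thesis .
  qed
  ultimately have "congr g (n + 2) (fr (square e x1 x3 x4 x2 D) - fr (square e x1 x4 x3 x2 D))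
     (fr (square e x4 x2 x1 x3 D) - fr (square e x4 x1 x2 x3 D))"
    by (auto intro: congr_diff congr_sym)
  with s1(1) s2(1) show ?thesis by (blast intro: congr_trans congr_sym)
qed

text \<open>Passing from one end of an inner edge to the other does not change the class, and
  connectedness reaches every trivalent vertex.\<close>

lemma blow_up_any_vertex:
  assumes "jac g n D" "h \<in> half D" "rot D h \<noteq> h" "k \<in> half D" "rot D k \<noteq> k"
  shows "congr g (n + 2) (fr (blow_up h D)) (fr (blow_up k D))"
proof -
  interpret jacobi g D using assms(1) by (rule jac_jacobi)
  let ?P = "\<lambda>x. congr g (n + 2) (fr (blow_up h D)) (fr (blow_up x D))"
  \<comment> \<open>A univalent half-edge has no blow-up of its own; it carries the claim for the
    vertex its leg is attached to, so that the set is closed under \<open>opp\<close>.\<close>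
  let ?S = "{x \<in> half D. (rot D x \<noteq> x \<longrightarrow> ?P x) \<and> (rot D x = x \<and> rot D (opp D x) \<noteq> opp D x \<longrightarrow> ?P (opp D x))}"
  have "?S = half D"
  proof (rule jac_closedI[OF assms(1)])
    show "h \<in> ?S" using assms by auto
    fix x assume x: "x \<in> ?S"
    then have xh: "x \<in> half D" by auto
    show "rot D x \<in> ?S"
    proof (cases "rot D x = x")
      case False
      have "blow_up (rot D x) D = blow_up x D" by (rule blow_up_cong) (rule vertex_rot[OF xh])
      then show ?thesis using x False xh by auto
    qed (use x in auto)
    show "opp D x \<in> ?S"
    proof (cases "rot D (opp D x) = opp D x")
      case True then show ?thesis using x by auto
    next
      case False
      have "?P (opp D x)"
      proof (cases "rot D x = x")
        case True then show ?thesis using x False by auto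
      next
        case nt: False
        show ?thesis
        proof (cases "opp D x \<in> {rot D x, rot D (rot D x)}")
          case True
          then have "blow_up (opp D x) D = blow_up x D"
            by (intro blow_up_cong vertex_eq xh) (auto simp: vertex_def)
          then show ?thesis using x nt by auto
        next
          case a: False
          then have "inner_edge D x" using xh nt False by (auto simp: inner_edge_def)
          from blow_up_across_edge[OF assms(1) this] show ?thesis using x nt by (blast intro: congr_trans)
        qed
      qed
      then show ?thesis using False xh by auto
    qed
  qed auto
  then show ?thesis using assms(4,5) by blast
qed

text \<open>Since a square forgets the wiring at \<open>e\<close>, the blow-ups of all rewirings are
  expressed by squares of the same diagram \<open>D\<close> and can be compared directly.\<close>

lemma blow_up_rewire:
  assumes "jac g n D" "inner_edge D e"
    "distinct [a, b, c, d]" "{a, b, c, d} = {rot D e, rot D (rot D e), rot D (opp D e), rot D (rot D (opp D e))}"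
  shows "congr g (n + 2) (fr (blow_up e (rewire e a b c d D)))
     (fr (square e b c d a D) - fr (square e b d c a D))"
    "jac g (n + 2) (square e b c d a D)" "jac g (n + 2) (square e b d c a D)"
proof -
  interpret jacobi g D using assms(1) by (rule jac_jacobi)
  let ?E = "rewire e a b c d D"
  note r = rewire_rot[OF assms(2-4)]
  have ie: "inner_edge ?E e" using r(8,9) by (auto simp: inner_edge_def r(1-6))
  have o: "rot ?E (opp ?E e) = c" by (simp add: r)
  have q: "square e b c d a ?E = square e b c d a D" "square e b d c a ?E = square e b d c a D"
    by (rule square_rewire[OF jd assms(2-4)]; auto)+
  note s = blow_up_square[OF rewire_jac[OF assms] ie r(1,2) o r(5), unfolded q]
  show "congr g (n + 2) (fr (blow_up e (rewire e a b c d D)))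
     (fr (square e b c d a D) - fr (square e b d c a D))"
    "jac g (n + 2) (square e b c d a D)" "jac g (n + 2) (square e b d c a D)" by (fact s)+
qed

text \<open>Up to rotation and reflection there are three ways P, Q, R to attach four half-edges to
  a square. The blow-ups of I, H and X are P - Q, P - R and Q - R, so the relation is an identity
  between these differences.\<close>

lemma blow_up_ihx:
  assumes "jac g n D" "inner_edge D e"
  shows "congr g (n + 2) (fr (blow_up e D)) (fr (blow_up e (ihx_H e D)) - fr (blow_up e (ihx_X e D)))"
proof -
  interpret jacobi g D using assms(1) by (rule jac_jacobi)
  define x2 x1 x3 x4 where x: "x2 = rot D e" "x1 = rot D x2" "x3 = rot D (opp D e)" "x4 = rot D x3"
  note sI = blow_up_square[OF assms x(1)[symmetric] x(2)[symmetric] x(3)[symmetric] x(4)[symmetric]]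
  have ne: "distinct [x1, x2, x3, x4]"
    using distinct6[OF inner_edge_distinct[OF assms(2)]] by (simp add: x)
  let ?V = "{rot D e, rot D (rot D e), rot D (opp D e), rot D (rot D (opp D e))}"
  have eq: "ihx_H e D = rewire e x1 x3 x4 x2 D" "ihx_X e D = rewire e x2 x3 x4 x1 D"
    by (simp_all add: ihx_rewire x)
  have sH: "congr g (n + 2) (fr (blow_up e (ihx_H e D))) (fr (square e x3 x4 x2 x1 D) - fr (square e x3 x2 x4 x1 D))"
    unfolding eq by (rule blow_up_rewire(1)[OF assms]) (use ne in \<open>auto simp: x\<close>)
  have sX: "congr g (n + 2) (fr (blow_up e (ihx_X e D))) (fr (square e x3 x4 x1 x2 D) - fr (square e x3 x1 x4 x2 D))"
    "jac g (n + 2) (square e x3 x1 x4 x2 D)"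
  proof -
    have p: "distinct [x2, x3, x4, x1]" "{x2, x3, x4, x1} = ?V" using ne by (auto simp: x)
    show "congr g (n + 2) (fr (blow_up e (ihx_X e D))) (fr (square e x3 x4 x1 x2 D) - fr (square e x3 x1 x4 x2 D))"
      "jac g (n + 2) (square e x3 x1 x4 x2 D)"
      unfolding eq by (rule blow_up_rewire[OF assms p])+
  qed
  have q1: "square e x1 x3 x4 x2 D = square e x3 x4 x2 x1 D" by (rule square_rotate) (use ne in auto)
  have q2: "congr g (n + 2) (fr (square e x1 x4 x3 x2 D)) (fr (square e x3 x4 x1 x2 D))"
  proof -
    have "congr g (n + 2) (fr (square e x1 x4 x3 x2 D)) (fr (square e x2 x3 x4 x1 D))"
      by (rule square_reverse_rotate[OF assms sI(3)]) (use ne in \<open>auto simp: x\<close>)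
    also have "square e x2 x3 x4 x1 D = square e x3 x4 x1 x2 D"
      by (rule square_rotate) (use ne in auto)
    finally show ?thesis .
  qed
  have q3: "congr g (n + 2) (fr (square e x3 x1 x4 x2 D)) (fr (square e x3 x2 x4 x1 D))"
  proof -
    have "congr g (n + 2) (fr (square e x3 x1 x4 x2 D)) (fr (square e x2 x4 x1 x3 D))"
      by (rule square_reverse_rotate[OF assms sX(2)]) (use ne in \<open>auto simp: x\<close>)
    also have "square e x2 x4 x1 x3 D = square e x3 x2 x4 x1 D"
      by (rule square_rotate[symmetric]) (use ne in auto)
    finally show ?thesis .
  qed
  have "congr g (n + 2) (fr (blow_up e (ihx_H e D)) - fr (blow_up e (ihx_X e D)))
     ((fr (square e x3 x4 x2 x1 D) - fr (square e x3 x1 x4 x2 D)) -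
      (fr (square e x1 x4 x3 x2 D) - fr (square e x3 x1 x4 x2 D)))"
    by (rule congr_diff[OF congr_trans[OF sH congr_diff[OF congr_refl congr_sym[OF q3]]]
          congr_trans[OF sX(1) congr_diff[OF congr_sym[OF q2] congr_refl]]])
  also have "\<dots> = fr (square e x1 x3 x4 x2 D) - fr (square e x1 x4 x3 x2 D)" by (simp add: q1)
  finally show ?thesis using sI(1) by (blast intro: congr_sym congr_trans)
qed

text \<open>The loop survives when a different vertex is blown up. A self-loop at the only trivalent
  vertex is outside the reach of this argument and is dealt with in
  \<open>bu_frag_relations\<close>.\<close>

lemma blow_up_self_loop:
  assumes "jac g n D" "h \<in> half D" "opp D h \<in> {rot D h, rot D (rot D h)}"
    "k \<in> half D" "rot D k \<noteq> k" "vertex D k \<noteq> vertex D h"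
  shows "congr g (n + 2) (fr (blow_up k D)) 0"
proof -
  interpret jacobi g D using assms(1) by (rule jac_jacobi)
  have nv: "x \<notin> vertex D k" if "vertex D x = vertex D h" for x
    using assms(6) vertex_eq[OF assms(4), of x] that by metis
  have "h \<notin> vertex D k" "rot D h \<notin> vertex D k"
    by (rule nv, simp) (rule nv, rule vertex_rot[OF assms(2)])
  then show ?thesis
    by (intro fr_self_loop[OF blow_up_jac(1)[OF assms(1,4,5)], of "Old h"]) (use assms in auto)
qed

subsection \<open>Theta diagrams\<close>

definition tlegs :: "label list \<Rightarrow> label list \<Rightarrow> label list \<Rightarrow> strand \<Rightarrow> label list" where
  "tlegs as bs cs s = (case s of Upper \<Rightarrow> as | Chord \<Rightarrow> bs | Lower \<Rightarrow> cs)"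

lemma tlegs_simps [simp]: "tlegs as bs cs Upper = as" "tlegs as bs cs Chord = bs" "tlegs as bs cs Lower = cs"
  by (simp_all add: tlegs_def)

lemma theta_half [simp]:
  "Lt s j \<in> half (theta as bs cs) \<longleftrightarrow> 1 \<le> j \<and> j \<le> length (tlegs as bs cs s) + 1"
  "Rt s j \<in> half (theta as bs cs) \<longleftrightarrow> j \<le> length (tlegs as bs cs s)"
  "Foot s j \<in> half (theta as bs cs) \<longleftrightarrow> 1 \<le> j \<and> j \<le> length (tlegs as bs cs s)"
  "Tip s j \<in> half (theta as bs cs) \<longleftrightarrow> 1 \<le> j \<and> j \<le> length (tlegs as bs cs s)"
  by (auto simp: theta_def tlegs_def Let_def)

lemma theta_rot [simp]:
  "rot (theta as bs cs) (Foot s j) = (if s = Lower then Rt s j else Lt s j)"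
  "rot (theta as bs cs) (Lt s j) =
     (if j = length (tlegs as bs cs s) + 1
      then (case s of Upper \<Rightarrow> Lt Chord (length bs + 1) | Chord \<Rightarrow> Lt Lower (length cs + 1) | Lower \<Rightarrow> Lt Upper (length as + 1))
      else if s = Lower then Foot s j else Rt s j)"
  "rot (theta as bs cs) (Rt s j) =
     (if j = 0 then (case s of Upper \<Rightarrow> Rt Lower 0 | Lower \<Rightarrow> Rt Chord 0 | Chord \<Rightarrow> Rt Upper 0)
      else if s = Lower then Lt s j else Foot s j)"
  "rot (theta as bs cs) (Tip s j) = Tip s j"
  by (cases s; simp add: theta_def Let_def)+

lemma theta_opp [simp]:
  "opp (theta as bs cs) (Rt s j) = Lt s (j + 1)"
  "opp (theta as bs cs) (Lt s j) = Rt s (j - 1)"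
  "opp (theta as bs cs) (Foot s j) = Tip s j"
  "opp (theta as bs cs) (Tip s j) = Foot s j"
  by (auto simp: theta_def Let_def)

lemma theta_lab [simp]: "lab (theta as bs cs) (Tip s j) = tlegs as bs cs s ! (j - 1)"
  by (auto simp: theta_def tlegs_def Let_def)

lemma theta_half_eq: "half (theta as bs cs) =
  (\<lambda>(s, j). Lt s j) ` (SIGMA s:UNIV. {1..length (tlegs as bs cs s) + 1}) \<union>
  ((\<lambda>(s, j). Rt s j) ` (SIGMA s:UNIV. {0..length (tlegs as bs cs s)}) \<union>
  ((\<lambda>(s, j). Foot s j) ` (SIGMA s:UNIV. {1..length (tlegs as bs cs s)}) \<union>
   (\<lambda>(s, j). Tip s j) ` (SIGMA s:UNIV. {1..length (tlegs as bs cs s)})))" (is "?l = ?r")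
proof (intro equalityI subsetI)
  fix k assume "k \<in> ?l" then show "k \<in> ?r" by (cases k) (auto simp: image_iff)
next
  fix k assume "k \<in> ?r" then show "k \<in> ?l" by auto
qed

lemma UNIV_strand: "UNIV = {Upper, Chord, Lower}"
  using strand.exhaust by auto

lemma finite_strand [simp]: "finite (UNIV :: strand set)"
  by (simp add: UNIV_strand)

lemma theta_jacobi:
  assumes "set as \<subseteq> labels g" "set bs \<subseteq> labels g" "set cs \<subseteq> labels g"
  shows "jacobi_diagram g (theta as bs cs)"
  unfolding jacobi_diagram_def
proof (intro conjI ballI)
  let ?D = "theta as bs cs"
  show "finite (half ?D)" unfolding theta_half_eq by (intro finite_UnI finite_imageI finite_SigmaI) auto
  fix k assume k: "k \<in> half ?D"
  have l: "set (tlegs as bs cs s) \<subseteq> labels g" for s using assms by (cases s) auto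
  show "rot ?D k \<in> half ?D" "rot ?D (rot ?D (rot ?D k)) = k" "opp ?D k \<in> half ?D" "opp ?D (opp ?D k) = k" "opp ?D k \<noteq> k"
    using k by (cases k; rename_tac s j; case_tac s; auto split: if_splits; fail)+
  show "rot ?D k = k \<longrightarrow> lab ?D k \<in> labels g"
  proof (cases k)
    case (Tip s j)
    then have "tlegs as bs cs s ! (j - 1) \<in> set (tlegs as bs cs s)" using k by (intro nth_mem) auto
    then show ?thesis using l Tip by auto
  qed (rename_tac s j; case_tac s; auto split: if_splits)+
qed

lemma closed_iff:
  assumes "jacobi_diagram g D" "S \<subseteq> half D" "\<And>h. h \<in> S \<Longrightarrow> rot D h \<in> S" "\<And>h. h \<in> S \<Longrightarrow> opp D h \<in> S" "h \<in> half D"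
  shows "rot D h \<in> S \<longleftrightarrow> h \<in> S" "opp D h \<in> S \<longleftrightarrow> h \<in> S"
proof -
  interpret jacobi g D by unfold_locales fact
  show "rot D h \<in> S \<longleftrightarrow> h \<in> S" using assms(3)[of h] assms(3)[of "rot D h"] assms(3)[of "rot D (rot D h)"] assms(5) by auto
  show "opp D h \<in> S \<longleftrightarrow> h \<in> S" using assms(4)[of h] assms(4)[of "opp D h"] assms(5) by auto
qed

lemma theta_tips: "tips (theta as bs cs) = (\<lambda>(s, j). Tip s j) ` (SIGMA s:UNIV. {1..length (tlegs as bs cs s)})" (is "?l = ?r")
proof (intro equalityI subsetI)
  fix k assume "k \<in> ?l" then show "k \<in> ?r"
    by (cases k) (auto simp: tips_def image_iff split: if_splits strand.splits)
next
  fix k assume "k \<in> ?r" then show "k \<in> ?l" by (auto simp: tips_def)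
qed

lemma theta_tips_iff: "x \<in> tips (theta as bs cs) \<longleftrightarrow> (\<exists>s j. x = Tip s j \<and> 1 \<le> j \<and> j \<le> length (tlegs as bs cs s))"
  unfolding theta_tips by auto

lemma card_theta_tips: "card (tips (theta as bs cs)) = length as + length bs + length cs"
proof -
  have "card (tips (theta as bs cs)) = card (SIGMA s:UNIV. {1..length (tlegs as bs cs s)})"
    unfolding theta_tips by (rule card_image) (auto simp: inj_on_def)
  then show ?thesis by (simp add: card_SigmaI UNIV_strand)
qed

lemma theta_jac:
  assumes "set as \<subseteq> labels g" "set bs \<subseteq> labels g" "set cs \<subseteq> labels g"
  shows "jac g (length as + length bs + length cs + 2) (theta as bs cs)"
proof (rule jacI)
  let ?D = "theta as bs cs"
  note j = theta_jacobi[OF assms]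
  show "jacobi_diagram g ?D" by (rule j)
  have "Rt Upper 0 \<in> half ?D" by simp
  then show "half ?D \<noteq> {}" by blast
  let ?A = "(\<lambda>(s, j). Lt s j) ` (SIGMA s:UNIV. {1..length (tlegs as bs cs s) + 1})"
  let ?B = "(\<lambda>(s, j). Rt s j) ` (SIGMA s:UNIV. {0..length (tlegs as bs cs s)})"
  let ?C = "(\<lambda>(s, j). Foot s j) ` (SIGMA s:UNIV. {1..length (tlegs as bs cs s)})"
  have "half ?D - tips ?D = ?A \<union> (?B \<union> ?C)" unfolding theta_half_eq theta_tips by auto
  moreover have "card (?A \<union> (?B \<union> ?C)) = card ?A + (card ?B + card ?C)"
    by (subst card_Un_disjoint; (subst card_Un_disjoint)?; (intro finite_UnI finite_imageI finite_SigmaI)?; auto)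
  moreover have "card ?A = card (SIGMA s:UNIV. {1..length (tlegs as bs cs s) + 1})"
    "card ?B = card (SIGMA s:UNIV. {0..length (tlegs as bs cs s)})"
    "card ?C = card (SIGMA s:UNIV. {1..length (tlegs as bs cs s)})"
    by (rule card_image; auto simp: inj_on_def)+
  ultimately show "card (half ?D - tips ?D) = 3 * (length as + length bs + length cs + 2)"
    by (simp add: card_SigmaI UNIV_strand)
  fix S assume S: "S \<subseteq> half ?D" "S \<noteq> {}" "\<And>h. h \<in> S \<Longrightarrow> rot ?D h \<in> S" "\<And>h. h \<in> S \<Longrightarrow> opp ?D h \<in> S"
  note c = closed_iff[OF j S(1,3,4)]
  have f: "Foot s i \<in> S \<longleftrightarrow> Rt s i \<in> S" "Lt s i \<in> S \<longleftrightarrow> Rt s i \<in> S" "Tip s i \<in> S \<longleftrightarrow> Rt s i \<in> S"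
    if "1 \<le> i" "i \<le> length (tlegs as bs cs s)" for s i
    using c(1)[of "Foot s i"] c(1)[of "Lt s i"] c(1)[of "Rt s i"] c(2)[of "Foot s i"] that by (auto split: if_splits)
  have l: "Lt s (Suc i) \<in> S \<longleftrightarrow> Rt s i \<in> S" if "i \<le> length (tlegs as bs cs s)" for s i
    using c(2)[of "Rt s i"] that by auto
  have r: "Rt s i \<in> S \<longleftrightarrow> Rt s 0 \<in> S" if "i \<le> length (tlegs as bs cs s)" for s i
    using that
  proof (induction i)
    case (Suc i) then show ?case using l[of i s] f(2)[of "Suc i" s] by simp
  qed simp
  have "Rt s 0 \<in> S \<longleftrightarrow> Rt Upper 0 \<in> S" for s
    using c(1)[of "Rt Upper 0"] c(1)[of "Rt Lower 0"] by (cases s) auto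
  with r have r': "Rt s i \<in> S \<longleftrightarrow> Rt Upper 0 \<in> S" if "i \<le> length (tlegs as bs cs s)" for s i
    using that by blast
  have all: "x \<in> S \<longleftrightarrow> Rt Upper 0 \<in> S" if x: "x \<in> half ?D" for x
  proof (cases x)
    case (Lt s j)
    then obtain i where "j = Suc i" "i \<le> length (tlegs as bs cs s)" using x by (cases j) auto
    with l[of i s] r'[of i s] Lt show ?thesis by blast
  next
    case (Rt s j)
    then have "j \<le> length (tlegs as bs cs s)" using x by auto
    from r'[OF this] Rt show ?thesis by blast
  next
    case (Foot s j)
    then have "1 \<le> j" "j \<le> length (tlegs as bs cs s)" using x by auto
    from f(1)[OF this] r'[OF this(2)] Foot show ?thesis by blast
  next
    case (Tip s j)
    then have "1 \<le> j" "j \<le> length (tlegs as bs cs s)" using x by auto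
    from f(3)[OF this] r'[OF this(2)] Tip show ?thesis by blast
  qed
  show "half ?D \<subseteq> S" using all S(1,2) by blast
qed

text \<open>Exchanging the lower strand with strand \<open>x\<close> reverses the two ends of the
  chord, with no total sign. It also moves the legs of both strands to the other side, because legs
  are attached above on \<open>Upper\<close> and \<open>Chord\<close> and below on
  \<open>Lower\<close>; each of them contributes a sign.\<close>

lemma theta_swap:
  assumes "set as \<subseteq> labels g" "set bs \<subseteq> labels g" "set cs \<subseteq> labels g" "n = length as + length bs + length cs + 2"
    and "(x, as', bs', cs') = (Upper, cs, bs, as) \<or> (x, as', bs', cs') = (Chord, as, cs, bs)"
  shows "congr g n (fr (theta as' bs' cs')) (frag_cmul ((-1) ^ (length (tlegs as bs cs x) + length cs)) (fr (theta as bs cs)))"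
proof -
  let ?D = "theta as bs cs" and ?E = "theta as' bs' cs'"
  let ?L = "tlegs as bs cs"
  have jac: "jac g n ?D" using theta_jac[OF assms(1-3)] assms(4) by simp
  define \<sigma> where "\<sigma> s = (if s = x then Lower else if s = Lower then x else s)" for s
  have x: "x \<noteq> Lower" using assms(5) by auto
  have L': "tlegs as' bs' cs' (\<sigma> s) = ?L s" for s using assms(5) by (cases s) (auto simp: \<sigma>_def)
  have ss [simp]: "\<sigma> (\<sigma> s) = s" for s using x by (auto simp: \<sigma>_def)
  let ?f = "\<lambda>k. case k of Lt s j \<Rightarrow> Lt (\<sigma> s) j | Rt s j \<Rightarrow> Rt (\<sigma> s) j | Foot s j \<Rightarrow> Foot (\<sigma> s) j | Tip s j \<Rightarrow> Tip (\<sigma> s) j"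
  define Q where "Q s j \<longleftrightarrow> s \<in> {x, Lower} \<and> 1 \<le> j \<and> j \<le> length (?L s)" for s j
  let ?I = "SIGMA s:{x, Lower}. {1..length (?L s)}"
  let ?Z1 = "(\<lambda>(s, j). Lt s j) ` ?I \<union> ((\<lambda>(s, j). Rt s j) ` ?I \<union> (\<lambda>(s, j). Foot s j) ` ?I)"
  let ?Z2 = "{Rt Upper 0, Rt Chord 0, Rt Lower 0, Lt Upper (length as + 1), Lt Chord (length bs + 1), Lt Lower (length cs + 1)}"
  define Z where "Z = ?Z1 \<union> ?Z2"
  have Zi: "Lt s j \<in> Z \<longleftrightarrow> Q s j \<or> j = length (?L s) + 1" "Rt s j \<in> Z \<longleftrightarrow> Q s j \<or> j = 0"
    "Foot s j \<in> Z \<longleftrightarrow> Q s j" "Tip s j \<notin> Z" for s j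
    unfolding Z_def by (cases s; auto simp: Q_def)+
  have iso: "iso_by ?f (flip Z ?D) ?E"
  proof (rule iso_byI[where f' = ?f])
    fix k assume "k \<in> half (flip Z ?D)"
    then have k: "k \<in> half ?D" by simp
    show "?f k \<in> half ?E \<and> ?f (?f k) = k" using k by (cases k) (simp_all add: L')
    show "opp ?E (?f k) = ?f (opp (flip Z ?D) k)" using k by (cases k) simp_all
    from assms(5) consider (U) "x = Upper" "as' = cs" "bs' = bs" "cs' = as" | (C) "x = Chord" "as' = as" "bs' = cs" "cs' = bs"
      by blast
    then show "rot ?E (?f k) = ?f (rot (flip Z ?D) k)"
    proof cases
      case U
      have sg: "\<sigma> Upper = Lower" "\<sigma> Lower = Upper" "\<sigma> Chord = Chord" by (simp_all add: \<sigma>_def U)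
      show ?thesis using k by (cases k; rename_tac s j; case_tac s) (auto simp: Zi Q_def U sg)
    next
      case C
      have sg: "\<sigma> Upper = Upper" "\<sigma> Lower = Chord" "\<sigma> Chord = Lower" by (simp_all add: \<sigma>_def C)
      show ?thesis using k by (cases k; rename_tac s j; case_tac s) (auto simp: Zi Q_def C sg)
    qed
    assume "rot (flip Z ?D) k = k"
    then show "lab ?E (?f k) = lab (flip Z ?D) k"
    proof (cases k)
      case (Lt s j) with \<open>rot (flip Z ?D) k = k\<close> show ?thesis by (cases s) (auto split: if_splits)
    next
      case (Rt s j) with \<open>rot (flip Z ?D) k = k\<close> show ?thesis by (cases s) (auto split: if_splits)
    next
      case (Foot s j) with \<open>rot (flip Z ?D) k = k\<close> k show ?thesis by (cases s) (auto split: if_splits)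
    next
      case (Tip s j) then show ?thesis by (simp add: L')
    qed
  next
    fix k assume k: "k \<in> half ?E"
    have "tlegs as' bs' cs' s = ?L (\<sigma> s)" for s using L'[of "\<sigma> s"] by simp
    with k show "?f k \<in> half (flip Z ?D) \<and> ?f (?f k) = k" by (cases k) simp_all
  qed
  have cI: "card ?I = length (?L x) + length cs" using x by (simp add: card_SigmaI)
  have "card ?Z1 = card ((\<lambda>(s, j). Lt s j) ` ?I) + (card ((\<lambda>(s, j). Rt s j) ` ?I) + card ((\<lambda>(s, j). Foot s j) ` ?I))"
    by (subst card_Un_disjoint; (subst card_Un_disjoint)?; auto)
  also have "\<dots> = card ?I + (card ?I + card ?I)"
    by (subst (1 2 3) card_image) (auto simp: inj_on_def)
  finally have c1: "card ?Z1 = 3 * (length (?L x) + length cs)" unfolding cI by simp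
  have "card Z = card ?Z1 + card ?Z2"
    unfolding Z_def by (rule card_Un_disjoint) (auto simp: tlegs_def split: strand.splits)
  then have c: "card Z = 3 * (length (?L x) + length cs + 2)" unfolding c1 by simp
  have Z1: "Z \<subseteq> half ?D - tips ?D" proof
    fix k assume "k \<in> Z"
    then show "k \<in> half ?D - tips ?D" by (cases k; rename_tac s j; case_tac s) (auto simp: Zi Q_def theta_tips_iff)
  qed
  have Z2: "rot ?D k \<in> Z" if "k \<in> Z" for k
    using that by (cases k; rename_tac s j; case_tac s) (auto simp: Zi Q_def)
  show ?thesis using fr_flip_iso(1)[OF jac Z1 Z2 c iso] by (simp add: power_add)
qed

text \<open>Reflection exchanging left and right reverses all \<open>n\<close> vertices.\<close>

lemma theta_mirror:
  assumes "set as \<subseteq> labels g" "set bs \<subseteq> labels g" "set cs \<subseteq> labels g" "n = length as + length bs + length cs + 2"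
  shows "congr g n (fr (theta (rev as) (rev bs) (rev cs))) (frag_cmul ((-1) ^ n) (fr (theta as bs cs)))"
proof -
  let ?D = "theta as bs cs" and ?E = "theta (rev as) (rev bs) (rev cs)"
  define len where "len s = length (tlegs as bs cs s)" for s
  have jac: "jac g n ?D" using theta_jac[OF assms(1-3)] assms(4) by simp
  have L': "tlegs (rev as) (rev bs) (rev cs) s = rev (tlegs as bs cs s)" for s by (cases s) auto
  have l: "length as = len Upper" "length bs = len Chord" "length cs = len Lower" by (simp_all add: len_def)
  define f where "f k = (case k of Lt s j \<Rightarrow> Rt s (len s + 1 - j) | Rt s j \<Rightarrow> Lt s (len s + 1 - j)
     | Foot s j \<Rightarrow> Foot s (len s + 1 - j) | Tip s j \<Rightarrow> Tip s (len s + 1 - j))" for k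
  have fs: "f (Lt s j) = Rt s (len s + 1 - j)" "f (Rt s j) = Lt s (len s + 1 - j)"
    "f (Foot s j) = Foot s (len s + 1 - j)" "f (Tip s j) = Tip s (len s + 1 - j)" for s j
    by (simp_all add: f_def)
  define Z where "Z = half ?D - tips ?D"
  have Zi: "Lt s j \<in> Z \<longleftrightarrow> 1 \<le> j \<and> j \<le> len s + 1" "Rt s j \<in> Z \<longleftrightarrow> j \<le> len s"
    "Foot s j \<in> Z \<longleftrightarrow> 1 \<le> j \<and> j \<le> len s" "Tip s j \<notin> Z" for s j
    unfolding Z_def len_def by (auto simp: theta_tips_iff)
  note th = theta_half[of _ _ as bs cs, folded len_def] theta_half[of _ _ "rev as" "rev bs" "rev cs", unfolded L' length_rev, folded len_def]
  note tr = theta_rot[of as bs cs, folded len_def, unfolded l] theta_rot[of "rev as" "rev bs" "rev cs", unfolded L' length_rev, folded len_def, unfolded l]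
  have iso: "iso_by f (flip Z ?D) ?E"
  proof (rule iso_byI[where f' = f])
    fix k assume "k \<in> half (flip Z ?D)"
    then have k: "k \<in> half ?D" by simp
    show "f k \<in> half ?E \<and> f (f k) = k" using k by (cases k) (auto simp: fs th simp del: theta_half)
    show "opp ?E (f k) = f (opp (flip Z ?D) k)" using k by (cases k) (auto simp: fs th simp del: theta_half)
    show "rot ?E (f k) = f (rot (flip Z ?D) k)"
      using k by (cases k; rename_tac s j; case_tac s) (auto simp: fs th tr Zi simp del: theta_half theta_rot)
    assume "rot (flip Z ?D) k = k"
    show "lab ?E (f k) = lab (flip Z ?D) k"
    proof (cases k)
      case (Tip s j)
      then have j: "1 \<le> j" "j \<le> length (tlegs as bs cs s)" using k by auto
      then have "rev (tlegs as bs cs s) ! (len s - j) = tlegs as bs cs s ! (j - 1)"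
        by (subst rev_nth) (auto simp: len_def)
      then show ?thesis using Tip by (simp add: fs L')
    next
      case (Lt s j) with \<open>rot (flip Z ?D) k = k\<close> show ?thesis by (cases s) (auto split: if_splits)
    next
      case (Rt s j) with \<open>rot (flip Z ?D) k = k\<close> show ?thesis by (cases s) (auto split: if_splits)
    next
      case (Foot s j) with \<open>rot (flip Z ?D) k = k\<close> k show ?thesis by (cases s) (auto split: if_splits)
    qed
  next
    fix k assume k: "k \<in> half ?E"
    then show "f k \<in> half (flip Z ?D) \<and> f (f k) = k" by (cases k) (auto simp: fs th simp del: theta_half)
  qed
  have c: "card Z = 3 * n" unfolding Z_def by (rule jac_cards(1)[OF jac])
  have Z2: "rot ?D k \<in> Z" if "k \<in> Z" for k
    using that by (cases k; rename_tac s j; case_tac s) (auto simp: Zi l tr simp del: theta_rot)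
  show ?thesis by (rule fr_flip_iso(1)[OF jac _ Z2 c iso]) (auto simp: Z_def)
qed

lemma theta_inner_edge: "inner_edge (theta (a # as) bs cs) (Rt Upper 0)"
  by (simp add: inner_edge_def)

text \<open>IHX at the leftmost edge of the upper strand slides the first leg over the left end of
  the chord: in H it lands on the lower strand, in X on the chord. In X both ends of the edge must
  be reversed, so no extra sign arises.\<close>

lemma theta_move:
  assumes "set (a # as) \<subseteq> labels g" "set bs \<subseteq> labels g" "set cs \<subseteq> labels g" "n = length as + length bs + length cs + 3"
  shows "congr g n (fr (theta (a # as) bs cs)) (fr (theta as bs (a # cs)) - fr (theta as (a # bs) cs))"
proof -
  let ?D = "theta (a # as) bs cs" and ?e = "Rt Upper 0"
  have jac: "jac g n ?D" using theta_jac[OF assms(1-3)] assms(4) by (simp add: numeral_3_eq_3)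
  note ie = theta_inner_edge[of a as bs cs]
  interpret jacobi g ?D using jac by (rule jac_jacobi)
  let ?H = "ihx_H ?e ?D" and ?X = "ihx_X ?e ?D"
  note jHX = ihx_jac[OF jac ie]
  have H: "?H = rewire ?e (Rt Chord 0) (Rt Upper 1) (Foot Upper 1) (Rt Lower 0) ?D"
    and X: "?X = rewire ?e (Rt Lower 0) (Rt Upper 1) (Foot Upper 1) (Rt Chord 0) ?D"
    by (simp_all add: ihx_rewire)
  have Hr: "rot ?H k = (if k = ?e then Rt Chord 0 else if k = Rt Chord 0 then Rt Upper 1 else if k = Rt Upper 1 then ?e
     else if k = Lt Upper 1 then Foot Upper 1 else if k = Foot Upper 1 then Rt Lower 0 else if k = Rt Lower 0 then Lt Upper 1
     else rot ?D k)" for k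
    unfolding H by (simp add: rewire_def cyc3_def)
  have Xr: "rot ?X k = (if k = ?e then Rt Lower 0 else if k = Rt Lower 0 then Rt Upper 1 else if k = Rt Upper 1 then ?e
     else if k = Lt Upper 1 then Foot Upper 1 else if k = Foot Upper 1 then Rt Chord 0 else if k = Rt Chord 0 then Lt Upper 1
     else rot ?D k)" for k
    unfolding X by (simp add: rewire_def cyc3_def)
  have sH: "half ?H = half ?D" "opp ?H = opp ?D" "lab ?H = lab ?D"
    and sX: "half ?X = half ?D" "opp ?X = opp ?D" "lab ?X = lab ?D"
    by (simp_all add: H X)
  \<comment> \<open>The moved leg and the edge to its left become the first ones of strand
    \<open>t\<close>, whose own legs are shifted by one to the right, while the remaining upper legs
    are shifted to the left. \<open>f'\<close> undoes this.\<close>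
  define f where "f t k = (case k of
       Rt s j \<Rightarrow> if s = Upper then (if j = 0 then Rt t 0 else Rt Upper (j - 1)) else if s = t then Rt t (j + 1) else Rt s j
     | Lt s j \<Rightarrow> if s = Upper then (if j = 1 then Lt t 1 else Lt Upper (j - 1)) else if s = t then Lt t (j + 1) else Lt s j
     | Foot s j \<Rightarrow> if s = Upper then (if j = 1 then Foot t 1 else Foot Upper (j - 1)) else if s = t then Foot t (j + 1) else Foot s j
     | Tip s j \<Rightarrow> if s = Upper then (if j = 1 then Tip t 1 else Tip Upper (j - 1)) else if s = t then Tip t (j + 1) else Tip s j)" for t k
  define f' where "f' t k = (case k of
       Rt s j \<Rightarrow> if s = Upper then Rt Upper (j + 1) else if s = t then (if j = 0 then Rt Upper 0 else Rt t (j - 1)) else Rt s j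
     | Lt s j \<Rightarrow> if s = Upper then Lt Upper (j + 1) else if s = t then (if j = 1 then Lt Upper 1 else Lt t (j - 1)) else Lt s j
     | Foot s j \<Rightarrow> if s = Upper then Foot Upper (j + 1) else if s = t then (if j = 1 then Foot Upper 1 else Foot t (j - 1)) else Foot s j
     | Tip s j \<Rightarrow> if s = Upper then Tip Upper (j + 1) else if s = t then (if j = 1 then Tip Upper 1 else Tip t (j - 1)) else Tip s j)" for t k
  have fs: "f t (Rt s j) = (if s = Upper then (if j = 0 then Rt t 0 else Rt Upper (j - 1)) else if s = t then Rt t (j + 1) else Rt s j)"
     "f t (Lt s j) = (if s = Upper then (if j = 1 then Lt t 1 else Lt Upper (j - 1)) else if s = t then Lt t (j + 1) else Lt s j)"
     "f t (Foot s j) = (if s = Upper then (if j = 1 then Foot t 1 else Foot Upper (j - 1)) else if s = t then Foot t (j + 1) else Foot s j)"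
     "f t (Tip s j) = (if s = Upper then (if j = 1 then Tip t 1 else Tip Upper (j - 1)) else if s = t then Tip t (j + 1) else Tip s j)"
    for t s j by (simp_all add: f_def)
  have fs': "f' t (Rt s j) = (if s = Upper then Rt Upper (j + 1) else if s = t then (if j = 0 then Rt Upper 0 else Rt t (j - 1)) else Rt s j)"
     "f' t (Lt s j) = (if s = Upper then Lt Upper (j + 1) else if s = t then (if j = 1 then Lt Upper 1 else Lt t (j - 1)) else Lt s j)"
     "f' t (Foot s j) = (if s = Upper then Foot Upper (j + 1) else if s = t then (if j = 1 then Foot Upper 1 else Foot t (j - 1)) else Foot s j)"
     "f' t (Tip s j) = (if s = Upper then Tip Upper (j + 1) else if s = t then (if j = 1 then Tip Upper 1 else Tip t (j - 1)) else Tip s j)"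
    for t s j by (simp_all add: f'_def)
  let ?E = "theta as bs (a # cs)"
  have iH: "iso_by (f Lower) ?H ?E"
  proof (rule iso_byI[where f' = "f' Lower"])
    fix k assume "k \<in> half ?H"
    then have k: "k \<in> half ?D" by (simp only: sH)
    show "f Lower k \<in> half ?E \<and> f' Lower (f Lower k) = k"
      using k by (cases k; rename_tac s j; case_tac s) (auto simp: fs fs')
    show "opp ?E (f Lower k) = f Lower (opp ?H k)"
      using k by (cases k; rename_tac s j; case_tac s) (auto simp: fs sH)
    show "rot ?E (f Lower k) = f Lower (rot ?H k)"
      using k by (cases k; rename_tac s j; case_tac s) (auto simp: fs Hr)
    show "rot ?H k = k \<Longrightarrow> lab ?E (f Lower k) = lab ?H k"
      using k by (cases k; rename_tac s j; case_tac s) (auto simp: fs Hr sH nth_Cons' split: if_splits)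
  next
    fix k assume k: "k \<in> half ?E"
    then show "f' Lower k \<in> half ?H \<and> f Lower (f' Lower k) = k"
      by (cases k; rename_tac s j; case_tac s) (auto simp: fs fs' sH)
  qed
  let ?F = "theta as (a # bs) cs" and ?Z = "{Rt Upper 0, Rt Lower 0, Rt Upper 1, Lt Upper 1, Foot Upper 1, Rt Chord 0}"
  have iX: "iso_by (f Chord) (flip ?Z ?X) ?F"
  proof (rule iso_byI[where f' = "f' Chord"])
    fix k assume "k \<in> half (flip ?Z ?X)"
    then have k: "k \<in> half ?D" by (simp only: sX flip_simps)
    show "f Chord k \<in> half ?F \<and> f' Chord (f Chord k) = k"
      using k by (cases k; rename_tac s j; case_tac s) (auto simp: fs fs')
    show "opp ?F (f Chord k) = f Chord (opp (flip ?Z ?X) k)"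
      using k by (cases k; rename_tac s j; case_tac s) (auto simp: fs sX)
    show "rot ?F (f Chord k) = f Chord (rot (flip ?Z ?X) k)"
      using k by (cases k; rename_tac s j; case_tac s) (auto simp: fs Xr)
    show "rot (flip ?Z ?X) k = k \<Longrightarrow> lab ?F (f Chord k) = lab (flip ?Z ?X) k"
      using k by (cases k; rename_tac s j; case_tac s) (auto simp: fs Xr sX nth_Cons' split: if_splits)
  next
    fix k assume k: "k \<in> half ?F"
    then show "f' Chord k \<in> half (flip ?Z ?X) \<and> f Chord (f' Chord k) = k"
      by (cases k; rename_tac s j; case_tac s) (auto simp: fs fs' sX)
  qed
  have c: "card ?Z = 3 * 2" by simp
  have Z1: "?Z \<subseteq> half ?X - tips ?X" by (auto simp: tips_def sX Xr)
  have Z2: "\<And>k. k \<in> ?Z \<Longrightarrow> rot ?X k \<in> ?Z" by (auto simp: Xr)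
  have 1: "congr g n (fr ?F) (fr ?X)" using fr_flip_iso(1)[OF jHX(3) Z1 Z2 c iX] by simp
  have "congr g n (fr ?D) (fr ?H - fr ?X)" by (rule fr_ihx[OF jac ie])
  also have "congr g n \<dots> (fr ?E - fr ?F)"
    by (rule congr_diff[OF fr_iso[OF jHX(1) iH] congr_sym[OF 1]])
  finally show ?thesis .
qed

text \<open>By the two swaps, the move relation says that three times the diagram vanishes; the
  mirror image, with its odd number of vertices, says that twice the diagram vanishes.\<close>

lemma theta_one:
  assumes "a \<in> labels g"
  shows "congr g 3 (fr (theta [a] [] [])) 0"
proof -
  let ?U = "fr (theta [a] [] [])" and ?C = "fr (theta [] [a] [])" and ?L = "fr (theta [] [] [a])"
  have m: "congr g 3 ?U (?L - ?C)" using theta_move[of a "[]" g "[]" "[]" 3] assms by simp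
  have UL: "congr g 3 ?L (- ?U)"
    using theta_swap[of "[a]" g "[]" "[]" 3 Upper "[]" "[]" "[a]"] assms by simp
  have CL: "congr g 3 ?L (- ?C)"
    using theta_swap[of "[]" g "[a]" "[]" 3 Chord "[]" "[]" "[a]"] assms by simp
  have mir: "congr g 3 ?U (- ?U)"
    using theta_mirror[of "[a]" g "[]" "[]" 3] assms by simp
  have "?U - (?L - ?C) \<in> relations g 3" "?L + ?U \<in> relations g 3" "?L + ?C \<in> relations g 3" "?U + ?U \<in> relations g 3"
    using m UL CL mir by (simp_all add: congr_def)
  \<comment> \<open>The combination \<open>(U - (L - C)) + (2 (L + U) - (L + C)) - 2 U\<close>,
    which equals \<open>U\<close>.\<close>
  from relsub(2)[OF relsub(4)[OF this(1) relsub(2)[OF relsub(4)[OF this(2) this(2)] this(3)]] this(4)]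
  show ?thesis by (simp add: congr_def)
qed

subsection \<open>Wheels\<close>

text \<open>\<open>WS i\<close> and \<open>WT i\<close> are the inner and the outer half of the
  spoke with label \<open>w ! i\<close>; \<open>WF i\<close> and \<open>WB i\<close> run along the
  rim to the next and to the previous spoke. A wheel with a single spoke has a self-loop.\<close>

datatype wheel_half = WF nat | WB nat | WS nat | WT nat

definition wheel :: "label list \<Rightarrow> wheel_half diagram" where
  "wheel w =
     (let k = length w in
      \<lparr>half = WF ` {..<k} \<union> WB ` {..<k} \<union> WS ` {..<k} \<union> WT ` {..<k},
       rot = (\<lambda>h. case h of WS i \<Rightarrow> WB i | WB i \<Rightarrow> WF i | WF i \<Rightarrow> WS i | WT i \<Rightarrow> WT i),
       opp = (\<lambda>h. case h of WF i \<Rightarrow> WB (if Suc i = k then 0 else Suc i)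
                          | WB i \<Rightarrow> WF (if i = 0 then k - 1 else i - 1)
                          | WS i \<Rightarrow> WT i | WT i \<Rightarrow> WS i),
       lab = (\<lambda>h. case h of WT i \<Rightarrow> w ! i | _ \<Rightarrow> undefined)\<rparr>)"

lemma wheel_simps [simp]:
  "WF i \<in> half (wheel w) \<longleftrightarrow> i < length w" "WB i \<in> half (wheel w) \<longleftrightarrow> i < length w"
  "WS i \<in> half (wheel w) \<longleftrightarrow> i < length w" "WT i \<in> half (wheel w) \<longleftrightarrow> i < length w"
  "rot (wheel w) (WS i) = WB i" "rot (wheel w) (WB i) = WF i" "rot (wheel w) (WF i) = WS i" "rot (wheel w) (WT i) = WT i"
  "opp (wheel w) (WF i) = WB (if Suc i = length w then 0 else Suc i)"
  "opp (wheel w) (WB i) = WF (if i = 0 then length w - 1 else i - 1)"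
  "opp (wheel w) (WS i) = WT i" "opp (wheel w) (WT i) = WS i"
  "lab (wheel w) (WT i) = w ! i"
  by (auto simp: wheel_def Let_def)

lemma wheel_half_eq: "half (wheel w) =
   WF ` {..<length w} \<union> (WB ` {..<length w} \<union> (WS ` {..<length w} \<union> WT ` {..<length w}))"
  by (auto simp: wheel_def Let_def)

lemma wheel_tips: "tips (wheel w) = WT ` {..<length w}"
proof (intro equalityI subsetI)
  fix k assume "k \<in> tips (wheel w)" then show "k \<in> WT ` {..<length w}"
    by (cases k) (auto simp: tips_def)
qed (auto simp: tips_def)

lemma card_wheel_tips: "card (tips (wheel w)) = length w"
  unfolding wheel_tips by (subst card_image) (auto simp: inj_on_def)

lemma wheel_jac:
  assumes "set w \<subseteq> labels g" "w \<noteq> []"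
  shows "jac g (length w) (wheel w)"
proof (rule jacI)
  let ?D = "wheel w"
  show j: "jacobi_diagram g ?D" unfolding jacobi_diagram_def
  proof (intro conjI ballI)
    show "finite (half ?D)" unfolding wheel_half_eq by simp
    fix k assume k: "k \<in> half ?D"
    show "rot ?D k \<in> half ?D" "rot ?D (rot ?D (rot ?D k)) = k" "opp ?D k \<in> half ?D" "opp ?D (opp ?D k) = k" "opp ?D k \<noteq> k"
      using k by (cases k; auto split: if_splits; fail)+
    show "rot ?D k = k \<longrightarrow> lab ?D k \<in> labels g"
      using k assms(1) nth_mem by (cases k) fastforce+
  qed
  have 0: "WF 0 \<in> half ?D" using assms(2) by simp
  then show "half ?D \<noteq> {}" by blast
  have "half ?D - tips ?D = WF ` {..<length w} \<union> (WB ` {..<length w} \<union> WS ` {..<length w})"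
    unfolding wheel_half_eq wheel_tips by auto
  moreover have "card \<dots> = card (WF ` {..<length w}) + (card (WB ` {..<length w}) + card (WS ` {..<length w}))"
    by (subst card_Un_disjoint; (subst card_Un_disjoint)?; auto)
  moreover have "card (WF ` {..<length w}) = length w" "card (WB ` {..<length w}) = length w" "card (WS ` {..<length w}) = length w"
    by (subst card_image; auto simp: inj_on_def)+
  ultimately show "card (half ?D - tips ?D) = 3 * length w" by simp
  fix S assume S: "S \<subseteq> half ?D" "S \<noteq> {}" "\<And>h. h \<in> S \<Longrightarrow> rot ?D h \<in> S" "\<And>h. h \<in> S \<Longrightarrow> opp ?D h \<in> S"
  note c = closed_iff[OF j S(1,3,4)]
  have f: "WS i \<in> S \<longleftrightarrow> WF i \<in> S" "WB i \<in> S \<longleftrightarrow> WF i \<in> S" "WT i \<in> S \<longleftrightarrow> WF i \<in> S"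
    if "i < length w" for i
    using c(1)[of "WF i"] c(1)[of "WB i"] c(2)[of "WS i"] that by auto
  have r: "WF i \<in> S \<longleftrightarrow> WF 0 \<in> S" if "i < length w" for i
    using that
  proof (induction i)
    case (Suc i) then show ?case using c(2)[of "WF i"] f(2)[of "Suc i"] by simp
  qed simp
  have all: "x \<in> S \<longleftrightarrow> WF 0 \<in> S" if x: "x \<in> half ?D" for x
  proof (cases x)
    case (WF i) with x r[of i] show ?thesis by simp
  next
    case (WB i) with x f(2)[of i] r[of i] show ?thesis by simp
  next
    case (WS i) with x f(1)[of i] r[of i] show ?thesis by simp
  next
    case (WT i) with x f(3)[of i] r[of i] show ?thesis by simp
  qed
  show "half ?D \<subseteq> S" using all S(1,2) by blast
qed

lemma wheel_rotate1:
  assumes "set w \<subseteq> labels g" "w \<noteq> []"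
  shows "congr g (length w) (fr (wheel w)) (fr (wheel (rotate1 w)))"
proof (rule fr_iso[OF wheel_jac[OF assms]])
  let ?k = "length w"
  have k: "0 < ?k" using assms by simp
  let ?p = "\<lambda>i. if i = 0 then ?k - 1 else i - 1" and ?s = "\<lambda>i. if Suc i = ?k then 0 else Suc i"
  let ?f = "\<lambda>q h. case h of WF i \<Rightarrow> WF (q i) | WB i \<Rightarrow> WB (q i) | WS i \<Rightarrow> WS (q i) | WT i \<Rightarrow> WT (q i)"
  show "iso_by (?f ?p) (wheel w) (wheel (rotate1 w))"
  proof (rule iso_byI[where f' = "?f ?s"])
    fix h assume h: "h \<in> half (wheel w)"
    show "?f ?p h \<in> half (wheel (rotate1 w)) \<and> ?f ?s (?f ?p h) = h"
      using h by (cases h) auto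
    show "rot (wheel (rotate1 w)) (?f ?p h) = ?f ?p (rot (wheel w) h)" by (cases h) auto
    show "opp (wheel (rotate1 w)) (?f ?p h) = ?f ?p (opp (wheel w) h)" using h by (cases h) auto
    assume "rot (wheel w) h = h"
    then obtain i where i: "h = WT i" by (cases h) auto
    have "rotate1 w ! j = w ! (Suc j mod ?k)" if "j < ?k" for j
      using nth_rotate[OF that, of 1] by simp
    then show "lab (wheel (rotate1 w)) (?f ?p h) = lab (wheel w) h" using h i by (cases i) auto
  next
    fix h assume h: "h \<in> half (wheel (rotate1 w))"
    show "?f ?s h \<in> half (wheel w) \<and> ?f ?p (?f ?s h) = h" using h by (cases h) auto
  qed
qed

lemma wheel_rotate:
  assumes "set w \<subseteq> labels g" "w \<noteq> []"
  shows "congr g (length w) (fr (wheel w)) (fr (wheel (rotate m w)))"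
proof (induction m)
  case (Suc m)
  have "congr g (length w) (fr (wheel (rotate m w))) (fr (wheel (rotate1 (rotate m w))))"
    using wheel_rotate1[of "rotate m w" g] assms by simp
  with Suc show ?case by (auto intro: congr_trans)
qed simp

text \<open>Reflection of the wheel reverses every vertex on the rim.\<close>

lemma wheel_rev:
  assumes "set w \<subseteq> labels g" "w \<noteq> []"
  shows "congr g (length w) (fr (wheel (rev w))) (frag_cmul ((-1) ^ length w) (fr (wheel w)))"
proof -
  let ?k = "length w" and ?D = "wheel w" and ?E = "wheel (rev w)"
  let ?Z = "half ?D - tips ?D"
  have k: "0 < ?k" using assms by simp
  let ?f = "\<lambda>h. case h of WF i \<Rightarrow> WB (?k - 1 - i) | WB i \<Rightarrow> WF (?k - 1 - i) | WS i \<Rightarrow> WS (?k - 1 - i) | WT i \<Rightarrow> WT (?k - 1 - i)"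
  have Zi: "WF i \<in> ?Z \<longleftrightarrow> i < ?k" "WB i \<in> ?Z \<longleftrightarrow> i < ?k" "WS i \<in> ?Z \<longleftrightarrow> i < ?k" "WT i \<notin> ?Z" for i
    by (auto simp: tips_def)
  have iso: "iso_by ?f (flip ?Z ?D) ?E"
  proof (rule iso_byI[where f' = ?f])
    fix h assume "h \<in> half (flip ?Z ?D)"
    then have h: "h \<in> half ?D" by simp
    show "?f h \<in> half ?E \<and> ?f (?f h) = h"
      using h by (cases h) auto
    show "rot ?E (?f h) = ?f (rot (flip ?Z ?D) h)" using h unfolding flip_simps by (cases h; simp only: Zi) auto
    show "opp ?E (?f h) = ?f (opp (flip ?Z ?D) h)" using h by (cases h) auto
    assume "rot (flip ?Z ?D) h = h"
    then obtain i where i: "h = WT i" using h unfolding flip_simps by (cases h; simp only: Zi) (auto split: if_splits)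
    then show "lab ?E (?f h) = lab (flip ?Z ?D) h" using h by (auto simp: rev_nth)
  next
    fix h assume h: "h \<in> half ?E"
    show "?f h \<in> half (flip ?Z ?D) \<and> ?f (?f h) = h" using h by (cases h) auto
  qed
  note jac = wheel_jac[OF assms]
  have Z2: "rot ?D h \<in> ?Z" if "h \<in> ?Z" for h
    using that by (cases h; simp only: Zi wheel_simps)
  show ?thesis by (rule fr_flip_iso(1)[OF jac _ Z2 jac_cards(1)[OF jac] iso]) auto
qed

text \<open>The triangle replaces the spoke vertex of \<open>b\<close>. Its two corners on the rim
  become the ends of the chord, the side between them becomes the empty chord, the two sides through
  the corner with \<open>b\<close> form the lower strand, and the rest of the rim is the upper
  strand.\<close>

lemma blow_up_wheel:
  assumes "set (b # as) \<subseteq> labels g"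
  shows "congr g (length as + 3) (fr (blow_up (WS 0) (wheel (b # as)))) (fr (theta as [] [b]))"
proof -
  let ?W = "wheel (b # as)" and ?p = "length as"
  let ?B = "blow_up (WS 0) ?W" and ?E = "theta as [] [b]"
  have jW: "jac g (Suc ?p) ?W" using wheel_jac[OF assms] by simp
  have jB: "jac g (?p + 3) ?B" using blow_up_jac(1)[OF jW, of "WS 0"] by (simp add: numeral_3_eq_3)
  have v: "vertex ?W (WS 0) = {WS 0, WB 0, WF 0}" by (simp add: vertex_def)
  let ?f = "\<lambda>k. case k of
      Old h \<Rightarrow> (case h of WF i \<Rightarrow> Rt Upper i | WB i \<Rightarrow> if i = 0 then Lt Upper (?p + 1) else Lt Upper i
                  | WS i \<Rightarrow> if i = 0 then Foot Lower 1 else Foot Upper i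
                  | WT i \<Rightarrow> if i = 0 then Tip Lower 1 else Tip Upper i)
    | Fwd h \<Rightarrow> (case h of WF i \<Rightarrow> Rt Lower 0 | WB i \<Rightarrow> Lt Chord 1 | WS i \<Rightarrow> Rt Lower 1 | WT i \<Rightarrow> undefined)
    | Bwd h \<Rightarrow> (case h of WF i \<Rightarrow> Rt Chord 0 | WB i \<Rightarrow> Lt Lower 2 | WS i \<Rightarrow> Lt Lower 1 | WT i \<Rightarrow> undefined)"
  let ?f' = "\<lambda>k. case k of
      Rt s j \<Rightarrow> if s = Upper then Old (WF j) else if s = Chord then Bwd (WF 0) else if j = 0 then Fwd (WF 0) else Fwd (WS 0)
    | Lt s j \<Rightarrow> if s = Upper then Old (WB (if j = ?p + 1 then 0 else j)) else if s = Chord then Fwd (WB 0)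
        else if j = 1 then Bwd (WS 0) else Bwd (WB 0)
    | Foot s j \<Rightarrow> if s = Upper then Old (WS j) else Old (WS 0)
    | Tip s j \<Rightarrow> if s = Upper then Old (WT j) else Old (WT 0)"
  have "iso_by ?f ?B ?E"
  proof (rule iso_byI[where f' = ?f'])
    fix k assume k: "k \<in> half ?B"
    consider (o) h where "k = Old h" "h \<in> half ?W" | (t) "k \<in> {Fwd (WS 0), Fwd (WB 0), Fwd (WF 0), Bwd (WS 0), Bwd (WB 0), Bwd (WF 0)}"
      using k v by (cases k) auto
    then have "(?f k \<in> half ?E \<and> ?f' (?f k) = k) \<and> opp ?E (?f k) = ?f (opp ?B k) \<and> rot ?E (?f k) = ?f (rot ?B k)"
    proof cases
      case o then show ?thesis by (cases h) (auto simp: v)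
    next
      case t then show ?thesis by (auto simp: v)
    qed
    then show "?f k \<in> half ?E \<and> ?f' (?f k) = k" "opp ?E (?f k) = ?f (opp ?B k)" "rot ?E (?f k) = ?f (rot ?B k)"
      by blast+
    assume "rot ?B k = k"
    then obtain i where "k = Old (WT i)"
      using k v by (cases k; rename_tac h; case_tac h) (auto split: if_splits)
    then show "lab ?E (?f k) = lab ?B k" using k by (cases i) auto
  next
    fix k assume k: "k \<in> half ?E"
    then show "?f' k \<in> half ?B \<and> ?f (?f' k) = k"
      by (cases k; rename_tac s j; case_tac s) (auto simp: v)
  qed
  then show ?thesis by (rule fr_iso[OF jB])
qed

subsection \<open>Cycles\<close>

text \<open>
  A set of half-edges closed under \<open>opp\<close> and meeting every vertex in none or two of its
  half-edges is a disjoint union of cycles; a cycle is a minimal one.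
\<close>

definition even_set :: "'h diagram \<Rightarrow> 'h set \<Rightarrow> bool" where
  "even_set D K \<longleftrightarrow> K \<subseteq> half D \<and> (\<forall>h\<in>K. opp D h \<in> K \<and> ((rot D h \<in> K) \<noteq> (rot D (rot D h) \<in> K)))"

definition cycle :: "'h diagram \<Rightarrow> 'h set \<Rightarrow> bool" where
  "cycle D K \<longleftrightarrow> even_set D K \<and> K \<noteq> {} \<and> (\<forall>L. even_set D L \<and> L \<noteq> {} \<and> L \<subseteq> K \<longrightarrow> L = K)"

lemma even_setD:
  assumes "even_set D K" "h \<in> K"
  shows "h \<in> half D" "opp D h \<in> K" "rot D h \<in> K \<longleftrightarrow> rot D (rot D h) \<notin> K"
  using assms by (auto simp: even_set_def)

text \<open>A counting argument modulo 2. Each edge set determines the set of vertices of odd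
  degree, which has even size by double counting; so not every vertex set occurs, and with at least
  as many edges as vertices two edge sets give the same result. Their symmetric difference has even
  degree everywhere, that is 0 or 2. A nonempty even set of least size is a cycle.\<close>

lemma cycle_exists:
  assumes "jacobi_diagram g D" "card (vertices D) \<le> card (edges D)" "half D \<noteq> {}"
  shows "\<exists>K. cycle D K"
proof -
  interpret jacobi g D by unfold_locales fact
  have fV: "finite (vertices D)" by (simp add: vertices_eq)
  have e: "edges D = (\<lambda>h. {h, opp D h}) ` half D" by (auto simp: edges_def)
  have fE: "finite (edges D)" by (simp add: e)
  have eD: "x = {h, opp D h}" if "x \<in> edges D" "h \<in> x" for x h using that by (auto simp: e)
  have eh: "x \<subseteq> half D" if "x \<in> edges D" for x using that by (auto simp: e)
  let ?F = "\<lambda>X. {v \<in> vertices D. odd (card (v \<inter> \<Union>X))}"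
  have ev: "even (card (?F X))" if X: "X \<subseteq> edges D" for X
  proof -
    have fX: "finite X" using X fE by (rule finite_subset)
    have "card (\<Union>X) = sum card X"
    proof (rule card_Union_disjoint)
      show "pairwise disjnt X"
      proof (intro pairwiseI)
        fix x y assume xy: "x \<in> X" "y \<in> X" "x \<noteq> y"
        have False if "h \<in> x" "h \<in> y" for h
          using eD[of x h] eD[of y h] that xy X by blast
        then show "disjnt x y" by (auto simp: disjnt_def)
      qed
      show "finite A" if "A \<in> X" for A using that X by (auto simp: e)
    qed
    also have "\<dots> = sum (\<lambda>_. 2) X"
    proof (rule sum.cong[OF refl])
      fix x assume "x \<in> X"
      then obtain h where h: "h \<in> half D" "x = {h, opp D h}" using X by (auto simp: e)
      then show "card x = 2" by simp
    qed
    finally have 1: "even (card (\<Union>X))" by simp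
    have "\<Union>X = (\<Union>v\<in>vertices D. v \<inter> \<Union>X)"
    proof (intro equalityI subsetI)
      fix h assume h: "h \<in> \<Union>X"
      then have "h \<in> half D" using X eh by blast
      then have "vertex D h \<in> vertices D" by (simp add: vertices_eq)
      then show "h \<in> (\<Union>v\<in>vertices D. v \<inter> \<Union>X)" using h self_in_vertex[of h] by blast
    qed auto
    then have "card (\<Union>X) = card (\<Union>v\<in>vertices D. v \<inter> \<Union>X)" by simp
    also have "\<dots> = (\<Sum>v\<in>vertices D. card (v \<inter> \<Union>X))"
    proof (rule card_UN_disjoint[OF fV])
      show "\<forall>v\<in>vertices D. finite (v \<inter> \<Union>X)" by (auto simp: vertices_eq)
      show "\<forall>i\<in>vertices D. \<forall>j\<in>vertices D. i \<noteq> j \<longrightarrow> (i \<inter> \<Union>X) \<inter> (j \<inter> \<Union>X) = {}"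
        using vertices_disjoint by blast
    qed
    finally have "even (\<Sum>v\<in>vertices D. card (v \<inter> \<Union>X))" using 1 by simp
    then show ?thesis by (simp add: even_sum_iff[OF fV])
  qed
  have "\<not> inj_on ?F (Pow (edges D))"
  proof
    assume inj: "inj_on ?F (Pow (edges D))"
    obtain h where h: "h \<in> half D" using assms(3) by blast
    have "?F ` Pow (edges D) \<subseteq> Pow (vertices D) - {{vertex D h}}"
    proof
      fix A assume "A \<in> ?F ` Pow (edges D)"
      then obtain X where X: "X \<subseteq> edges D" "A = ?F X" by blast
      have "even (card A)" unfolding X(2) by (rule ev[OF X(1)])
      then have "A \<noteq> {vertex D h}" by auto
      then show "A \<in> Pow (vertices D) - {{vertex D h}}" using X(2) by blast
    qed
    then have "card (?F ` Pow (edges D)) \<le> card (Pow (vertices D) - {{vertex D h}})"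
      by (rule card_mono[rotated]) (simp add: fV)
    also have "\<dots> < card (Pow (vertices D))"
      by (rule card_Diff1_less) (use fV h in \<open>auto simp: vertices_eq\<close>)
    finally have "card (Pow (edges D)) < card (Pow (vertices D))" by (simp add: card_image[OF inj])
    then show False using assms(2) fE fV by (simp add: card_Pow)
  qed
  then obtain X Y where XY: "X \<subseteq> edges D" "Y \<subseteq> edges D" "X \<noteq> Y" "?F X = ?F Y"
    by (auto simp: inj_on_def)
  define K where "K = (\<Union>X - \<Union>Y) \<union> (\<Union>Y - \<Union>X)"
  have mem: "x \<in> X" if "X \<subseteq> edges D" "h \<in> \<Union>X" "x \<in> edges D" "h \<in> x" for X x h
    using that eD[of x h] eD[of _ h] by blast
  have "K \<noteq> {}"
  proof -
    from XY(3) obtain x where x: "x \<in> X \<and> x \<notin> Y \<or> x \<in> Y \<and> x \<notin> X" by blast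
    then have xe: "x \<in> edges D" using XY by blast
    then obtain h where h: "h \<in> x" by (auto simp: e)
    have "h \<in> \<Union>X \<longleftrightarrow> x \<in> X" "h \<in> \<Union>Y \<longleftrightarrow> x \<in> Y" using mem[OF XY(1) _ xe h] mem[OF XY(2) _ xe h] h by blast+
    then show ?thesis using x unfolding K_def by blast
  qed
  have opp: "opp D h \<in> \<Union>X \<longleftrightarrow> h \<in> \<Union>X" if "X \<subseteq> edges D" "h \<in> half D" for X h
  proof -
    have "{h, opp D h} \<in> edges D" using that by (auto simp: e)
    from mem[OF that(1) _ this] show ?thesis by blast
  qed
  have Kh: "K \<subseteq> half D" unfolding K_def using XY eh by blast
  have "even_set D K" unfolding even_set_def
  proof (intro conjI ballI Kh)
    fix h assume hK: "h \<in> K"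
    then have h: "h \<in> half D" using Kh by blast
    show "opp D h \<in> K" using hK opp[OF XY(1) h] opp[OF XY(2) h] unfolding K_def by blast
    let ?v = "vertex D h"
    have v: "?v \<in> vertices D" using h by (simp add: vertices_eq)
    let ?A = "?v \<inter> \<Union>X" and ?B = "?v \<inter> \<Union>Y"
    have "even (card ?A) \<longleftrightarrow> even (card ?B)" using XY(4) v by blast
    moreover have "card ?A = card (?A - ?B) + card (?A \<inter> ?B)" "card ?B = card (?B - ?A) + card (?A \<inter> ?B)"
      using card_Int_Diff[of ?A ?B] card_Int_Diff[of ?B ?A] by (simp_all add: Int_commute)
    moreover have "card (?v \<inter> K) = card (?A - ?B) + card (?B - ?A)"
    proof -
      have "?v \<inter> K = (?A - ?B) \<union> (?B - ?A)" unfolding K_def by blast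
      also have "card \<dots> = card (?A - ?B) + card (?B - ?A)"
        by (rule card_Un_disjoint) auto
      finally show ?thesis .
    qed
    ultimately have ev2: "even (card (?v \<inter> K))" by (metis even_add)
    show "(rot D h \<in> K) \<noteq> (rot D (rot D h) \<in> K)"
    proof (cases "rot D h = h")
      case True
      then have "?v \<inter> K = {h}" using hK by (auto simp: vertex_def)
      then show ?thesis using ev2 by simp
    next
      case False
      then have d: "rot D h \<noteq> h" "rot D (rot D h) \<noteq> h" "rot D (rot D h) \<noteq> rot D h" using h by auto
      have "?v \<inter> K = insert h ((if rot D h \<in> K then {rot D h} else {}) \<union> (if rot D (rot D h) \<in> K then {rot D (rot D h)} else {}))"
        using hK by (auto simp: vertex_def)
      then show ?thesis using ev2 d by (auto split: if_splits)
    qed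
  qed
  with \<open>K \<noteq> {}\<close> have "\<exists>K. even_set D K \<and> K \<noteq> {}" by blast
  then obtain K where K: "even_set D K \<and> K \<noteq> {}" "\<And>L. even_set D L \<and> L \<noteq> {} \<Longrightarrow> card K \<le> card L"
    using ex_has_least_nat[of "\<lambda>K. even_set D K \<and> K \<noteq> {}" _ card] by blast
  have "L = K" if "even_set D L \<and> L \<noteq> {} \<and> L \<subseteq> K" for L
  proof (rule card_subset_eq)
    show "finite K" using K(1) fin by (auto simp: even_set_def intro: finite_subset)
    then show "card L = card K" using K(2)[of L] that card_mono[of K L] by (simp add: le_antisym)
  qed (use that in auto)
  then show ?thesis using K(1) unfolding cycle_def by blast
qed

text \<open>The edge \<open>e\<close> leaves the cycle towards a vertex off the cycle. After
  rewiring, \<open>a\<close> and \<open>d\<close>, which met at one vertex, sit at different ends of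
  \<open>e\<close>, so the cycle is prolonged by \<open>e\<close>. The unordered conditions on
  \<open>{a, d}\<close> and \<open>{b, c}\<close> cover H and X alike.\<close>

lemma cycle_rewire:
  assumes "jac g n D" "cycle D K" "inner_edge D e" "rot D e \<in> K" "rot D (rot D e) \<in> K" "e \<notin> K"
    "vertex D (opp D e) \<inter> K = {}"
    "{a, d} = {rot D e, rot D (rot D e)}" "{b, c} = {rot D (opp D e), rot D (rot D (opp D e))}"
  shows "cycle (rewire e a b c d D) (insert e (insert (opp D e) K))"
proof -
  interpret jacobi g D using assms(1) by (rule jac_jacobi)
  let ?E = "rewire e a b c d D" and ?e = "opp D e"
  let ?K = "insert e (insert ?e K)"
  note dd = distinct6[OF inner_edge_distinct[OF assms(3)]]
  have ev: "even_set D K" and K0: "K \<noteq> {}" and mn: "\<And>L. even_set D L \<Longrightarrow> L \<noteq> {} \<Longrightarrow> L \<subseteq> K \<Longrightarrow> L = K"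
    using assms(2) by (auto simp: cycle_def)
  note ed = even_setD[OF ev]
  have eh: "e \<in> half D" "?e \<in> half D" "opp D ?e = e" using assms(3) by (auto simp: inner_edge_def)
  have d4: "distinct [a, b, c, d]"
    using assms(8,9) dd by (auto simp: doubleton_eq_iff)
  have s4: "{a, b, c, d} = {rot D e, rot D (rot D e), rot D ?e, rot D (rot D ?e)}"
    using assms(8,9) by blast
  note r = rewire_rot[OF assms(3) d4 s4]
  let ?T = "{e, ?e, a, b, c, d}"
  have nd: "e \<noteq> ?e" "a \<noteq> e" "a \<noteq> ?e" "b \<noteq> e" "b \<noteq> ?e" "c \<noteq> e" "c \<noteq> ?e" "d \<noteq> e" "d \<noteq> ?e"
    using r(9) by auto
  have K: "a \<in> K" "d \<in> K" "b \<notin> K" "c \<notin> K" "?e \<notin> K" "e \<notin> K"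
    using assms(4-9) by (auto simp: vertex_def doubleton_eq_iff)
  have out: "rot ?E h = rot D h" "rot ?E (rot ?E h) = rot D (rot D h)" "rot D h \<notin> ?T" "rot D (rot D h) \<notin> ?T"
    if "h \<in> half D" "h \<notin> ?T" for h
  proof -
    show 1: "rot D h \<notin> ?T" using r(10)[OF that(1)] that(2) by blast
    show "rot D (rot D h) \<notin> ?T" using r(10)[of "rot D h"] that(1) 1 by simp
    show "rot ?E h = rot D h" using r(7)[OF that(2)] .
    then show "rot ?E (rot ?E h) = rot D (rot D h)" using r(7)[OF 1] by simp
  qed
  show ?thesis unfolding cycle_def
  proof (intro conjI allI impI)
    show "even_set ?E ?K" unfolding even_set_def
    proof (intro conjI ballI)
      show "?K \<subseteq> half ?E" using ed(1) eh by auto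
      fix h assume h: "h \<in> ?K"
      show "opp ?E h \<in> ?K" using h ed(2) eh by auto
      show "(rot ?E h \<in> ?K) \<noteq> (rot ?E (rot ?E h) \<in> ?K)"
      proof (cases "h \<in> ?T")
        case True
        then have "h \<in> {e, ?e, a, d}" using h K by auto
        then show ?thesis using K nd by (elim insertE emptyE) (simp_all add: r(1-6))
      next
        case False
        then have hK: "h \<in> K" using h by simp
        have hh: "h \<in> half D" using ed(1)[OF hK] .
        show ?thesis unfolding out(2)[OF hh False] unfolding out(1)[OF hh False] using ed(3)[OF hK] out(3,4)[OF hh False] by auto
      qed
    qed
    show "?K \<noteq> {}" by simp
    fix L assume L: "even_set ?E L \<and> L \<noteq> {} \<and> L \<subseteq> ?K"
    note el = even_setD[of ?E L, OF conjunct1[OF L]]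
    have bc: "b \<notin> L" "c \<notin> L" using L K nd by auto
    have ee: "e \<in> L \<longleftrightarrow> ?e \<in> L" using el(2)[of e] el(2)[of ?e] eh by auto
    have ae: "a \<in> L \<longleftrightarrow> e \<in> L" using el(3)[of e] el(3)[of a] bc by (auto simp: r(1-6))
    have de: "d \<in> L \<longleftrightarrow> e \<in> L" using el(3)[of ?e] el(3)[of d] bc ee by (auto simp: r(1-6))
    \<comment> \<open>For minimality, an even subset of the longer cycle is shortened by
      \<open>e\<close> to an even subset of \<open>K\<close> in \<open>D\<close>.\<close>
    define L0 where "L0 = L - {e, ?e}"
    have L0K: "L0 \<subseteq> K" using L unfolding L0_def by auto
    have "even_set D L0" unfolding even_set_def
    proof (intro conjI ballI)
      show "L0 \<subseteq> half D" using L0K ed(1) by blast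
      fix h assume h: "h \<in> L0"
      then have hK: "h \<in> K" and hL: "h \<in> L" using L0K unfolding L0_def by auto
      have hh: "h \<in> half D" using ed(1)[OF hK] .
      have "opp D h \<noteq> e" "opp D h \<noteq> ?e" using h hh eh unfolding L0_def by auto
      then show "opp D h \<in> L0" using el(2)[OF hL] unfolding L0_def by simp
      show "(rot D h \<in> L0) \<noteq> (rot D (rot D h) \<in> L0)"
      proof (cases "h \<in> ?T")
        case True
        then have had: "h = a \<or> h = d" using h bc unfolding L0_def by auto
        then have "e \<in> L" using hL ae de by auto
        then have adL: "rot D e \<in> L0" "rot D (rot D e) \<in> L0"
          using ae de assms(8) nd unfolding L0_def by (auto simp: doubleton_eq_iff)
        have "h = rot D e \<or> h = rot D (rot D e)" using had assms(8) by (auto simp: doubleton_eq_iff)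
        then show ?thesis using adL eh unfolding L0_def by auto
      next
        case False
        show ?thesis using el(3)[OF hL, unfolded out(2)[OF hh False], unfolded out(1)[OF hh False]] out(3,4)[OF hh False]
          unfolding L0_def by auto
      qed
    qed
    moreover have "L0 \<noteq> {}"
    proof (cases "e \<in> L")
      case True then show ?thesis using ae nd unfolding L0_def by auto
    next
      case False then show ?thesis using ee L unfolding L0_def by auto
    qed
    ultimately have "L0 = K" using mn L0K by blast
    then have "a \<in> L0" using K by simp
    then have "e \<in> L" using ae unfolding L0_def by simp
    then show "L = ?K" using \<open>L0 = K\<close> ee L unfolding L0_def by auto
  qed
qed

lemma cycle_trivalent:
  assumes "jacobi_diagram g D" "even_set D K" "h \<in> half D" "vertex D h \<inter> K \<noteq> {}" "h \<notin> K"
  shows "rot D h \<noteq> h" "rot D h \<in> K" "rot D (rot D h) \<in> K"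
proof -
  interpret jacobi g D by unfold_locales fact
  have "rot D h \<in> K \<or> rot D (rot D h) \<in> K" using assms(4,5) by (auto simp: vertex_def)
  then show "rot D h \<in> K" "rot D (rot D h) \<in> K"
    using even_setD(3)[OF assms(2), of "rot D h"] even_setD(3)[OF assms(2), of "rot D (rot D h)"] assms(3,5) by auto
  then show "rot D h \<noteq> h" using assms(5) by auto
qed

text \<open>Induction on the number of half-edges off the cycle: H and X have the same half-edges as
  \<open>D\<close>, and in both the cycle contains one edge more. When no edge leads from the cycle
  to a trivalent vertex off it, connectedness shows that none exists.\<close>

lemma hamiltonian_reduction:
  fixes D :: "'h diagram"
  assumes "is_sub S" "relations g n \<subseteq> S"
    and base: "\<And>(D :: 'h diagram) K. jac g n D \<Longrightarrow> card (tips D) = u \<Longrightarrow> cycle D K \<Longrightarrow>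
       (\<And>h. h \<in> half D \<Longrightarrow> rot D h \<noteq> h \<Longrightarrow> vertex D h \<inter> K \<noteq> {}) \<Longrightarrow> fr D \<in> S"
    and "jac g n D" "card (tips D) = u" "cycle D K"
  shows "fr D \<in> S"
  using assms(4-6)
proof (induction "card (half D) - card K" arbitrary: D K rule: less_induct)
  case less
  interpret jacobi g D using less.prems(1) by (rule jac_jacobi)
  have ev: "even_set D K" using less.prems(3) by (simp add: cycle_def)
  have KD: "K \<subseteq> half D" using even_setD(1)[OF ev] by blast
  have fK: "finite K" using KD fin by (rule finite_subset)
  show ?case
  proof (cases "\<exists>e. e \<in> half D \<and> e \<notin> K \<and> vertex D e \<inter> K \<noteq> {} \<and> rot D (opp D e) \<noteq> opp D e \<and> vertex D (opp D e) \<inter> K = {}")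
    case True
    then obtain e where e: "e \<in> half D" "e \<notin> K" "vertex D e \<inter> K \<noteq> {}" "rot D (opp D e) \<noteq> opp D e" "vertex D (opp D e) \<inter> K = {}"
      by blast
    note t = cycle_trivalent[OF jd ev e(1,3,2)]
    have eK: "opp D e \<notin> K" using e(5) self_in_vertex[of "opp D e"] by blast
    have ie: "inner_edge D e" using e t eK by (auto simp: inner_edge_def)
    let ?K = "insert e (insert (opp D e) K)"
    have c: "cycle (ihx_H e D) ?K" "cycle (ihx_X e D) ?K"
      unfolding ihx_rewire by (rule cycle_rewire[OF less.prems(1,3) ie t(2,3) e(2,5)]; auto)+
    note j = ihx_jac[OF less.prems(1) ie]
    have "card ?K = card K + 2" using e eK fK by simp
    moreover have "card ?K \<le> card (half D)" by (rule card_mono) (use KD e in auto)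
    ultimately have m: "card (half D) - card ?K < card (half D) - card K" by linarith
    have h: "half (ihx_H e D) = half D" "half (ihx_X e D) = half D" by (simp_all add: ihx_rewire)
    have "fr (ihx_H e D) \<in> S" by (rule less.hyps[OF _ j(1) _ c(1)]) (use m h j(2) less.prems(2) in auto)
    moreover have "fr (ihx_X e D) \<in> S" by (rule less.hyps[OF _ j(3) _ c(2)]) (use m h j(4) less.prems(2) in auto)
    moreover have "fr D - (fr (ihx_H e D) - fr (ihx_X e D)) \<in> S"
      using fr_ihx[OF less.prems(1) ie] assms(2) by (auto simp: congr_def)
    ultimately show ?thesis using is_sub_diff_iff[OF assms(1)] is_subD(2)[OF assms(1)] by blast
  next
    case False
    \<comment> \<open>The tips of legs attached to the cycle are included to make the set closed
      under \<open>opp\<close>.\<close>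
    let ?S = "{h \<in> half D. vertex D h \<inter> K \<noteq> {} \<or> (rot D h = h \<and> vertex D (opp D h) \<inter> K \<noteq> {})}"
    obtain x where x: "x \<in> K" using less.prems(3) by (auto simp: cycle_def)
    have "?S = half D"
    proof (rule jac_closedI[OF less.prems(1)])
      show "x \<in> ?S" using x KD self_in_vertex[of x] by blast
      fix h assume h: "h \<in> ?S"
      then have hh: "h \<in> half D" by blast
      show "rot D h \<in> ?S" using h vertex_rot[OF hh] by auto
      show "opp D h \<in> ?S"
      proof (cases "vertex D h \<inter> K = {}")
        case True
        then show ?thesis using h by auto
      next
        case t: False
        show ?thesis
        proof (cases "rot D (opp D h) = opp D h \<or> h \<in> K")
          case True
          then show ?thesis
          proof
            assume "h \<in> K"
            then have "opp D h \<in> K" by (rule even_setD(2)[OF ev])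
            then have "vertex D (opp D h) \<inter> K \<noteq> {}" using self_in_vertex[of "opp D h"] by blast
            then show ?thesis using hh by simp
          qed (use t hh in auto)
        next
          case False
          then show ?thesis using \<open>\<not> (\<exists>e. _ e)\<close> hh t by auto
        qed
      qed
    qed auto
    then show ?thesis by (intro base[OF less.prems]) blast
  qed
qed

section \<open>Diagrams with a cycle through all trivalent vertices\<close>

locale hamiltonian = jacobi g D for g and D :: "'h diagram" +
  fixes n :: nat and K :: "'h set" and h0 :: 'h
  assumes jac: "jac g n D" and cyc: "cycle D K"
    and full: "\<And>h. h \<in> half D \<Longrightarrow> rot D h \<noteq> h \<Longrightarrow> vertex D h \<inter> K \<noteq> {}"
    and h0: "h0 \<in> K"
begin

lemma ev: "even_set D K" and mn: "even_set D L \<Longrightarrow> L \<noteq> {} \<Longrightarrow> L \<subseteq> K \<Longrightarrow> L = K"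
  using cyc by (auto simp: cycle_def)

lemma K_half: "h \<in> K \<Longrightarrow> h \<in> half D" and K_opp: "h \<in> K \<Longrightarrow> opp D h \<in> K"
  and K_rot: "h \<in> K \<Longrightarrow> rot D h \<in> K \<longleftrightarrow> rot D (rot D h) \<notin> K"
  by (rule even_setD[OF ev]; assumption)+

text \<open>
  \<open>tau\<close> crosses a vertex along the cycle and \<open>third\<close> is the half-edge pointing away from
  it; \<open>c\<close> runs along the cycle.
\<close>

definition tau :: "'h \<Rightarrow> 'h" where
  "tau h = (if rot D h \<in> K then rot D h else rot D (rot D h))"

definition third :: "'h \<Rightarrow> 'h" where
  "third h = (if rot D h \<in> K then rot D (rot D h) else rot D h)"

definition c :: "nat \<Rightarrow> 'h" where
  "c i = ((\<lambda>h. tau (opp D h)) ^^ i) h0"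

lemma tau_facts:
  assumes "h \<in> K"
  shows "tau h \<in> K" "tau (tau h) = h" "tau h \<noteq> h" "third h \<notin> K" "third h \<in> half D" "third (tau h) = third h"
    "vertex D h = {h, tau h, third h}" "rot D h \<noteq> h" "rot D (third h) \<noteq> third h"
proof -
  note h = K_half[OF assms]
  show 1: "rot D h \<noteq> h" using K_rot[OF assms] assms by auto
  then show "tau h \<noteq> h" using h by (simp add: tau_def)
  show "tau h \<in> K" "third h \<notin> K" using K_rot[OF assms] by (auto simp: tau_def third_def)
  show "third h \<in> half D" "rot D (third h) \<noteq> third h" using h 1 by (auto simp: third_def)
  show "tau (tau h) = h" "third (tau h) = third h"
    using h assms K_rot[OF assms] by (auto simp: tau_def third_def)
  show "vertex D h = {h, tau h, third h}" by (auto simp: tau_def third_def vertex_def)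
qed

lemma c_0 [simp]: "c 0 = h0" and c_Suc: "c (Suc i) = tau (opp D (c i))"
  by (simp_all add: c_def)

lemma c_K: "c i \<in> K"
  by (induction i) (simp_all add: h0 c_Suc tau_facts K_opp)

lemma tau_c_Suc: "tau (c (Suc i)) = opp D (c i)"
  by (simp add: c_Suc tau_facts K_opp c_K)

lemma c_half [simp]: "c i \<in> half D"
  by (rule K_half[OF c_K])

lemma c_Suc_inj: "c (Suc i) = c (Suc j) \<Longrightarrow> c i = c j"
  using tau_c_Suc[of i] tau_c_Suc[of j] opp_opp[of "c i"] opp_opp[of "c j"] by simp

lemma c_shift: "c i = c (i + d) \<Longrightarrow> c d = h0"
  by (induction i) (auto dest: c_Suc_inj)

definition k :: nat where "k = (LEAST d. 0 < d \<and> c d = h0)"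

lemma k_pos: "0 < k" and c_k: "c k = h0" and k_least: "0 < d \<Longrightarrow> c d = h0 \<Longrightarrow> k \<le> d"
proof -
  have "finite (range c)" using c_half by (intro finite_subset[OF _ fin]) auto
  then have "\<not> inj c" using infinite_UNIV_nat finite_imageD by blast
  then obtain i j where "i < j" "c i = c j" by (metis injI linorder_neqE_nat)
  then have "0 < j - i \<and> c (j - i) = h0" using c_shift[of i "j - i"] by simp
  then have "0 < k \<and> c k = h0" unfolding k_def by (rule LeastI)
  then show "0 < k" "c k = h0" by auto
  show "0 < d \<Longrightarrow> c d = h0 \<Longrightarrow> k \<le> d" unfolding k_def by (rule Least_le) simp
qed

lemma c_period: "c (i + k) = c i"
  by (induction i) (simp_all add: c_k c_Suc)

lemma c_inj: "i < k \<Longrightarrow> j < k \<Longrightarrow> c i = c j \<Longrightarrow> i = j"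
proof (induction i j rule: linorder_wlog)
  case (le i j)
  then have "c (j - i) = h0" using c_shift[of i "j - i"] by simp
  then show ?case using k_least[of "j - i"] le by (cases "i = j") auto
qed auto

lemma c_mod: "c (i mod k) = c i"
proof (induction i rule: less_induct)
  case (less i)
  show ?case
  proof (cases "i < k")
    case False
    then have "c ((i - k) mod k) = c (i - k)" using k_pos by (intro less) simp
    then show ?thesis using False c_period[of "i - k"] by (simp add: le_mod_geq)
  qed simp
qed

text \<open>The walk never runs along an edge in both directions. If it did, stepping forward from
  one visit and backward from the other would bring the two positions closer by two, until a fixed
  point of \<open>opp\<close> or of \<open>tau\<close> appeared.\<close>

lemma opp_c_neq: "opp D (c i) \<noteq> c j"
proof -
  have *: "opp D (c i) \<noteq> c (i + d)" for i d
  proof (induction d arbitrary: i rule: less_induct)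
    case (less d)
    consider "d = 0" | "d = 1" | e where "d = Suc (Suc e)" by (metis One_nat_def not0_implies_Suc)
    then show ?case
    proof cases
      case 2 then show ?thesis using tau_facts(3)[OF K_opp[OF c_K[of i]]] by (auto simp: c_Suc)
    next
      case (3 e)
      show ?thesis
      proof
        assume a: "opp D (c i) = c (i + d)"
        have "c (i + d) = tau (opp D (c (i + Suc e)))" by (simp add: 3 c_Suc)
        with a have "tau (opp D (c i)) = opp D (c (i + Suc e))" by (simp add: tau_facts K_opp c_K)
        then have "opp D (c (Suc i)) = c (Suc i + e)" by (simp add: c_Suc[of i])
        then show False using less[of e "Suc i"] 3 by simp
      qed
    qed (simp)
  qed
  \<comment> \<open>The shrinking argument treats positions \<open>i + d\<close> only; periodicity
    replaces \<open>j\<close> by a later index.\<close>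
  have kk: "c (j + m * k) = c j" for m by (induction m) (simp_all add: c_period add.assoc[symmetric], metis add.assoc add.commute c_period)
  have "i * 1 \<le> i * k" by (rule mult_le_mono2) (use k_pos in simp)
  then have "i + (j + i * k - i) = j + i * k" by linarith
  then have "c (i + (j + i * k - i)) = c j" using kk[of i] by simp
  then show ?thesis using *[of i "j + i * k - i"] by simp
qed

lemma tau_c_neq: "tau (c i) \<noteq> c j"
  using opp_c_neq[of "i + k - 1" j] tau_c_Suc[of "i + k - 1"] k_pos by (simp add: c_period)

text \<open>The half-edges met by the walk together with their opposites form a nonempty even subset
  of \<open>K\<close>, and \<open>K\<close> is minimal.\<close>

lemma K_eq: "h \<in> K \<Longrightarrow> \<exists>i<k. h = c i \<or> h = tau (c i)"
proof -
  assume h: "h \<in> K"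
  let ?L = "range c \<union> opp D ` range c"
  have LK: "?L \<subseteq> K" using c_K K_opp by auto
  have tL: "tau x \<in> ?L" if "x \<in> ?L" for x
    using that
  proof
    assume "x \<in> range c"
    then obtain i where "x = c i" by auto
    moreover have "tau (c i) = opp D (c (i + k - 1))"
      using tau_c_Suc[of "i + k - 1"] k_pos by (simp add: c_period)
    ultimately show ?thesis by auto
  next
    assume "x \<in> opp D ` range c"
    then obtain i where "x = opp D (c i)" by auto
    then have "tau x = c (Suc i)" by (simp add: c_Suc)
    then show ?thesis by auto
  qed
  have "even_set D ?L" unfolding even_set_def
  proof (intro conjI ballI)
    show "?L \<subseteq> half D" using LK K_half by blast
    fix x assume x: "x \<in> ?L"
    show "opp D x \<in> ?L" using x by auto
    have "third x \<notin> ?L" using tau_facts(4)[of x] LK x by blast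
    then show "(rot D x \<in> ?L) \<noteq> (rot D (rot D x) \<in> ?L)"
      using tL[OF x] unfolding tau_def third_def by (auto split: if_splits)
  qed
  then have "?L = K" using mn LK by blast
  then have "h \<in> ?L" using h by simp
  then obtain i where "h = c i \<or> h = opp D (c i)" by auto
  then have "h = c i \<or> h = tau (c (Suc i))" by (simp add: tau_c_Suc)
  then have "h = c (i mod k) \<or> h = tau (c (Suc i mod k))" by (simp add: c_mod)
  moreover have "i mod k < k" "Suc i mod k < k" using k_pos by simp_all
  ultimately show ?thesis by blast
qed

lemma trivalent_cases:
  assumes "h \<in> half D" "rot D h \<noteq> h"
  obtains i where "i < k" "h = c i \<or> h = tau (c i) \<or> h = third (c i)"
proof -
  obtain x where x: "x \<in> vertex D h" "x \<in> K" using full[OF assms] by blast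
  then obtain i where i: "i < k" "x = c i \<or> x = tau (c i)" using K_eq by blast
  have "vertex D x = vertex D h" using vertex_eq[OF assms(1) x(1)] .
  then have "h \<in> vertex D x" by simp
  then have "h \<in> {x, tau x, third x}" using tau_facts(7)[OF x(2)] by simp
  then show ?thesis using that i tau_facts[OF c_K] by auto
qed

lemma third_inj:
  assumes "i < k" "j < k" "third (c i) = third (c j)" shows "i = j"
proof -
  have "third (c i) \<in> vertex D (c i)" "third (c j) \<in> vertex D (c j)" using tau_facts(7)[OF c_K] by simp_all
  then have "vertex D (c i) = vertex D (c j)"
    using vertex_eq[OF c_half] assms(3) by metis
  then have "c j \<in> vertex D (c i)" by simp
  then have "c j \<in> {c i, tau (c i), third (c i)}" using tau_facts(7)[OF c_K] by simp
  then have "c j = c i" using tau_c_neq[of i j] tau_facts(4)[OF c_K[of i]] c_K[of j] by auto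
  then show ?thesis using c_inj assms by metis
qed

definition leg :: "nat \<Rightarrow> bool" where "leg i \<longleftrightarrow> rot D (opp D (third (c i))) = opp D (third (c i))"

text \<open>
  Reversing \<open>Z\<close> puts all legs on the left and all chords on the right of the cycle.
\<close>

definition Z :: "'h set" where
  "Z = (\<Union>i\<in>{i. i < k \<and> (rot D (c i) \<in> K \<longleftrightarrow> leg i)}. vertex D (c i))"

abbreviation "N \<equiv> flip Z D"

lemma vertex_c_disj:
  assumes "i < k" "j < k" "x \<in> vertex D (c i)" "x \<in> vertex D (c j)" shows "i = j"
proof -
  have "vertex D (c i) = vertex D (c j)" using vertex_eq[OF c_half] assms(3,4) by metis
  then have "third (c i) \<in> {c j, tau (c j), third (c j)}" using tau_facts(7)[OF c_K] by (metis insertCI)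
  then have "third (c i) = third (c j)" using tau_facts(4)[OF c_K[of i]] tau_facts(1)[OF c_K[of j]] c_K[of j] by auto
  then show ?thesis by (rule third_inj[OF assms(1,2)])
qed

lemma Z_iff: "i < k \<Longrightarrow> x \<in> vertex D (c i) \<Longrightarrow> x \<in> Z \<longleftrightarrow> (rot D (c i) \<in> K \<longleftrightarrow> leg i)"
  unfolding Z_def using vertex_c_disj by blast

lemma rot_N:
  assumes "i < k"
  shows "rot N (c i) = (if leg i then third (c i) else tau (c i))"
    "rot N (tau (c i)) = (if leg i then c i else third (c i))"
    "rot N (third (c i)) = (if leg i then tau (c i) else c i)"
proof -
  have "c i \<in> vertex D (c i)" "tau (c i) \<in> vertex D (c i)" "third (c i) \<in> vertex D (c i)"
    using tau_facts(7)[OF c_K[of i]] by simp_all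
  note z = this[THEN Z_iff[OF assms]]
  show "rot N (c i) = (if leg i then third (c i) else tau (c i))"
    "rot N (tau (c i)) = (if leg i then c i else third (c i))"
    "rot N (third (c i)) = (if leg i then tau (c i) else c i)"
    unfolding flip_simps z by (auto simp: tau_def third_def)
qed

lemma N_facts: "jac g n N" "tips N = tips D" "is_sub S \<Longrightarrow> relations g n \<subseteq> S \<Longrightarrow> fr N \<in> S \<Longrightarrow> fr D \<in> S"
proof -
  have cl: "\<And>x. x \<in> Z \<Longrightarrow> x \<in> half D \<and> rot D x \<in> Z"
    unfolding Z_def using vertex_closed[OF jd c_half] by blast
  show "jac g n N" "tips N = tips D" by (rule flip_jac[of g n D Z, OF jac cl]; assumption)+
  have nt: "Z \<subseteq> half D - tips D"
  proof
    fix x assume x: "x \<in> Z"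
    then obtain i where "x \<in> vertex D (c i)" unfolding Z_def by blast
    then have "rot D x \<noteq> x" using vertex_tip[OF c_half] tau_facts(8)[OF c_K] by blast
    then show "x \<in> half D - tips D" using cl[OF x] by (simp add: tips_def)
  qed
  let ?I = "{i. i < k \<and> (rot D (c i) \<in> K \<longleftrightarrow> leg i)}"
  have "card Z = (\<Sum>i\<in>?I. card (vertex D (c i)))"
    unfolding Z_def by (rule card_UN_disjoint) (use vertex_c_disj in auto)
  also have "\<dots> = (\<Sum>i\<in>?I. 3)" by (rule sum.cong) (simp_all add: card_vertex tau_facts(8) c_K)
  finally have c: "card Z = 3 * card ?I" by simp
  have *: "congr g n (fr N) (frag_cmul ((-1) ^ card ?I) (fr D))"
    by (rule fr_flip[OF jac nt _ c]) (use cl in blast)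
  assume S: "is_sub S" "relations g n \<subseteq> S" "fr N \<in> S"
  have "frag_cmul ((-1) ^ card ?I) (fr D) \<in> S"
    using * is_sub_diff_iff[OF S(1)] S(2,3) unfolding congr_def by blast
  then have "frag_cmul ((-1) ^ card ?I) (frag_cmul ((-1) ^ card ?I) (fr D)) \<in> S" by (rule is_sub_cmul[OF S(1)])
  then show "fr D \<in> S" by (simp flip: power_add mult_2)
qed

lemma k_eq: "k = n"
proof -
  have "half D - tips D = (\<Union>i\<in>{..<k}. vertex D (c i))"
  proof (intro equalityI subsetI)
    fix h assume "h \<in> half D - tips D"
    then obtain i where "i < k" "h = c i \<or> h = tau (c i) \<or> h = third (c i)"
      using trivalent_cases[of h] by (auto simp: tips_def)
    then show "h \<in> (\<Union>i\<in>{..<k}. vertex D (c i))" using tau_facts(7)[OF c_K[of i]] by auto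
  next
    fix h assume "h \<in> (\<Union>i\<in>{..<k}. vertex D (c i))"
    then obtain i where "h \<in> vertex D (c i)" by blast
    then show "h \<in> half D - tips D"
      using vertex_tip[OF c_half, of h i] tau_facts(8)[OF c_K[of i]] vertex_closed[OF jd c_half, of h i] by (auto simp: tips_def)
  qed
  moreover have "card (\<Union>i\<in>{..<k}. vertex D (c i)) = (\<Sum>i\<in>{..<k}. card (vertex D (c i)))"
    by (rule card_UN_disjoint) (use vertex_c_disj in auto)
  moreover have "\<dots> = (\<Sum>i\<in>{..<k}. 3)" by (rule sum.cong) (simp_all add: card_vertex tau_facts(8) c_K)
  ultimately show ?thesis using jac_cards(1)[OF jac] by simp
qed

lemma opp_tip:
  assumes "x \<in> tips D"
  obtains i where "i < k" "opp D x = third (c i)" "leg i" "x = opp D (third (c i))"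
proof -
  have x: "x \<in> half D" "rot D x = x" using assms by (auto simp: tips_def)
  have nt: "rot D (opp D x) \<noteq> opp D x"
  proof
    assume "rot D (opp D x) = opp D x"
    then have "{x, opp D x} = half D" by (intro jac_closedI[OF jac, of _ x]) (use x in auto)
    then have "h0 = x \<or> h0 = opp D x" using K_half[OF h0] by blast
    then show False using tau_facts(8)[OF h0] x \<open>rot D (opp D x) = opp D x\<close> by auto
  qed
  have nK: "opp D x \<notin> K"
  proof
    assume "opp D x \<in> K"
    then have "x \<in> K" using K_opp[of "opp D x"] x by simp
    then show False using tau_facts(8) x by blast
  qed
  obtain i where i: "i < k" "opp D x = c i \<or> opp D x = tau (c i) \<or> opp D x = third (c i)"
    using trivalent_cases[OF _ nt] x by auto
  then have o: "opp D x = third (c i)" using nK c_K[of i] tau_facts(1)[OF c_K[of i]] by auto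
  then have "x = opp D (third (c i))" using opp_opp[OF x(1)] by simp
  then show ?thesis using that[OF i(1) o] x(2) by (simp add: leg_def)
qed

lemma card_legs: "card {i. i < k \<and> leg i} = card (tips D)"
proof -
  have "(\<lambda>i. opp D (third (c i))) ` {i. i < k \<and> leg i} = tips D"
  proof (intro equalityI subsetI)
    fix x assume "x \<in> tips D" then show "x \<in> (\<lambda>i. opp D (third (c i))) ` {i. i < k \<and> leg i}"
      by (rule opp_tip) auto
  qed (auto simp: tips_def leg_def tau_facts c_K)
  moreover have "inj_on (\<lambda>i. opp D (third (c i))) {i. i < k \<and> leg i}"
    by (rule inj_onI) (use third_inj in \<open>auto simp: tau_facts c_K\<close>)
  ultimately show ?thesis using card_image by fastforce
qed

lemma nonleg_partner:
  assumes "i < k" "\<not> leg i"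
  obtains j where "j < k" "j \<noteq> i" "\<not> leg j" "opp D (third (c i)) = third (c j)" "opp D (third (c j)) = third (c i)"
proof -
  have si: "third (c i) \<in> half D" "rot D (third (c i)) \<noteq> third (c i)" using tau_facts c_K by auto
  have nK: "opp D (third (c i)) \<notin> K"
    using K_opp[of "opp D (third (c i))"] tau_facts(4)[OF c_K[of i]] si by auto
  obtain j where j: "j < k" "opp D (third (c i)) = c j \<or> opp D (third (c i)) = tau (c j) \<or> opp D (third (c i)) = third (c j)"
    using trivalent_cases[of "opp D (third (c i))"] si assms(2) by (auto simp: leg_def)
  then have o: "opp D (third (c i)) = third (c j)" using nK c_K[of j] tau_facts(1)[OF c_K[of j]] by auto
  then have o': "opp D (third (c j)) = third (c i)" using opp_opp[OF si(1)] by simp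
  have "j \<noteq> i" using o si opp_neq by metis
  moreover have "\<not> leg j" unfolding leg_def o' by (rule si(2))
  ultimately show ?thesis using that j o o' by blast
qed

end

lemma (in jacobi) card_half: "card (half D) = card (tips D) + card (half D - tips D)"
  using card_Diff_subset[of "tips D" "half D"] card_mono[of "half D" "tips D"] by (auto simp: tips_def)

context hamiltonian begin

declare c_0 [simp del]

lemma c_k0: "c k = c 0"
  by (simp add: c_k c_0)

lemma lab_leg: "leg i \<Longrightarrow> lab D (opp D (third (c i))) \<in> labels g"
  by (rule lab_in) (auto simp: leg_def tau_facts c_K)

lemma opp_tau_c: "opp D (tau (c i)) = c (i + k - 1)"
proof -
  have "tau (c (Suc (i + k - 1))) = opp D (c (i + k - 1))" by (rule tau_c_Suc)
  moreover have "c (Suc (i + k - 1)) = c i" using k_pos by (simp add: c_period)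
  ultimately show ?thesis by simp
qed

text \<open>Only surjectivity of \<open>f\<close> has to be verified. Injectivity is a matter of
  counting: both diagrams have \<open>3 * n\<close> trivalent half-edges and equally many
  legs.\<close>

lemma surj_iso:
  assumes "jac g n E" "card (tips E) = card (tips D)"
    and "\<And>x. x \<in> half E \<Longrightarrow> f x \<in> half D"
    and "\<And>i. i < k \<Longrightarrow> {c i, tau (c i), third (c i)} \<subseteq> f ` half E"
    and "\<And>i. i < k \<Longrightarrow> leg i \<Longrightarrow> opp D (third (c i)) \<in> f ` half E"
    and "\<And>x. x \<in> half E \<Longrightarrow> f (rot E x) = rot N (f x)"
    and "\<And>x. x \<in> half E \<Longrightarrow> f (opp E x) = opp D (f x)"
    and "\<And>x. x \<in> half E \<Longrightarrow> rot E x = x \<Longrightarrow> lab D (f x) = lab E x"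
  shows "congr g n (fr E) (fr N)"
proof (rule fr_iso[OF assms(1)])
  interpret E: jacobi g E using assms(1) by (rule jac_jacobi)
  have surj: "f ` half E = half D"
  proof
    show "f ` half E \<subseteq> half D" using assms(3) by blast
    show "half D \<subseteq> f ` half E"
    proof
      fix h assume h: "h \<in> half D"
      show "h \<in> f ` half E"
      proof (cases "rot D h = h")
        case True
        then have "h \<in> tips D" using h by (simp add: tips_def)
        then show ?thesis by (rule opp_tip) (use assms(5) in auto)
      next
        case False
        then obtain i where "i < k" "h = c i \<or> h = tau (c i) \<or> h = third (c i)"
          using trivalent_cases h by blast
        then show ?thesis using assms(4)[of i] by auto
      qed
    qed
  qed
  have "card (half E) = card (half D)"
    using E.card_half card_half jac_cards(1)[OF assms(1)] jac_cards(1)[OF jac] assms(2) by simp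
  then have "inj_on f (half E)" using surj by (intro eq_card_imp_inj_on) auto
  then show "iso_by f E N" unfolding iso_by_def using surj assms(6-8) by (simp add: bij_betw_def)
qed

lemma wheel_iso:
  assumes "\<And>i. i < k \<Longrightarrow> leg i"
  shows "\<exists>w. set w \<subseteq> labels g \<and> length w = n \<and> w \<noteq> [] \<and> congr g n (fr (wheel w)) (fr N)"
proof -
  define w where "w = map (\<lambda>i. lab D (opp D (third (c i)))) [0..<k]"
  have lw: "length w = n" "length w = k" by (simp_all add: w_def k_eq)
  have w: "set w \<subseteq> labels g" "w \<noteq> []" using lab_leg assms k_pos by (auto simp: w_def)
  let ?f = "\<lambda>x. case x of WF i \<Rightarrow> c i | WB i \<Rightarrow> tau (c i) | WS i \<Rightarrow> third (c i) | WT i \<Rightarrow> opp D (third (c i))"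
  note th = tau_facts[OF c_K]
  have "congr g n (fr (wheel w)) (fr N)"
  proof (rule surj_iso[where f = ?f])
    show "jac g n (wheel w)" using wheel_jac[OF w] lw by simp
    show "card (tips (wheel w)) = card (tips D)"
    proof -
      have "{i. i < k \<and> leg i} = {..<k}" using assms by auto
      then show ?thesis using card_legs lw(2) by (simp add: card_wheel_tips)
    qed
  next
    fix x assume x: "x \<in> half (wheel w)"
    show "?f x \<in> half D" using x th(1,5) K_half by (cases x) auto
    show "?f (rot (wheel w) x) = rot N (?f x)"
    proof (cases x)
      case (WT i)
      then have i: "i < k" using x lw by simp
      then have "opp D (third (c i)) \<in> tips N" using assms th by (simp add: N_facts(2) tips_def leg_def)
      then show ?thesis using WT by (simp add: tips_def del: flip_simps)
    qed (use x lw assms in \<open>simp_all add: rot_N del: flip_simps\<close>)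
    show "?f (opp (wheel w) x) = opp D (?f x)"
    proof (cases x)
      case (WF i)
      then show ?thesis using x lw tau_c_Suc[of i] c_k0 by auto
    next
      case (WB i)
      then show ?thesis using x lw opp_tau_c[of i] c_period[of "i - 1"] by (cases i) auto
    qed (use th in auto)
    show "rot (wheel w) x = x \<Longrightarrow> lab D (?f x) = lab (wheel w) x"
      using x lw by (cases x) (auto simp: w_def)
  next
    fix i assume i: "i < k"
    have "WF i \<in> half (wheel w)" "WB i \<in> half (wheel w)" "WS i \<in> half (wheel w)" "WT i \<in> half (wheel w)"
      using i lw by auto
    from this[THEN imageI, of ?f]
    show "{c i, tau (c i), third (c i)} \<subseteq> ?f ` half (wheel w)" "opp D (third (c i)) \<in> ?f ` half (wheel w)" by auto
  qed
  then show ?thesis using w lw by blast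
qed

text \<open>The upper strand follows the cycle from vertex 0 to vertex \<open>m\<close>. The lower
  strand runs from left to right against the direction of the cycle, from \<open>c k\<close>, which
  is \<open>c 0\<close>, down to \<open>c m\<close>; hence the indices \<open>k - j\<close>. The
  chord is the edge between the third half-edges at 0 and \<open>m\<close>.\<close>

lemma theta_iso:
  assumes "0 < m" "m < k" "\<And>i. i < k \<Longrightarrow> leg i \<longleftrightarrow> i \<noteq> 0 \<and> i \<noteq> m"
    and "opp D (third (c 0)) = third (c m)" "opp D (third (c m)) = third (c 0)"
  shows "\<exists>as cs. set as \<subseteq> labels g \<and> set cs \<subseteq> labels g \<and> length as + length cs + 2 = n \<and> congr g n (fr (theta as [] cs)) (fr N)"
proof -
  define as where "as = map (\<lambda>i. lab D (opp D (third (c i)))) [1..<m]"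
  define cs where "cs = map (\<lambda>i. lab D (opp D (third (c (k - i))))) [1..<k - m]"
  have la: "length as = m - 1" and lc: "length cs = k - m - 1" by (simp_all add: as_def cs_def)
  have sa: "set as \<subseteq> labels g" "set cs \<subseteq> labels g"   proof -
    have "lab D (opp D (third (c (k - i)))) \<in> labels g" if "i \<in> {1..<k - m}" for i
      by (rule lab_leg) (use that assms(1-3) in auto)
    moreover have "lab D (opp D (third (c i))) \<in> labels g" if "i \<in> {1..<m}" for i
      by (rule lab_leg) (use that assms(1-3) in auto)
    ultimately show "set as \<subseteq> labels g" "set cs \<subseteq> labels g"
      unfolding as_def cs_def by (simp_all add: image_subset_iff)
  qed
  have ln: "length as + length cs + 2 = n" using assms(1,2) by (simp add: la lc flip: k_eq)
  let ?E = "theta as [] cs"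
  define f where "f x = (case x of
      Rt s j \<Rightarrow> (case s of Upper \<Rightarrow> c j | Chord \<Rightarrow> third (c 0) | Lower \<Rightarrow> tau (c (k - j)))
    | Lt s j \<Rightarrow> (case s of Upper \<Rightarrow> tau (c j) | Chord \<Rightarrow> third (c m) | Lower \<Rightarrow> c (k - j))
    | Foot s j \<Rightarrow> third (c (if s = Upper then j else k - j))
    | Tip s j \<Rightarrow> opp D (third (c (if s = Upper then j else k - j))))" for x
  have fs: "f (Rt Upper j) = c j" "f (Rt Chord j) = third (c 0)" "f (Rt Lower j) = tau (c (k - j))"
    "f (Lt Upper j) = tau (c j)" "f (Lt Chord j) = third (c m)" "f (Lt Lower j) = c (k - j)"
    "f (Foot Upper j) = third (c j)" "f (Foot Lower j) = third (c (k - j))"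
    "f (Tip Upper j) = opp D (third (c j))" "f (Tip Lower j) = opp D (third (c (k - j)))" for j
    by (simp_all add: f_def)
  note th = tau_facts[OF c_K]
  have legN: "rot N (opp D (third (c i))) = opp D (third (c i))" if "i < k" "leg i" for i
  proof -
    have "opp D (third (c i)) \<in> tips N" using that th by (simp add: N_facts(2) tips_def leg_def)
    then show ?thesis by (simp add: tips_def del: flip_simps)
  qed
  have nl: "\<not> leg 0" "\<not> leg m" using assms(1-3) by auto
  have "congr g n (fr ?E) (fr N)"
  proof (rule surj_iso[where f = f])
    show "jac g n ?E" using theta_jac[OF sa(1) _ sa(2), of "[]"] ln by simp
    show "card (tips ?E) = card (tips D)"
    proof -
      have "{i. i < k \<and> leg i} = {..<k} - {0, m}" using assms(3) by auto
      then have "card (tips D) = k - 2" using card_legs assms(1,2) by (simp add: card_Diff_subset)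
      then show ?thesis using ln k_eq by (simp add: card_theta_tips)
    qed
  next
    fix x assume x: "x \<in> half ?E"
    show "f x \<in> half D" using x th(1,5) K_half by (cases x; rename_tac s j; case_tac s) (auto simp: fs)
    show "f (rot ?E x) = rot N (f x)"
    proof (cases x)
      case (Rt s j)
      show ?thesis
      proof (cases s)
        case Upper
        then show ?thesis using x Rt assms(1-3) la nl by (auto simp: fs rot_N c_k0 simp del: flip_simps)
      next
        case Chord
        then show ?thesis using x Rt assms(1-3) la nl rot_N(3)[of 0] by (auto simp: fs simp del: flip_simps)
      next
        case Lower
        then show ?thesis
        proof (cases "j = 0")
          case True
          then show ?thesis using x Rt Lower nl rot_N(2)[of 0] k_pos by (simp add: fs c_k0 del: flip_simps)
        next
          case False
          then have "k - j < k" "leg (k - j)" using x Rt Lower assms(1-3) lc by auto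
          then show ?thesis using x Rt Lower False by (simp add: fs rot_N del: flip_simps)
        qed
      qed
    next
      case (Lt s j)
      show ?thesis
      proof (cases s)
        case Upper
        then have j: "1 \<le> j" "j \<le> m" using x Lt la assms(1) by auto
        show ?thesis
        proof (cases "j = m")
          case True
          then show ?thesis using Lt Upper la nl assms(1,2) by (simp add: fs rot_N del: flip_simps)
        next
          case False
          then have "j < k" "leg j" "j \<noteq> length as + 1" using j assms(1-3) la by auto
          then show ?thesis using Lt Upper by (simp add: fs rot_N del: flip_simps)
        qed
      next
        case Chord
        then show ?thesis using x Lt assms(1-3) lc nl by (auto simp: fs rot_N simp del: flip_simps)
      next
        case Lower
        then have j: "1 \<le> j" "j \<le> k - m" using x Lt lc assms(2) by auto
        show ?thesis
        proof (cases "j = k - m")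
          case True
          then have q: "j = Suc (length cs)" "k - j = m" "k - Suc (length cs) = m" "Suc (length as) = m"
            using lc la assms(1,2) by auto
          have "f (rot ?E x) = tau (c m)" using Lt Lower q by (simp add: fs)
          moreover have "f x = c m" using Lt Lower q by (simp add: fs)
          ultimately show ?thesis using rot_N(1)[OF assms(2)] nl by (simp del: flip_simps)
        next
          case False
          then have "k - j < k" "leg (k - j)" "j \<noteq> length cs + 1" using j assms(1-3) lc by auto
          then show ?thesis using Lt Lower by (simp add: fs rot_N del: flip_simps)
        qed
      qed
    next
      case (Foot s j)
      show ?thesis
      proof (cases s)
        case Upper
        then have "j < k" "leg j" using x Foot la assms(1-3) by auto
        then show ?thesis using Foot Upper by (simp add: fs rot_N del: flip_simps)
      next
        case Lower
        then have "k - j < k" "leg (k - j)" using x Foot lc assms(1-3) by auto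
        then show ?thesis using Foot Lower by (simp add: fs rot_N del: flip_simps)
      qed (use x Foot in auto)
    next
      case (Tip s j)
      show ?thesis
      proof (cases s)
        case Upper
        then have "j < k" "leg j" using x Tip la assms(1-3) by auto
        then show ?thesis using Tip Upper by (simp add: fs legN del: flip_simps)
      next
        case Lower
        then have "k - j < k" "leg (k - j)" using x Tip lc assms(1-3) by auto
        then show ?thesis using Tip Lower by (simp add: fs legN del: flip_simps)
      qed (use x Tip in auto)
    qed
    have sd: "Suc (k - Suc j) = k - j" if "j < k" for j using that by simp
    show "f (opp ?E x) = opp D (f x)"
    proof (cases x)
      case (Rt s j)
      show ?thesis
      proof (cases s)
        case Upper then show ?thesis using Rt tau_c_Suc[of j] by (simp add: fs)
      next
        case Chord then show ?thesis using Rt x assms(4) by (simp add: fs)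
      next
        case Lower
        then have "j < k" using x Rt lc assms(2) by auto
        then have "tau (c (k - j)) = opp D (c (k - Suc j))" using tau_c_Suc[of "k - Suc j"] by (simp add: sd)
        then show ?thesis using Rt Lower by (simp add: fs)
      qed
    next
      case (Lt s j)
      show ?thesis
      proof (cases s)
        case Upper
        then obtain i where "j = Suc i" using x Lt by (cases j) auto
        then show ?thesis using Lt Upper by (simp add: fs tau_c_Suc)
      next
        case Chord then show ?thesis using Lt x assms(5) by (simp add: fs)
      next
        case Lower
        then obtain i where i: "j = Suc i" "i < k" using x Lt lc assms(2) by (cases j) auto
        then have "tau (c (k - i)) = opp D (c (k - Suc i))" using tau_c_Suc[of "k - Suc i"] by (simp add: sd)
        then show ?thesis using Lt Lower i by (simp add: fs)
      qed
    next
      case (Foot s j) then show ?thesis using x by (cases s) (auto simp: fs)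
    next
      case (Tip s j) then show ?thesis using x th(5) by (cases s) (auto simp: fs)
    qed
    assume r: "rot ?E x = x"
    show "lab D (f x) = lab ?E x"
    proof (cases x)
      case (Tip s j)
      then show ?thesis using x la lc by (cases s) (auto simp: fs as_def cs_def)
    next
      case (Lt s j) with r show ?thesis by (cases s) (auto split: if_splits)
    next
      case (Rt s j) with r show ?thesis by (cases s) (auto split: if_splits)
    next
      case (Foot s j) with r show ?thesis by (cases s) (auto split: if_splits)
    qed
  next
    fix i assume i: "i < k"
    have 1: "c i \<in> f ` half ?E"
    proof (cases "i < m")
      case True
      then have "Rt Upper i \<in> half ?E" using la by simp
      then show ?thesis using fs(1)[of i] by (metis imageI)
    next
      case False
      then have "Lt Lower (k - i) \<in> half ?E" using lc i by auto
      then show ?thesis using fs(6)[of "k - i"] i by (metis imageI diff_diff_cancel less_imp_le)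
    qed
    have 2: "tau (c i) \<in> f ` half ?E"
    proof -
      consider "i = 0" | "0 < i" "i \<le> m" | "m < i" by linarith
      then show ?thesis
      proof cases
        case 1
        have "Rt Lower 0 \<in> half ?E" by simp
        then show ?thesis using fs(3)[of 0] 1 c_k0 by (metis imageI diff_zero)
      next
        case 2
        then have "Lt Upper i \<in> half ?E" using la by simp
        then show ?thesis using fs(4)[of i] by (metis imageI)
      next
        case 3
        then have "Rt Lower (k - i) \<in> half ?E" using lc i by auto
        then show ?thesis using fs(3)[of "k - i"] i by (metis imageI diff_diff_cancel less_imp_le)
      qed
    qed
    have ft: "Foot Upper i \<in> half ?E \<and> Tip Upper i \<in> half ?E \<or> Foot Lower (k - i) \<in> half ?E \<and> Tip Lower (k - i) \<in> half ?E"
      if "i \<noteq> 0" "i \<noteq> m" using that la lc i by auto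
    have kk: "k - (k - i) = i" using i by simp
    have 3: "third (c i) \<in> f ` half ?E"
    proof -
      consider "i = 0" | "i = m" | "i \<noteq> 0" "i \<noteq> m" by blast
      then show ?thesis
      proof cases
        case 1
        have "Rt Chord 0 \<in> half ?E" by simp
        then show ?thesis using fs(2)[of 0] 1 by (metis imageI)
      next
        case 2
        have "Lt Chord 1 \<in> half ?E" by simp
        then show ?thesis using fs(5)[of 1] 2 by (metis imageI)
      next
        case 3
        from ft[OF this] show ?thesis using fs(7)[of i] fs(8)[of "k - i"] unfolding kk by (metis imageI)
      qed
    qed
    show "{c i, tau (c i), third (c i)} \<subseteq> f ` half ?E" using 1 2 3 by simp
    assume "leg i"
    then have "i \<noteq> 0" "i \<noteq> m" using assms(3) i by auto
    from ft[OF this] show "opp D (third (c i)) \<in> f ` half ?E"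
      using fs(9)[of i] fs(10)[of "k - i"] unfolding kk by (metis imageI)
  qed
  then show ?thesis using sa ln by blast
qed

end

section \<open>Wheels and thetas span the one-loop and two-loop parts\<close>

lemma cycle_exists':
  assumes "jac g n D" "card (tips D) \<le> n"
  shows "\<exists>K. cycle D K"
proof -
  interpret jacobi g D using assms(1) by (rule jac_jacobi)
  have "2 * card (edges D) = card (tips D) + 3 * n"
    using card_half card_edges jac_cards(1)[OF assms(1)] by simp
  moreover have "card (vertices D) = card (tips D) + n"
    using card_vertices assms(1) by (simp add: jac_def)
  ultimately have "card (vertices D) \<le> card (edges D)" using assms(2) by linarith
  moreover have "half D \<noteq> {}" using assms(1) by (simp add: jac_def connected_iff)
  ultimately show ?thesis using cycle_exists[OF jd] by blast
qed

text \<open>With as many legs as trivalent vertices, every vertex of the long cycle carries a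
  leg.\<close>

lemma one_loop_span:
  fixes D :: "'h diagram"
  assumes "is_sub S" "relations g n \<subseteq> S"
    and "\<And>w. set w \<subseteq> labels g \<Longrightarrow> length w = n \<Longrightarrow> w \<noteq> [] \<Longrightarrow> fr (wheel w) \<in> S"
    and "jac g n D" "card (tips D) = n"
  shows "fr D \<in> S"
proof -
  obtain K where "cycle D K" using cycle_exists' assms(4,5) by blast
  from assms(1,2) _ assms(4,5) this show ?thesis
  proof (rule hamiltonian_reduction)
    fix D :: "'h diagram" and K
    assume D: "jac g n D" "card (tips D) = n" "cycle D K"
      "\<And>h. h \<in> half D \<Longrightarrow> rot D h \<noteq> h \<Longrightarrow> vertex D h \<inter> K \<noteq> {}"
    then obtain h0 where "h0 \<in> K" by (auto simp: cycle_def)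
    then interpret hamiltonian g D n K h0
      by (intro hamiltonian.intro hamiltonian_axioms.intro jac_jacobi[OF D(1)] D)
    have "{i. i < k \<and> leg i} = {..<k}"
      by (rule card_subset_eq) (use card_legs D(2) k_eq in auto)
    then have "\<And>i. i < k \<Longrightarrow> leg i" by blast
    then obtain w where w: "set w \<subseteq> labels g" "length w = n" "w \<noteq> []" "congr g n (fr (wheel w)) (fr N)"
      using wheel_iso by blast
    have "fr N \<in> S"
      using assms(3)[OF w(1-3)] is_sub_diff_iff[OF assms(1)] w(4) assms(2) unfolding congr_def by blast
    then show "fr D \<in> S" by (rule N_facts(3)[OF assms(1,2)])
  qed
qed

text \<open>Two vertices of the long cycle carry no leg. The third half-edge at one of them must be
  joined to that of the other, which yields the chord.\<close>

lemma two_loop_span: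
  fixes D :: "'h diagram"
  assumes "is_sub S" "relations g n \<subseteq> S"
    and "\<And>as cs. set as \<subseteq> labels g \<Longrightarrow> set cs \<subseteq> labels g \<Longrightarrow> length as + length cs + 2 = n \<Longrightarrow> fr (theta as [] cs) \<in> S"
    and "jac g n D" "card (tips D) + 2 = n"
  shows "fr D \<in> S"
proof -
  obtain K where "cycle D K" using cycle_exists'[OF assms(4)] assms(5) by auto
  from assms(1,2) _ assms(4) refl this show ?thesis
  proof (rule hamiltonian_reduction)
    fix E :: "'h diagram" and K
    assume D: "jac g n E" "card (tips E) = card (tips D)" "cycle E K"
      "\<And>h. h \<in> half E \<Longrightarrow> rot E h \<noteq> h \<Longrightarrow> vertex E h \<inter> K \<noteq> {}"
    then obtain h0 where "h0 \<in> K" by (auto simp: cycle_def)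
    then interpret R0: hamiltonian g E n K h0
      by (intro hamiltonian.intro hamiltonian_axioms.intro jac_jacobi[OF D(1)] D)
    have cl: "card {i. i < R0.k \<and> R0.leg i} < R0.k" using R0.card_legs D(2) R0.k_eq assms(5) by simp
    have "{i. i < R0.k \<and> R0.leg i} \<noteq> {..<R0.k}"
    proof
      assume e: "{i. i < R0.k \<and> R0.leg i} = {..<R0.k}"
      show False using cl unfolding e by simp
    qed
    then obtain i0 where i0: "i0 < R0.k" "\<not> R0.leg i0" by blast
    \<comment> \<open>The same cycle is read again from a vertex without leg, since the chord of the
      theta starts at position 0.\<close>
    interpret hamiltonian g E n K "R0.c i0"
      by (intro hamiltonian.intro hamiltonian_axioms.intro jac_jacobi[OF D(1)] D R0.c_K)
    have "\<not> leg 0" using i0(2) by (simp add: leg_def R0.leg_def c_0)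
    with k_pos obtain m where m: "m < k" "m \<noteq> 0" "\<not> leg m" "opp E (third (c 0)) = third (c m)" "opp E (third (c m)) = third (c 0)"
      using nonleg_partner[of 0] by metis
    have nl: "{i. i < k \<and> \<not> leg i} = {0, m}"
    proof (rule card_subset_eq[symmetric])
      show "finite {i. i < k \<and> \<not> leg i}" by simp
      show "{0, m} \<subseteq> {i. i < k \<and> \<not> leg i}" using m \<open>\<not> leg 0\<close> k_pos by auto
      have "{i. i < k \<and> \<not> leg i} = {..<k} - {i. i < k \<and> leg i}" by auto
      moreover have "card ({..<k} - {i. i < k \<and> leg i}) = card {..<k} - card {i. i < k \<and> leg i}"
        by (rule card_Diff_subset) auto
      ultimately show "card {0, m} = card {i. i < k \<and> \<not> leg i}"
        using card_legs D(2) k_eq assms(5) m by simp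
    qed
    have l: "leg i \<longleftrightarrow> i \<noteq> 0 \<and> i \<noteq> m" if "i < k" for i
    proof -
      have "i \<in> {i. i < k \<and> \<not> leg i} \<longleftrightarrow> i \<in> {0, m}" by (simp only: nl)
      then show ?thesis using that by auto
    qed
    have "0 < m" using m(2) by simp
    from theta_iso[OF this m(1) l m(4,5)]
    obtain as cs where w: "set as \<subseteq> labels g" "set cs \<subseteq> labels g" "length as + length cs + 2 = n"
        "congr g n (fr (theta as [] cs)) (fr N)"
      by blast
    have "fr N \<in> S"
      using assms(3)[OF w(1-3)] is_sub_diff_iff[OF assms(1)] w(4) assms(2) unfolding congr_def by blast
    then show "fr E \<in> S" by (rule N_facts(3)[OF assms(1,2)])
  qed
qed

subsection \<open>Faces of ribbon graphs\<close>

text \<open>The cyclic orders thicken the graph to a surface with disks at the vertices and bands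
  along the edges. Crossing an edge and turning to the next half-edge follows its boundary, so the
  boundary components are the orbits of this map. Each tip lies on exactly one of them, immediately
  after its stem.\<close>

definition face :: "'h diagram \<Rightarrow> 'h \<Rightarrow> 'h" where
  "face R h = rot R (opp R h)"

text \<open>The last element is sent to \<open>z\<close>. Keeping the end point free allows
  induction on and concatenation of pieces of an orbit; \<open>loop\<close> closes them up with
  \<open>z\<close> equal to the head.\<close>

fun chain :: "('h \<Rightarrow> 'h) \<Rightarrow> 'h \<Rightarrow> 'h list \<Rightarrow> bool" where
  "chain \<phi> z [] \<longleftrightarrow> True"
| "chain \<phi> z [x] \<longleftrightarrow> \<phi> x = z"
| "chain \<phi> z (x # y # r) \<longleftrightarrow> \<phi> x = y \<and> chain \<phi> z (y # r)"

lemma chain_Cons: "chain \<phi> z (x # r) \<longleftrightarrow> \<phi> x = (if r = [] then z else hd r) \<and> chain \<phi> z r"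
  by (cases r) auto

lemma chain_append: "chain \<phi> z (xs @ y # ys) \<longleftrightarrow> chain \<phi> y xs \<and> chain \<phi> z (y # ys)"
  by (induction xs) (auto simp: chain_Cons)

lemma chain_unique:
  "chain \<phi> z (x # xs) \<Longrightarrow> chain \<phi> z (x # ys) \<Longrightarrow> z \<notin> set xs \<Longrightarrow> z \<notin> set ys \<Longrightarrow> xs = ys"
proof (induction xs arbitrary: x ys)
  case Nil then show ?case by (cases ys) auto
next
  case (Cons a xs) then show ?case by (cases ys) auto
qed

lemma chain_map: "chain \<phi> z xs \<Longrightarrow> (\<And>x. x \<in> set xs \<Longrightarrow> \<psi> (f x) = f (\<phi> x)) \<Longrightarrow> chain \<psi> (f z) (map f xs)"
  by (induction \<phi> z xs rule: chain.induct) auto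

lemma chain_image: "chain \<phi> z xs \<Longrightarrow> x \<in> set xs \<Longrightarrow> \<phi> x \<in> insert z (set xs)"
  by (induction \<phi> z xs rule: chain.induct) auto

lemma chain_pred: "chain \<phi> z (h # xs) \<Longrightarrow> y \<in> insert z (set xs) \<Longrightarrow> \<exists>x\<in>set (h # xs). \<phi> x = y"
proof (induction xs arbitrary: h)
  case (Cons a xs) then show ?case by (auto simp: chain_Cons)
qed auto

definition loop :: "('h \<Rightarrow> 'h) \<Rightarrow> 'h list \<Rightarrow> bool" where
  "loop \<phi> xs \<longleftrightarrow> xs \<noteq> [] \<and> distinct xs \<and> chain \<phi> (hd xs) xs"

lemma loop_rotate: "loop \<phi> (us @ v # vs) \<Longrightarrow> loop \<phi> (v # vs @ us)"
proof (cases us)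
  case (Cons u us')
  assume l: "loop \<phi> (us @ v # vs)"
  then have "chain \<phi> v us" "chain \<phi> u (v # vs)" using chain_append[of \<phi> u us v vs] by (auto simp: loop_def Cons)
  then have "chain \<phi> v ((v # vs) @ u # us')" unfolding chain_append by (simp add: Cons)
  then show ?thesis using l by (auto simp: loop_def Cons)
qed simp

lemma loop_unique: "loop \<phi> (x # xs) \<Longrightarrow> loop \<phi> (x # ys) \<Longrightarrow> xs = ys"
  unfolding loop_def by (auto intro: chain_unique)

lemma loop_pred: "loop \<phi> xs \<Longrightarrow> y \<in> set xs \<Longrightarrow> \<exists>x\<in>set xs. \<phi> x = y"
  using chain_pred[of \<phi> "hd xs" "hd xs" "tl xs" y] by (cases xs) (auto simp: loop_def)

text \<open>One orbit contains all tips, and \<open>w\<close> lists their labels in the order met.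
  The starting point of \<open>xs\<close> is arbitrary, so words are determined only up to rotation,
  which is why this is a relation.\<close>

definition bword_by :: "'h diagram \<Rightarrow> 'h list \<Rightarrow> label list \<Rightarrow> bool" where
  "bword_by R xs w \<longleftrightarrow> loop (face R) xs \<and> set xs \<subseteq> half R \<and> tips R \<subseteq> set xs \<and>
     w = map (lab R) (filter (\<lambda>x. x \<in> tips R) xs)"

definition bword :: "'h diagram \<Rightarrow> label list \<Rightarrow> bool" where
  "bword R w \<longleftrightarrow> (\<exists>xs. bword_by R xs w)"

text \<open>
  \<open>F\<close> is a union of face orbits without tips; no single orbit needs to be chosen.
\<close>

definition freeface :: "'h diagram \<Rightarrow> bool" where
  "freeface R \<longleftrightarrow> (\<exists>F. F \<noteq> {} \<and> F \<subseteq> half R \<and> F \<inter> tips R = {} \<and> face R ` F \<subseteq> F)"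

text \<open>
  The word is reversed because, on the outer face of \<open>theta as [] cs\<close>, the upper legs are met from
  right to left.
\<close>

definition val :: "'h diagram \<Rightarrow> nat diagram \<Rightarrow>\<^sub>0 int" where
  "val R = (if freeface R \<and> (\<exists>w. bword R w) then fr (wheel (rev (SOME w. bword R w))) else 0)"

lemma val_eq_0: "\<not> (freeface R \<and> (\<exists>w. bword R w)) \<Longrightarrow> val R = 0"
  by (simp only: val_def if_False)

lemma bword_by_start:
  assumes "bword_by R xs w" "t \<in> set xs"
  obtains r u v where "bword_by R (t # r) (v @ u)" "w = u @ v"
proof -
  obtain us vs where xs: "xs = us @ t # vs" using assms(2) by (meson split_list)
  let ?f = "\<lambda>xs. map (lab R) (filter (\<lambda>x. x \<in> tips R) xs)"
  have "bword_by R (t # vs @ us) (?f (t # vs) @ ?f us)"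
    using assms(1) loop_rotate[of "face R" us t vs] unfolding bword_by_def xs by auto
  moreover have "w = ?f us @ ?f (t # vs)" using assms(1) by (simp add: bword_by_def xs)
  ultimately show ?thesis using that by blast
qed

lemma bword_by_unique:
  "bword_by R (t # r) w \<Longrightarrow> bword_by R (t # r') w' \<Longrightarrow> w = w'"
  unfolding bword_by_def using loop_unique by metis

lemma bword_length:
  assumes "bword R w" "jacobi_diagram g R"
  shows "length w = card (tips R)" "set w \<subseteq> labels g"
proof -
  interpret jacobi g R by unfold_locales fact
  obtain xs where xs: "bword_by R xs w" using assms(1) by (auto simp: bword_def)
  have "length w = card (set (filter (\<lambda>x. x \<in> tips R) xs))"
    using xs by (simp add: bword_by_def loop_def distinct_card del: set_filter)
  also have "set (filter (\<lambda>x. x \<in> tips R) xs) = tips R" using xs by (auto simp: bword_by_def)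
  finally show "length w = card (tips R)" .
  show "set w \<subseteq> labels g" using xs lab_in by (auto simp: bword_by_def tips_def)
qed

section \<open>Well-definedness of the value of a ribbon graph\<close>

lemma wheel_swap:
  assumes "set (u @ v) \<subseteq> labels g" "length (u @ v) = m" "0 < m"
  shows "congr g m (fr (wheel (u @ v))) (fr (wheel (v @ u)))"
proof -
  have "u @ v \<noteq> []" using assms(2,3) by auto
  from wheel_rotate[OF assms(1) this, of "length u"] show ?thesis unfolding rotate_append assms(2) .
qed

text \<open>Two boundary words come from lists containing a common tip, hence from the same orbit
  read from different starting points. They differ by a rotation, which a wheel does not
  detect.\<close>

lemma val_eq:
  assumes "jacobi_diagram g R" "bword R w" "freeface R" "0 < card (tips R)"
  shows "congr g (card (tips R)) (val R) (fr (wheel (rev w)))"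
proof -
  define w' where "w' = (SOME w. bword R w)"
  have w': "bword R w'" unfolding w'_def using assms(2) by (rule someI)
  obtain xs xs' where xs: "bword_by R xs w" "bword_by R xs' w'" using assms(2) w' by (auto simp: bword_def)
  obtain t where "t \<in> tips R" using assms(4) by (metis card.empty ex_in_conv less_numeral_extra(3))
  then have t: "t \<in> set xs" "t \<in> set xs'" using xs by (auto simp: bword_by_def)
  obtain r u v where 1: "bword_by R (t # r) (v @ u)" "w = u @ v" by (rule bword_by_start[OF xs(1) t(1)])
  obtain r' u' v' where 2: "bword_by R (t # r') (v' @ u')" "w' = u' @ v'" by (rule bword_by_start[OF xs(2) t(2)])
  have e: "v @ u = v' @ u'" using bword_by_unique[OF 1(1) 2(1)] .
  note l = bword_length[OF assms(2,1)]
  let ?m = "card (tips R)"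
  have s: "set (v @ u) \<subseteq> labels g" "length (v @ u) = ?m" using l 1(2) by auto
  have "congr g ?m (fr (wheel (rev w'))) (fr (wheel (rev (v' @ u'))))"
    using wheel_swap[of "rev v'" "rev u'" g ?m] s assms(4) unfolding e 2(2) by (simp add: Un_commute add.commute)
  also have "fr (wheel (rev (v' @ u'))) = fr (wheel (rev (v @ u)))" by (simp only: e)
  also have "congr g ?m \<dots> (fr (wheel (rev w)))"
    using wheel_swap[of "rev u" "rev v" g ?m] s assms(4) unfolding 1(2) by (simp add: Un_commute add.commute)
  finally show ?thesis using assms(2,3) unfolding val_def w'_def by auto
qed

text \<open>One common boundary word suffices, because any other word gives the same class; this
  leaves the constructions below free to change the starting point.\<close>

lemma val_congr:
  assumes "jacobi_diagram g R" "jacobi_diagram g R'" "card (tips R) = m" "card (tips R') = m" "0 < m"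
    and "freeface R \<longleftrightarrow> freeface R'"
    and "\<And>w. bword R w \<Longrightarrow> \<exists>w'. bword R w' \<and> bword R' w'" "\<And>w. bword R' w \<Longrightarrow> \<exists>w'. bword R w'"
  shows "congr g m (val R) (val R')"
proof (cases "freeface R \<and> (\<exists>w. bword R w)")
  case True
  then obtain w where w: "bword R w" "bword R' w" using assms(7) by blast
  have "congr g m (val R) (fr (wheel (rev w)))" using val_eq[OF assms(1) w(1)] True assms(3,5) by simp
  moreover have "congr g m (val R') (fr (wheel (rev w)))" using val_eq[OF assms(2) w(2)] True assms(4,5,6) by simp
  ultimately show ?thesis by (blast intro: congr_trans congr_sym)
next
  case False
  then have "\<not> (freeface R' \<and> (\<exists>w. bword R' w))" using assms(6,8) by blast
  then show ?thesis using False by (simp only: val_eq_0 congr_refl not_False_eq_True)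
qed

lemma iso_by_face:
  assumes "jacobi_diagram g R" "iso_by f R R'" "x \<in> half R"
  shows "face R' (f x) = f (face R x)"
proof -
  interpret jacobi g R by unfold_locales fact
  show ?thesis using assms(3) by (simp add: face_def iso_byD[OF assms(2)])
qed

lemma iso_by_bword:
  assumes "jacobi_diagram g R" "iso_by f R R'" "bword R w"
  shows "bword R' w"
proof -
  interpret jacobi g R by unfold_locales fact
  note f = iso_byD[OF assms(2)]
  obtain xs where xs: "bword_by R xs w" using assms(3) by (auto simp: bword_def)
  have x: "x \<in> half R" if "x \<in> set xs" for x using xs that by (auto simp: bword_by_def)
  have t: "tips R' = f ` tips R" by (rule iso_by_tips[OF assms(1,2)])
  have ft: "f x \<in> tips R' \<longleftrightarrow> x \<in> tips R" if "x \<in> half R" for x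
  proof
    assume "f x \<in> tips R'"
    then obtain y where y: "y \<in> tips R" "f x = f y" unfolding t by blast
    then have "y \<in> half R" by (simp add: tips_def)
    then have "x = y" using f(8)[OF that] y(2) by blast
    then show "x \<in> tips R" using y by simp
  qed (simp add: t)
  have "bword_by R' (map f xs) w" unfolding bword_by_def
  proof (intro conjI)
    show "loop (face R') (map f xs)" unfolding loop_def
    proof (intro conjI)
      have "inj_on f (set xs)" by (rule inj_on_subset[OF f(2)]) (use x in blast)
      then show "distinct (map f xs)" using xs by (simp add: bword_by_def loop_def distinct_map)
      show "map f xs \<noteq> []" using xs by (simp add: bword_by_def loop_def)
      have "chain (face R') (f (hd xs)) (map f xs)"
      proof (rule chain_map[of "face R"])
        show "chain (face R) (hd xs) xs" using xs unfolding bword_by_def loop_def by blast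
        show "face R' (f y) = f (face R y)" if "y \<in> set xs" for y by (rule iso_by_face[OF assms(1,2) x[OF that]])
      qed
      then show "chain (face R') (hd (map f xs)) (map f xs)" using xs by (simp add: bword_by_def loop_def hd_map)
    qed
    show "set (map f xs) \<subseteq> half R'" using x f(4) by (simp add: image_subset_iff)
    show "tips R' \<subseteq> set (map f xs)" using xs unfolding t bword_by_def by (simp add: image_mono)
    have "map (lab R') (filter (\<lambda>x. x \<in> tips R') (map f xs)) = map (\<lambda>x. lab R' (f x)) (filter (\<lambda>x. f x \<in> tips R') xs)"
      by (simp add: filter_map o_def)
    also have "filter (\<lambda>x. f x \<in> tips R') xs = filter (\<lambda>x. x \<in> tips R) xs"
      by (rule filter_cong[OF refl]) (simp only: ft x)
    also have "map (\<lambda>x. lab R' (f x)) \<dots> = map (lab R) (filter (\<lambda>x. x \<in> tips R) xs)"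
      by (rule map_cong[OF refl]) (simp add: tips_def f(7))
    finally show "w = map (lab R') (filter (\<lambda>x. x \<in> tips R') (map f xs))" using xs by (simp add: bword_by_def)
  qed
  then show ?thesis by (auto simp: bword_def)
qed

lemma iso_by_freeface:
  assumes "jacobi_diagram g R" "iso_by f R R'" "freeface R"
  shows "freeface R'"
proof -
  note f = iso_byD[OF assms(2)]
  obtain F where F: "F \<noteq> {}" "F \<subseteq> half R" "F \<inter> tips R = {}" "face R ` F \<subseteq> F"
    using assms(3) unfolding freeface_def by metis
  have nt: "f x \<notin> tips R'" if x: "x \<in> F" for x
  proof
    assume "f x \<in> tips R'"
    then obtain y where y: "y \<in> tips R" "f x = f y" unfolding iso_by_tips[OF assms(1,2)] by blast
    moreover have "x \<in> half R" "y \<in> half R" using x y F(2) by (auto simp: tips_def)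
    ultimately have "x = y" using f(8) by blast
    then show False using y x F(3) by blast
  qed
  have cl: "face R' (f x) \<in> f ` F" if x: "x \<in> F" for x
  proof -
    have "face R' (f x) = f (face R x)" by (rule iso_by_face[OF assms(1,2)]) (use x F(2) in blast)
    then show ?thesis using x F(4) by blast
  qed
  show ?thesis unfolding freeface_def
  proof (intro exI[of _ "f ` F"] conjI)
    show "f ` F \<noteq> {}" using F(1) by simp
    show "f ` F \<subseteq> half R'" using F(2) f(4) by blast
    show "f ` F \<inter> tips R' = {}" using nt by blast
    show "face R' ` f ` F \<subseteq> f ` F" using cl by blast
  qed
qed

lemma iso_by_val:
  assumes "jacobi_diagram g R" "iso_by f R R'" "jacobi_diagram g R'"
  shows "val R = val R'"
proof -
  note s = iso_by_sym[OF assms(1,2)]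
  have "bword R = bword R'" using iso_by_bword[OF assms(1,2)] iso_by_bword[OF assms(3) s] by blast
  moreover have "freeface R \<longleftrightarrow> freeface R'" using iso_by_freeface[OF assms(1,2)] iso_by_freeface[OF assms(3) s] by blast
  ultimately show ?thesis by (simp only: val_def)
qed

subsection \<open>Reversing all vertices reverses the boundary word\<close>

text \<open>Along a face each tip directly follows its stem, so both occur in the same order. The
  conditions at the two ends of the list prevent a tip from being separated from its stem.\<close>

lemma tips_stems:
  assumes "jacobi_diagram g R" "chain (face R) z xs" "set xs \<subseteq> half R" "z \<notin> tips R" "xs \<noteq> [] \<Longrightarrow> hd xs \<notin> tips R"
  shows "filter (\<lambda>x. x \<in> tips R) xs = map (opp R) (filter (\<lambda>x. opp R x \<in> tips R) xs)"
  using assms(2-)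
proof (induction "length xs" arbitrary: xs rule: less_induct)
  case less
  interpret jacobi g R by unfold_locales fact
  have nt: "face R x \<notin> tips R" if "x \<in> half R" "opp R x \<notin> tips R" for x
    using that by (auto simp: face_def tips_def)
  show ?case
  proof (cases xs)
    case (Cons x r)
    have x: "x \<in> half R" "x \<notin> tips R" using less.prems Cons by auto
    have c: "face R x = (if r = [] then z else hd r)" "chain (face R) z r" using less.prems(1) Cons by (auto simp: chain_Cons)
    show ?thesis
    proof (cases "opp R x \<in> tips R")
      case True
      then have fx: "face R x = opp R x" by (auto simp: face_def tips_def)
      then have "r \<noteq> []" using c True less.prems(3) by auto
      then obtain y r' where r: "r = y # r'" by (cases r) auto
      then have y: "y = opp R x" using c fx by simp
      have c': "face R y = (if r' = [] then z else hd r')" "chain (face R) z r'" using c(2) r by (auto simp: chain_Cons)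
      have ox: "opp R y = x" using y x by simp
      have "face R y \<notin> tips R" by (rule nt) (use y x in auto)
      then have "filter (\<lambda>x. x \<in> tips R) r' = map (opp R) (filter (\<lambda>x. opp R x \<in> tips R) r')"
        using less.prems c' by (intro less.hyps) (auto simp: Cons r)
      then show ?thesis using True x y ox by (simp add: Cons r)
    next
      case False
      have "filter (\<lambda>x. x \<in> tips R) r = map (opp R) (filter (\<lambda>x. opp R x \<in> tips R) r)"
        using less.prems c nt[OF x(1) False] by (intro less.hyps) (auto simp: Cons)
      then show ?thesis using False x by (simp add: Cons)
    qed
  qed simp
qed

lemma chain_rev:
  "chain \<phi> z xs \<Longrightarrow> xs \<noteq> [] \<Longrightarrow> (\<And>x. x \<in> set xs \<Longrightarrow> \<psi> (\<phi> x) = x) \<Longrightarrow> chain \<psi> (\<psi> (hd xs)) (z # rev xs)"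
proof (induction xs)
  case (Cons x r)
  have c: "\<phi> x = (if r = [] then z else hd r)" "chain \<phi> z r" using Cons.prems(1) by (auto simp: chain_Cons)
  have "chain \<psi> x (z # rev r)"
  proof (cases "r = []")
    case True then show ?thesis using c Cons.prems(3)[of x] by simp
  next
    case False
    then have "chain \<psi> (\<psi> (hd r)) (z # rev r)" using Cons c by auto
    moreover have "\<psi> (hd r) = x" using c False Cons.prems(3)[of x] by simp
    ultimately show ?thesis by simp
  qed
  then have "chain \<psi> (\<psi> x) ((z # rev r) @ [x])" unfolding chain_append by simp
  then show ?case by simp
qed simp

lemma loop_rev:
  assumes "loop \<phi> xs" "\<And>x. x \<in> set xs \<Longrightarrow> \<psi> (\<phi> x) = x"
  shows "loop \<psi> (rev xs)"
proof -
  obtain h r where xs: "xs = h # r" using assms(1) by (cases xs) (auto simp: loop_def)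
  have "chain \<psi> (\<psi> h) (h # rev xs)" using chain_rev[of \<phi> h xs \<psi>] assms by (auto simp: loop_def xs)
  then have "chain \<psi> (\<psi> h) ((h # rev r) @ [h])" by (simp add: xs)
  then have "chain \<psi> h (h # rev r)" unfolding chain_append by simp
  then have l: "loop \<psi> (h # rev r)" using assms(1) by (auto simp: loop_def xs)
  show ?thesis
  proof (cases "rev r")
    case Nil then show ?thesis using l by (simp add: xs)
  next
    case (Cons v vs)
    then have "loop \<psi> ([h] @ v # vs)" using l by simp
    from loop_rotate[OF this] show ?thesis by (simp add: xs Cons)
  qed
qed

text \<open>After reversal of all vertices, \<open>opp\<close> conjugates the face map to the
  inverse of the old one. The new orbit is therefore the old one read backwards with every half-edge
  replaced by its opposite. This exchanges tips and stems, and \<open>tips_stems\<close> shows that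
  the labels are still read in exactly reversed order.\<close>

lemma bword_flip_all:
  assumes "jacobi_diagram g R" "bword R w" "tips R \<noteq> {}" "\<And>t. t \<in> tips R \<Longrightarrow> opp R t \<notin> tips R"
  shows "\<exists>w. bword R w \<and> bword (flip (half R - tips R) R) (rev w)"
proof -
  interpret jacobi g R by unfold_locales fact
  let ?R = "flip (half R - tips R) R"
  have cl: "x \<in> half R - tips R \<Longrightarrow> x \<in> half R \<and> rot R x \<in> half R - tips R" for x by (auto simp: tips_def)
  have fl: "jacobi_diagram g ?R" "tips ?R = tips R" by (rule flip_jacobi, rule cl, assumption)+
  have rR: "rot ?R x = rot R (rot R x)" if "x \<in> half R" for x using that by (auto simp: tips_def)
  obtain xs0 where xs0: "bword_by R xs0 w" using assms(2) by (auto simp: bword_def)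
  obtain t where t: "t \<in> tips R" using assms(3) by blast
  have pre: "opp R t \<in> set ys" if "bword_by R ys v" "t \<in> tips R" for t ys v
  proof -
    have ys: "loop (face R) ys" "t \<in> set ys" using that unfolding bword_by_def by blast+
    from loop_pred[OF this] obtain x where x: "x \<in> set ys" "face R x = t" by blast
    have xh: "x \<in> half R" using x that(1) by (auto simp: bword_by_def)
    have th: "t \<in> half R" "rot R t = t" using that(2) by (auto simp: tips_def)
    then have "rot R (opp R x) = rot R t" using x(2) by (simp add: face_def)
    then have "opp R x = t" using rot_eq_iff[OF opp_in[OF xh] th(1)] by blast
    then show ?thesis using x xh by auto
  qed
  \<comment> \<open>The orbit is cut just before a stem, so that no pair of stem and tip is torn
    apart at the ends of the list.\<close>
  obtain r w where xs: "bword_by R (opp R t # r) w"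
    using bword_by_start[OF xs0 pre[OF xs0 t]] by metis
  let ?xs = "opp R t # r"
  have xh: "x \<in> half R" if "x \<in> set ?xs" for x using xs that by (auto simp: bword_by_def)
  let ?zs = "map (opp R) (rev ?xs)"
  let ?\<psi> = "\<lambda>x. opp R (rot R (rot R x))"
  have lp: "loop (face R) ?xs" using xs by (simp add: bword_by_def)
  have "loop ?\<psi> (rev ?xs)"
    by (rule loop_rev[OF lp]) (use xh in \<open>simp add: face_def\<close>)
  then have l: "distinct (rev ?xs)" "chain ?\<psi> (hd (rev ?xs)) (rev ?xs)" unfolding loop_def by auto
  have ch: "chain (face ?R) (opp R (hd (rev ?xs))) ?zs"
  proof (rule chain_map[OF l(2)])
    fix x assume "x \<in> set (rev ?xs)"
    then have "x \<in> half R" using xh by (simp only: set_rev)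
    then show "face ?R (opp R x) = opp R (?\<psi> x)" by (simp add: face_def rR del: flip_simps(4))
  qed
  have inj: "inj_on (opp R) (set (rev ?xs))"
  proof (rule inj_onI)
    fix x y assume "x \<in> set (rev ?xs)" "y \<in> set (rev ?xs)" "opp R x = opp R y"
    moreover have "x \<in> half R" "y \<in> half R" using calculation(1,2) xh unfolding set_rev by blast+
    ultimately show "x = y" by (simp only: opp_eq_iff)
  qed
  have lz: "loop (face ?R) ?zs" unfolding loop_def
  proof (intro conjI)
    show "?zs \<noteq> []" by simp
    show "distinct ?zs" using l(1) inj distinct_map by blast
    show "chain (face ?R) (hd ?zs) ?zs" using ch by (subst hd_map) simp_all
  qed
  have zt: "x \<in> set ?zs" if "x \<in> tips R" for x
  proof -
    have "x \<in> half R" using that by (simp add: tips_def)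
    then have "x = opp R (opp R x)" by simp
    then show ?thesis unfolding set_map set_rev using pre[OF xs that] by (rule image_eqI)
  qed
  have "filter (\<lambda>x. x \<in> tips R) ?xs = map (opp R) (filter (\<lambda>x. opp R x \<in> tips R) ?xs)"
    by (rule tips_stems[OF assms(1), of "opp R t"]) (use lp xh assms(4)[OF t] in \<open>auto simp: loop_def\<close>)
  then have "rev (filter (\<lambda>x. x \<in> tips R) ?xs) = filter (\<lambda>x. x \<in> tips R) ?zs"
    by (simp only: rev_map rev_filter filter_map o_def)
  moreover have "w = map (lab R) (filter (\<lambda>x. x \<in> tips R) ?xs)" using xs by (simp only: bword_by_def)
  ultimately have "rev w = map (lab ?R) (filter (\<lambda>x. x \<in> tips ?R) ?zs)"
    by (simp only: rev_map flip_simps fl(2))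
  moreover have "set ?zs \<subseteq> half ?R" using xh by auto
  moreover have "tips ?R \<subseteq> set ?zs" unfolding fl(2) using zt by blast
  ultimately have "bword_by ?R ?zs (rev w)" unfolding bword_by_def using lz by blast
  then show ?thesis using xs by (auto simp: bword_def)
qed

lemma finite_closed_surj:
  assumes "finite F" "inj_on \<phi> F" "\<phi> ` F \<subseteq> F"
  shows "\<phi> ` F = F"
  using assms by (metis card_image card_subset_eq)

lemma face_inj:
  assumes "jacobi_diagram g R" shows "inj_on (face R) (half R)"
proof -
  interpret jacobi g R by unfold_locales fact
  show ?thesis by (rule inj_onI) (simp add: face_def)
qed

text \<open>The image under \<open>opp\<close> is used again. Following the faces backwards needs
  \<open>F\<close> to be mapped onto itself, which holds because \<open>face\<close> is injective on
  the finite set \<open>F\<close>.\<close>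

lemma freeface_flip_all:
  assumes "jacobi_diagram g R" "freeface R"
  shows "freeface (flip (half R - tips R) R)"
proof -
  interpret jacobi g R by unfold_locales fact
  let ?R = "flip (half R - tips R) R"
  have cl: "x \<in> half R - tips R \<Longrightarrow> x \<in> half R \<and> rot R x \<in> half R - tips R" for x by (auto simp: tips_def)
  have fl: "jacobi_diagram g ?R" "tips ?R = tips R" by (rule flip_jacobi, rule cl, assumption)+
  have rR: "rot ?R x = rot R (rot R x)" if "x \<in> half R" for x using that by (auto simp: tips_def)
  obtain F where F: "F \<noteq> {}" "F \<subseteq> half R" "F \<inter> tips R = {}" "face R ` F \<subseteq> F"
    using assms(2) unfolding freeface_def by metis
  have FF: "face R ` F = F"
    by (rule finite_closed_surj[OF _ _ F(4)]) (use F(2) fin face_inj[OF jd] in \<open>auto intro: finite_subset inj_on_subset\<close>)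
  have "face ?R y \<in> opp R ` F" if y: "y \<in> opp R ` F" for y
  proof -
    obtain x where x: "x \<in> F" "y = opp R x" using y by blast
    have "x \<in> face R ` F" using x(1) FF by simp
    then obtain z where z: "z \<in> F" "x = rot R (opp R z)" unfolding face_def by blast
    have zh: "z \<in> half R" "x \<in> half R" using z x F(2) by auto
    have "face ?R y = rot R (rot R x)" using x zh by (simp add: face_def rR del: flip_simps(4))
    also have "\<dots> = opp R z" using z zh by simp
    finally show ?thesis using z by simp
  qed
  moreover have "opp R x \<notin> tips R" if "x \<in> F" for x
  proof
    assume "opp R x \<in> tips R"
    then have "face R x \<in> tips R" by (simp add: face_def tips_def)
    then show False using F that by blast
  qed
  moreover have "opp R ` F \<subseteq> half ?R" using F(2) by auto
  moreover have "opp R ` F \<noteq> {}" using F(1) by simp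
  ultimately show ?thesis unfolding freeface_def fl(2) by (intro exI[of _ "opp R ` F"]) blast
qed

lemma val_flip_all:
  assumes "jacobi_diagram g R" "card (tips R) = m" "0 < m" "\<And>t. t \<in> tips R \<Longrightarrow> opp R t \<notin> tips R"
  shows "congr g m (val (flip (half R - tips R) R)) (frag_cmul ((-1) ^ m) (val R))"
proof -
  interpret jacobi g R by unfold_locales fact
  let ?R = "flip (half R - tips R) R"
  have cl: "x \<in> half R - tips R \<Longrightarrow> x \<in> half R \<and> rot R x \<in> half R - tips R" for x by (auto simp: tips_def)
  have fl: "jacobi_diagram g ?R" "tips ?R = tips R" by (rule flip_jacobi, rule cl, assumption)+
  have tt: "tips R \<noteq> {}" using assms(2,3) by auto
  have ff: "flip (half ?R - tips ?R) ?R = R"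
  proof -
    let ?Z = "half R - tips R"
    have "flip ?Z (flip ?Z R) = flip ((?Z - ?Z) \<union> (?Z - ?Z)) R"
      by (rule flip_flip[OF jd]) (rule cl, assumption)+
    also have "\<dots> = R" by (simp only: Diff_cancel Un_empty_left flip_empty)
    finally show ?thesis by (simp only: fl(2) flip_simps(1))
  qed
  have o: "\<And>t. t \<in> tips ?R \<Longrightarrow> opp ?R t \<notin> tips ?R" using assms(4) by (simp add: fl(2))
  show ?thesis
  proof (cases "freeface R \<and> (\<exists>w. bword R w)")
    case True
    then obtain w where w: "bword R w" "bword ?R (rev w)" using bword_flip_all[OF jd _ tt assms(4)] by blast
    have "congr g m (val ?R) (fr (wheel w))"
      using val_eq[OF fl(1) w(2) freeface_flip_all[OF jd]] True assms(2,3) by (simp add: fl(2))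
    also have "congr g m \<dots> (frag_cmul ((-1) ^ m) (fr (wheel (rev w))))"
      using wheel_rev[of "rev w" g] bword_length[OF w(1) jd] assms(2,3) by auto
    also have "congr g m \<dots> (frag_cmul ((-1) ^ m) (val R))"
      by (rule congr_cmul, rule congr_sym) (use val_eq[OF jd w(1)] True assms(2,3) in simp)
    finally show ?thesis .
  next
    case False
    have "\<not> (freeface ?R \<and> (\<exists>w. bword ?R w))"
    proof
      assume a: "freeface ?R \<and> (\<exists>w. bword ?R w)"
      then have "\<exists>w. bword R w" using bword_flip_all[OF fl(1) _ _ o] tt unfolding ff by (auto simp: fl(2))
      moreover have "freeface R" using freeface_flip_all[OF fl(1)] a unfolding ff by blast
      ultimately show False using False by blast
    qed
    then show ?thesis using False by (simp only: val_eq_0 congr_refl frag_cmul_zero2 not_False_eq_True)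
  qed
qed

subsection \<open>Contracting an edge\<close>

lemma chain_bypass:
  assumes "chain \<phi> z xs" "z \<notin> E" "xs \<noteq> [] \<Longrightarrow> hd xs \<notin> E" "\<And>x. x \<in> set xs \<Longrightarrow> x \<in> E \<Longrightarrow> \<phi> x \<notin> E"
  shows "chain (\<lambda>x. if \<phi> x \<in> E then \<phi> (\<phi> x) else \<phi> x) z (filter (\<lambda>x. x \<notin> E) xs)"
  using assms
proof (induction "length xs" arbitrary: xs rule: less_induct)
  case less
  let ?p = "\<lambda>x. if \<phi> x \<in> E then \<phi> (\<phi> x) else \<phi> x"
  show ?case
  proof (cases xs)
    case (Cons x r)
    have c: "\<phi> x = (if r = [] then z else hd r)" "chain \<phi> z r" using less.prems(1) Cons by (auto simp: chain_Cons)
    have x: "x \<notin> E" using less.prems(3) Cons by simp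
    show ?thesis
    proof (cases r)
      case Nil then show ?thesis using c x less.prems(2) by (simp add: Cons)
    next
      case r: (Cons y r')
      show ?thesis
      proof (cases "y \<in> E")
        case False
        have "chain ?p z (filter (\<lambda>x. x \<notin> E) r)"
          by (rule less.hyps) (use less.prems c False in \<open>auto simp: Cons r\<close>)
        then show ?thesis using c x False by (simp add: Cons r chain_Cons)
      next
        case True
        have c': "\<phi> y = (if r' = [] then z else hd r')" "chain \<phi> z r'" using c(2) r by (auto simp: chain_Cons)
        have y: "\<phi> y \<notin> E" using less.prems(4)[of y] True by (simp add: Cons r)
        have "chain ?p z (filter (\<lambda>x. x \<notin> E) r')"
          by (rule less.hyps) (use less.prems c' y in \<open>auto simp: Cons r\<close>)
        moreover have "?p x = (if filter (\<lambda>x. x \<notin> E) r' = [] then z else hd (filter (\<lambda>x. x \<notin> E) r'))"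
          using c c' y True by (cases r') (auto simp: r)
        ultimately show ?thesis using x True by (simp add: Cons r chain_Cons)
      qed
    qed
  qed simp
qed

definition detour :: "('h \<Rightarrow> 'h) \<Rightarrow> 'h set \<Rightarrow> 'h \<Rightarrow> 'h list" where
  "detour \<phi> E x = (if \<phi> x \<in> E then [x, \<phi> x] else [x])"

lemma chain_detour:
  assumes "chain p z xs" "\<And>x. x \<in> set xs \<Longrightarrow> p x = (if \<phi> x \<in> E then \<phi> (\<phi> x) else \<phi> x)"
  shows "chain \<phi> z (concat (map (detour \<phi> E) xs))"
  using assms
proof (induction xs)
  case (Cons x r)
  have c: "p x = (if r = [] then z else hd r)" "chain p z r" using Cons.prems(1) by (auto simp: chain_Cons)
  define C where "C = concat (map (detour \<phi> E) r)"
  have IH: "chain \<phi> z C" unfolding C_def using Cons.IH[OF c(2)] Cons.prems(2) by simp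
  have h: "(if C = [] then z else hd C) = p x"
    unfolding C_def using c(1) by (cases r) (auto simp: detour_def)
  show ?case
  proof (cases "\<phi> x \<in> E")
    case True
    then have "p x = \<phi> (\<phi> x)" using Cons.prems(2)[of x] by simp
    moreover have "concat (map (detour \<phi> E) (x # r)) = x # \<phi> x # C" using True by (simp add: C_def detour_def)
    ultimately show ?thesis using IH h by (simp add: chain_Cons)
  next
    case False
    then have "p x = \<phi> x" using Cons.prems(2)[of x] by simp
    moreover have "concat (map (detour \<phi> E) (x # r)) = x # C" using False by (simp add: C_def detour_def)
    ultimately show ?thesis using IH h by (simp add: chain_Cons)
  qed
qed simp

text \<open>\<open>E\<close> is meant to be the pair of halves of an edge that is contracted. When
  the half-edges of \<open>E\<close> are skipped, both diagrams have the same face map, so an orbit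
  of one becomes an orbit of the other by deleting \<open>E\<close> and inserting the detours of the
  second diagram. No two members of \<open>E\<close> are consecutive, so each detour has length one,
  and tips are not affected.\<close>

lemma bword_bypass:
  assumes "jacobi_diagram g R" "jacobi_diagram g R'" "half R' = half R" "lab R' = lab R" "tips R' = tips R" "tips R \<noteq> {}"
    and E: "E \<inter> tips R = {}" "E \<subseteq> half R"
    and no: "\<And>x. x \<in> E \<Longrightarrow> face R x \<notin> E" "\<And>x. x \<in> E \<Longrightarrow> face R' x \<notin> E"
    and bp: "\<And>x. x \<in> half R - E \<Longrightarrow>
      (if face R x \<in> E then face R (face R x) else face R x) = (if face R' x \<in> E then face R' (face R' x) else face R' x)"
  shows "bword R w \<Longrightarrow> \<exists>w'. bword R w' \<and> bword R' w'" "freeface R \<Longrightarrow> freeface R'"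
proof -
  interpret jacobi g R by unfold_locales fact
  interpret R': jacobi g R' by unfold_locales fact
  have fh: "face R' x \<in> half R" if "x \<in> half R" for x using that assms(3) R'.rot_in R'.opp_in by (auto simp: face_def)
  have inj': "face R' x = face R' y \<longleftrightarrow> x = y" if "x \<in> half R" "y \<in> half R" for x y
    using face_inj[OF assms(2)] that assms(3) by (auto simp: inj_on_eq_iff)
  let ?p = "\<lambda>x. if face R x \<in> E then face R (face R x) else face R x"
  assume "bword R w"
  then obtain xs0 where xs0: "bword_by R xs0 w" by (auto simp: bword_def)
  obtain t where t: "t \<in> tips R" using assms(6) by blast
  then have "t \<in> set xs0" using xs0 by (auto simp: bword_by_def)
  then obtain r w where xs: "bword_by R (t # r) w" using bword_by_start[OF xs0] by metis
  have tE: "t \<notin> E" using t E by blast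
  let ?xs = "t # r"
  have xh: "x \<in> half R" if "x \<in> set ?xs" for x using xs that by (auto simp: bword_by_def)
  have lp: "chain (face R) t ?xs" "distinct ?xs" using xs by (auto simp: bword_by_def loop_def)
  let ?ys = "filter (\<lambda>x. x \<notin> E) ?xs"
  have cy: "chain ?p t ?ys" by (rule chain_bypass[OF lp(1) tE]) (use tE no in auto)
  let ?zs = "concat (map (detour (face R') E) ?ys)"
  have cz: "chain (face R') t ?zs"
  proof (rule chain_detour[OF cy])
    fix x assume "x \<in> set ?ys"
    then have "x \<in> half R - E" using xh unfolding set_filter by blast
    then show "?p x = (if face R' x \<in> E then face R' (face R' x) else face R' x)" by (rule bp)
  qed
  have hz: "hd ?zs = t" "?zs \<noteq> []" using tE by (auto simp: detour_def)
  have sz: "x \<in> half R" if "x \<in> set ?zs" for x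
    using that xh fh by (auto simp: detour_def split: if_splits)
  \<comment> \<open>An inserted element of \<open>E\<close> determines its predecessor by
    injectivity of \<open>face R'\<close>, so no detour is taken twice.\<close>
  have dz: "distinct (concat (map (detour (face R') E) us))" if "distinct us" "\<And>x. x \<in> set us \<Longrightarrow> x \<in> half R - E" for us
    using that
  proof (induction us)
    case (Cons u us)
    define C where "C = concat (map (detour (face R') E) us)"
    have IH: "distinct C" unfolding C_def using Cons by auto
    have uE: "u \<in> half R" "u \<notin> E" using Cons.prems by auto
    have m: "y \<in> set us \<or> (y \<in> E \<and> (\<exists>v\<in>set us. y = face R' v))" if "y \<in> set C" for y
      using that unfolding C_def by (auto simp: detour_def split: if_splits)
    have "u \<notin> set C" using m[of u] uE Cons.prems by auto
    moreover have "face R' u \<notin> set C" if "face R' u \<in> E"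
    proof
      assume "face R' u \<in> set C"
      then consider "face R' u \<in> set us" | v where "v \<in> set us" "face R' u = face R' v" using m by blast
      then show False
      proof cases
        case 1 then show ?thesis using Cons.prems(2) that by auto
      next
        case 2
        then have "u = v" using inj'[of u v] Cons.prems(2) uE by auto
        then show ?thesis using 2 Cons.prems(1) by simp
      qed
    qed
    moreover have "u \<noteq> face R' u" if "face R' u \<in> E" using that uE by metis
    moreover have "concat (map (detour (face R') E) (u # us)) = (if face R' u \<in> E then [u, face R' u] else [u]) @ C"
      by (simp add: C_def detour_def)
    ultimately show ?case using IH by (simp del: concat.simps list.map)
  qed simp
  have lz: "loop (face R') ?zs"
  proof -
    have "distinct ?zs"
    proof (rule dz)
      show "distinct ?ys" using lp(2) by (rule distinct_filter)
      show "x \<in> half R - E" if "x \<in> set ?ys" for x using that xh unfolding set_filter by blast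
    qed
    then show ?thesis unfolding loop_def hz(1) using cz hz(2) by blast
  qed
  have ft: "filter (\<lambda>x. x \<in> tips R) (concat (map (detour (face R') E) us)) = filter (\<lambda>x. x \<in> tips R) us" for us
    using E(1) by (induction us) (auto simp: detour_def)
  have fy: "filter (\<lambda>x. x \<in> tips R) ?ys = filter (\<lambda>x. x \<in> tips R) ?xs"
    unfolding filter_filter by (rule filter_cong) (use E(1) in auto)
  have "set (filter (\<lambda>x. x \<in> tips R) ?zs) = set (filter (\<lambda>x. x \<in> tips R) ?xs)" by (simp only: ft fy)
  then have "{x \<in> set ?zs. x \<in> tips R} = {x \<in> set ?xs. x \<in> tips R}" by (simp only: set_filter)
  moreover have "tips R \<subseteq> set ?xs" using xs unfolding bword_by_def by blast
  ultimately have tz: "tips R \<subseteq> set ?zs" by blast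
  have "bword_by R' ?zs w" unfolding bword_by_def assms(3-5) ft fy
    using lz sz tz xs unfolding bword_by_def by blast
  then show "\<exists>w'. bword R w' \<and> bword R' w'" using xs unfolding bword_def by blast
next
  interpret jacobi g R by unfold_locales fact
  interpret R': jacobi g R' by unfold_locales fact
  have fh: "face R' x \<in> half R" if "x \<in> half R" for x using that assms(3) R'.rot_in R'.opp_in by (auto simp: face_def)
  assume "freeface R"
  then obtain F where F: "F \<noteq> {}" "F \<subseteq> half R" "F \<inter> tips R = {}" "face R ` F \<subseteq> F" unfolding freeface_def by metis
  \<comment> \<open>The part of the free faces outside \<open>E\<close>, together with those members
    of \<open>E\<close> that the face map of \<open>R'\<close> meets on the way.\<close>
  let ?F = "(F - E) \<union> {face R' y |y. y \<in> F - E \<and> face R' y \<in> E}"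
  have p: "(if face R' x \<in> E then face R' (face R' x) else face R' x) \<in> F - E" if "x \<in> F - E" for x
  proof -
    have x: "x \<in> half R - E" using that F(2) by blast
    have "face R x \<in> F" using that F(4) by blast
    then have "face R x \<in> E \<Longrightarrow> face R (face R x) \<in> F - E" using F(4) no(1) by blast
    then show ?thesis using \<open>face R x \<in> F\<close> unfolding bp[OF x, symmetric] by simp
  qed
  show "freeface R'" unfolding freeface_def
  proof (intro exI[of _ ?F] conjI)
    obtain x where "x \<in> F" using F(1) by blast
    then have "x \<in> F - E \<or> face R x \<in> F - E" using no(1)[of x] F(4) by blast
    then show "?F \<noteq> {}" by blast
    show "?F \<subseteq> half R'" using F(2) fh assms(3) by auto
    show "?F \<inter> tips R' = {}" using F(3) E(1) assms(5) by auto
    show "face R' ` ?F \<subseteq> ?F"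
    proof
      fix z assume "z \<in> face R' ` ?F"
      then consider y where "y \<in> F - E" "z = face R' y" | y where "y \<in> F - E" "face R' y \<in> E" "z = face R' (face R' y)"
        by blast
      then show "z \<in> ?F"
      proof cases
        case 1 then show ?thesis using p[OF 1(1)] by (cases "z \<in> E") auto
      next
        case 2 then show ?thesis using p[OF 2(1)] by auto
      qed
    qed
  qed
qed

subsection \<open>The state sum\<close>

lemma no_tip_edge:
  assumes "jac g n D" "0 < n" "t \<in> tips D"
  shows "opp D t \<notin> tips D"
proof
  interpret jacobi g D using assms(1) by (rule jac_jacobi)
  assume o: "opp D t \<in> tips D"
  have "{t, opp D t} = half D"
    by (rule jac_closedI[OF assms(1), of _ t]) (use o assms(3) in \<open>auto simp: tips_def\<close>)
  then have "half D - tips D = {}" using o assms(3) by auto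
  then have "card (half D - tips D) = 0" by (simp only: card.empty)
  then show False using jac_cards(1)[OF assms(1)] assms(2) by linarith
qed

lemma frag_cmul_diff2: "frag_cmul c (a - b) = frag_cmul c a - frag_cmul c b"
proof -
  have "frag_cmul c (a - b) + frag_cmul c b = frag_cmul c a"
    using frag_cmul_distrib2[of c "a - b" b] by simp
  then show ?thesis by (simp add: eq_diff_eq)
qed

definition state :: "'h set set \<Rightarrow> 'h diagram \<Rightarrow> nat diagram \<Rightarrow>\<^sub>0 int" where
  "state Y D = val (flip (\<Union>Y) D)"

definition chi_at :: "'h set \<Rightarrow> 'h diagram \<Rightarrow> nat diagram \<Rightarrow>\<^sub>0 int" where
  "chi_at u D = (\<Sum>Y\<in>Pow (trivalent_vertices D - {u}). frag_cmul ((-1) ^ card Y) (state Y D))"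

lemma sum_Pow_insert:
  fixes f :: "'a set \<Rightarrow> 'b :: comm_monoid_add"
  assumes "finite W" "v \<notin> W"
  shows "sum f (Pow (insert v W)) = (\<Sum>Y\<in>Pow W. f Y + f (insert v Y))"
proof -
  have "sum f (Pow (insert v W)) = sum f (Pow W) + sum f (insert v ` Pow W)"
    unfolding Pow_insert by (rule sum.union_disjoint) (use assms in auto)
  also have "sum f (insert v ` Pow W) = sum (f \<circ> insert v) (Pow W)"
    by (rule sum.reindex) (use assms in \<open>auto simp: inj_on_def insert_ident\<close>)
  finally show ?thesis by (simp add: sum.distrib)
qed

text \<open>Pairing the states that differ only at \<open>v\<close> isolates the effect of reversing
  \<open>v\<close>; AS, self-loops and IHX are all read off from such pairs.\<close>

lemma signed_sum_Pow_insert: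
  assumes "finite W" "v \<notin> W"
  shows "(\<Sum>Y\<in>Pow (insert v W). frag_cmul ((-1) ^ card Y) (f Y)) =
    (\<Sum>Y\<in>Pow W. frag_cmul ((-1) ^ card Y) (f Y - f (insert v Y)))"
  unfolding sum_Pow_insert[OF assms]
proof (rule sum.cong[OF refl])
  fix Y assume "Y \<in> Pow W"
  then have "finite Y" "v \<notin> Y" using assms finite_subset by auto
  then have "card (insert v Y) = Suc (card Y)" by simp
  then show "frag_cmul ((-1) ^ card Y) (f Y) + frag_cmul ((-1) ^ card (insert v Y)) (f (insert v Y)) =
    frag_cmul ((-1) ^ card Y) (f Y - f (insert v Y))"
    by (simp add: frag_cmul_diff2 flip: minus_frag_cmul)
qed

lemma flip_Union:
  assumes "jacobi_diagram g D" "Y \<subseteq> trivalent_vertices D"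
  shows "jacobi_diagram g (flip (\<Union>Y) D)" "tips (flip (\<Union>Y) D) = tips D"
    "\<And>h. h \<in> \<Union>Y \<Longrightarrow> h \<in> half D \<and> rot D h \<in> \<Union>Y"
proof -
  interpret jacobi g D by unfold_locales fact
  show cl: "h \<in> half D \<and> rot D h \<in> \<Union>Y" if h: "h \<in> \<Union>Y" for h
  proof -
    obtain v where v: "v \<in> Y" "h \<in> v" using h by blast
    then have "v = vertex D h" "h \<in> half D" using trivalent_memD assms(2) by blast+
    then have "rot D h \<in> v" by (simp add: vertex_def)
    then show ?thesis using v(1) \<open>h \<in> half D\<close> by blast
  qed
  show "jacobi_diagram g (flip (\<Union>Y) D)" "tips (flip (\<Union>Y) D) = tips D"
    by (rule flip_jacobi, rule cl, assumption)+
qed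

lemma flip_Union_flip:
  assumes "jacobi_diagram g D" "Y \<subseteq> trivalent_vertices D" "X \<subseteq> trivalent_vertices D"
  shows "flip (\<Union>X) (flip (\<Union>Y) D) = flip (\<Union>((X - Y) \<union> (Y - X))) D"
proof -
  interpret jacobi g D by unfold_locales fact
  have dj: "x = y" if "x \<in> X \<union> Y" "y \<in> X \<union> Y" "h \<in> x" "h \<in> y" for x y h
    using trivalent_memD[of x h] trivalent_memD[of y h] that assms(2,3) by blast
  have "flip (\<Union>X) (flip (\<Union>Y) D) = flip ((\<Union>X - \<Union>Y) \<union> (\<Union>Y - \<Union>X)) D"
  proof (rule flip_flip[OF assms(1)])
    show "h \<in> half D \<and> rot D h \<in> \<Union>X" if "h \<in> \<Union>X" for h by (rule flip_Union(3)[OF assms(1,3) that])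
    show "h \<in> half D \<and> rot D h \<in> \<Union>Y" if "h \<in> \<Union>Y" for h by (rule flip_Union(3)[OF assms(1,2) that])
  qed
  also have "(\<Union>X - \<Union>Y) \<union> (\<Union>Y - \<Union>X) = \<Union>((X - Y) \<union> (Y - X))"
  proof (intro equalityI subsetI)
    fix h assume "h \<in> (\<Union>X - \<Union>Y) \<union> (\<Union>Y - \<Union>X)" then show "h \<in> \<Union>((X - Y) \<union> (Y - X))" by blast
  next
    fix h assume "h \<in> \<Union>((X - Y) \<union> (Y - X))"
    then obtain x where x: "h \<in> x" "x \<in> X \<and> x \<notin> Y \<or> x \<in> Y \<and> x \<notin> X" by blast
    then show "h \<in> (\<Union>X - \<Union>Y) \<union> (\<Union>Y - \<Union>X)" using dj[of x _ h] by blast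
  qed
  finally show ?thesis .
qed

lemma card_trivalent: "jac g n D \<Longrightarrow> card (trivalent_vertices D) = n"
  by (simp add: jac_def)

lemma state_complement:
  assumes "jac g n D" "card (tips D) = m" "0 < m" "0 < n" "Y \<subseteq> trivalent_vertices D"
  shows "congr g m (state (trivalent_vertices D - Y) D) (frag_cmul ((-1) ^ m) (state Y D))"
proof -
  interpret jacobi g D using assms(1) by (rule jac_jacobi)
  let ?T = "trivalent_vertices D" and ?R = "flip (\<Union>Y) D"
  note f = flip_Union[OF jd assms(5)]
  have "flip (half ?R - tips ?R) ?R = flip (\<Union>?T) ?R" by (simp only: f(2) flip_simps(1) Union_trivalent)
  also have "\<dots> = flip (\<Union>((?T - Y) \<union> (Y - ?T))) D" by (rule flip_Union_flip[OF jd assms(5)]) simp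
  also have "(?T - Y) \<union> (Y - ?T) = ?T - Y" using assms(5) by blast
  finally have e: "flip (\<Union>(?T - Y)) D = flip (half ?R - tips ?R) ?R" by simp
  have nt: "\<And>t. t \<in> tips ?R \<Longrightarrow> opp ?R t \<notin> tips ?R"
    unfolding f(2) flip_simps(2) by (rule no_tip_edge[OF assms(1,4)])
  show ?thesis unfolding state_def e
    by (rule val_flip_all[OF f(1) _ assms(3) nt]) (simp_all only: f(2) assms(2))
qed

text \<open>States reversing neither \<open>u\<close> nor \<open>v\<close> occur in both sums. A
  remaining state reverses exactly one of them, and passing to the complement exchanges the two
  kinds; the sign of the complementary state is compensated by the change in the number of
  reversals.\<close>

lemma chi_at_indep:
  assumes "jac g (m + 2) D" "card (tips D) = m" "0 < m" "u \<in> trivalent_vertices D" "v \<in> trivalent_vertices D"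
  shows "congr g m (chi_at u D) (chi_at v D)"
proof (cases "u = v")
  case False
  interpret jacobi g D using assms(1) by (rule jac_jacobi)
  let ?T = "trivalent_vertices D"
  define W where "W = ?T - {u, v}"
  have fW: "finite W" by (simp add: W_def)
  have Tu: "?T - {u} = insert v W" and Tv: "?T - {v} = insert u W" using False assms(4,5) by (auto simp: W_def)
  have uW: "u \<notin> W" "v \<notin> W" by (auto simp: W_def)
  have cW: "card W = m"
    unfolding W_def using False assms(4,5) card_trivalent[OF assms(1)] by (simp add: card_Diff_subset)
  let ?s = "\<lambda>Y. (-1 :: int) ^ card Y" and ?S = "\<lambda>Y. state Y D"
  have "congr g m (\<Sum>Y\<in>Pow W. frag_cmul (?s Y) (?S (insert u Y))) (\<Sum>Y\<in>Pow W. frag_cmul (?s (W - Y)) (?S (insert v (W - Y))))"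
  proof (rule congr_sum)
    fix Y assume Y: "Y \<in> Pow W"
    then have YT: "insert u Y \<subseteq> ?T" using assms(4) by (auto simp: W_def)
    have c: "?T - insert u Y = insert v (W - Y)" using False assms(5) Y uW by (auto simp: W_def)
    have "card (W - Y) = m - card Y" "card Y \<le> m"
      using Y fW cW card_mono[of W Y] by (auto simp: card_Diff_subset finite_subset)
    \<comment> \<open>\<open>W\<close> has \<open>m\<close> elements, two fewer than there are
      trivalent vertices, so this sign is precisely the one produced by
      \<open>state_complement\<close>.\<close>
    then have "?s Y = ?s (W - Y) * (-1) ^ m"
      by (simp add: power_add[symmetric] minus_one_power_iff)
    then have "frag_cmul (?s Y) (?S (insert u Y)) = frag_cmul (?s (W - Y)) (frag_cmul ((-1) ^ m) (?S (insert u Y)))"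
      by simp
    also have "congr g m \<dots> (frag_cmul (?s (W - Y)) (?S (insert v (W - Y))))"
    proof -
      have "congr g m (?S (insert v (W - Y))) (frag_cmul ((-1) ^ m) (?S (insert u Y)))"
        using state_complement[OF assms(1-3) _ YT] unfolding c by simp
      then show ?thesis by (rule congr_cmul[OF congr_sym])
    qed
    finally show "congr g m (frag_cmul (?s Y) (?S (insert u Y))) (frag_cmul (?s (W - Y)) (?S (insert v (W - Y))))" .
  qed
  also have "(\<Sum>Y\<in>Pow W. frag_cmul (?s (W - Y)) (?S (insert v (W - Y)))) = (\<Sum>Y\<in>Pow W. frag_cmul (?s Y) (?S (insert v Y)))"
    by (rule sum.reindex_bij_witness[of _ "\<lambda>Y. W - Y" "\<lambda>Y. W - Y"]) (auto simp: double_diff)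
  finally have 1: "congr g m (\<Sum>Y\<in>Pow W. frag_cmul (?s Y) (?S (insert u Y))) (\<Sum>Y\<in>Pow W. frag_cmul (?s Y) (?S (insert v Y)))" .
  have "chi_at u D = (\<Sum>Y\<in>Pow W. frag_cmul (?s Y) (?S Y)) - (\<Sum>Y\<in>Pow W. frag_cmul (?s Y) (?S (insert v Y)))"
    unfolding chi_at_def Tu signed_sum_Pow_insert[OF fW uW(2)] by (simp only: frag_cmul_diff2 sum_subtractf)
  moreover have "chi_at v D = (\<Sum>Y\<in>Pow W. frag_cmul (?s Y) (?S Y)) - (\<Sum>Y\<in>Pow W. frag_cmul (?s Y) (?S (insert u Y)))"
    unfolding chi_at_def Tv signed_sum_Pow_insert[OF fW uW(1)] by (simp only: frag_cmul_diff2 sum_subtractf)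
  ultimately show ?thesis using congr_diff[OF congr_refl congr_sym[OF 1]] by simp
qed simp

lemma chi_at_iso:
  assumes "jacobi_diagram g D" "iso_by f D E"
  shows "u \<in> trivalent_vertices D \<Longrightarrow> f ` u \<in> trivalent_vertices E \<and> chi_at (f ` u) E = chi_at u D"
proof -
  assume u: "u \<in> trivalent_vertices D"
  interpret jacobi g D by unfold_locales fact
  note f = iso_byD[OF assms(2)]
  have "iso_by (inv_into (half D) f) E D" by (rule iso_by_sym[OF assms])
  have jE: "jacobi_diagram g E" unfolding jacobi_diagram_def
  proof (intro conjI ballI)
    show "finite (half E)" unfolding f(3)[symmetric] using fin by (rule finite_imageI)
  next
    fix x assume "x \<in> half E"
    then obtain h where h: "h \<in> half D" "x = f h" using f(9) by blast
    then show "rot E x \<in> half E" "rot E (rot E (rot E x)) = x" "opp E x \<in> half E"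
       "opp E (opp E x) = x" "opp E x \<noteq> x" "rot E x = x \<longrightarrow> lab E x \<in> labels g"
      using f(8)[of "rot D h" h] by (auto simp: f lab_in)
  qed
  interpret E: jacobi g E by unfold_locales (rule jE)
  let ?T = "trivalent_vertices D"
  have nt: "half E - tips E = f ` (half D - tips D)"
    unfolding iso_by_tips[OF assms] f(3)[symmetric]
    by (rule inj_on_image_set_diff[OF f(2), symmetric]) (auto simp: tips_def)
  have TE: "trivalent_vertices E = (`) f ` ?T"
  proof -
    have "trivalent_vertices E = (\<lambda>h. vertex E (f h)) ` (half D - tips D)"
      unfolding E.trivalent_eq nt by (simp only: image_image)
    also have "\<dots> = (\<lambda>h. f ` vertex D h) ` (half D - tips D)"
      by (rule image_cong[OF refl]) (simp add: iso_by_vertex[OF assms])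
    finally show ?thesis unfolding trivalent_eq by (simp only: image_image)
  qed
  have inj: "inj_on ((`) f) ?T"
  proof (rule inj_onI)
    fix x y assume "x \<in> ?T" "y \<in> ?T" "f ` x = f ` y"
    then show "x = y" using inj_on_image_eq_iff[OF f(2)] trivalent_sub by blast
  qed
  have "f ` u \<in> trivalent_vertices E" unfolding TE using u by blast
  moreover have "chi_at (f ` u) E = chi_at u D"
  proof -
    have "trivalent_vertices E - {f ` u} = (`) f ` (?T - {u})"
      unfolding TE using inj_on_image_set_diff[OF inj, of ?T "{u}"] u by simp
    then have "Pow (trivalent_vertices E - {f ` u}) = (`) ((`) f) ` Pow (?T - {u})"
      by (simp only: image_Pow_surj)
    moreover have "inj_on ((`) ((`) f)) (Pow (?T - {u}))"
      by (rule inj_on_image_Pow) (rule inj_on_subset[OF inj], blast)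
    ultimately have "chi_at (f ` u) E =
      (\<Sum>Y\<in>Pow (?T - {u}). frag_cmul ((-1) ^ card ((`) f ` Y)) (state ((`) f ` Y) E))"
      unfolding chi_at_def by (simp only: sum.reindex o_def)
    also have "\<dots> = chi_at u D" unfolding chi_at_def
    proof (rule sum.cong[OF refl])
      fix Y assume "Y \<in> Pow (?T - {u})"
      then have Y: "Y \<subseteq> ?T" by blast
      have c: "card ((`) f ` Y) = card Y" by (rule card_image) (rule inj_on_subset[OF inj Y])
      have i: "iso_by f (flip (\<Union>Y) D) (flip (f ` \<Union>Y) E)"
        by (rule iso_by_flip[OF assms]) (use trivalent_sub Y in blast)
      have YE: "(`) f ` Y \<subseteq> trivalent_vertices E" unfolding TE using Y by blast
      have un: "f ` \<Union>Y = \<Union>((`) f ` Y)" by (rule image_Union)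
      have "state Y D = state ((`) f ` Y) E"
        unfolding state_def un[symmetric]
        by (rule iso_by_val[OF flip_Union(1)[OF jd Y] i]) (unfold un, rule flip_Union(1)[OF jE YE])
      then show "frag_cmul ((-1) ^ card ((`) f ` Y)) (state ((`) f ` Y) E) = frag_cmul ((-1) ^ card Y) (state Y D)"
        by (simp only: c)
    qed
    finally show ?thesis .
  qed
  ultimately show ?thesis by blast
qed

text \<open>Reversing a vertex other than the fixed one permutes the states, exchanging those that
  contain it with those that do not, and so changes every sign.\<close>

lemma chi_at_flip:
  assumes "jac g n D" "h \<in> half D" "rot D h \<noteq> h" "u \<in> trivalent_vertices D" "u \<noteq> vertex D h"
  shows "chi_at u (flip (vertex D h) D) = - chi_at u D"
proof -
  interpret jacobi g D using assms(1) by (rule jac_jacobi)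
  let ?T = "trivalent_vertices D" and ?v = "vertex D h"
  let ?W = "?T - {u, ?v}"
  have vT: "?v \<in> ?T" using trivalent_iff assms(2,3) by blast
  have T: "?T - {u} = insert ?v ?W" using vT assms(5) by blast
  have W: "finite ?W" "?v \<notin> ?W" by simp_all
  have tf: "trivalent_vertices (flip ?v D) = ?T"
    by (rule flip_jac(3)[OF assms(1)]) (rule vertex_closed[OF jd assms(2)])
  have fl: "flip (\<Union>X) (flip ?v D) = flip (\<Union>((X - {?v}) \<union> ({?v} - X))) D" if "X \<subseteq> ?T" for X
    using flip_Union_flip[OF jd, of "{?v}" X] vT that by simp
  have "chi_at u (flip ?v D) = (\<Sum>Y\<in>Pow ?W. frag_cmul ((-1) ^ card Y) (state Y (flip ?v D) - state (insert ?v Y) (flip ?v D)))"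
    unfolding chi_at_def tf unfolding T by (rule signed_sum_Pow_insert[OF W])
  also have "\<dots> = (\<Sum>Y\<in>Pow ?W. - frag_cmul ((-1) ^ card Y) (state Y D - state (insert ?v Y) D))"
  proof (rule sum.cong[OF refl])
    fix Y assume Y: "Y \<in> Pow ?W"
    then have vY: "?v \<notin> Y" "Y \<subseteq> ?T" "insert ?v Y \<subseteq> ?T" using vT by auto
    have e1: "(Y - {?v}) \<union> ({?v} - Y) = insert ?v Y" using vY by blast
    have e2: "(insert ?v Y - {?v}) \<union> ({?v} - insert ?v Y) = Y" using vY by blast
    have "state Y (flip ?v D) = state (insert ?v Y) D" unfolding state_def fl[OF vY(2)] e1 ..
    moreover have "state (insert ?v Y) (flip ?v D) = state Y D" unfolding state_def fl[OF vY(3)] e2 ..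
    ultimately show "frag_cmul ((-1) ^ card Y) (state Y (flip ?v D) - state (insert ?v Y) (flip ?v D)) =
      - frag_cmul ((-1) ^ card Y) (state Y D - state (insert ?v Y) D)" by (simp only: frag_cmul_diff2 minus_diff_eq)
  qed
  also have "\<dots> = - chi_at u D"
    unfolding chi_at_def unfolding T signed_sum_Pow_insert[OF W] by (rule sum_negf)
  finally show ?thesis .
qed

text \<open>Turning the loop around, by exchanging its two halves, has the same effect as reversing
  its vertex.\<close>

lemma self_loop_symmetry:
  assumes "jacobi_diagram g D" "h \<in> half D" "opp D h \<in> {rot D h, rot D (rot D h)}"
  shows "\<exists>f. iso_by f D (flip (vertex D h) D)"
proof -
  interpret jacobi g D by unfold_locales fact
  define k where "k = opp D h"
  have k: "k \<in> half D" "k \<noteq> h" "opp D k = h" "opp D h = k" using assms(2) by (auto simp: k_def)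
  have kv: "k \<in> vertex D h" using assms(3) by (auto simp: k_def vertex_def)
  have r: "rot D h \<noteq> h" using assms(3) k unfolding k_def[symmetric] by auto
  obtain s where s: "s \<in> half D" "s \<noteq> h" "s \<noteq> k" "vertex D h = {h, k, s}"
     "rot D h = k \<and> rot D k = s \<and> rot D s = h \<or> rot D h = s \<and> rot D s = k \<and> rot D k = h"
  proof (cases "rot D h = k")
    case True
    then show ?thesis using that[of "rot D k"] assms(2) r rot3[OF assms(2)] rot2_eq[OF assms(2)] k by (auto simp: vertex_def)
  next
    case False
    then have "rot D (rot D h) = k" using assms(3) by (auto simp: k_def)
    then show ?thesis using that[of "rot D h"] assms(2) r rot3[OF assms(2)] False k by (auto simp: vertex_def)
  qed
  let ?f = "\<lambda>x. if x = h then k else if x = k then h else x"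
  have out: "rot D x \<notin> {h, k, s}" if "x \<in> half D" "x \<notin> {h, k, s}" for x
    using that vertex_rot[OF that(1)] s(4) vertex_eq[OF assms(2), of "rot D x"] self_in_vertex[of x] by metis
  have oo: "opp D x \<noteq> h" "opp D x \<noteq> k" if "x \<in> half D" "x \<noteq> h" "x \<noteq> k" for x
    using opp_eq_iff[OF that(1) k(1)] opp_eq_iff[OF that(1) assms(2)] that k by simp_all
  have "iso_by ?f D (flip (vertex D h) D)"
  proof (rule iso_byI[where f' = ?f])
    fix x assume x: "x \<in> half D"
    show "?f x \<in> half (flip (vertex D h) D) \<and> ?f (?f x) = x" using x k assms(2) by simp
    show "opp (flip (vertex D h) D) (?f x) = ?f (opp D x)" using x k oo[OF x] by auto
    show "rot (flip (vertex D h) D) (?f x) = ?f (rot D x)"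
    proof (cases "x \<in> {h, k, s}")
      case True
      then show ?thesis unfolding flip_simps s(4) using s(2,3,5) k(2) by auto
    next
      case False
      then show ?thesis unfolding flip_simps s(4) using out[OF x False] by auto
    qed
    assume "rot D x = x"
    then have "x \<notin> {h, k, s}" using s(2,3,5) k(2) by auto
    then show "lab (flip (vertex D h) D) (?f x) = lab D x" by simp
  next
    fix x assume "x \<in> half (flip (vertex D h) D)"
    then show "?f x \<in> half D \<and> ?f (?f x) = x" using k assms(2) by simp
  qed
  then show ?thesis by blast
qed

text \<open>States that differ at the vertex of the loop are isomorphic ribbon graphs and occur with
  opposite signs.\<close>

lemma chi_at_self_loop:
  assumes "jac g n D" "h \<in> half D" "opp D h \<in> {rot D h, rot D (rot D h)}"
    "u \<in> trivalent_vertices D" "u \<noteq> vertex D h"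
  shows "chi_at u D = 0"
proof -
  interpret jacobi g D using assms(1) by (rule jac_jacobi)
  let ?T = "trivalent_vertices D" and ?v = "vertex D h"
  let ?W = "?T - {u, ?v}"
  have r: "rot D h \<noteq> h" using assms(2,3) opp_neq[OF assms(2)] by auto
  have vT: "?v \<in> ?T" using trivalent_iff assms(2) r by blast
  have T: "?T - {u} = insert ?v ?W" using vT assms(5) by blast
  have W: "finite ?W" "?v \<notin> ?W" by simp_all
  have "state Y D = state (insert ?v Y) D" if "Y \<in> Pow ?W" for Y
  proof -
    have Y: "Y \<subseteq> ?T" "?v \<notin> Y" using that by auto
    let ?E = "flip (\<Union>Y) D"
    note f = flip_Union[OF jd Y(1)]
    have vE: "vertex ?E h = ?v" by (rule flip_jacobi(3)[OF _ assms(2)]) (rule f(3))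
    have hY: "h \<notin> \<Union>Y"
    proof
      assume "h \<in> \<Union>Y"
      then obtain y where "y \<in> Y" "h \<in> y" by blast
      then show False using trivalent_memD[of y h] Y by blast
    qed
    have rY: "rot D h \<notin> \<Union>Y" using f(3)[of "rot D h"] f(3)[of "rot D (rot D h)"] hY assms(2) by auto
    have "opp ?E h \<in> {rot ?E h, rot ?E (rot ?E h)}" using assms(3) hY rY by simp
    from self_loop_symmetry[OF f(1) _ this] assms(2) obtain \<phi> where \<phi>: "iso_by \<phi> ?E (flip ?v ?E)"
      unfolding vE flip_simps by blast
    have "flip ?v ?E = flip (\<Union>(({?v} - Y) \<union> (Y - {?v}))) D"
      using flip_Union_flip[OF jd Y(1), of "{?v}"] vT by simp
    also have "({?v} - Y) \<union> (Y - {?v}) = insert ?v Y" using Y(2) by blast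
    finally have e: "flip ?v ?E = flip (\<Union>(insert ?v Y)) D" .
    show ?thesis unfolding state_def
      by (rule iso_by_val[OF f(1) \<phi>[unfolded e]]) (rule flip_Union(1)[OF jd], use Y vT in blast)
  qed
  then show ?thesis unfolding chi_at_def T signed_sum_Pow_insert[OF W] by (intro sum.neutral) simp
qed

subsection \<open>The state sum and IHX\<close>

text \<open>Contracting \<open>e\<close> leaves a four-valent vertex with cyclic order
  \<open>a, b, c, d\<close> without changing boundary components or legs. The two wirings are the
  two planar ways of splitting this vertex, so their values agree.\<close>

lemma val_rewire:
  assumes "jacobi_diagram g D" "inner_edge D e" "distinct [a, b, c, d]"
    "{a, b, c, d} = {rot D e, rot D (rot D e), rot D (opp D e), rot D (rot D (opp D e))}"
    "card (tips D) = m" "0 < m"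
  shows "congr g m (val (rewire e a b c d D)) (val (rewire e b c d a D))"
proof -
  interpret jacobi g D by unfold_locales fact
  let ?R = "rewire e a b c d D" and ?S = "rewire e b c d a D"
  have d': "distinct [b, c, d, a]" using assms(3) by auto
  have s': "{b, c, d, a} = {rot D e, rot D (rot D e), rot D (opp D e), rot D (rot D (opp D e))}"
    using assms(4) by auto
  note r = rewire_rot[OF assms(2-4)] and r' = rewire_rot[OF assms(2) d' s']
  note j = rewire_jacobi[OF assms(2-4)] and j' = rewire_jacobi[OF assms(2) d' s']
  let ?e = "opp D e" and ?E = "{e, opp D e}"
  have eh: "e \<in> half D" "?e \<in> half D" "opp D ?e = e" using assms(2) by (auto simp: inner_edge_def)
  note ne = distinct6[OF r(9)]
  have tt: "tips D \<noteq> {}" using assms(5,6) by auto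
  have Et: "?E \<inter> tips D = {}" using r(11)[of e] r(11)[of ?e] by (auto simp: tips_def)
  have no: "face ?R x \<notin> ?E" "face ?S x \<notin> ?E" if "x \<in> ?E" for x
    using that ne eh by (auto simp: face_def r(1-6) r'(1-6))
  have bp: "(if face ?R x \<in> ?E then face ?R (face ?R x) else face ?R x) =
      (if face ?S x \<in> ?E then face ?S (face ?S x) else face ?S x)" if x: "x \<in> half D - ?E" for x
  proof -
    have y: "opp D x \<in> half D" "opp D x \<noteq> e" "opp D x \<noteq> ?e"
      using x eh opp_eq_iff[of x ?e] opp_eq_iff[of x e] by auto
    consider "opp D x = a" | "opp D x = b" | "opp D x = c" | "opp D x = d" | "opp D x \<notin> {e, ?e, a, b, c, d}"
      using y by blast
    then show ?thesis
    proof cases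
      case 5
      have 6: "opp D x \<notin> {e, ?e, b, c, d, a}" using 5 by auto
      have "rot D (opp D x) \<notin> ?E" using r(10)[OF y(1)] 5 by blast
      then show ?thesis by (simp add: face_def r(7)[OF 5] r'(7)[OF 6])
    qed (use ne eh in \<open>simp_all add: face_def r(1-6) r'(1-6)\<close>)
  qed
  have Eh: "?E \<subseteq> half D" using eh by simp
  note b1 = bword_bypass[OF j(1) j'(1), of ?E, unfolded j(2) j'(2) rewire_simps, OF refl refl refl tt Et Eh no bp]
  note b2 = bword_bypass[OF j'(1) j(1), of ?E, unfolded j(2) j'(2) rewire_simps, OF refl refl refl tt Et Eh no(2) no(1) bp[symmetric]]
  show ?thesis
  proof (rule val_congr[OF j(1) j'(1) _ _ assms(6)])
    show "card (tips ?R) = m" "card (tips ?S) = m" by (simp_all only: j(2) j'(2) assms(5))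
    show "freeface ?R \<longleftrightarrow> freeface ?S" using b1(2) b2(2) by blast
    show "\<exists>w'. bword ?R w' \<and> bword ?S w'" if "bword ?R w" for w using b1(1)[of w] that by blast
    show "\<exists>w'. bword ?R w'" if "bword ?S w" for w using b2(1)[of w] that by blast
  qed
qed

lemma flip_rewire:
  assumes "jacobi_diagram g D" "inner_edge D e" "distinct [a, b, c, d]"
    "{a, b, c, d} = {rot D e, rot D (rot D e), rot D (opp D e), rot D (rot D (opp D e))}"
    "\<And>h. h \<in> Z \<Longrightarrow> h \<in> half D \<and> rot D h \<in> Z" "Z \<inter> {e, opp D e, a, b, c, d} = {}"
  shows "flip Z (rewire e a b c d D) = rewire e a b c d (flip Z D)"
proof -
  interpret jacobi g D by unfold_locales fact
  note r = rewire_rot(7)[OF assms(2-4)]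
  have "rot (flip Z (rewire e a b c d D)) h = rot (rewire e a b c d (flip Z D)) h" for h
  proof (cases "h \<in> Z")
    case True
    then have n: "h \<notin> {e, opp D e, a, b, c, d}" "rot D h \<notin> {e, opp D e, a, b, c, d}" using assms(5,6) by blast+
    have "rot (rewire e a b c d (flip Z D)) h = rot (flip Z D) h"
      using n(1) unfolding rewire_def cyc3_def by simp
    then show ?thesis using True r[OF n(1)] r[OF n(2)] by simp
  next
    case False
    then show ?thesis unfolding rewire_def cyc3_def by simp
  qed
  then show ?thesis unfolding flip_def rewire_def by (auto simp: fun_eq_iff)
qed

lemma flip_rewire_vertex:
  assumes "distinct [e, opp D e, a, b, c, d]"
  shows "flip {e, a, b} (rewire e a b c d D) = rewire e b a c d D"
    "flip {opp D e, c, d} (rewire e a b c d D) = rewire e a b d c D"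
  unfolding flip_def rewire_def cyc3_def using distinct6[OF assms] by (auto simp: fun_eq_iff)

lemma trivalent_rewire:
  assumes "jacobi_diagram g D" "inner_edge D e" "distinct [a, b, c, d]"
    "{a, b, c, d} = {rot D e, rot D (rot D e), rot D (opp D e), rot D (rot D (opp D e))}"
  shows "trivalent_vertices (rewire e a b c d D) =
    insert {e, a, b} (insert {opp D e, c, d} (trivalent_vertices D - {vertex D e, vertex D (opp D e)}))"
    "v \<in> trivalent_vertices D - {vertex D e, vertex D (opp D e)} \<Longrightarrow> v \<inter> {e, opp D e, a, b, c, d} = {}"
proof -
  interpret jacobi g D by unfold_locales fact
  let ?R = "rewire e a b c d D" and ?T = "{e, opp D e, a, b, c, d}"
  note r = rewire_rot[OF assms(2-4)] and j = rewire_jacobi[OF assms(2-4)]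
  interpret R: jacobi g ?R by unfold_locales (rule j(1))
  have eh: "e \<in> half D" "opp D e \<in> half D" using assms(2) by (auto simp: inner_edge_def)
  have six: "?T = vertex D e \<union> vertex D (opp D e)" using assms(4) by (auto simp: vertex_def)
  show disj: "v \<inter> ?T = {}" if v: "v \<in> trivalent_vertices D - {vertex D e, vertex D (opp D e)}" for v
  proof -
    have "v \<in> vertices D" "vertex D e \<in> vertices D" "vertex D (opp D e) \<in> vertices D"
      using v eh by (auto simp: trivalent_vertices_def vertices_eq)
    then show ?thesis unfolding six using vertices_disjoint v by blast
  qed
  have out: "vertex ?R h = vertex D h" if "h \<in> half D" "h \<notin> ?T" for h
  proof -
    have "rot D h \<notin> ?T" using r(10)[OF that(1)] that(2) by blast
    then show ?thesis unfolding vertex_def using r(7)[OF that(2)] r(7)[of "rot D h"] by simp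
  qed
  have vin: "vertex ?R h = {e, a, b}" if "h \<in> {e, a, b}" for h
    using that unfolding vertex_def by (elim insertE emptyE) (simp_all add: r(1-6) insert_commute)
  have vin': "vertex ?R h = {opp D e, c, d}" if "h \<in> {opp D e, c, d}" for h
    using that unfolding vertex_def by (elim insertE emptyE) (simp_all add: r(1-6) insert_commute)
  have ntT: "h \<in> half D - tips D" if "h \<in> ?T" for h using r(8) r(11)[OF that] that by (auto simp: tips_def)
  show "trivalent_vertices ?R = insert {e, a, b} (insert {opp D e, c, d} (trivalent_vertices D - {vertex D e, vertex D (opp D e)}))"
    unfolding R.trivalent_eq j(2) rewire_simps
  proof (intro equalityI subsetI)
    fix v assume "v \<in> vertex ?R ` (half D - tips D)"
    then obtain h where h: "h \<in> half D" "h \<notin> tips D" "v = vertex ?R h" by blast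
    show "v \<in> insert {e, a, b} (insert {opp D e, c, d} (trivalent_vertices D - {vertex D e, vertex D (opp D e)}))"
    proof (cases "h \<in> ?T")
      case True
      then have "h \<in> {e, a, b} \<or> h \<in> {opp D e, c, d}" by blast
      then have "v = {e, a, b} \<or> v = {opp D e, c, d}" using vin[of h] vin'[of h] unfolding h(3) by metis
      then show ?thesis by (elim disjE) simp_all
    next
      case False
      then have v: "v = vertex D h" using out h by simp
      have "h \<notin> vertex D e" "h \<notin> vertex D (opp D e)" using False unfolding six by blast+
      then have "v \<noteq> vertex D e" "v \<noteq> vertex D (opp D e)" unfolding v using self_in_vertex by blast+
      moreover have "v \<in> trivalent_vertices D" unfolding v using h by (simp add: trivalent_iff tips_def)
      ultimately show ?thesis by blast
    qed
  next
    fix v assume "v \<in> insert {e, a, b} (insert {opp D e, c, d} (trivalent_vertices D - {vertex D e, vertex D (opp D e)}))"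
    then consider "v = {e, a, b}" | "v = {opp D e, c, d}" | "v \<in> trivalent_vertices D - {vertex D e, vertex D (opp D e)}" by blast
    then show "v \<in> vertex ?R ` (half D - tips D)"
    proof cases
      case 1 then show ?thesis using vin[of e] ntT[of e] by blast
    next
      case 2 then show ?thesis using vin'[of "opp D e"] ntT[of "opp D e"] by blast
    next
      case 3
      then obtain h where h: "h \<in> half D - tips D" "v = vertex D h" unfolding trivalent_eq by blast
      then have "h \<notin> ?T" using disj[OF 3] self_in_vertex[of h] by blast
      then show ?thesis using out[of h] h by blast
    qed
  qed
qed

lemma insert2_diff: "a \<noteq> u \<Longrightarrow> b \<noteq> u \<Longrightarrow> insert a (insert b (X - {v, w})) - {u} = insert a (insert b (X - {v, w, u}))"
  by blast

text \<open>For each choice \<open>Y\<close> away from \<open>e\<close> there are four states at the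
  two ends of \<open>e\<close>; reversing an end exchanges \<open>a\<close> and \<open>b\<close>, or
  \<open>c\<close> and \<open>d\<close>, so each of them is again a rewiring.\<close>

lemma chi_at_rewire:
  assumes "jacobi_diagram g D" "inner_edge D e" "distinct [a, b, c, d]"
    "{a, b, c, d} = {rot D e, rot D (rot D e), rot D (opp D e), rot D (rot D (opp D e))}"
    "u \<in> trivalent_vertices D" "u \<noteq> vertex D e" "u \<noteq> vertex D (opp D e)"
  shows "chi_at u (rewire e a b c d D) =
    (\<Sum>Y\<in>Pow (trivalent_vertices D - {vertex D e, vertex D (opp D e), u}). frag_cmul ((-1) ^ card Y)
      (val (rewire e a b c d (flip (\<Union>Y) D)) - val (rewire e b a c d (flip (\<Union>Y) D)) -
       (val (rewire e a b d c (flip (\<Union>Y) D)) - val (rewire e b a d c (flip (\<Union>Y) D)))))"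
proof -
  interpret jacobi g D by unfold_locales fact
  let ?R = "rewire e a b c d D" and ?T = "{e, opp D e, a, b, c, d}"
  let ?A = "{e, a, b}" and ?B = "{opp D e, c, d}"
  let ?W = "trivalent_vertices D - {vertex D e, vertex D (opp D e), u}"
  note r = rewire_rot[OF assms(2-4)] and j = rewire_jacobi[OF assms(2-4)]
  note t = trivalent_rewire[OF assms(1-4)]
  note ne = distinct6[OF r(9)]
  have u: "u \<inter> ?T = {}" by (rule t(2)) (use assms(5-7) in blast)
  have WT: "v \<inter> ?T = {}" if "v \<in> ?W" for v by (rule t(2)) (use that in blast)
  have AW: "?A \<notin> ?W" "?B \<notin> ?W" "?A \<noteq> ?B" "?A \<noteq> u" "?B \<noteq> u" using WT u ne by blast+
  have T: "trivalent_vertices ?R - {u} = insert ?A (insert ?B ?W)" unfolding t(1) by (rule insert2_diff[OF AW(4,5)])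
  have fW: "finite ?W" "finite (insert ?B ?W)" "?A \<notin> insert ?B ?W" using AW by auto
  have *: "(\<Sum>Y\<in>Pow (insert ?A (insert ?B ?W)). frag_cmul ((-1) ^ card Y) (state Y ?R)) =
      (\<Sum>Y\<in>Pow ?W. frag_cmul ((-1) ^ card Y)
        (state Y ?R - state (insert ?A Y) ?R - (state (insert ?B Y) ?R - state (insert ?A (insert ?B Y)) ?R)))"
    unfolding signed_sum_Pow_insert[OF fW(2,3)] signed_sum_Pow_insert[OF fW(1) AW(2)] ..
  show ?thesis unfolding chi_at_def T *
  proof (rule sum.cong[OF refl])
    fix Y assume Y: "Y \<in> Pow ?W"
    then have YT: "Y \<subseteq> trivalent_vertices D" by blast
    have YR: "Y \<subseteq> trivalent_vertices ?R" "?A \<in> trivalent_vertices ?R" "?B \<in> trivalent_vertices ?R"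
      unfolding t(1) using Y by blast+
    have AY: "?A \<notin> Y" "?B \<notin> Y" using AW Y by blast+
    have d: "distinct [e, opp (flip (\<Union>Y) D) e, a, b, c, d]" "distinct [e, opp (flip (\<Union>Y) D) e, b, a, c, d]"
      "distinct [e, opp (flip (\<Union>Y) D) e, a, b, d, c]"
      using r(9) by auto
    have 0: "flip (\<Union>Y) ?R = rewire e a b c d (flip (\<Union>Y) D)"
      by (rule flip_rewire[OF assms(1-4) flip_Union(3)[OF assms(1) YT]]) (use WT Y in blast)+
    have ins: "flip (\<Union>(insert x X)) ?R = flip x (flip (\<Union>X) ?R)"
      if "x \<in> trivalent_vertices ?R" "X \<subseteq> trivalent_vertices ?R" "x \<notin> X" for x X
    proof -
      have "flip (\<Union>{x}) (flip (\<Union>X) ?R) = flip (\<Union>(({x} - X) \<union> (X - {x}))) ?R"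
        by (rule flip_Union_flip[OF j(1) that(2)]) (use that(1) in blast)
      moreover have "({x} - X) \<union> (X - {x}) = insert x X" using that(3) by blast
      ultimately show ?thesis by simp
    qed
    have 1: "flip (\<Union>(insert ?A Y)) ?R = rewire e b a c d (flip (\<Union>Y) D)"
      unfolding ins[OF YR(2,1) AY(1)] 0 by (rule flip_rewire_vertex(1)[OF d(1)])
    have 2: "flip (\<Union>(insert ?B Y)) ?R = rewire e a b d c (flip (\<Union>Y) D)"
      unfolding ins[OF YR(3,1) AY(2)] 0 using flip_rewire_vertex(2)[OF d(1)] by simp
    have 3: "flip (\<Union>(insert ?A (insert ?B Y))) ?R = rewire e b a d c (flip (\<Union>Y) D)"
    proof -
      have "flip (\<Union>(insert ?A (insert ?B Y))) ?R = flip ?A (flip (\<Union>(insert ?B Y)) ?R)"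
        by (rule ins) (use YR AY AW(3) in blast)+
      also have "\<dots> = rewire e b a d c (flip (\<Union>Y) D)" unfolding 2 by (rule flip_rewire_vertex(1)[OF d(3)])
      finally show ?thesis .
    qed
    show "frag_cmul ((-1) ^ card Y)
        (state Y ?R - state (insert ?A Y) ?R - (state (insert ?B Y) ?R - state (insert ?A (insert ?B Y)) ?R)) =
      frag_cmul ((-1) ^ card Y)
      (val (rewire e a b c d (flip (\<Union>Y) D)) - val (rewire e b a c d (flip (\<Union>Y) D)) -
       (val (rewire e a b d c (flip (\<Union>Y) D)) - val (rewire e b a d c (flip (\<Union>Y) D))))"
      unfolding state_def 0 1 2 3 ..
  qed
qed

text \<open>Each of I, H and X contributes four states at \<open>e\<close>. After contraction of
  \<open>e\<close> such a state is a cyclic order of the four neighbours; each of the six cyclic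
  orders arises from exactly two of the twelve states, belonging to different diagrams, with signs
  that cancel. All four states are available because the fixed vertex is not an end of
  \<open>e\<close>.\<close>

lemma chi_at_ihx:
  assumes "jac g n D" "inner_edge D e" "card (tips D) = m" "0 < m"
    "u \<in> trivalent_vertices D" "u \<noteq> vertex D e" "u \<noteq> vertex D (opp D e)"
  shows "congr g m (chi_at u D) (chi_at u (ihx_H e D) - chi_at u (ihx_X e D))"
proof -
  interpret jacobi g D using assms(1) by (rule jac_jacobi)
  define x2 x1 x3 x4 where x: "x2 = rot D e" "x1 = rot D x2" "x3 = rot D (opp D e)" "x4 = rot D x3"
  let ?V = "{rot D e, rot D (rot D e), rot D (opp D e), rot D (rot D (opp D e))}"
  let ?W = "trivalent_vertices D - {vertex D e, vertex D (opp D e), u}"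
  have ne: "distinct [x1, x2, x3, x4]"
    using distinct6[OF inner_edge_distinct[OF assms(2)]] by (simp add: x)
  have V: "?V = {x1, x2, x3, x4}" by (auto simp: x)
  have I: "D = rewire e x2 x1 x3 x4 D" using rewire_self[OF assms(2)] by (simp add: x)
  have H: "ihx_H e D = rewire e x1 x3 x4 x2 D" and X: "ihx_X e D = rewire e x2 x3 x4 x1 D"
    by (simp_all add: ihx_rewire x)
  let ?v = "\<lambda>Y a b c d. val (rewire e a b c d (flip (\<Union>Y) D))"
  let ?t = "\<lambda>a b c d Y. ?v Y a b c d - ?v Y b a c d - (?v Y a b d c - ?v Y b a d c)"
  have c: "chi_at u (rewire e a b c d D) = (\<Sum>Y\<in>Pow ?W. frag_cmul ((-1) ^ card Y) (?t a b c d Y))"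
    if "distinct [a, b, c, d]" "{a, b, c, d} = {x1, x2, x3, x4}" for a b c d
    by (rule chi_at_rewire[OF jd assms(2) that(1) _ assms(5-7)]) (simp only: that(2) V)
  have "congr g m (\<Sum>Y\<in>Pow ?W. frag_cmul ((-1) ^ card Y) (?t x2 x1 x3 x4 Y))
     (\<Sum>Y\<in>Pow ?W. frag_cmul ((-1) ^ card Y) (?t x1 x3 x4 x2 Y - ?t x2 x3 x4 x1 Y))"
  proof (rule congr_sum, rule congr_cmul)
    fix Y assume Y: "Y \<in> Pow ?W"
    let ?E = "flip (\<Union>Y) D"
    have YT: "Y \<subseteq> trivalent_vertices D" using Y by blast
    note f = flip_Union[OF jd YT]
    have six: "x \<notin> \<Union>Y" if "x \<in> {e, opp D e, x2, x1, x3, x4}" for x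
    proof -
      have "v \<inter> {e, opp D e, x2, x1, x3, x4} = {}" if "v \<in> Y" for v
        by (rule trivalent_rewire(2)[OF jd assms(2)]) (use ne V that Y in auto)
      then show ?thesis using that by blast
    qed
    have s6: "e \<notin> \<Union>Y" "x2 \<notin> \<Union>Y" "opp D e \<notin> \<Union>Y" "x3 \<notin> \<Union>Y" by (rule six; simp)+
    have rE: "rot ?E e = x2" "rot ?E x2 = x1" "rot ?E (opp D e) = x3" "rot ?E x3 = x4"
      unfolding flip_simps by (simp_all only: s6 if_False x(1)[symmetric] x(2)[symmetric] x(3)[symmetric] x(4)[symmetric])
    have ie: "inner_edge ?E e"
      using assms(2) rE by (simp add: inner_edge_def x del: flip_simps(4))
    have VE: "{rot ?E e, rot ?E (rot ?E e), rot ?E (opp ?E e), rot ?E (rot ?E (opp ?E e))} = {x1, x2, x3, x4}"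
      unfolding flip_simps(2) rE by auto
    have cy: "?v Y a b c d - ?v Y b c d a \<in> relations g m" if "distinct [a, b, c, d]" "{a, b, c, d} = {x1, x2, x3, x4}" for a b c d
      using val_rewire[OF f(1) ie that(1) _ _ assms(4)] that(2) unfolding VE f(2) congr_def using assms(3) by blast
    \<comment> \<open>One line for each cyclic order of the four neighbours, matching its two
      splittings.\<close>
    have "?v Y x2 x1 x3 x4 - ?v Y x1 x3 x4 x2 \<in> relations g m"
      "?v Y x1 x2 x3 x4 - ?v Y x2 x3 x4 x1 \<in> relations g m"
      "?v Y x3 x2 x1 x4 - ?v Y x2 x1 x4 x3 \<in> relations g m"
      "?v Y x3 x1 x2 x4 - ?v Y x1 x2 x4 x3 \<in> relations g m"
      "?v Y x2 x3 x1 x4 - ?v Y x3 x1 x4 x2 \<in> relations g m"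
      "?v Y x1 x3 x2 x4 - ?v Y x3 x2 x4 x1 \<in> relations g m"
      by (rule cy; use ne in auto)+
    note q = this
    have "(?v Y x2 x1 x3 x4 - ?v Y x1 x3 x4 x2) - (?v Y x1 x2 x3 x4 - ?v Y x2 x3 x4 x1)
       + (?v Y x3 x2 x1 x4 - ?v Y x2 x1 x4 x3) - (?v Y x3 x1 x2 x4 - ?v Y x1 x2 x4 x3)
       - (?v Y x2 x3 x1 x4 - ?v Y x3 x1 x4 x2) + (?v Y x1 x3 x2 x4 - ?v Y x3 x2 x4 x1) \<in> relations g m"
      by (intro relsub(2) relsub(4) q)
    then show "congr g m (?t x2 x1 x3 x4 Y) (?t x1 x3 x4 x2 Y - ?t x2 x3 x4 x1 Y)"
      unfolding congr_def by (simp add: algebra_simps)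
  qed
  also have "(\<Sum>Y\<in>Pow ?W. frag_cmul ((-1) ^ card Y) (?t x1 x3 x4 x2 Y - ?t x2 x3 x4 x1 Y)) =
     (\<Sum>Y\<in>Pow ?W. frag_cmul ((-1) ^ card Y) (?t x1 x3 x4 x2 Y)) - (\<Sum>Y\<in>Pow ?W. frag_cmul ((-1) ^ card Y) (?t x2 x3 x4 x1 Y))"
    by (simp only: frag_cmul_diff2[of _ "?t x1 x3 x4 x2 _"] sum_subtractf)
  also have "\<dots> = chi_at u (rewire e x1 x3 x4 x2 D) - chi_at u (rewire e x2 x3 x4 x1 D)"
    by (subst (1 2) c) (use ne in auto)
  also have "(\<Sum>Y\<in>Pow ?W. frag_cmul ((-1) ^ card Y) (?t x2 x1 x3 x4 Y)) = chi_at u (rewire e x2 x1 x3 x4 D)"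
    by (subst c) (use ne in auto)
  finally show ?thesis unfolding H X using I by simp
qed

subsection \<open>The map induced by the state sum\<close>

definition chi :: "'h diagram \<Rightarrow> nat diagram \<Rightarrow>\<^sub>0 int" where
  "chi D = chi_at (SOME v. v \<in> trivalent_vertices D) D"

text \<open>The relations live in the module of all Betti numbers together. Each relator involves a
  single number of legs, so extending by zero off the two-loop diagrams is compatible with
  them.\<close>

definition chi_map :: "(nat diagram \<Rightarrow>\<^sub>0 int) \<Rightarrow> nat diagram \<Rightarrow>\<^sub>0 int" where
  "chi_map = frag_extend (\<lambda>D. if betti1 D = 2 then chi D else 0)"

lemma betti1_two_iff: "jac g (m + 2) D \<Longrightarrow> betti1 D = 2 \<longleftrightarrow> card (tips D) = m"
  using jac_cards(2)[of g "m + 2" D] by auto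

lemma betti1_one_iff: "jac g m D \<Longrightarrow> betti1 D = 1 \<longleftrightarrow> card (tips D) = m"
  using jac_cards(2)[of g m D] by auto

lemma chi_congr:
  assumes "jac g (m + 2) D" "card (tips D) = m" "0 < m" "u \<in> trivalent_vertices D"
  shows "congr g m (chi D) (chi_at u D)"
proof -
  have "(SOME v. v \<in> trivalent_vertices D) \<in> trivalent_vertices D" using assms(4) by (rule someI)
  then show ?thesis unfolding chi_def by (rule chi_at_indep[OF assms(1-3) _ assms(4)])
qed

lemma chi_map_of: "chi_map (frag_of D) = (if betti1 D = 2 then chi D else 0)"
  by (simp add: chi_map_def)

lemma chi_map_fr:
  assumes "jac g (m + 2) D" "card (tips D) = m" "0 < m" "u \<in> trivalent_vertices D"
  shows "congr g m (chi_map (fr D)) (chi_at u D)"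
proof -
  interpret jacobi g D using assms(1) by (rule jac_jacobi)
  obtain E :: "nat diagram" and f where E: "jac g (m + 2) E" "iso_by f D E" "fr D = frag_of E"
    using fr_ex[OF assms(1)] by blast
  have t: "card (tips E) = m" using iso_by_jac(2)[OF assms(1) E(2)] assms(2) by simp
  then have b: "betti1 E = 2" using betti1_two_iff[OF E(1)] by simp
  note u = chi_at_iso[OF jd E(2) assms(4)]
  have "congr g m (chi E) (chi_at (f ` u) E)" by (rule chi_congr[OF E(1) t assms(3)]) (use u in blast)
  then show ?thesis unfolding E(3) chi_map_of using b u by simp
qed

lemma exists_other_trivalent:
  assumes "jac g n D" "card F < n" "finite F"
  shows "\<exists>u\<in>trivalent_vertices D. u \<notin> F"
proof (rule ccontr)
  assume "\<not> ?thesis"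
  then have "trivalent_vertices D \<subseteq> F" by blast
  then have "card (trivalent_vertices D) \<le> card F" by (rule card_mono[OF assms(3)])
  then show False using assms(1,2) by (simp add: jac_def)
qed

text \<open>For each relator the fixed vertex is chosen away from the vertices involved. This is
  possible since at most two are involved and there are \<open>m + 2\<close>, hence at least three,
  trivalent vertices.\<close>

lemma chi_map_relations:
  assumes "0 < m" "x \<in> relations g (m + 2)"
  shows "chi_map x \<in> relations g m"
proof (rule relations_hom[OF is_sub_relations _ _ assms(2)])
  show "chi_map (x - y) = chi_map x - chi_map y" for x y by (simp add: chi_map_def frag_extend_diff)
  have add: "chi_map (x + y) = chi_map x + chi_map y" for x y by (simp add: chi_map_def frag_extend_add)
  have diff: "chi_map (x - y) = chi_map x - chi_map y" for x y by (simp add: chi_map_def frag_extend_diff)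
  have ct: "congr g m (chi_map (frag_of D)) (chi_at u D)"
    if "jac g (m + 2) D" "card (tips D) = m" "u \<in> trivalent_vertices D" for u and D :: "nat diagram"
    unfolding chi_map_of using betti1_two_iff[OF that(1)] that(2) chi_congr[OF that(1,2) assms(1) that(3)] by simp
  have c0: "chi_map (frag_of D) = 0" if "jac g (m + 2) D" "card (tips D) \<noteq> m" for D
    unfolding chi_map_of using betti1_two_iff[OF that(1)] that(2) by simp
  fix x assume "x \<in> relators g (m + 2)"
  then consider "x \<in> iso_relators g (m + 2)" | "x \<in> as_relators g (m + 2)" | "x \<in> ihx_relators g (m + 2)"
    | "x \<in> self_loop_relators g (m + 2)" by blast
  then show "chi_map x \<in> relations g m"
  proof cases
    case 1
    then obtain D E f where D: "x = frag_of D - frag_of E" "jac g (m + 2) D" "jac g (m + 2) E" "iso_by f D E"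
      unfolding iso_relators_def jac_mem diagram_iso_iff by blast
    note t = iso_by_jac(2)[OF D(2,4)]
    show ?thesis
    proof (cases "card (tips D) = m")
      case True
      obtain u where u: "u \<in> trivalent_vertices D" using exists_other_trivalent[OF D(2), of "{}"] by auto
      note v = chi_at_iso[OF _ D(4) u]
      have jD: "jacobi_diagram g D" using D(2) by (simp add: jac_def)
      have "congr g m (chi_map (frag_of D)) (chi_at u D)" by (rule ct[OF D(2) True u])
      moreover have "congr g m (chi_map (frag_of E)) (chi_at (f ` u) E)"
        by (rule ct[OF D(3)]) (use True t v[OF jD] in auto)
      ultimately have "congr g m (chi_map (frag_of D)) (chi_map (frag_of E))"
        using v[OF jD] by (metis congr_sym congr_trans)
      then show ?thesis unfolding D(1) diff congr_def .
    next
      case False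
      then show ?thesis unfolding D(1) diff using c0[OF D(2)] c0[OF D(3)] t relsub(1) by simp
    qed
  next
    case 2
    then obtain D h where D: "x = frag_of D + frag_of (flip (vertex D h) D)" "jac g (m + 2) D" "h \<in> half D" "rot D h \<noteq> h"
      unfolding as_relators_eq by blast
    note j = flip_vertex_jac[OF D(2,3)]
    show ?thesis
    proof (cases "card (tips D) = m")
      case True
      obtain u where u: "u \<in> trivalent_vertices D" "u \<noteq> vertex D h"
        using exists_other_trivalent[OF D(2), of "{vertex D h}"] by auto
      have jD: "jacobi_diagram g D" using D(2) by (simp add: jac_def)
      have tf: "trivalent_vertices (flip (vertex D h) D) = trivalent_vertices D"
        by (rule flip_jac(3)[OF D(2)]) (rule vertex_closed[OF jD D(3)])
      have "congr g m (chi_map (frag_of D)) (chi_at u D)" by (rule ct[OF D(2) True u(1)])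
      moreover have "congr g m (chi_map (frag_of (flip (vertex D h) D))) (chi_at u (flip (vertex D h) D))"
        by (rule ct[OF j(1)]) (use j(2) True u tf in auto)
      ultimately have "congr g m (chi_map x) (chi_at u D + chi_at u (flip (vertex D h) D))"
        unfolding D(1) add by (rule congr_add)
      then show ?thesis unfolding chi_at_flip[OF D(2-4) u] by (simp add: congr_def)
    next
      case False
      then show ?thesis unfolding D(1) add using c0[OF D(2)] c0[OF j(1)] j(2) relsub(1) by simp
    qed
  next
    case 3
    then obtain D e where D: "x = frag_of D - frag_of (ihx_H e D) + frag_of (ihx_X e D)" "jac g (m + 2) D" "inner_edge D e"
      unfolding ihx_relators_eq by blast
    note j = ihx_jac[OF D(2,3)]
    show ?thesis
    proof (cases "card (tips D) = m")
      case True
      have "card {vertex D e, vertex D (opp D e)} < m + 2"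
        using card_insert_le_m1[of 2 "{vertex D (opp D e)}" "vertex D e"] assms(1) by (simp add: card_insert_if)
      then obtain u where u: "u \<in> trivalent_vertices D" "u \<noteq> vertex D e" "u \<noteq> vertex D (opp D e)"
        using exists_other_trivalent[OF D(2), of "{vertex D e, vertex D (opp D e)}"] by auto
      have jD: "jacobi_diagram g D" using D(2) by (simp add: jac_def)
      note dd = distinct6[OF jacobi.inner_edge_distinct[OF jac_jacobi[OF D(2)] D(3)]]
      have uH: "u \<in> trivalent_vertices (ihx_H e D)"
        unfolding ihx_rewire by (subst trivalent_rewire(1)[OF jD D(3)]) (use dd u in auto)
      have uX: "u \<in> trivalent_vertices (ihx_X e D)"
        unfolding ihx_rewire by (subst trivalent_rewire(1)[OF jD D(3)]) (use dd u in auto)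
      have "congr g m (chi_map (frag_of D)) (chi_at u D)" by (rule ct[OF D(2) True u(1)])
      moreover have "congr g m (chi_map (frag_of (ihx_H e D))) (chi_at u (ihx_H e D))"
        by (rule ct[OF j(1) _ uH]) (use j(2) True in simp)
      moreover have "congr g m (chi_map (frag_of (ihx_X e D))) (chi_at u (ihx_X e D))"
        by (rule ct[OF j(3) _ uX]) (use j(4) True in simp)
      ultimately have "congr g m (chi_map x) (chi_at u D - chi_at u (ihx_H e D) + chi_at u (ihx_X e D))"
        unfolding D(1) add diff by (intro congr_add congr_diff)
      also have "congr g m \<dots> 0"
        using chi_at_ihx[OF D(2,3) True assms(1) u] unfolding congr_def by (simp add: algebra_simps)
      finally show ?thesis by (simp only: congr_0_iff)
    next
      case False
      then show ?thesis unfolding D(1) add diff using c0[OF D(2)] c0[OF j(1)] c0[OF j(3)] j(2,4) relsub(1) by simp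
    qed
  next
    case 4
    then obtain D h where D: "x = frag_of D" "jac g (m + 2) D" "h \<in> half D" "opp D h \<in> {rot D h, rot D (rot D h)}"
      unfolding self_loop_relators_def jac_mem by blast
    show ?thesis
    proof (cases "card (tips D) = m")
      case True
      obtain u where u: "u \<in> trivalent_vertices D" "u \<noteq> vertex D h"
        using exists_other_trivalent[OF D(2), of "{vertex D h}"] by auto
      show ?thesis using ct[OF D(2) True u(1)] unfolding D(1) chi_at_self_loop[OF D(2-4) u] congr_0_iff .
    next
      case False
      then show ?thesis unfolding D(1) using c0[OF D(2)] relsub(1) by simp
    qed
  qed
qed

subsection \<open>The state sum of theta diagrams\<close>

definition left_vertex :: "theta_half set" where
  "left_vertex = {Rt Upper 0, Rt Lower 0, Rt Chord 0}"

datatype region = Outer | Upper_inner | Lower_inner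

text \<open>
  As long as the right end of the chord is not reversed, \<open>side Z\<close> is constant on the boundary
  components: they are those of the planar theta, with the feet in \<open>Z\<close> pushed to the other side of
  their strand.
\<close>

definition side :: "theta_half set \<Rightarrow> theta_half \<Rightarrow> region" where
  "side Z h = (case h of
      Rt s j \<Rightarrow> (case s of Upper \<Rightarrow> Upper_inner | Chord \<Rightarrow> Lower_inner | Lower \<Rightarrow> Outer)
    | Lt s j \<Rightarrow> (case s of Upper \<Rightarrow> Outer | Chord \<Rightarrow> Upper_inner | Lower \<Rightarrow> Lower_inner)
    | Foot s j \<Rightarrow> (if Foot s j \<in> Z then (case s of Upper \<Rightarrow> Upper_inner | Chord \<Rightarrow> Lower_inner | Lower \<Rightarrow> Lower_inner)
                   else (case s of Upper \<Rightarrow> Outer | Chord \<Rightarrow> Upper_inner | Lower \<Rightarrow> Outer))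
    | Tip s j \<Rightarrow> (if Foot s j \<in> Z then (case s of Upper \<Rightarrow> Upper_inner | Chord \<Rightarrow> Lower_inner | Lower \<Rightarrow> Lower_inner)
                   else (case s of Upper \<Rightarrow> Outer | Chord \<Rightarrow> Upper_inner | Lower \<Rightarrow> Outer)))"

locale theta_state =
  fixes g :: nat and as bs cs :: "label list" and Y :: "theta_half set set"
  assumes labs: "set as \<subseteq> labels g" "set bs \<subseteq> labels g" "set cs \<subseteq> labels g"
    and Y: "Y \<subseteq> trivalent_vertices (theta as bs cs) - {left_vertex}"
begin

abbreviation "D \<equiv> theta as bs cs"
abbreviation "len s \<equiv> length (tlegs as bs cs s)"
abbreviation "Z \<equiv> \<Union>Y"
abbreviation "R \<equiv> flip Z D"

sublocale jacobi g D
  by unfold_locales (rule theta_jacobi[OF labs])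

lemma Z_closed: "h \<in> Z \<Longrightarrow> h \<in> half D \<and> rot D h \<in> Z"
  using flip_Union(3)[OF jd, of Y h] Y by blast

lemma Z_rot: "h \<in> half D \<Longrightarrow> rot D h \<in> Z \<longleftrightarrow> h \<in> Z"
  using Z_closed[of h] Z_closed[of "rot D h"] Z_closed[of "rot D (rot D h)"] by auto

lemma jacobi_R: "jacobi_diagram g R" "tips R = tips D"
  using flip_Union(1,2)[OF jd, of Y] Y by blast+

lemma left_notin: "Rt s 0 \<notin> Z"
proof
  assume "Rt s 0 \<in> Z"
  then obtain v where v: "v \<in> Y" "Rt s 0 \<in> v" by blast
  then have "v = vertex D (Rt s 0)" using trivalent_memD Y by blast
  also have "\<dots> = left_vertex" by (cases s) (auto simp: vertex_def left_vertex_def)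
  finally show False using v(1) Y by blast
qed

lemma legs_Z:
  assumes "1 \<le> j" "j \<le> len s"
  shows "Lt s j \<in> Z \<longleftrightarrow> Foot s j \<in> Z" "Rt s j \<in> Z \<longleftrightarrow> Foot s j \<in> Z"
  using Z_rot[of "Foot s j"] Z_rot[of "Lt s j"] Z_rot[of "Rt s j"] assms by (auto split: if_splits)

lemma tips_Z: "Tip s j \<notin> Z"
proof
  assume "Tip s j \<in> Z"
  then obtain v where "v \<in> Y" "Tip s j \<in> v" by blast
  then have "rot D (Tip s j) \<noteq> Tip s j" using trivalent_memD Y by blast
  then show False by simp
qed

lemma right_Z: "Lt s (Suc (len s)) \<in> Z \<longleftrightarrow> Lt Upper (Suc (length as)) \<in> Z"
  using Z_rot[of "Lt Upper (Suc (length as))"] Z_rot[of "Lt Chord (Suc (length bs))"] by (cases s) auto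

text \<open>The test \<open>(s = Lower) = (Foot s j \<in> Z)\<close> says that the leg is drawn
  above its strand, as legs of \<open>Lower\<close> start out below it. A face runs below the strand
  along \<open>Rt\<close> and above it along \<open>Lt\<close>, and meets only the legs on its
  side.\<close>

lemma face_R:
  "j < len s \<Longrightarrow> face R (Rt s j) = (if (s = Lower) = (Foot s (Suc j) \<in> Z) then Rt s (Suc j) else Foot s (Suc j))"
  "1 \<le> j \<Longrightarrow> j \<le> len s \<Longrightarrow> face R (Lt s (Suc j)) = (if (s = Lower) = (Foot s j \<in> Z) then Foot s j else Lt s j)"
  "face R (Foot s j) = Tip s j"
  "1 \<le> j \<Longrightarrow> j \<le> len s \<Longrightarrow> face R (Tip s j) = (if (s = Lower) = (Foot s j \<in> Z) then Lt s j else Rt s j)"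
  "face R (Lt s (Suc 0)) = Rt (case s of Upper \<Rightarrow> Lower | Lower \<Rightarrow> Chord | Chord \<Rightarrow> Upper) 0"
proof -
  show "face R (Rt s j) = (if (s = Lower) = (Foot s (Suc j) \<in> Z) then Rt s (Suc j) else Foot s (Suc j))" if j: "j < len s"
    using j legs_Z[of "Suc j" s] unfolding face_def flip_simps theta_opp by (cases s) (simp_all del: Union_iff)
  show "face R (Lt s (Suc j)) = (if (s = Lower) = (Foot s j \<in> Z) then Foot s j else Lt s j)" if j: "1 \<le> j" "j \<le> len s"
    using j legs_Z[OF j] unfolding face_def flip_simps theta_opp by (cases s) (simp_all del: Union_iff)
  show "face R (Foot s j) = Tip s j" using tips_Z[of s j] unfolding face_def flip_simps theta_opp by (simp del: Union_iff)
  show "face R (Tip s j) = (if (s = Lower) = (Foot s j \<in> Z) then Lt s j else Rt s j)" if j: "1 \<le> j" "j \<le> len s"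
    using j unfolding face_def flip_simps theta_opp by (simp del: Union_iff)
  show "face R (Lt s (Suc 0)) = Rt (case s of Upper \<Rightarrow> Lower | Lower \<Rightarrow> Chord | Chord \<Rightarrow> Upper) 0"
    using left_notin[of s] unfolding face_def flip_simps theta_opp by (cases s) (simp_all del: Union_iff)
qed

lemma face_R_end:
  "face R (Rt s (len s)) =
    (if Lt Upper (Suc (length as)) \<in> Z
     then (case s of Upper \<Rightarrow> Lt Lower (Suc (length cs)) | Lower \<Rightarrow> Lt Chord (Suc (length bs)) | Chord \<Rightarrow> Lt Upper (Suc (length as)))
     else (case s of Upper \<Rightarrow> Lt Chord (Suc (length bs)) | Chord \<Rightarrow> Lt Lower (Suc (length cs)) | Lower \<Rightarrow> Lt Upper (Suc (length as))))"
  using right_Z[of s] unfolding face_def flip_simps theta_opp by (cases s) (simp_all del: Union_iff)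

lemma side_face:
  assumes "Lt Upper (Suc (length as)) \<notin> Z" "h \<in> half D"
  shows "side Z (face R h) = side Z h"
proof (cases h)
  case (Rt s j)
  then consider "j < len s" | "j = len s" using assms(2) by fastforce
  then show ?thesis
  proof cases
    case 1 then show ?thesis unfolding Rt face_R(1)[OF 1] by (cases s) (auto simp: side_def simp del: Union_iff)
  next
    case 2 then show ?thesis unfolding Rt 2 face_R_end using assms(1) by (cases s) (auto simp: side_def simp del: Union_iff)
  qed
next
  case (Lt s j)
  then consider "j = Suc 0" | i where "j = Suc i" "1 \<le> i" "i \<le> len s" using assms(2) by (cases j) fastforce+
  then show ?thesis
  proof cases
    case 1 then show ?thesis unfolding Lt 1 face_R(5) by (cases s) (auto simp: side_def)
  next
    case 2 show ?thesis unfolding Lt 2(1) face_R(2)[OF 2(2,3)] by (cases s) (auto simp: side_def simp del: Union_iff)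
  qed
next
  case (Foot s j) then show ?thesis by (simp add: face_R(3) side_def del: Union_iff)
next
  case (Tip s j)
  then have "1 \<le> j" "j \<le> len s" using assms(2) by auto
  from face_R(4)[OF this] show ?thesis unfolding Tip by (cases s) (auto simp: side_def simp del: Union_iff)
qed

lemma chain_side:
  assumes "Lt Upper (Suc (length as)) \<notin> Z"
  shows "chain (face R) z xs \<Longrightarrow> set xs \<subseteq> half D \<Longrightarrow> x \<in> set xs \<Longrightarrow> side Z x = side Z z"
proof (induction xs arbitrary: x)
  case (Cons y r)
  have c: "face R y = (if r = [] then z else hd r)" "chain (face R) z r" using Cons.prems(1) by (auto simp: chain_Cons)
  have "side Z y = side Z z"
  proof (cases "r = []")
    case True then show ?thesis using c(1) side_face[OF assms, of y] Cons.prems(2) by simp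
  next
    case False
    then have "side Z (hd r) = side Z z" using Cons.IH[of "hd r"] c Cons.prems(2) by simp
    then show ?thesis using c(1) False side_face[OF assms, of y] Cons.prems(2) by simp
  qed
  then show ?case using Cons c by auto
qed simp

lemma bword_side:
  assumes "Lt Upper (Suc (length as)) \<notin> Z" "bword R w" "x \<in> tips D" "y \<in> tips D"
  shows "side Z x = side Z y"
proof -
  obtain xs where xs: "bword_by R xs w" using assms(2) by (auto simp: bword_def)
  then have c: "chain (face R) (hd xs) xs" "set xs \<subseteq> half D" "tips D \<subseteq> set xs"
    unfolding bword_by_def loop_def jacobi_R(2) by auto
  show ?thesis using chain_side[OF assms(1) c(1,2)] c(3) assms(3,4) by (metis subsetD)
qed

text \<open>With one end of the chord reversed, the theta without its legs has a single boundary
  component, which runs along both sides of every strand. A face avoiding all tips would have to run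
  along both sides of the upper strand and miss its first leg.\<close>

lemma no_freeface:
  assumes "Lt Upper (Suc (length as)) \<in> Z" "as \<noteq> []"
  shows "\<not> freeface R"
proof
  assume "freeface R"
  then obtain F where F: "F \<noteq> {}" "F \<subseteq> half D" "F \<inter> tips D = {}" "face R ` F \<subseteq> F"
    unfolding freeface_def jacobi_R(2) flip_simps(1) by metis
  have fF: "face R x \<in> F" if "x \<in> F" for x using that F(4) by blast
  have nT: "Tip s j \<notin> F" for s j
  proof
    assume t: "Tip s j \<in> F"
    then have "Tip s j \<in> tips D" using F(2) by (auto simp: tips_def)
    then show False using t F(3) by blast
  qed
  have nF: "Foot s j \<notin> F" for s j using fF[of "Foot s j"] nT[of s j] by (auto simp: face_R(3))
  have r: "Rt s (Suc j) \<in> F" if "Rt s j \<in> F" "j < len s" for s j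
    using fF[OF that(1)] nF[of s "Suc j"] unfolding face_R(1)[OF that(2)] by (auto split: if_splits)
  have l: "Lt s j \<in> F" if "Lt s (Suc j) \<in> F" "1 \<le> j" "j \<le> len s" for s j
    using fF[OF that(1)] nF[of s j] unfolding face_R(2)[OF that(2,3)] by (auto split: if_splits)
  have rr: "Rt s (len s) \<in> F" if "Rt s j \<in> F" for s j
  proof -
    have "j \<le> len s" using that F(2) by auto
    then show ?thesis using that by (induction rule: inc_induct) (auto intro: r)
  qed
  have ll: "Lt s (Suc 0) \<in> F" if "Lt s (Suc i) \<in> F" "i \<le> len s" for s i
    using that
  proof (induction i)
    case (Suc i)
    have "Lt s (Suc i) \<in> F" using Suc.prems l[of s "Suc i"] by simp
    then show ?case using Suc by simp
  qed
  have L: "Rt (case s of Upper \<Rightarrow> Lower | Lower \<Rightarrow> Chord | Chord \<Rightarrow> Upper) 0 \<in> F" if "Lt s (Suc i) \<in> F" "i \<le> len s" for s i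
    using fF[OF ll[OF that]] unfolding face_R(5) .
  have E: "Lt (case s of Upper \<Rightarrow> Lower | Lower \<Rightarrow> Chord | Chord \<Rightarrow> Upper) (Suc (len (case s of Upper \<Rightarrow> Lower | Lower \<Rightarrow> Chord | Chord \<Rightarrow> Upper))) \<in> F"
    if "Rt s j \<in> F" for s j
    using fF[OF rr[OF that]] unfolding face_R_end using assms(1) by (cases s) (simp_all del: Union_iff)
  have step: "Rt Chord 0 \<in> F" "Lt Lower (Suc (length cs)) \<in> F" if "Rt Upper j \<in> F" for j
    using E[OF that] L[of Lower "length cs"] by auto
  have step': "Rt Lower 0 \<in> F" "Lt Upper (Suc (length as)) \<in> F" if "Rt Chord j \<in> F" for j
    using E[OF that] L[of Upper "length as"] by auto
  have step'': "Rt Upper 0 \<in> F" "Lt Chord (Suc (length bs)) \<in> F" if "Rt Lower j \<in> F" for j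
    using E[OF that] L[of Chord "length bs"] by auto
  have ex: "\<exists>s j. Rt s j \<in> F"
  proof -
    obtain x where x: "x \<in> F" using F(1) by blast
    then have xh: "x \<in> half D" using F(2) by blast
    show ?thesis
    proof (cases x)
      case (Lt s j)
      then obtain i where "j = Suc i" "i \<le> len s" using xh by (cases j) auto
      then show ?thesis using L[of s i] x Lt by blast
    next
      case (Rt s j) then show ?thesis using x by blast
    qed (use x nF nT in auto)
  qed
  then obtain s j where "Rt s j \<in> F" by blast
  then have U: "Rt Upper 0 \<in> F" by (cases s) (use step step' step'' in blast)+
  then have L1: "Lt Upper (Suc (length as)) \<in> F" using step step' by blast
  have p: "1 \<le> length as" using assms(2) by (simp add: Suc_leI)
  have "Lt Upper (Suc 1) \<in> F"
  proof -
    have "Lt Upper (Suc i) \<in> F" if "1 \<le> i" "i \<le> length as" for i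
      using that(2,1)
    proof (induction rule: inc_induct)
      case base show ?case by (rule L1)
    next
      case (step n) then show ?case using l[of Upper "Suc n"] by simp
    qed
    then show ?thesis using p by blast
  qed
  \<comment> \<open>The face above the strand misses the leg only if it is reversed, while the face
    below misses it only if it is not.\<close>
  from fF[OF this] have "Foot Upper 1 \<in> Z" using face_R(2)[of 1 Upper] p nF by (auto split: if_splits simp del: Union_iff)
  moreover have "Foot Upper 1 \<notin> Z"
  proof
    assume z: "Foot Upper 1 \<in> Z"
    have "0 < len Upper" using assms(2) by simp
    from face_R(1)[OF this] have "face R (Rt Upper 0) = Foot Upper 1" using z by (simp del: Union_iff)
    then show False using fF[OF U] nF[of Upper 1] by simp
  qed
  ultimately show False by blast
qed

text \<open>If the right end of the chord is reversed, there is no free face. Otherwise all legs lie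
  in one region, and the only region available to both upper and lower legs is \<open>Outer\<close>.
  Legs of the chord can never lie there, and upper and lower ones do so only when unreversed; thus
  \<open>bs\<close> is empty and no vertex is reversed.\<close>

lemma state_zero:
  assumes "as \<noteq> []" "cs \<noteq> []" "bs \<noteq> [] \<or> Y \<noteq> {}"
  shows "state Y D = 0"
proof -
  have "\<not> (freeface R \<and> (\<exists>w. bword R w))"
  proof
    assume a: "freeface R \<and> (\<exists>w. bword R w)"
    then obtain w where w: "bword R w" by blast
    have nr: "Lt Upper (Suc (length as)) \<notin> Z" using no_freeface[OF _ assms(1)] a by blast
    note sd = bword_side[OF nr w]
    have tU: "Tip Upper j \<in> tips D" if "1 \<le> j" "j \<le> length as" for j using that by (simp add: tips_def)
    have tL: "Tip Lower j \<in> tips D" if "1 \<le> j" "j \<le> length cs" for j using that by (simp add: tips_def)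
    have tC: "Tip Chord j \<in> tips D" if "1 \<le> j" "j \<le> length bs" for j using that by (simp add: tips_def)
    have len: "1 \<le> length as" "1 \<le> length cs" using assms(1,2) by (simp_all add: Suc_leI)
    have s1: "side Z (Tip Upper j) \<in> {Outer, Upper_inner}" "side Z (Tip Lower j) \<in> {Outer, Lower_inner}"
      "side Z (Tip Chord j) \<in> {Upper_inner, Lower_inner}" for j
      by (simp_all add: side_def del: Union_iff)
    have out: "side Z x = Outer" if "x \<in> tips D" for x
    proof -
      have "side Z x = side Z (Tip Upper 1)" "side Z x = side Z (Tip Lower 1)"
        using sd[OF that tU[of 1]] sd[OF that tL[of 1]] len by auto
      then show ?thesis using s1(1,2)[of 1] by auto
    qed
    have "bs = []"
    proof (rule ccontr)
      assume "bs \<noteq> []"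
      then have "1 \<le> length bs" by (simp add: Suc_leI)
      then have "side Z (Tip Chord 1) = Outer" using out tC by blast
      then show False using s1(3)[of 1] by simp
    qed
    then have "Y \<noteq> {}" using assms(3) by blast
    then obtain v where v: "v \<in> Y" by blast
    then obtain h where h: "h \<in> half D - tips D" "v = vertex D h" using Y unfolding trivalent_eq by blast
    then have hZ: "h \<in> Z" using v self_in_vertex[of h] by blast
    have nf: "Foot s j \<notin> Z" if "1 \<le> j" "j \<le> len s" for s j
    proof -
      have "Tip s j \<in> tips D" using that by (simp add: tips_def)
      then have "side Z (Tip s j) = Outer" by (rule out)
      then show ?thesis using that \<open>bs = []\<close> by (cases s) (auto simp: side_def simp del: Union_iff split: if_splits)
    qed
    show False
    proof (cases h)
      case (Lt s j)
      then consider "j = Suc (len s)" | "1 \<le> j" "j \<le> len s" using h(1) by fastforce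
      then show ?thesis
      proof cases
        case 1 then show ?thesis using hZ Lt right_Z[of s] nr by blast
      next
        case 2 then show ?thesis using hZ Lt legs_Z(1)[OF 2] nf[OF 2] by blast
      qed
    next
      case (Rt s j)
      then consider "j = 0" | "1 \<le> j" "j \<le> len s" using h(1) by fastforce
      then show ?thesis
      proof cases
        case 1 then show ?thesis using hZ Rt left_notin[of s] by blast
      next
        case 2 then show ?thesis using hZ Rt legs_Z(2)[OF 2] nf[OF 2] by blast
      qed
    next
      case (Foot s j)
      then have "1 \<le> j" "j \<le> len s" using h(1) by auto
      then show ?thesis using hZ Foot nf by blast
    next
      case (Tip s j) then show ?thesis using hZ tips_Z by blast
    qed
  qed
  then show ?thesis unfolding state_def by (rule val_eq_0)
qed

end

lemma left_vertex_trivalent: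
  assumes "set as \<subseteq> labels g" "set bs \<subseteq> labels g" "set cs \<subseteq> labels g"
  shows "left_vertex \<in> trivalent_vertices (theta as bs cs)"
proof -
  interpret jacobi g "theta as bs cs" by unfold_locales (rule theta_jacobi[OF assms])
  have "left_vertex = vertex (theta as bs cs) (Rt Upper 0)" by (auto simp: vertex_def left_vertex_def)
  moreover have "vertex (theta as bs cs) (Rt Upper 0) \<in> trivalent_vertices (theta as bs cs)"
    by (subst trivalent_iff) simp_all
  ultimately show ?thesis by simp
qed

lemma chi_at_theta_ge1:
  assumes "set as \<subseteq> labels g" "set bs \<subseteq> labels g" "set cs \<subseteq> labels g" "as \<noteq> []" "bs \<noteq> []" "cs \<noteq> []"
  shows "chi_at left_vertex (theta as bs cs) = 0"
  unfolding chi_at_def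
proof (rule sum.neutral, rule ballI)
  fix Y assume "Y \<in> Pow (trivalent_vertices (theta as bs cs) - {left_vertex})"
  then interpret theta_state g as bs cs Y by unfold_locales (use assms in auto)
  show "frag_cmul ((-1) ^ card Y) (state Y (theta as bs cs)) = 0" using state_zero assms(4-6) by simp
qed

definition upper_walk :: "nat \<Rightarrow> theta_half list" where
  "upper_walk p = concat (map (\<lambda>j. [Lt Upper (Suc j), Foot Upper j, Tip Upper j]) (rev [1..<Suc p]))"

lemma upper_walk_Suc: "upper_walk (Suc p) = [Lt Upper (Suc (Suc p)), Foot Upper (Suc p), Tip Upper (Suc p)] @ upper_walk p"
  by (simp add: upper_walk_def)

lemma upper_walk_0: "upper_walk 0 = []"
  by (simp add: upper_walk_def)

lemma set_upper_walk: "set (upper_walk p) = (\<Union>j\<in>{1..p}. {Lt Upper (Suc j), Foot Upper j, Tip Upper j})"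
  by (induction p) (auto simp: upper_walk_0 upper_walk_Suc atLeastAtMostSuc_conv)

lemma distinct_upper_walk: "distinct (upper_walk p)"
  by (induction p) (auto simp: upper_walk_0 upper_walk_Suc set_upper_walk)

text \<open>The outer face passes the upper legs from right to left and then \<open>b\<close>. As
  the chord carries no legs, the region between it and the upper strand is a free face.\<close>

lemma theta_outer_word:
  assumes "set as \<subseteq> labels g" "b \<in> labels g" "as \<noteq> []"
  shows "bword (theta as [] [b]) (rev as @ [b])" "freeface (theta as [] [b])"
proof -
  let ?D = "theta as [] [b]" and ?p = "length as"
  interpret theta_state g as "[]" "[b]" "{}" by unfold_locales (use assms in auto)
  have f: "j \<le> ?p \<Longrightarrow> 1 \<le> j \<Longrightarrow> face ?D (Lt Upper (Suc j)) = Foot Upper j"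
    "face ?D (Foot s j) = Tip s j" "j \<le> ?p \<Longrightarrow> 1 \<le> j \<Longrightarrow> face ?D (Tip Upper j) = Lt Upper j"
    "face ?D (Lt Upper (Suc 0)) = Rt Lower 0" "face ?D (Rt Lower 0) = Foot Lower 1"
    "face ?D (Tip Lower 1) = Rt Lower 1" "face ?D (Rt Lower 1) = Lt Upper (Suc ?p)"
    "j < ?p \<Longrightarrow> face ?D (Rt Upper j) = Rt Upper (Suc j)" "face ?D (Rt Upper ?p) = Lt Chord 1"
    "face ?D (Lt Chord 1) = Rt Upper 0" for j s
    by (auto simp: face_def)
  let ?t = "[Rt Lower 0, Foot Lower 1, Tip Lower 1, Rt Lower 1]"
  let ?xs = "upper_walk ?p @ Lt Upper (Suc 0) # ?t"
  have hd: "hd (upper_walk q @ Lt Upper (Suc 0) # ?t) = Lt Upper (Suc q)" for q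
    by (cases q) (simp_all add: upper_walk_0 upper_walk_Suc)
  have ch: "chain (face ?D) (Lt Upper (Suc ?p)) (upper_walk q @ Lt Upper (Suc 0) # ?t)" if "q \<le> ?p" for q
    using that
  proof (induction q)
    case 0 then show ?case using f by (simp add: upper_walk_0)
  next
    case (Suc q)
    have "chain (face ?D) (Lt Upper (Suc ?p)) (upper_walk q @ Lt Upper (Suc 0) # ?t)" using Suc by simp
    then show ?case unfolding upper_walk_Suc append.assoc
      using f(1)[of "Suc q"] f(2)[of Upper "Suc q"] f(3)[of "Suc q"] Suc.prems hd[of q]
      by (simp add: chain_Cons)
  qed
  have w: "map (lab ?D) (filter (\<lambda>x. x \<in> tips ?D) (upper_walk q)) = map (\<lambda>j. as ! (j - 1)) (rev [1..<Suc q])" if "q \<le> ?p" for q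
    using that by (induction q) (simp_all add: upper_walk_0 upper_walk_Suc tips_def)
  have r: "map (\<lambda>j. as ! (j - 1)) (rev [1..<Suc ?p]) = rev as"
  proof -
    have "map (\<lambda>j. as ! (j - 1)) [1..<Suc ?p] = as" by (rule nth_equalityI) (auto simp del: upt_Suc)
    then show ?thesis by (simp only: rev_map[symmetric])
  qed
  have "bword_by ?D ?xs (rev as @ [b])" unfolding bword_by_def loop_def
  proof (intro conjI)
    show "distinct ?xs" using distinct_upper_walk[of ?p] by (auto simp: set_upper_walk)
    show "chain (face ?D) (List.hd ?xs) ?xs" unfolding hd using ch[of ?p] by simp
    show "set ?xs \<subseteq> half ?D" by (auto simp: set_upper_walk)
    show "tips ?D \<subseteq> set ?xs"
    proof
      fix x assume "x \<in> tips ?D"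
      then obtain s j where x: "x = Tip s j" "1 \<le> j" "j \<le> length (tlegs as [] [b] s)" by (auto simp: theta_tips_iff)
      then show "x \<in> set ?xs" by (cases s) (auto simp: set_upper_walk)
    qed
    show "rev as @ [b] = map (lab ?D) (filter (\<lambda>x. x \<in> tips ?D) ?xs)"
      using w[of ?p] r by (simp add: tips_def)
  qed simp
  then show "bword ?D (rev as @ [b])" unfolding bword_def by blast
  let ?F = "insert (Lt Chord 1) ((\<lambda>j. Rt Upper j) ` {..?p})"
  show "freeface ?D" unfolding freeface_def
  proof (intro exI[of _ ?F] conjI)
    show "?F \<subseteq> half ?D" by auto
    show "?F \<inter> tips ?D = {}" by (auto simp: theta_tips_iff)
    show "face ?D ` ?F \<subseteq> ?F"
    proof
      fix y assume "y \<in> face ?D ` ?F"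
      then consider "y = face ?D (Lt Chord 1)" | j where "j < ?p" "y = face ?D (Rt Upper j)" | "y = face ?D (Rt Upper ?p)"
        by (auto simp: le_less)
      then show "y \<in> ?F"
      proof cases
        case 1 then show ?thesis unfolding 1 f(10) by simp
      next
        case 2 then show ?thesis unfolding 2 f(8)[OF 2(1)] by simp
      next
        case 3 then show ?thesis unfolding 3 f(9) by simp
      qed
    qed
  qed simp
qed

text \<open>By \<open>state_zero\<close> only the empty set of reversals contributes. The result is
  the very wheel whose blow-up is this theta in \<open>blow_up_wheel\<close>, so wheels are
  recovered without a coefficient.\<close>

lemma chi_at_theta:
  assumes "set as \<subseteq> labels g" "b \<in> labels g" "as \<noteq> []" "m = Suc (length as)"
  shows "congr g m (chi_at left_vertex (theta as [] [b])) (fr (wheel (b # as)))"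
proof -
  let ?D = "theta as [] [b]" and ?T = "trivalent_vertices (theta as [] [b]) - {left_vertex}"
  interpret jacobi g ?D by unfold_locales (rule theta_jacobi, use assms in auto)
  have "frag_cmul ((-1) ^ card Y) (state Y ?D) = 0" if "Y \<in> Pow ?T - {{}}" for Y
  proof -
    interpret theta_state g as "[]" "[b]" Y by unfold_locales (use assms that in auto)
    show ?thesis using state_zero assms(3) that by simp
  qed
  then have "chi_at left_vertex ?D = (\<Sum>Y\<in>{{}}. frag_cmul ((-1) ^ card Y) (state Y ?D))"
    unfolding chi_at_def by (intro sum.mono_neutral_right) auto
  also have "\<dots> = val ?D" by (simp add: state_def)
  also have "congr g m (val ?D) (fr (wheel (rev (rev as @ [b]))))"
    using val_eq[OF jd theta_outer_word[OF assms(1-3)]] assms(4) by (simp add: card_theta_tips)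
  finally show ?thesis by simp
qed

subsection \<open>The blow-up homomorphism on chains\<close>

text \<open>The chosen half-edge selects the vertex to blow up; by \<open>blow_up_any_vertex\<close>
  the choice does not affect the class. Other Betti numbers are sent to zero for the same reason as
  in \<open>chi_map\<close>.\<close>

definition bu_frag :: "(nat diagram \<Rightarrow>\<^sub>0 int) \<Rightarrow> nat diagram \<Rightarrow>\<^sub>0 int" where
  "bu_frag = frag_extend (\<lambda>D. if betti1 D = 1 then fr (blow_up (SOME h. h \<in> half D \<and> rot D h \<noteq> h) D) else 0)"

lemma bu_frag_of:
  "bu_frag (frag_of D) = (if betti1 D = 1 then fr (blow_up (SOME h. h \<in> half D \<and> rot D h \<noteq> h) D) else 0)"
  by (simp add: bu_frag_def)

lemma bu_frag_add: "bu_frag (x + y) = bu_frag x + bu_frag y" and bu_frag_diff: "bu_frag (x - y) = bu_frag x - bu_frag y"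
  by (simp_all add: bu_frag_def frag_extend_add frag_extend_diff)

lemma chi_map_add: "chi_map (x + y) = chi_map x + chi_map y" and chi_map_diff: "chi_map (x - y) = chi_map x - chi_map y"
  by (simp_all add: chi_map_def frag_extend_add frag_extend_diff)

lemma bu_frag_congr:
  assumes "jac g m D" "card (tips D) = m" "h \<in> half D" "rot D h \<noteq> h"
  shows "congr g (m + 2) (bu_frag (frag_of D)) (fr (blow_up h D))"
proof -
  let ?k = "SOME h. h \<in> half D \<and> rot D h \<noteq> h"
  have "?k \<in> half D \<and> rot D ?k \<noteq> ?k" by (rule someI[of _ h]) (use assms(3,4) in blast)
  then show ?thesis unfolding bu_frag_of using betti1_one_iff[OF assms(1)] assms(2)
    blow_up_any_vertex[OF assms(1) _ _ assms(3,4), of ?k] by simp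
qed

lemma exists_trivalent_half:
  assumes "jac g n D" "0 < n"
  shows "\<exists>h\<in>half D. rot D h \<noteq> h"
proof (rule ccontr)
  assume "\<not> ?thesis"
  then have "half D - tips D = {}" by (auto simp: tips_def)
  then have "card (half D - tips D) = 0" by (simp only: card.empty)
  then show False using jac_cards(1)[OF assms(1)] assms(2) by linarith
qed

lemma bu_frag_fr:
  assumes "jac g m D" "card (tips D) = m" "h \<in> half D" "rot D h \<noteq> h"
  shows "congr g (m + 2) (bu_frag (fr D)) (fr (blow_up h D))"
proof -
  interpret jacobi g D using assms(1) by (rule jac_jacobi)
  obtain E :: "nat diagram" and f where E: "jac g m E" "iso_by f D E" "fr D = frag_of E"
    using fr_ex[OF assms(1)] by blast
  note f = iso_byD[OF E(2)]
  have t: "card (tips E) = m" using iso_by_jac(2)[OF assms(1) E(2)] assms(2) by simp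
  have h: "f h \<in> half E" "rot E (f h) \<noteq> f h" using assms(3,4) by (auto simp: f)
  have "congr g (m + 2) (bu_frag (fr D)) (fr (blow_up (f h) E))" unfolding E(3) by (rule bu_frag_congr[OF E(1) t h])
  also have "congr g (m + 2) \<dots> (fr (blow_up h D))"
    by (rule congr_sym, rule fr_iso[OF blow_up_jac(1)[OF assms(1,3,4)] blow_up_iso[OF jd E(2) assms(3,4)]])
  finally show ?thesis .
qed

text \<open>All two-loop diagrams with one leg vanish. This covers the blow-up of a diagram whose
  only trivalent vertex carries a self-loop.\<close>

lemma two_loop_three:
  assumes "jac g 3 D" "card (tips D) = 1"
  shows "fr D \<in> relations g 3"
proof (rule two_loop_span[OF is_sub_relations subset_refl _ assms(1)])
  fix as cs assume a: "set as \<subseteq> labels g" "set cs \<subseteq> labels g" "length as + length cs + 2 = 3"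
  then consider a where "as = [a]" "cs = []" "a \<in> labels g" | a where "as = []" "cs = [a]" "a \<in> labels g"
    by (cases as; cases cs) auto
  then show "fr (theta as [] cs) \<in> relations g 3"
  proof cases
    case 1 then show ?thesis using theta_one[OF 1(3)] by (simp only: congr_0_iff)
  next
    case 2
    have "congr g 3 (fr (theta [] [] [a])) (- fr (theta [a] [] []))"
      using theta_swap[of "[a]" g "[]" "[]" 3 Upper "[]" "[]" "[a]"] 2(3) by simp
    also have "congr g 3 \<dots> (- 0)" by (rule congr_minus[OF theta_one[OF 2(3)]])
    finally show ?thesis unfolding 2 by (simp add: congr_0_iff)
  qed
qed (use assms(2) in simp)

text \<open>Independence of the vertex allows a convenient choice for each relator: the reversed
  vertex for AS, an end of the edge for IHX, and a vertex off the loop for self-loops, provided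
  there is one.\<close>

lemma bu_frag_relations:
  assumes "0 < m" "x \<in> relations g m"
  shows "bu_frag x \<in> relations g (m + 2)"
proof (rule relations_hom[OF is_sub_relations bu_frag_diff _ assms(2)])
  have c0: "bu_frag (frag_of D) = 0" if "jac g m D" "card (tips D) \<noteq> m" for D
    unfolding bu_frag_of using betti1_one_iff[OF that(1)] that(2) by simp
  fix x assume "x \<in> relators g m"
  then consider "x \<in> iso_relators g m" | "x \<in> as_relators g m" | "x \<in> ihx_relators g m"
    | "x \<in> self_loop_relators g m" by blast
  then show "bu_frag x \<in> relations g (m + 2)"
  proof cases
    case 1
    then obtain D E f where D: "x = frag_of D - frag_of E" "jac g m D" "jac g m E" "iso_by f D E"
      unfolding iso_relators_def jac_mem diagram_iso_iff by blast
    note t = iso_by_jac(2)[OF D(2,4)]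
    show ?thesis
    proof (cases "card (tips D) = m")
      case True
      interpret jacobi g D using D(2) by (rule jac_jacobi)
      note f = iso_byD[OF D(4)]
      obtain h where h: "h \<in> half D" "rot D h \<noteq> h" using exists_trivalent_half[OF D(2) assms(1)] by blast
      have h': "f h \<in> half E" "rot E (f h) \<noteq> f h" using h by (auto simp: f)
      have "congr g (m + 2) (bu_frag (frag_of D)) (fr (blow_up h D))" by (rule bu_frag_congr[OF D(2) True h])
      also have "congr g (m + 2) \<dots> (fr (blow_up (f h) E))"
        by (rule fr_iso[OF blow_up_jac(1)[OF D(2) h] blow_up_iso[OF jd D(4) h]])
      also have "congr g (m + 2) \<dots> (bu_frag (frag_of E))"
        by (rule congr_sym, rule bu_frag_congr[OF D(3) _ h']) (use t True in simp)
      finally show ?thesis unfolding D(1) bu_frag_diff congr_def .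
    next
      case False
      then show ?thesis unfolding D(1) bu_frag_diff using c0[OF D(2)] c0[OF D(3)] t relsub(1) by simp
    qed
  next
    case 2
    then obtain D h where D: "x = frag_of D + frag_of (flip (vertex D h) D)" "jac g m D" "h \<in> half D" "rot D h \<noteq> h"
      unfolding as_relators_eq by blast
    interpret jacobi g D using D(2) by (rule jac_jacobi)
    note j = flip_vertex_jac[OF D(2,3)]
    show ?thesis
    proof (cases "card (tips D) = m")
      case True
      have r: "rot (flip (vertex D h) D) h \<noteq> h" using D(3,4) by simp
      have "congr g (m + 2) (bu_frag (frag_of D)) (fr (blow_up h D))" by (rule bu_frag_congr[OF D(2) True D(3,4)])
      moreover have "congr g (m + 2) (bu_frag (frag_of (flip (vertex D h) D))) (- fr (blow_up h D))"
        by (rule congr_trans[OF bu_frag_congr[OF j(1) _ _ r] blow_up_flip[OF D(2-4)]]) (use j(2) True D(3) in simp_all)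
      ultimately have "congr g (m + 2) (bu_frag x) (fr (blow_up h D) + - fr (blow_up h D))"
        unfolding D(1) bu_frag_add by (rule congr_add)
      then show ?thesis by (simp add: congr_0_iff)
    next
      case False
      then show ?thesis unfolding D(1) bu_frag_add using c0[OF D(2)] c0[OF j(1)] j(2) relsub(1) by simp
    qed
  next
    case 3
    then obtain D e where D: "x = frag_of D - frag_of (ihx_H e D) + frag_of (ihx_X e D)" "jac g m D" "inner_edge D e"
      unfolding ihx_relators_eq by blast
    interpret jacobi g D using D(2) by (rule jac_jacobi)
    note j = ihx_jac[OF D(2,3)]
    show ?thesis
    proof (cases "card (tips D) = m")
      case True
      have e: "e \<in> half D" "rot D e \<noteq> e" using D(3) by (auto simp: inner_edge_def)
      have hf: "half (ihx_H e D) = half D" "half (ihx_X e D) = half D" by (simp_all add: ihx_rewire)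
      have nt: "e \<notin> tips D" using e by (simp add: tips_def)
      have rH: "rot (ihx_H e D) e \<noteq> e" and rX: "rot (ihx_X e D) e \<noteq> e"
        using nt e(1) j(2,4) hf unfolding tips_def by blast+
      have "congr g (m + 2) (bu_frag (frag_of D)) (fr (blow_up e D))" by (rule bu_frag_congr[OF D(2) True e])
      moreover have "congr g (m + 2) (bu_frag (frag_of (ihx_H e D))) (fr (blow_up e (ihx_H e D)))"
        by (rule bu_frag_congr[OF j(1) _ _ rH]) (use j(2) True e hf in simp_all)
      moreover have "congr g (m + 2) (bu_frag (frag_of (ihx_X e D))) (fr (blow_up e (ihx_X e D)))"
        by (rule bu_frag_congr[OF j(3) _ _ rX]) (use j(4) True e hf in simp_all)
      ultimately have "congr g (m + 2) (bu_frag x) (fr (blow_up e D) - fr (blow_up e (ihx_H e D)) + fr (blow_up e (ihx_X e D)))"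
        unfolding D(1) bu_frag_add bu_frag_diff by (intro congr_add congr_diff)
      also have "congr g (m + 2) \<dots> 0"
        using blow_up_ihx[OF D(2,3)] unfolding congr_def by (simp add: algebra_simps)
      finally show ?thesis by (simp only: congr_0_iff)
    next
      case False
      then show ?thesis unfolding D(1) bu_frag_add bu_frag_diff using c0[OF D(2)] c0[OF j(1)] c0[OF j(3)] j(2,4) relsub(1) by simp
    qed
  next
    case 4
    then obtain D h where D: "x = frag_of D" "jac g m D" "h \<in> half D" "opp D h \<in> {rot D h, rot D (rot D h)}"
      unfolding self_loop_relators_def jac_mem by blast
    interpret jacobi g D using D(2) by (rule jac_jacobi)
    show ?thesis
    proof (cases "card (tips D) = m")
      case True
      show ?thesis
      proof (cases "m = 1")
        case m1: True
        \<comment> \<open>Blowing up the only vertex destroys the loop, so the class is shown to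
          vanish as a two-loop diagram with one leg.\<close>
        obtain k where k: "k \<in> half D" "rot D k \<noteq> k" using exists_trivalent_half[OF D(2) assms(1)] by blast
        note b = blow_up_jac[OF D(2) k]
        have "card (tips (blow_up k D)) = 1" unfolding b(2) using True m1 by (subst card_image) (auto simp: inj_on_def)
        then have "fr (blow_up k D) \<in> relations g (m + 2)" using two_loop_three[of g "blow_up k D"] b(1) m1 by (simp add: numeral_3_eq_3)
        then show ?thesis
          using bu_frag_congr[OF D(2) True k] is_sub_diff_iff[OF is_sub_relations] unfolding D(1) congr_def by blast
      next
        case False
        then obtain v where v: "v \<in> trivalent_vertices D" "v \<noteq> vertex D h"
          using exists_other_trivalent[OF D(2), of "{vertex D h}"] assms(1) by auto
        then obtain k where k: "k \<in> half D - tips D" "v = vertex D k" unfolding trivalent_eq by blast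
        then have k': "k \<in> half D" "rot D k \<noteq> k" "vertex D k \<noteq> vertex D h" using v(2) by (auto simp: tips_def)
        show ?thesis
          using congr_trans[OF bu_frag_congr[OF D(2) True k'(1,2)] blow_up_self_loop[OF D(2-4) k']]
          unfolding D(1) congr_0_iff .
      qed
    next
      case False
      then show ?thesis unfolding D(1) using c0[OF D(2)] relsub(1) by simp
    qed
  qed
qed

section \<open>The state sum inverts the blow-up\<close>

definition loop_diagrams :: "nat \<Rightarrow> nat \<Rightarrow> nat \<Rightarrow> nat diagram set" where
  "loop_diagrams g n l = {D. jac g n D \<and> betti1 D = int l}"

lemma fr_keys_loop: "jac g n D \<Longrightarrow> betti1 D = int l \<Longrightarrow> Poly_Mapping.keys (fr D) \<subseteq> loop_diagrams g n l"
proof -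
  assume a: "jac g n D" "betti1 D = int l"
  obtain E :: "nat diagram" and f where "jac g n E" "iso_by f D E" "fr D = frag_of E" using fr_ex[OF a(1)] by blast
  then show ?thesis using iso_by_jac(3)[OF a(1)] a(2) by (simp add: loop_diagrams_def keys_frag_of)
qed

lemma bu_frag_keys:
  assumes "Poly_Mapping.keys x \<subseteq> loop_diagrams g m 1" "0 < m"
  shows "Poly_Mapping.keys (bu_frag x) \<subseteq> loop_diagrams g (m + 2) 2"
proof -
  have "Poly_Mapping.keys (if betti1 D = 1 then fr (blow_up (SOME h. h \<in> half D \<and> rot D h \<noteq> h) D) else 0)
      \<subseteq> loop_diagrams g (m + 2) 2" if D: "D \<in> Poly_Mapping.keys x" for D
  proof -
    have jD: "jac g m D" "betti1 D = 1" using D assms(1) by (auto simp: loop_diagrams_def)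
    let ?k = "SOME h. h \<in> half D \<and> rot D h \<noteq> h"
    have k: "?k \<in> half D \<and> rot D ?k \<noteq> ?k"
      by (rule someI_ex) (use exists_trivalent_half[OF jD(1) assms(2)] in blast)
    note b = blow_up_jac[OF jD(1) conjunct1[OF k] conjunct2[OF k]]
    have "card (tips (blow_up ?k D)) = card (tips D)" unfolding b(2) by (rule card_image) (auto simp: inj_on_def)
    then have "betti1 (blow_up ?k D) = 2" using betti1_two_iff[OF b(1)] betti1_one_iff[OF jD(1)] jD(2) by simp
    then show ?thesis using fr_keys_loop[OF b(1), of 2] jD(2) by simp
  qed
  then show ?thesis unfolding bu_frag_def by (intro order_trans[OF keys_frag_extend] UN_least)
qed

text \<open>The chains on which the composite is congruent to the identity form a subgroup
  containing the relations, so by \<open>one_loop_span\<close> wheels are enough. The bound on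
  \<open>m\<close> leaves a nonempty upper strand after the blow-up, as \<open>chi_at_theta\<close>
  requires.\<close>

lemma chi_bu:
  assumes "2 \<le> m" "Poly_Mapping.keys x \<subseteq> loop_diagrams g m 1"
  shows "congr g m (chi_map (bu_frag x)) x"
proof -
  define S where "S = {z. chi_map (bu_frag z) - z \<in> relations g m}"
  have m: "0 < m" using assms(1) by simp
  have S: "is_sub S" unfolding is_sub_def S_def
  proof (intro conjI ballI)
    show "0 \<in> {z. chi_map (bu_frag z) - z \<in> relations g m}" using relsub(1) by (simp add: bu_frag_def chi_map_def)
    fix x y assume "x \<in> {z. chi_map (bu_frag z) - z \<in> relations g m}" "y \<in> {z. chi_map (bu_frag z) - z \<in> relations g m}"
    then have "(chi_map (bu_frag x) - x) - (chi_map (bu_frag y) - y) \<in> relations g m" using relsub(2) by blast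
    then show "x - y \<in> {z. chi_map (bu_frag z) - z \<in> relations g m}"
      by (simp add: bu_frag_diff chi_map_diff algebra_simps)
  qed
  have R: "relations g m \<subseteq> S"
    using chi_map_relations[OF m bu_frag_relations[OF m]] relsub(2) unfolding S_def by blast
  have W: "fr (wheel w) \<in> S" if w: "set w \<subseteq> labels g" "length w = m" "w \<noteq> []" for w
  proof -
    obtain b as where ba: "w = b # as" using w(3) by (cases w) auto
    have as: "as \<noteq> []" using w(2) ba assms(1) by auto
    have jW: "jac g m (wheel w)" using wheel_jac[OF w(1,3)] w(2) by simp
    have lab: "set as \<subseteq> labels g" "b \<in> labels g" using w(1) ba by auto
    let ?T = "theta as [] [b]"
    have "congr g (m + 2) (bu_frag (fr (wheel w))) (fr (blow_up (WS 0) (wheel w)))"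
      by (rule bu_frag_fr[OF jW]) (use w m in \<open>simp_all add: card_wheel_tips\<close>)
    also have "congr g (m + 2) \<dots> (fr ?T)"
      using blow_up_wheel[of b as g] w(1,2) unfolding ba by (simp add: numeral_3_eq_3)
    finally have "chi_map (bu_frag (fr (wheel w)) - fr ?T) \<in> relations g m"
      unfolding congr_def by (rule chi_map_relations[OF m])
    then have 1: "congr g m (chi_map (bu_frag (fr (wheel w)))) (chi_map (fr ?T))"
      unfolding chi_map_diff congr_def .
    have jT: "jac g (m + 2) ?T" using theta_jac[OF lab(1), of "[]" "[b]"] lab w(2) ba by simp
    have "congr g m (chi_map (fr ?T)) (chi_at left_vertex ?T)"
      by (rule chi_map_fr[OF jT _ m left_vertex_trivalent]) (use lab w(2) ba in \<open>simp_all add: card_theta_tips\<close>)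
    also have "congr g m \<dots> (fr (wheel (b # as)))"
      by (rule chi_at_theta[OF lab as]) (use w(2) ba in simp)
    finally have "congr g m (chi_map (bu_frag (fr (wheel w)))) (fr (wheel w))" unfolding ba[symmetric] by (rule congr_trans[OF 1])
    then show ?thesis by (simp add: S_def congr_def)
  qed
  have "x \<in> S" using assms(2)
  proof (induction rule: frag_induction)
    case zero show ?case using is_subD(1)[OF S] .
  next
    case (one D)
    then have D: "jac g m D" "card (tips D) = m" using betti1_one_iff by (auto simp: loop_diagrams_def)
    have "fr D \<in> S" by (rule one_loop_span[OF S R W D])
    then show ?case using frag_of_fr[OF D(1)] R is_sub_diff_iff[OF S] unfolding congr_def by blast
  next
    case (diff a b) then show ?case using is_subD(2)[OF S] by blast
  qed
  then show ?thesis by (simp add: S_def congr_def)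
qed

text \<open>The rim of a wheel with one spoke is a self-loop. This replaces \<open>chi_bu\<close> in
  the case \<open>m = 1\<close>.\<close>

lemma one_loop_one:
  assumes "Poly_Mapping.keys x \<subseteq> loop_diagrams g 1 1"
  shows "x \<in> relations g 1"
  using assms
proof (induction rule: frag_induction)
  case zero show ?case by (rule relsub(1))
next
  case (one D)
  then have D: "jac g 1 D" "card (tips D) = 1" using betti1_one_iff[of g 1 D] by (auto simp: loop_diagrams_def)
  have "fr D \<in> relations g 1"
  proof (rule one_loop_span[OF is_sub_relations subset_refl _ D])
    fix w assume w: "set w \<subseteq> labels g" "length w = 1" "w \<noteq> []"
    have "congr g 1 (fr (wheel w)) 0"
      by (rule fr_self_loop[of g 1 _ "WF 0"]) (use wheel_jac[OF w(1,3)] w(2) in simp_all)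
    then show "fr (wheel w) \<in> relations g 1" by (simp only: congr_0_iff)
  qed
  then show ?case using frag_of_fr[OF D(1)] is_sub_diff_iff[OF is_sub_relations] unfolding congr_def by blast
next
  case (diff a b) then show ?case by (rule relsub(2))
qed

subsection \<open>Two-loop diagrams are generated by blow-ups and thetas\<close>

text \<open>Modulo \<open>S\<close>, thetas with an empty chord are reduced to those with exactly
  one lower leg, which are blow-ups of wheels. The subgroup is kept abstract;
  \<open>decompose\<close> takes it to be the sums of a theta part and a blow-up.\<close>

lemma two_loop_generated:
  assumes "is_sub S" "relations g (m + 2) \<subseteq> S" "0 < m"
    and th: "\<And>as bs cs. set as \<subseteq> labels g \<Longrightarrow> set bs \<subseteq> labels g \<Longrightarrow> set cs \<subseteq> labels g \<Longrightarrow> as \<noteq> [] \<Longrightarrow> bs \<noteq> [] \<Longrightarrow> cs \<noteq> [] \<Longrightarrow>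
       length as + length bs + length cs = m \<Longrightarrow> fr (theta as bs cs) \<in> S"
    and bu: "\<And>D :: nat diagram. jac g m D \<Longrightarrow> card (tips D) = m \<Longrightarrow> bu_frag (frag_of D) \<in> S"
    and x: "Poly_Mapping.keys x \<subseteq> loop_diagrams g (m + 2) 2"
  shows "x \<in> S"
proof -
  have congS: "u \<in> S \<longleftrightarrow> v \<in> S" if "congr g (m + 2) u v" for u v
    using is_sub_diff_iff[OF assms(1)] that assms(2) unfolding congr_def by blast
  have neg: "u \<in> S" if "congr g (m + 2) u (frag_cmul c v)" "v \<in> S" for u v c
    using congS[OF that(1)] is_sub_cmul[OF assms(1) that(2)] by blast
  have one: "fr (theta as [] [b]) \<in> S" if "set as \<subseteq> labels g" "b \<in> labels g" "Suc (length as) = m" for as b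
  proof -
    have w: "set (b # as) \<subseteq> labels g" using that by simp
    have jW: "jac g m (wheel (b # as))" using wheel_jac[OF w] that(3) by simp
    obtain E :: "nat diagram" and f where E: "jac g m E" "iso_by f (wheel (b # as)) E" "fr (wheel (b # as)) = frag_of E"
      using fr_ex[OF jW] by blast
    have t: "card (tips E) = m" using iso_by_jac(2)[OF jW E(2)] that(3) by (simp add: card_wheel_tips)
    have "bu_frag (fr (wheel (b # as))) \<in> S" unfolding E(3) by (rule bu[OF E(1) t])
    moreover have "congr g (m + 2) (bu_frag (fr (wheel (b # as)))) (fr (blow_up (WS 0) (wheel (b # as))))"
      by (rule bu_frag_fr[OF jW]) (use that in \<open>simp_all add: card_wheel_tips\<close>)
    moreover have "congr g (m + 2) (fr (blow_up (WS 0) (wheel (b # as)))) (fr (theta as [] [b]))"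
      using blow_up_wheel[OF w] that(3) by (simp add: numeral_3_eq_3)
    ultimately show ?thesis using congS by blast
  qed
  \<comment> \<open>When all legs are on one strand, moving one of them gives a difference of two
    diagrams with a single leg on another strand; a swap makes both multiples of the case
    \<open>one\<close>.\<close>
  have single: "fr (theta as [] []) \<in> S" if as: "set as \<subseteq> labels g" "length as = m" for as
  proof -
    obtain a as' where aa: "as = a # as'" using as(2) assms(3) by (cases as) auto
    have l: "set as' \<subseteq> labels g" "a \<in> labels g" "Suc (length as') = m" using as aa by auto
    have 1: "fr (theta as' [] [a]) \<in> S" by (rule one[OF l])
    have "congr g (m + 2) (fr (theta as' [a] [])) (frag_cmul ((-1) ^ (length (tlegs as' [] [a] Chord) + length [a])) (fr (theta as' [] [a])))"
      by (rule theta_swap[of as' g "[]" "[a]"]) (use l in simp_all)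
    then have 2: "fr (theta as' [a] []) \<in> S" using 1 by (rule neg)
    have "congr g (m + 2) (fr (theta (a # as') [] [])) (fr (theta as' [] [a]) - fr (theta as' [a] []))"
      by (rule theta_move) (use l in simp_all)
    then show ?thesis unfolding aa using congS is_subD(2)[OF assms(1) 1 2] by blast
  qed
  have two: "fr (theta as [] cs) \<in> S" if "set as \<subseteq> labels g" "set cs \<subseteq> labels g" "length as + length cs = m" "as \<noteq> []" "cs \<noteq> []" for as cs
    using that
  proof (induction cs arbitrary: as)
    case (Cons c cs)
    show ?case
    proof (cases "cs = []")
      case True then show ?thesis using one[of as c] Cons.prems by simp
    next
      case False
      \<comment> \<open>The move relation is read backwards: it expresses the theta with
        \<open>c\<close> on the lower strand by the one with \<open>c\<close> on the upper strand
        and one with three nonempty strands.\<close>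
      have "fr (theta (c # as) [] cs) \<in> S" by (rule Cons.IH) (use Cons.prems False in simp_all)
      moreover have "fr (theta as [c] cs) \<in> S" by (rule th) (use Cons.prems False in simp_all)
      moreover have "congr g (m + 2) (fr (theta (c # as) [] cs)) (fr (theta as [] (c # cs)) - fr (theta as [c] cs))"
        by (rule theta_move) (use Cons.prems in simp_all)
      ultimately show ?thesis using congS is_subD(4)[OF assms(1)] by (metis diff_add_cancel)
    qed
  qed simp
  have all: "fr (theta as [] cs) \<in> S" if "set as \<subseteq> labels g" "set cs \<subseteq> labels g" "length as + length cs + 2 = m + 2" for as cs
  proof -
    consider "cs = []" | "as = []" "cs \<noteq> []" | "as \<noteq> []" "cs \<noteq> []" by blast
    then show ?thesis
    proof cases
      case 1 then show ?thesis using single[of as] that by simp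
    next
      case 2
      have "congr g (m + 2) (fr (theta [] [] cs)) (frag_cmul ((-1) ^ (length (tlegs cs [] [] Upper) + length ([] :: label list))) (fr (theta cs [] [])))"
        by (rule theta_swap[of cs g "[]" "[]"]) (use that 2 in simp_all)
      then show ?thesis unfolding 2(1) by (rule neg) (use single[of cs] that 2 in simp)
    next
      case 3 then show ?thesis using two[of as cs] that by simp
    qed
  qed
  show ?thesis using x
  proof (induction rule: frag_induction)
    case zero show ?case using is_subD(1)[OF assms(1)] .
  next
    case (one D)
    then have D: "jac g (m + 2) D" "card (tips D) = m" using betti1_two_iff by (auto simp: loop_diagrams_def)
    have "fr D \<in> S" by (rule two_loop_span[OF assms(1,2) all D(1)]) (use D(2) in simp_all)
    then show ?case using congS[OF frag_of_fr[OF D(1)]] by blast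
  next
    case (diff a b) then show ?case using is_subD(2)[OF assms(1)] by blast
  qed
qed

subsection \<open>Passing to the quotient groups\<close>

definition qcls :: "nat \<Rightarrow> nat \<Rightarrow> (nat diagram \<Rightarrow>\<^sub>0 int) \<Rightarrow> (nat diagram \<Rightarrow>\<^sub>0 int) set" where
  "qcls g n x = relations g n #>\<^bsub>free_Abelian_group (jacobi_diagrams g n)\<^esub> x"

lemma qcls_eq: "qcls g n x = (\<lambda>r. r + x) ` relations g n"
  by (auto simp: qcls_def r_coset_def)

lemma cls_qcls: "cls g n D = qcls g n (fr D)"
  by (simp add: cls_def qcls_def fr_def)

lemma qcls_eq_iff: "qcls g n x = qcls g n y \<longleftrightarrow> congr g n x y"
proof
  assume "qcls g n x = qcls g n y"
  moreover have "x \<in> qcls g n x" unfolding qcls_eq using relsub(1)[of g n] by force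
  ultimately obtain r where "r \<in> relations g n" "x = r + y" unfolding qcls_eq by auto
  then show "congr g n x y" by (simp add: congr_def)
next
  assume c: "congr g n x y"
  have "qcls g n u \<subseteq> qcls g n v" if "congr g n u v" for u v
  proof
    fix z assume "z \<in> qcls g n u"
    then obtain r where r: "r \<in> relations g n" "z = r + u" unfolding qcls_eq by auto
    then have "r + (u - v) \<in> relations g n" using that by (intro relsub(4)) (simp_all add: congr_def)
    moreover have "z = (r + (u - v)) + v" using r by simp
    ultimately show "z \<in> qcls g n v" unfolding qcls_eq by blast
  qed
  then show "qcls g n x = qcls g n y" using c congr_sym by blast
qed

lemma comm_group_A: "comm_group (A g n)"
  unfolding A_def by (rule comm_group.abelian_FactGroup[OF abelian_free_Abelian_group relations_subgroup])

lemma carrier_A: "carrier (A g n) = qcls g n ` {x. Poly_Mapping.keys x \<subseteq> jacobi_diagrams g n}"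
  unfolding A_def carrier_FactGroup qcls_def by (auto simp: free_Abelian_group_def)

lemma mult_A: "qcls g n x \<otimes>\<^bsub>A g n\<^esub> qcls g n y = qcls g n (x + y)"
proof -
  have "qcls g n x \<otimes>\<^bsub>A g n\<^esub> qcls g n y = {h + k |h k. h \<in> qcls g n x \<and> k \<in> qcls g n y}"
    unfolding A_def by (auto simp: set_mult_def)
  also have "\<dots> = qcls g n (x + y)"
  proof (intro equalityI subsetI)
    fix z assume "z \<in> {h + k |h k. h \<in> qcls g n x \<and> k \<in> qcls g n y}"
    then obtain r s where rs: "r \<in> relations g n" "s \<in> relations g n" "z = (r + x) + (s + y)" unfolding qcls_eq by auto
    then have "z = (r + s) + (x + y)" by (simp add: algebra_simps)
    then show "z \<in> qcls g n (x + y)" unfolding qcls_eq using relsub(4)[OF rs(1,2)] by blast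
  next
    fix z assume "z \<in> qcls g n (x + y)"
    then obtain r where r: "r \<in> relations g n" "z = r + (x + y)" unfolding qcls_eq by auto
    then have "z = (r + x) + (0 + y)" by (simp add: algebra_simps)
    moreover have "r + x \<in> qcls g n x" "0 + y \<in> qcls g n y" unfolding qcls_eq using r relsub(1) by blast+
    ultimately show "z \<in> {h + k |h k. h \<in> qcls g n x \<and> k \<in> qcls g n y}" by blast
  qed
  finally show ?thesis .
qed

lemma one_A: "\<one>\<^bsub>A g n\<^esub> = qcls g n 0"
  unfolding A_def qcls_eq by simp

lemma loop_sub: "loop_diagrams g n l \<subseteq> jacobi_diagrams g n"
  by (auto simp: loop_diagrams_def jac_mem)

lemma inv_A:
  assumes "Poly_Mapping.keys x \<subseteq> jacobi_diagrams g n"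
  shows "inv\<^bsub>A g n\<^esub> (qcls g n x) = qcls g n (- x)"
proof -
  interpret comm_group "A g n" by (rule comm_group_A)
  show ?thesis
    by (rule inv_equality) (use assms in \<open>auto simp: mult_A one_A carrier_A keys_minus intro!: imageI\<close>)
qed

lemma loop_generators: "{cls g n D |D. D \<in> jacobi_diagrams g n \<and> betti1 D = int l} = (\<lambda>D. qcls g n (frag_of D)) ` loop_diagrams g n l"
proof -
  have "cls g n D = qcls g n (frag_of D)" if "jac g n D" for D :: "nat diagram"
    unfolding cls_qcls qcls_eq_iff by (rule congr_sym[OF frag_of_fr[OF that]])
  then show ?thesis unfolding loop_diagrams_def jac_mem by (auto simp: image_iff)
qed

text \<open>Classes of chains supported on diagrams of Betti number \<open>l\<close> already form a
  subgroup, so every element of the generated submodule has a representative of this kind, to which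
  statements about chains apply.\<close>

lemma carrier_A_loop: "carrier (A_loop g n l) = qcls g n ` {x. Poly_Mapping.keys x \<subseteq> loop_diagrams g n l}"
proof -
  interpret comm_group "A g n" by (rule comm_group_A)
  let ?G = "(\<lambda>D. qcls g n (frag_of D)) ` loop_diagrams g n l"
  have "?G \<subseteq> carrier (A g n)" unfolding carrier_A using loop_sub[of g n l] by (fastforce simp: keys_frag_of)
  then have sg: "subgroup (generate (A g n) ?G) (A g n)" by (rule generate_is_subgroup)
  have "generate (A g n) ?G = qcls g n ` {x. Poly_Mapping.keys x \<subseteq> loop_diagrams g n l}"
  proof (intro equalityI subsetI)
    fix z assume "z \<in> generate (A g n) ?G"
    then show "z \<in> qcls g n ` {x. Poly_Mapping.keys x \<subseteq> loop_diagrams g n l}"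
    proof induction
      case one show ?case unfolding one_A by (rule imageI) simp
    next
      case (incl h) then show ?case by (auto simp: keys_frag_of)
    next
      case (inv h)
      then obtain D where D: "D \<in> loop_diagrams g n l" "h = qcls g n (frag_of D)" by blast
      have "inv\<^bsub>A g n\<^esub> h = qcls g n (- frag_of D)" unfolding D(2) by (rule inv_A) (use D(1) loop_sub in \<open>auto simp: keys_frag_of\<close>)
      then show ?case using D(1) by (auto simp: keys_minus keys_frag_of)
    next
      case (eng h1 h2)
      then obtain x y where xy: "Poly_Mapping.keys x \<subseteq> loop_diagrams g n l" "Poly_Mapping.keys y \<subseteq> loop_diagrams g n l"
        "h1 = qcls g n x" "h2 = qcls g n y" by blast
      show ?case unfolding xy(3,4) mult_A by (rule imageI) (use keys_add_sub[OF xy(1,2)] in blast)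
    qed
  next
    fix z assume "z \<in> qcls g n ` {x. Poly_Mapping.keys x \<subseteq> loop_diagrams g n l}"
    then obtain x where x: "Poly_Mapping.keys x \<subseteq> loop_diagrams g n l" "z = qcls g n x" by blast
    have "Poly_Mapping.keys x \<subseteq> jacobi_diagrams g n \<and> qcls g n x \<in> generate (A g n) ?G" using x(1)
    proof (induction rule: frag_induction)
      case zero show ?case using generate.one[of "A g n" ?G] by (simp add: one_A)
    next
      case (one D) then show ?case using loop_sub by (auto simp: keys_frag_of intro: generate.incl)
    next
      case (diff a b)
      have "qcls g n a \<otimes>\<^bsub>A g n\<^esub> inv\<^bsub>A g n\<^esub> (qcls g n b) \<in> generate (A g n) ?G"
        using diff subgroup.m_closed[OF sg] subgroup.m_inv_closed[OF sg] by blast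
      moreover have "qcls g n a \<otimes>\<^bsub>A g n\<^esub> inv\<^bsub>A g n\<^esub> (qcls g n b) = qcls g n (a - b)"
        using diff by (simp add: inv_A mult_A)
      ultimately show ?case using diff keys_diff_sub by metis
    qed
    then show "z \<in> generate (A g n) ?G" using x(2) by simp
  qed
  then show ?thesis unfolding A_loop_def loop_generators by simp
qed

lemma A_loop_simps: "x \<otimes>\<^bsub>A_loop g n l\<^esub> y = x \<otimes>\<^bsub>A g n\<^esub> y" "\<one>\<^bsub>A_loop g n l\<^esub> = \<one>\<^bsub>A g n\<^esub>"
  by (simp_all add: A_loop_def)

lemma qcls_A_loop: "Poly_Mapping.keys x \<subseteq> loop_diagrams g n l \<Longrightarrow> qcls g n x \<in> carrier (A_loop g n l)"
  unfolding carrier_A_loop by (rule imageI) simp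

lemma comm_group_A_loop: "comm_group (A_loop g n l)"
proof -
  interpret comm_group "A g n" by (rule comm_group_A)
  have "(\<lambda>D. qcls g n (frag_of D)) ` loop_diagrams g n l \<subseteq> carrier (A g n)"
    unfolding carrier_A using loop_sub[of g n l] by (fastforce simp: keys_frag_of)
  then have sg: "subgroup (generate (A g n) ((\<lambda>D. qcls g n (frag_of D)) ` loop_diagrams g n l)) (A g n)"
    by (rule generate_is_subgroup)
  have "group (A_loop g n l)"
    unfolding A_loop_def loop_generators by (rule subgroup.subgroup_is_group[OF sg is_group])
  then show ?thesis
    by (rule group.group_comm_groupI) (auto simp: A_loop_simps carrier_A_loop mult_A add.commute)
qed

section \<open>The blow-up homomorphism on classes\<close>

text \<open>A homomorphism is determined by the generators, hence any map with the prescribed values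
  is induced by \<open>bu_frag\<close>. This gives uniqueness and later makes \<open>bu\<close>
  computable on representatives.\<close>

lemma bu_hom_values:
  assumes "is_blow_up_hom g m 1 f" "0 < m" "Poly_Mapping.keys x \<subseteq> loop_diagrams g m 1"
  shows "f (qcls g m x) = qcls g (m + 2) (bu_frag x)"
proof -
  have hom: "f \<in> hom (A_loop g m 1) (A_loop g (m + 2) 2)"
    and gen: "\<And>(D :: nat diagram) h. jac g m D \<Longrightarrow> betti1 D = 1 \<Longrightarrow> h \<in> half D \<Longrightarrow> rot D h \<noteq> h \<Longrightarrow> f (cls g m D) = cls g (m + 2) (blow_up h D)"
    using assms(1) unfolding is_blow_up_hom_def one_add_one of_nat_1 by (simp_all add: jac_mem)
  have "Poly_Mapping.keys x \<subseteq> loop_diagrams g m 1 \<and> f (qcls g m x) = qcls g (m + 2) (bu_frag x)"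
    using assms(3)
  proof (induction rule: frag_induction)
    case zero
    have "f (qcls g m 0) \<in> carrier (A_loop g (m + 2) 2)" using hom qcls_A_loop[of 0 g m 1] by (auto simp: hom_def)
    then obtain y where y: "f (qcls g m 0) = qcls g (m + 2) y" unfolding carrier_A_loop by blast
    have "f (qcls g m 0 \<otimes>\<^bsub>A_loop g m 1\<^esub> qcls g m 0) = f (qcls g m 0) \<otimes>\<^bsub>A_loop g (m + 2) 2\<^esub> f (qcls g m 0)"
      using hom qcls_A_loop[of 0 g m 1] by (intro hom_mult[OF hom]) simp_all
    then have "qcls g (m + 2) y = qcls g (m + 2) (y + y)" unfolding A_loop_simps mult_A y by (simp add: y mult_A)
    then have "congr g (m + 2) 0 y" unfolding qcls_eq_iff congr_def using relsub(3) by fastforce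
    then show ?case using y unfolding bu_frag_def by (simp add: qcls_eq_iff congr_sym)
  next
    case (one D)
    then have D: "jac g m D" "betti1 D = 1" by (auto simp: loop_diagrams_def)
    obtain h where h: "h \<in> half D" "rot D h \<noteq> h" using exists_trivalent_half[OF D(1) assms(2)] by blast
    have t: "card (tips D) = m" using betti1_one_iff[OF D(1)] D(2) by simp
    have "qcls g m (frag_of D) = cls g m D" unfolding cls_qcls qcls_eq_iff by (rule frag_of_fr[OF D(1)])
    then have "f (qcls g m (frag_of D)) = qcls g (m + 2) (fr (blow_up h D))" using gen[OF D h] by (simp only: cls_qcls)
    also have "\<dots> = qcls g (m + 2) (bu_frag (frag_of D))"
      unfolding qcls_eq_iff by (rule congr_sym[OF bu_frag_congr[OF D(1) t h]])
    finally show ?case using one by (simp add: keys_frag_of)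
  next
    case (diff a b)
    have k: "Poly_Mapping.keys (a - b) \<subseteq> loop_diagrams g m 1" using diff keys_diff_sub by blast
    have "f (qcls g m (a - b)) \<in> carrier (A_loop g (m + 2) 2)" using hom qcls_A_loop[OF k] by (auto simp: hom_def)
    then obtain y where y: "f (qcls g m (a - b)) = qcls g (m + 2) y" unfolding carrier_A_loop by blast
    have "f (qcls g m (a - b) \<otimes>\<^bsub>A_loop g m 1\<^esub> qcls g m b) = f (qcls g m (a - b)) \<otimes>\<^bsub>A_loop g (m + 2) 2\<^esub> f (qcls g m b)"
      by (rule hom_mult[OF hom qcls_A_loop[OF k] qcls_A_loop]) (use diff in blast)
    then have "qcls g (m + 2) (bu_frag a) = qcls g (m + 2) (y + bu_frag b)"
      using diff unfolding A_loop_simps y by (simp add: mult_A)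
    then have "congr g (m + 2) (bu_frag a - bu_frag b) y" unfolding qcls_eq_iff congr_def by (simp add: algebra_simps)
    then show ?case using k y unfolding bu_frag_diff by (simp add: qcls_eq_iff congr_sym)
  qed
  then show ?thesis by blast
qed

text \<open>The map is defined on a chosen representative of each class; the choice is harmless
  because \<open>bu_frag\<close> maps relations to relations.\<close>

lemma bu_exists:
  assumes "0 < m"
  shows "\<exists>f. is_blow_up_hom g m 1 f"
proof -
  define r where "r X = (SOME x. Poly_Mapping.keys x \<subseteq> loop_diagrams g m 1 \<and> X = qcls g m x)" for X
  define f where "f = restrict (\<lambda>X. qcls g (m + 2) (bu_frag (r X))) (carrier (A_loop g m 1))"
  have f: "f (qcls g m x) = qcls g (m + 2) (bu_frag x)" if "Poly_Mapping.keys x \<subseteq> loop_diagrams g m 1" for x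
  proof -
    have "Poly_Mapping.keys (r (qcls g m x)) \<subseteq> loop_diagrams g m 1 \<and> qcls g m x = qcls g m (r (qcls g m x))"
      unfolding r_def by (rule someI[of _ x]) (use that in blast)
    then have "x - r (qcls g m x) \<in> relations g m" unfolding qcls_eq_iff congr_def by blast
    then have "congr g (m + 2) (bu_frag (r (qcls g m x))) (bu_frag x)"
      using bu_frag_relations[OF assms] unfolding congr_def bu_frag_diff[symmetric]
      using congr_sym congr_def bu_frag_diff by metis
    then show ?thesis unfolding f_def using qcls_A_loop[OF that] by (simp add: qcls_eq_iff)
  qed
  have "f \<in> hom (A_loop g m 1) (A_loop g (m + 2) 2)"
  proof (rule homI)
    fix X assume "X \<in> carrier (A_loop g m 1)"
    then obtain x where x: "Poly_Mapping.keys x \<subseteq> loop_diagrams g m 1" "X = qcls g m x" unfolding carrier_A_loop by blast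
    show "f X \<in> carrier (A_loop g (m + 2) 2)" unfolding x(2) f[OF x(1)] by (rule qcls_A_loop[OF bu_frag_keys[OF x(1) assms]])
    fix Y assume "Y \<in> carrier (A_loop g m 1)"
    then obtain y where y: "Poly_Mapping.keys y \<subseteq> loop_diagrams g m 1" "Y = qcls g m y" unfolding carrier_A_loop by blast
    show "f (X \<otimes>\<^bsub>A_loop g m 1\<^esub> Y) = f X \<otimes>\<^bsub>A_loop g (m + 2) 2\<^esub> f Y"
      unfolding A_loop_simps x(2) y(2) mult_A f[OF x(1)] f[OF y(1)] f[OF keys_add_sub[OF x(1) y(1)]] bu_frag_add ..
  qed
  moreover have "f \<in> extensional (carrier (A_loop g m 1))" unfolding f_def by simp
  moreover have "f (cls g m D) = cls g (m + 2) (blow_up h D)"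
    if D: "jac g m D" "betti1 D = 1" "h \<in> half D" "rot D h \<noteq> h" for D :: "nat diagram" and h
  proof -
    have t: "card (tips D) = m" using betti1_one_iff[OF D(1)] D(2) by simp
    have "f (cls g m D) = qcls g (m + 2) (bu_frag (fr D))"
      unfolding cls_qcls by (rule f[OF fr_keys_loop]) (use D in simp_all)
    also have "\<dots> = qcls g (m + 2) (fr (blow_up h D))"
      unfolding qcls_eq_iff by (rule bu_frag_fr[OF D(1) t D(3,4)])
    finally show ?thesis by (simp only: cls_qcls)
  qed
  ultimately have "is_blow_up_hom g m 1 f" unfolding is_blow_up_hom_def one_add_one of_nat_1
    by (intro conjI ballI impI) (simp_all only: jac_mem)
  then show ?thesis by blast
qed

lemma bu_is_blow_up_hom:
  assumes "0 < m"
  shows "is_blow_up_hom g m 1 (bu g m 1)"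
proof -
  obtain f where f: "is_blow_up_hom g m 1 f" using bu_exists[OF assms] by blast
  have "h = f" if h: "is_blow_up_hom g m 1 h" for h
  proof (rule extensionalityI)
    show "h \<in> extensional (carrier (A_loop g m 1))" "f \<in> extensional (carrier (A_loop g m 1))"
      using h f unfolding is_blow_up_hom_def by blast+
    fix X assume "X \<in> carrier (A_loop g m 1)"
    then obtain x where "Poly_Mapping.keys x \<subseteq> loop_diagrams g m 1" "X = qcls g m x" unfolding carrier_A_loop by blast
    then show "h X = f X" using bu_hom_values[OF h assms] bu_hom_values[OF f assms] by simp
  qed
  then show ?thesis unfolding bu_def by (rule theI[of "is_blow_up_hom g m 1", OF f])
qed

lemma Theta_subgroup: "subgroup (Theta_ge1 g n) (A_loop g n 2)"
proof -
  interpret comm_group "A_loop g n 2" by (rule comm_group_A_loop)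
  show ?thesis unfolding Theta_ge1_def
  proof (rule generate_is_subgroup, rule subsetI)
    fix X assume "X \<in> {cls g n (theta as bs cs) |as bs cs. length as \<ge> 1 \<and> length bs \<ge> 1 \<and> length cs \<ge> 1 \<and>
          length as + length bs + length cs + 2 = n \<and> set as \<subseteq> labels g \<and> set bs \<subseteq> labels g \<and> set cs \<subseteq> labels g}"
    then obtain as bs cs where a: "X = cls g n (theta as bs cs)" "length as + length bs + length cs + 2 = n"
      "set as \<subseteq> labels g" "set bs \<subseteq> labels g" "set cs \<subseteq> labels g" by blast
    have j: "jac g n (theta as bs cs)" using theta_jac[OF a(3-5)] a(2) by simp
    then have "betti1 (theta as bs cs) = 2"
      using betti1_two_iff[of g "length as + length bs + length cs" "theta as bs cs"] a(2) by (simp add: card_theta_tips)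
    then show "X \<in> carrier (A_loop g n 2)" unfolding a(1) cls_qcls by (intro qcls_A_loop fr_keys_loop[OF j]) simp
  qed
qed

text \<open>The state sum is a map on chains while \<open>Theta_ge1\<close> consists of classes, so
  the claim is made for an arbitrary representative. The induction over the generated subgroup
  passes from one representative to another through \<open>chi_map_relations\<close>.\<close>

lemma chi_Theta:
  assumes "0 < m" "qcls g (m + 2) t \<in> Theta_ge1 g (m + 2)"
  shows "chi_map t \<in> relations g m"
proof -
  interpret comm_group "A_loop g (m + 2) 2" by (rule comm_group_A_loop)
  have chc: "chi_map u \<in> relations g m \<longleftrightarrow> chi_map v \<in> relations g m" if "congr g (m + 2) u v" for u v
    using chi_map_relations[OF assms(1), of "u - v" g] that is_sub_diff_iff[OF is_sub_relations] unfolding congr_def chi_map_diff by blast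
  have th: "chi_map t \<in> relations g m"
    if "qcls g (m + 2) t = cls g (m + 2) (theta as bs cs)" "length as \<ge> 1" "length bs \<ge> 1" "length cs \<ge> 1"
      "length as + length bs + length cs + 2 = m + 2" "set as \<subseteq> labels g" "set bs \<subseteq> labels g" "set cs \<subseteq> labels g" for t as bs cs
  proof -
    have j: "jac g (m + 2) (theta as bs cs)" using theta_jac[OF that(6-8)] that(5) by simp
    have ne: "as \<noteq> []" "bs \<noteq> []" "cs \<noteq> []" using that(2-4) by auto
    have "congr g m (chi_map (fr (theta as bs cs))) (chi_at left_vertex (theta as bs cs))"
      by (rule chi_map_fr[OF j _ assms(1) left_vertex_trivalent[OF that(6-8)]]) (use that(5) in \<open>simp add: card_theta_tips\<close>)
    then have "chi_map (fr (theta as bs cs)) \<in> relations g m"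
      unfolding chi_at_theta_ge1[OF that(6-8) ne] congr_0_iff .
    moreover have "congr g (m + 2) t (fr (theta as bs cs))" using that(1) unfolding cls_qcls qcls_eq_iff .
    ultimately show ?thesis using chc by blast
  qed
  have "\<forall>t. qcls g (m + 2) t = X \<longrightarrow> chi_map t \<in> relations g m" if "X \<in> Theta_ge1 g (m + 2)" for X
    using that unfolding Theta_ge1_def
  proof induction
    case one
    show ?case
    proof (intro allI impI)
      fix t assume "qcls g (m + 2) t = \<one>\<^bsub>A_loop g (m + 2) 2\<^esub>"
      then have "congr g (m + 2) t 0" unfolding A_loop_simps one_A qcls_eq_iff .
      then show "chi_map t \<in> relations g m" using chi_map_relations[OF assms(1)] unfolding congr_0_iff by blast
    qed
  next
    case (incl h) then show ?case using th by blast
  next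
    case (inv h)
    then have hT: "h \<in> Theta_ge1 g (m + 2)" unfolding Theta_ge1_def by (rule generate.incl)
    then have hc: "h \<in> carrier (A_loop g (m + 2) 2)" using subgroup.mem_carrier[OF Theta_subgroup] by blast
    then obtain u where u: "h = qcls g (m + 2) u" unfolding carrier_A_loop by blast
    have cu: "chi_map u \<in> relations g m" using inv u th by blast
    show ?case
    proof (intro allI impI)
      fix t assume t: "qcls g (m + 2) t = inv\<^bsub>A_loop g (m + 2) 2\<^esub> h"
      have "qcls g (m + 2) t \<otimes>\<^bsub>A_loop g (m + 2) 2\<^esub> qcls g (m + 2) u = \<one>\<^bsub>A_loop g (m + 2) 2\<^esub>"
        unfolding t using l_inv[OF hc] by (simp only: u)
      then have "congr g (m + 2) (t + u) 0" unfolding A_loop_simps mult_A one_A qcls_eq_iff .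
      then have "chi_map (t + u) \<in> relations g m" using chi_map_relations[OF assms(1)] unfolding congr_0_iff by blast
      then have "chi_map t + chi_map u - chi_map u \<in> relations g m" unfolding chi_map_add using cu by (rule relsub(2))
      then show "chi_map t \<in> relations g m" by simp
    qed
  next
    case (eng h1 h2)
    have "h1 \<in> carrier (A_loop g (m + 2) 2)" "h2 \<in> carrier (A_loop g (m + 2) 2)"
      using eng(1,2) subgroup.mem_carrier[OF Theta_subgroup[of g "m + 2"]] unfolding Theta_ge1_def by blast+
    then obtain u v where uv: "h1 = qcls g (m + 2) u" "h2 = qcls g (m + 2) v" unfolding carrier_A_loop by blast
    show ?case
    proof (intro allI impI)
      fix t assume "qcls g (m + 2) t = h1 \<otimes>\<^bsub>A_loop g (m + 2) 2\<^esub> h2"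
      then have "congr g (m + 2) t (u + v)" unfolding uv A_loop_simps mult_A qcls_eq_iff .
      moreover have "chi_map (u + v) \<in> relations g m" unfolding chi_map_add using eng(3,4) uv relsub(4) by blast
      ultimately show "chi_map t \<in> relations g m" using chc by blast
    qed
  qed
  then show ?thesis using assms(2) by blast
qed

text \<open>The surjectivity statement at the level of chains: the sums of a theta part and a
  blow-up, up to congruence, form a subgroup to which \<open>two_loop_generated\<close>
  applies.\<close>

lemma decompose:
  assumes "0 < m" "Poly_Mapping.keys y \<subseteq> loop_diagrams g (m + 2) 2"
  obtains x t where "Poly_Mapping.keys x \<subseteq> loop_diagrams g m 1" "qcls g (m + 2) t \<in> Theta_ge1 g (m + 2)"
    "congr g (m + 2) y (t + bu_frag x)"
proof -
  interpret comm_group "A_loop g (m + 2) 2" by (rule comm_group_A_loop)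
  interpret T: subgroup "Theta_ge1 g (m + 2)" "A_loop g (m + 2) 2" by (rule Theta_subgroup)
  let ?T = "{t. qcls g (m + 2) t \<in> Theta_ge1 g (m + 2)}"
  define S where "S = {y. \<exists>x t. Poly_Mapping.keys x \<subseteq> loop_diagrams g m 1 \<and> t \<in> ?T \<and> congr g (m + 2) y (t + bu_frag x)}"
  have T0: "0 \<in> ?T" using T.one_closed by (simp add: A_loop_simps one_A)
  have Td: "s - t \<in> ?T" if "s \<in> ?T" "t \<in> ?T" for s t
  proof -
    let ?i = "inv\<^bsub>A_loop g (m + 2) 2\<^esub> (qcls g (m + 2) t)"
    have tc: "qcls g (m + 2) t \<in> carrier (A_loop g (m + 2) 2)" using that T.mem_carrier by blast
    then have "?i \<in> carrier (A_loop g (m + 2) 2)" by (rule inv_closed)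
    then obtain u where u: "?i = qcls g (m + 2) u" unfolding carrier_A_loop by blast
    have "congr g (m + 2) (u + t) 0"
      using l_inv[OF tc] unfolding u A_loop_simps mult_A one_A qcls_eq_iff .
    then have "congr g (m + 2) (s + u) (s - t)" unfolding congr_def by (simp add: algebra_simps)
    moreover have "qcls g (m + 2) (s + u) \<in> Theta_ge1 g (m + 2)"
      using that T.m_closed[of "qcls g (m + 2) s" ?i] T.m_inv_closed[of "qcls g (m + 2) t"] unfolding u A_loop_simps mult_A by blast
    ultimately show ?thesis using qcls_eq_iff by (metis mem_Collect_eq)
  qed
  have S: "is_sub S" unfolding is_sub_def
  proof (intro conjI ballI)
    show "0 \<in> S" unfolding S_def using T0 by (auto intro!: exI[of _ 0] simp: bu_frag_def)
    fix y y' assume "y \<in> S" "y' \<in> S"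
    then obtain x t x' t' where *: "Poly_Mapping.keys x \<subseteq> loop_diagrams g m 1" "t \<in> ?T" "congr g (m + 2) y (t + bu_frag x)"
      "Poly_Mapping.keys x' \<subseteq> loop_diagrams g m 1" "t' \<in> ?T" "congr g (m + 2) y' (t' + bu_frag x')"
      unfolding S_def by blast
    have "congr g (m + 2) (y - y') ((t - t') + bu_frag (x - x'))"
      using congr_diff[OF *(3,6)] unfolding bu_frag_diff by (simp add: algebra_simps)
    then show "y - y' \<in> S" unfolding S_def using Td[OF *(2,5)] keys_diff_sub[OF *(1,4)] by blast
  qed
  have R: "relations g (m + 2) \<subseteq> S"
  proof
    fix r assume "r \<in> relations g (m + 2)"
    then have "congr g (m + 2) r (0 + bu_frag 0)" by (simp add: congr_0_iff bu_frag_def)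
    then show "r \<in> S" unfolding S_def using T0 by (auto intro!: exI[of _ 0])
  qed
  have "y \<in> S"
  proof (rule two_loop_generated[OF S R assms(1) _ _ assms(2)])
    fix as bs cs assume a: "set as \<subseteq> labels g" "set bs \<subseteq> labels g" "set cs \<subseteq> labels g" "as \<noteq> []" "bs \<noteq> []" "cs \<noteq> []"
       "length as + length bs + length cs = m"
    have "cls g (m + 2) (theta as bs cs) \<in> Theta_ge1 g (m + 2)" unfolding Theta_ge1_def
      by (rule generate.incl) (use a in \<open>auto simp: Suc_le_eq\<close>)
    then have "fr (theta as bs cs) \<in> ?T" by (simp add: cls_qcls)
    moreover have "congr g (m + 2) (fr (theta as bs cs)) (fr (theta as bs cs) + bu_frag 0)" by (simp add: bu_frag_def)
    ultimately show "fr (theta as bs cs) \<in> S" unfolding S_def by (metis (mono_tags, lifting) empty_subsetI keys_zero mem_Collect_eq)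
  next
    fix D :: "nat diagram" assume D: "jac g m D" "card (tips D) = m"
    have "Poly_Mapping.keys (frag_of D) \<subseteq> loop_diagrams g m 1"
      using D betti1_one_iff[OF D(1)] by (simp add: keys_frag_of loop_diagrams_def)
    moreover have "congr g (m + 2) (bu_frag (frag_of D)) (0 + bu_frag (frag_of D))" by simp
    ultimately show "bu_frag (frag_of D) \<in> S" unfolding S_def using T0 by blast
  qed
  then show ?thesis unfolding S_def using that by blast
qed

section \<open>The isomorphism onto the quotient\<close>

theorem theorem1p3:
  fixes g n :: nat
  assumes "n \<ge> 3"
  shows "is_blow_up_hom g (n - 2) 1 (bu g (n - 2) 1) \<and>
    (\<lambda>x. Theta_ge1 g n #>\<^bsub>A_loop g n 2\<^esub> bu g (n - 2) 1 x)
      \<in> iso (A_loop g (n - 2) 1) (A_loop g n 2 Mod Theta_ge1 g n)"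
proof -
  define m where "m = n - 2"
  have n: "n = m + 2" and m: "0 < m" using assms by (simp_all add: m_def)
  let ?G = "A_loop g (m + 2) 2" and ?H = "A_loop g m 1" and ?T = "Theta_ge1 g (m + 2)" and ?b = "bu g m 1"
  interpret G: comm_group ?G by (rule comm_group_A_loop)
  interpret T: normal ?T ?G by (rule G.subgroup_imp_normal[OF Theta_subgroup])
  have b: "is_blow_up_hom g m 1 ?b" by (rule bu_is_blow_up_hom[OF m])
  then have bh: "?b \<in> hom ?H ?G" unfolding is_blow_up_hom_def one_add_one by blast
  note bv = bu_hom_values[OF b m]
  let ?\<phi> = "\<lambda>x. ?T #>\<^bsub>?G\<^esub> ?b x"
  have hom: "?\<phi> \<in> hom ?H (?G Mod ?T)"
    using hom_compose[OF bh T.r_coset_hom_Mod] by (simp add: o_def)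
  have inj: "inj_on ?\<phi> (carrier ?H)"
  proof (rule inj_onI)
    fix X Y assume XY: "X \<in> carrier ?H" "Y \<in> carrier ?H" "?\<phi> X = ?\<phi> Y"
    then obtain x y where x: "Poly_Mapping.keys x \<subseteq> loop_diagrams g m 1" "X = qcls g m x"
      and y: "Poly_Mapping.keys y \<subseteq> loop_diagrams g m 1" "Y = qcls g m y" unfolding carrier_A_loop by blast
    have k: "Poly_Mapping.keys (x - y) \<subseteq> loop_diagrams g m 1" by (rule keys_diff_sub[OF x(1) y(1)])
    have "x - y \<in> relations g m"
    proof (cases "m = 1")
      \<comment> \<open>Here every one-loop chain is a relation.\<close>
      case True then show ?thesis using one_loop_one k by blast
    next
      case False
      have "?b X \<in> carrier ?G" using XY(1) bh by (auto simp: hom_def)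
      then have "?b X \<in> ?\<phi> X" by (rule G.rcos_self[OF _ Theta_subgroup])
      then have "?b X \<in> ?T #>\<^bsub>?G\<^esub> ?b Y" using XY(3) by (simp only:)
      then obtain th where th: "th \<in> ?T" "?b X = th \<otimes>\<^bsub>?G\<^esub> ?b Y" unfolding r_coset_def by blast
      then obtain t where t: "th = qcls g (m + 2) t" using T.mem_carrier unfolding carrier_A_loop by blast
      have "congr g (m + 2) (bu_frag x) (t + bu_frag y)"
        using th(2) unfolding x(2) y(2) bv[OF x(1)] bv[OF y(1)] t A_loop_simps mult_A qcls_eq_iff .
      then have "bu_frag (x - y) - t \<in> relations g (m + 2)" unfolding congr_def bu_frag_diff by (simp add: algebra_simps)
      \<comment> \<open>Equality of the images means that the blow-up of \<open>x - y\<close> is a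
        theta part up to relations. The state sum kills that part and returns \<open>x - y\<close>
        from the blow-up.\<close>
      then have "chi_map (bu_frag (x - y)) - chi_map t \<in> relations g m"
        using chi_map_relations[OF m] unfolding chi_map_diff[symmetric] by blast
      moreover have "chi_map t \<in> relations g m" using chi_Theta[OF m] th(1) unfolding t by blast
      ultimately have "chi_map (bu_frag (x - y)) \<in> relations g m" using is_sub_diff_iff[OF is_sub_relations] by blast
      moreover have "chi_map (bu_frag (x - y)) - (x - y) \<in> relations g m"
        using chi_bu[OF _ k] m False unfolding congr_def by simp
      ultimately show ?thesis using is_sub_diff_iff[OF is_sub_relations] by blast
    qed
    then show "X = Y" unfolding x(2) y(2) qcls_eq_iff congr_def .
  qed
  have surj: "?\<phi> ` carrier ?H = carrier (?G Mod ?T)"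
  proof
    show "?\<phi> ` carrier ?H \<subseteq> carrier (?G Mod ?T)" using hom by (auto simp: hom_def)
    show "carrier (?G Mod ?T) \<subseteq> ?\<phi> ` carrier ?H"
    proof
      fix C assume "C \<in> carrier (?G Mod ?T)"
      then obtain Y where Y: "Y \<in> carrier ?G" "C = ?T #>\<^bsub>?G\<^esub> Y" unfolding carrier_FactGroup by blast
      then obtain y where y: "Poly_Mapping.keys y \<subseteq> loop_diagrams g (m + 2) 2" "Y = qcls g (m + 2) y"
        unfolding carrier_A_loop by blast
      obtain x t where xt: "Poly_Mapping.keys x \<subseteq> loop_diagrams g m 1" "qcls g (m + 2) t \<in> ?T"
        "congr g (m + 2) y (t + bu_frag x)" by (rule decompose[OF m y(1)])
      let ?X = "qcls g m x"
      have X: "?X \<in> carrier ?H" by (rule qcls_A_loop[OF xt(1)])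
      then have bX: "?b ?X \<in> carrier ?G" using bh by (auto simp: hom_def)
      have "Y = qcls g (m + 2) t \<otimes>\<^bsub>?G\<^esub> ?b ?X"
        unfolding y(2) bv[OF xt(1)] A_loop_simps mult_A qcls_eq_iff by (rule xt(3))
      then have "Y \<in> ?T #>\<^bsub>?G\<^esub> ?b ?X" unfolding r_coset_def using xt(2) by blast
      then have "?T #>\<^bsub>?G\<^esub> ?b ?X = ?T #>\<^bsub>?G\<^esub> Y" by (rule G.repr_independence[OF _ bX Theta_subgroup])
      then show "C \<in> ?\<phi> ` carrier ?H" using X unfolding Y(2) by blast
    qed
  qed
  have "?\<phi> \<in> iso ?H (?G Mod ?T)" unfolding iso_def using hom inj surj by (simp add: bij_betw_def)
  then show ?thesis using b unfolding n by simp
qed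

end
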